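(* Let $G=\mathrm{PSL}_2(\mathbb{R})$, acting by isometries on the hyperbolic plane $\mathbb{H}^2$, fix a base point $p_0\in\mathbb{H}^2$, let $\lambda$ be a Haar measure on $G$, and for $r>0$ let $F_r=\{g\in G: d_{\mathbb{H}^2}(p_0,gp_0)\le r\}$. For a probability-measure-preserving action $G\curvearrowright (X,\mu)$ on a standard probability space, $f\in L^1(X,\mu)$ and $x\in X$, set $$(\mathsf{A}_r f)(x)=\lambda(F_r)^{-1}\int_{F_r} f(g\cdot x)\,\mathrm{d}\lambda(g),\qquad (\mathsf{M}f)(x)=\sup_{r\ge 1}(\mathsf{A}_r|f|)(x).$$ Then there exists an ergodic probability-measure-preserving action $G\curvearrowright (X,\mu)$ on a standard probability space and a nonnegative function $f\in L^1(X,\mu)$ such that $(\mathsf{M}f)(x)=\infty$ for $\mu$-almost every $x\in X$. In particular, for $\mu$-almost every $x\in X$ the averages $(\mathsf{A}_r f)(x)$ fail to converge as $r\to\infty$.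
   Context: $d_{\mathbb{H}^2}$ is the hyperbolic metric (curvature $-1$) on $\mathbb{H}^2$, on which $\mathrm{PSL}_2(\mathbb{R})$ acts as the group of orientation-preserving isometries. *)

theory Defs
  imports "HOL-Probability.Probability"
begin

text \<open>PSL_2(R) = SL_2(R)/{I,-I}. We work with SL_2(R) and require actions to be trivial
  on the centre {I,-I}, which is exactly an action of PSL_2(R). Haar measures and the
  sets F_r pull back along the 2:1 quotient map, and the normalized averages are unchanged.\<close>

definition SL2 :: "(real^2^2) set" where
  "SL2 = {A. det A = 1}"

definition SL2_borel :: "(real^2^2) measure" where
  "SL2_borel = restrict_space borel SL2"

definition haar_measure_SL2 :: "(real^2^2) measure \<Rightarrow> bool" where
  "haar_measure_SL2 lam \<longleftrightarrow>
     sets lam = sets SL2_borel \<and> space lam = SL2 \<and>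
     (\<forall>g\<in>SL2. \<forall>E\<in>sets lam. emeasure lam ((\<lambda>h. g ** h) ` E) = emeasure lam E) \<and>
     (\<forall>K. compact K \<and> K \<subseteq> SL2 \<longrightarrow> emeasure lam K < \<infinity>) \<and>
     (\<forall>U. openin (top_of_set SL2) U \<and> U \<noteq> {} \<longrightarrow> emeasure lam U > 0)"

definition H2 :: "complex set" where
  "H2 = {z. Im z > 0}"

definition hdist :: "complex \<Rightarrow> complex \<Rightarrow> real" where
  "hdist z w = arcosh (1 + (cmod (z - w))\<^sup>2 / (2 * Im z * Im w))"

definition mobius :: "real^2^2 \<Rightarrow> complex \<Rightarrow> complex" where
  "mobius A z = (of_real (A$1$1) * z + of_real (A$1$2)) / (of_real (A$2$1) * z + of_real (A$2$2))"

definition ballF :: "complex \<Rightarrow> real \<Rightarrow> (real^2^2) set" where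
  "ballF p0 r = {g \<in> SL2. hdist p0 (mobius g p0) \<le> r}"

definition measure_preserving_map :: "'a measure \<Rightarrow> ('a \<Rightarrow> 'a) \<Rightarrow> bool" where
  "measure_preserving_map M T \<longleftrightarrow> T \<in> measurable M M \<and> distr M M T = M"

text \<open>Standard probability space: up to Borel isomorphism every standard Borel space is
  a Borel subset of the real line with its Borel sigma-algebra.\<close>
definition standard_prob_space_real :: "real measure \<Rightarrow> bool" where
  "standard_prob_space_real M \<longleftrightarrow> prob_space M \<and> space M \<in> sets borel \<and>
     sets M = sets (restrict_space borel (space M))"

text \<open>A measurable action of PSL_2(R) (= SL_2(R)-action trivial on -I) preserving M.\<close>
definition pmp_action :: "real measure \<Rightarrow> (real^2^2 \<Rightarrow> real \<Rightarrow> real) \<Rightarrow> bool" where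
  "pmp_action M act \<longleftrightarrow>
     (\<lambda>(g, x). act g x) \<in> measurable (SL2_borel \<Otimes>\<^sub>M M) M \<and>
     (\<forall>x\<in>space M. act (mat 1) x = x) \<and>
     (\<forall>x\<in>space M. act (- mat 1) x = x) \<and>
     (\<forall>g\<in>SL2. \<forall>h\<in>SL2. \<forall>x\<in>space M. act (g ** h) x = act g (act h x)) \<and>
     (\<forall>g\<in>SL2. measure_preserving_map M (act g))"

definition ergodic_action :: "real measure \<Rightarrow> (real^2^2 \<Rightarrow> real \<Rightarrow> real) \<Rightarrow> bool" where
  "ergodic_action M act \<longleftrightarrow>
     (\<forall>A\<in>sets M. (\<forall>g\<in>SL2. act g -` A \<inter> space M = A) \<longrightarrow>
        emeasure M A = 0 \<or> emeasure M A = 1)"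

definition ball_avg_ennreal ::
  "(real^2^2) measure \<Rightarrow> complex \<Rightarrow> (real^2^2 \<Rightarrow> real \<Rightarrow> real) \<Rightarrow> (real \<Rightarrow> real) \<Rightarrow> real \<Rightarrow> real \<Rightarrow> ennreal" where
  "ball_avg_ennreal lam p0 act f r x =
     (\<integral>\<^sup>+ g. ennreal (f (act g x)) * indicator (ballF p0 r) g \<partial>lam) / emeasure lam (ballF p0 r)"

definition ball_avg ::
  "(real^2^2) measure \<Rightarrow> complex \<Rightarrow> (real^2^2 \<Rightarrow> real \<Rightarrow> real) \<Rightarrow> (real \<Rightarrow> real) \<Rightarrow> real \<Rightarrow> real \<Rightarrow> real" where
  "ball_avg lam p0 act f r x =
     (\<integral> g. indicator (ballF p0 r) g * f (act g x) \<partial>lam) / measure lam (ballF p0 r)"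

definition maximal_fn ::
  "(real^2^2) measure \<Rightarrow> complex \<Rightarrow> (real^2^2 \<Rightarrow> real \<Rightarrow> real) \<Rightarrow> (real \<Rightarrow> real) \<Rightarrow> real \<Rightarrow> ennreal" where
  "maximal_fn lam p0 act f x = (SUP r\<in>{1..}. ball_avg_ennreal lam p0 act (\<lambda>y. \<bar>f y\<bar>) r x)"

end

theory Submission
 imports Defs "HOL-Analysis.Kronecker_Approximation_Theorem"
begin

text \<open>The space is the quotient of \<open>SL\<^sub>2(\<real>) \<times> [0,1)\<close> by the congruence subgroup \<open>\<Gamma>(2)\<close>, which acts on the circle
  through a homomorphism to the integers and an irrational rotation; it is realised on a fundamental domain.
  Functions supported far out in the cusp around which the homomorphism is trivial behave under ball averages
  like delayed copies of functions living near the boundary of that cusp, at the same cost in mass, and the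
  circle coordinate serves as a weight. Since balls equidistribute while the circle coordinate drifts slowly
  along suitable sets, a weight can be split into a part acting now on a set \<open>E\<close> and a part acting much later
  on the complement, when the first part has equidistributed and contributes a constant. Each such step keeps the
  maximal function at least about one almost everywhere and lowers the mass from \<open>\<alpha>\<close> to
  \<open>\<alpha> - c \<alpha>\<^sup>2 / 4\<close>, so the mass can be made arbitrarily small; a series of such functions has
  infinite maximal function.\<close>

section \<open>Coding Euclidean spaces by real numbers\<close>

text \<open>The circle factor answers an obstacle. The extension stays ergodic but loses the gap:
  for most points and bounded radii mainly bounded powers of the rotation matter, and the sets
  \<open>slow q s\<close> with \<open>q * theta\<close> close to an integer hardly move under these.
  Ergodicity in turn gives convergence in mean over large balls, which makes the early half of a
  weight look constant later. The weight attached to an excursion into a cusp has to be well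
  defined, so the homomorphism must be trivial on the stabiliser of that cusp. It is built by
  counting crossings of geodesics of which none ends at the cusps of odd over odd type, whereas
  \<open>up 2\<close> is sent to one. Only the order of magnitude of volumes is ever compared. The
  constants lost are collected in \<open>c0\<close>, and the recursion drives the mass to zero for
  every positive \<open>c0\<close>.\<close>

definition bit_of :: "nat => real => int" where
 "bit_of n u = \<lfloor>2 ^ Suc n * u\<rfloor> mod 2"

lemma bit_of_cases: "bit_of n u = 0 \<or> bit_of n u = 1"
 unfolding bit_of_def by presburger

lemma sum_bit_of:
 assumes "0 <= u" "u < 1"
 shows "(\<Sum>n<N. real_of_int (bit_of n u) / 2 ^ Suc n) = real_of_int \<lfloor>2 ^ N * u\<rfloor> / 2 ^ N"
proof (induction N)
 case 0
 have "\<lfloor>u\<rfloor> = 0" using assms by linarith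
 then show ?case by simp
next
 case (Suc N)
 let ?a = "\<lfloor>2 ^ N * u\<rfloor>" and ?b = "\<lfloor>2 ^ Suc N * u\<rfloor>"
 have "?b div 2 = ?a"
  using floor_divide_real_eq_div[of 2 "2 ^ Suc N * u"] by simp
 then have "?b = 2 * ?a + bit_of N u"
  unfolding bit_of_def by presburger
 then have "real_of_int ?b = 2 * real_of_int ?a + real_of_int (bit_of N u)"
  by linarith
 then show ?case
  using Suc.IH by (simp add: field_simps)
qed

lemma bit_of_sums:
 assumes "0 <= u" "u < 1"
 shows "(%n. real_of_int (bit_of n u) / 2 ^ Suc n) sums u"
proof -
 have "(%N. real_of_int \<lfloor>2 ^ N * u\<rfloor> / 2 ^ N) \<longlonglongrightarrow> u"
 proof (rule tendsto_sandwich[where f = "%N. u - (1/2) ^ N" and h = "%N. u"])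
  show "\<forall>\<^sub>F N in sequentially. u - (1/2) ^ N <= real_of_int \<lfloor>2 ^ N * u\<rfloor> / 2 ^ N"
  proof (intro always_eventually allI)
   fix N
   have "2 ^ N * u - 1 <= real_of_int \<lfloor>2 ^ N * u\<rfloor>" by linarith
   then have "(2 ^ N * u - 1) / 2 ^ N <= real_of_int \<lfloor>2 ^ N * u\<rfloor> / 2 ^ N"
    by (intro divide_right_mono) auto
   then show "u - (1/2) ^ N <= real_of_int \<lfloor>2 ^ N * u\<rfloor> / 2 ^ N"
    by (simp add: field_simps power_one_over)
  qed
  show "\<forall>\<^sub>F N in sequentially. real_of_int \<lfloor>2 ^ N * u\<rfloor> / 2 ^ N <= u"
   by (intro always_eventually allI) (subst pos_divide_le_eq, auto simp: mult.commute)
  have "(%N. u - (1/2::real) ^ N) \<longlonglongrightarrow> u - 0"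
   by (intro tendsto_intros LIMSEQ_realpow_zero) auto
  then show "(%N. u - (1/2::real) ^ N) \<longlonglongrightarrow> u" by simp
 qed auto
 then show ?thesis
  unfolding sums_def using sum_bit_of[OF assms] by simp
qed

definition squash :: "real => real" where
 "squash x = 1 / 2 + x / (2 * (1 + \<bar>x\<bar>))"

definition unsquash :: "real => real" where
 "unsquash u = (2 * u - 1) / (1 - \<bar>2 * u - 1\<bar>)"

lemma squash_bounds: "0 <= squash x" "squash x < 1"
 unfolding squash_def by (auto simp: field_simps abs_if)

lemma unsquash_squash: "unsquash (squash x) = x"
proof -
 have 1: "2 * squash x - 1 = x / (1 + \<bar>x\<bar>)"
  unfolding squash_def by (simp add: field_simps)
 have "1 - \<bar>x / (1 + \<bar>x\<bar>)\<bar> = 1 / (1 + \<bar>x\<bar>)"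
  by (simp add: abs_divide field_simps)
 then show ?thesis unfolding unsquash_def 1 by (simp add: field_simps)
qed

lemma measurable_squash [measurable]: "squash : borel_measurable borel"
 unfolding squash_def[abs_def] by measurable

lemma measurable_unsquash [measurable]: "unsquash : borel_measurable borel"
 unfolding unsquash_def[abs_def] by measurable

text \<open>The two binary expansions are interleaved into digits between 0 and 3. These are read in
  base 8 rather than 4, so that no expansion ends in maximal digits, no carry occurs, and every
  digit of the code is recovered by a floor.\<close>

definition pair_digit :: "real \<times> real => nat => int" where
 "pair_digit z n = 2 * bit_of n (squash (fst z)) + bit_of n (squash (snd z))"

definition pair_code :: "real \<times> real => real" where
 "pair_code z = (\<Sum>n. real_of_int (pair_digit z n) / 8 ^ Suc n)"

definition code_digit :: "nat => real => int" where
 "code_digit n z = \<lfloor>8 ^ Suc n * z\<rfloor> mod 8"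

definition pair_decode :: "real => real \<times> real" where
 "pair_decode z =
   (unsquash (\<Sum>n. real_of_int (code_digit n z div 2) / 2 ^ Suc n),
   unsquash (\<Sum>n. real_of_int (code_digit n z mod 2) / 2 ^ Suc n))"

lemma pair_digit_bounds: "0 <= pair_digit z n" "pair_digit z n <= 3"
 unfolding pair_digit_def using bit_of_cases[of n "squash (fst z)"] bit_of_cases[of n "squash (snd z)"]
 by auto

text \<open>The tail behind position \<open>N\<close> contributes at most 3/8 + 3/64 + ... = 3/7 of
  a unit, so taking the floor truncates exactly.\<close>

lemma digits_floor:
 fixes d :: "nat => int"
 assumes d: "\<And>n. 0 <= d n" "\<And>n. d n <= 3"
 shows "\<lfloor>8 ^ N * (\<Sum>n. real_of_int (d n) / 8 ^ Suc n)\<rfloor> = (\<Sum>n<N. d n * 8 ^ (N - Suc n))"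
proof -
 have geo: "(%n. (3/8) * (1/8::real) ^ n) sums (3/8 * (1 / (1 - 1/8)))"
  by (intro sums_mult geometric_sums) auto
 have le: "real_of_int (d n) / 8 ^ Suc n <= (3/8) * (1/8) ^ n" for n
  using d(2)[of n] by (simp add: field_simps power_one_over)
 have summ: "summable (%n. real_of_int (d n) / 8 ^ Suc n)"
  by (rule summable_comparison_test[OF _ sums_summable[OF geo]]) (use le d(1) in auto)
 define t where "t = (\<Sum>n. real_of_int (d (n + N)) / 8 ^ Suc (n + N))"
 have split: "(\<Sum>n. real_of_int (d n) / 8 ^ Suc n) = t + (\<Sum>n<N. real_of_int (d n) / 8 ^ Suc n)"
  unfolding t_def using suminf_split_initial_segment[OF summ, of N] by simp
 have summN: "summable (%n. real_of_int (d (n + N)) / 8 ^ Suc (n + N))"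
  using summ by (subst summable_iff_shift)
 have t0: "0 <= t" unfolding t_def using d(1) by (intro suminf_nonneg summN) auto
 have gN: "(%n. (1/8) ^ N * ((3/8) * (1/8::real) ^ n)) sums ((1/8) ^ N * (3/8 * (1 / (1 - 1/8))))"
  by (intro sums_mult geometric_sums) auto
 have "t <= (1/8) ^ N * (3/8 * (1 / (1 - 1/8)))"
  unfolding t_def sums_unique[OF gN]
  by (intro suminf_le summN sums_summable[OF gN])
    (use le in \<open>auto simp: power_add field_simps\<close>)
 then have t1: "8 ^ N * t < 1"
  by (simp add: field_simps power_one_over)
 have "8 ^ N * (\<Sum>n<N. real_of_int (d n) / 8 ^ Suc n) = (\<Sum>n<N. real_of_int (d n * 8 ^ (N - Suc n)))"
  unfolding sum_distrib_left
 proof (rule sum.cong[OF refl])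
  fix n assume "n : {..<N}"
  then have "(8::real) ^ N = 8 ^ Suc n * 8 ^ (N - Suc n)"
   by (simp flip: power_add power_Suc)
  then show "8 ^ N * (real_of_int (d n) / 8 ^ Suc n) = real_of_int (d n * 8 ^ (N - Suc n))"
   by simp
 qed
 then have "8 ^ N * (\<Sum>n. real_of_int (d n) / 8 ^ Suc n)
   = 8 ^ N * t + real_of_int (\<Sum>n<N. d n * 8 ^ (N - Suc n))"
  unfolding split by (simp add: distrib_left)
 then show ?thesis
  using t0 t1 by (intro floor_unique) auto
qed

lemma code_digit_code: "code_digit n (pair_code z) = pair_digit z n"
proof -
 have "(\<Sum>k<Suc n. pair_digit z k * 8 ^ (Suc n - Suc k)) mod 8 = pair_digit z n"
 proof -
  have "(\<Sum>k<n. pair_digit z k * 8 ^ (n - k)) = 8 * (\<Sum>k<n. pair_digit z k * 8 ^ (n - Suc k))"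
   unfolding sum_distrib_left
  proof (rule sum.cong[OF refl])
   fix k assume "k : {..<n}"
   then have "n - k = Suc (n - Suc k)" by auto
   then show "pair_digit z k * 8 ^ (n - k) = 8 * (pair_digit z k * 8 ^ (n - Suc k))" by simp
  qed
  then have "(\<Sum>k<Suc n. pair_digit z k * 8 ^ (Suc n - Suc k))
    = 8 * (\<Sum>k<n. pair_digit z k * 8 ^ (n - Suc k)) + pair_digit z n"
   by simp
  then show ?thesis using pair_digit_bounds[of z n] by simp
 qed
 then show ?thesis
  unfolding code_digit_def pair_code_def
  by (subst digits_floor) (auto simp: pair_digit_bounds)
qed

text \<open>A Borel left inverse of a Borel injection. This is enough to recognise the image of the
  coding later as a Borel set of reals.\<close>

lemma pair_decode_code: "pair_decode (pair_code z) = z"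
proof -
 let ?u = "squash (fst z)" and ?v = "squash (snd z)"
 have "pair_digit z n div 2 = bit_of n ?u" "pair_digit z n mod 2 = bit_of n ?v" for n
  unfolding pair_digit_def using bit_of_cases[of n ?u] bit_of_cases[of n ?v] by auto
 moreover have "(\<Sum>n. real_of_int (bit_of n ?u) / 2 ^ Suc n) = ?u"
  "(\<Sum>n. real_of_int (bit_of n ?v) / 2 ^ Suc n) = ?v"
  using bit_of_sums[of ?u] bit_of_sums[of ?v] squash_bounds by (simp_all only: sums_iff)
 ultimately show ?thesis
  unfolding pair_decode_def code_digit_code by (simp add: unsquash_squash del: power_Suc)
qed

lemma measurable_pair_code [measurable]: "pair_code : borel_measurable (borel \<Otimes>\<^sub>M borel)"
 unfolding pair_code_def[abs_def] pair_digit_def bit_of_def by measurable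

lemma measurable_pair_decode [measurable]: "pair_decode : measurable borel (borel \<Otimes>\<^sub>M borel)"
 unfolding pair_decode_def[abs_def] code_digit_def by measurable

section \<open>Matrices through their entries, and their real codes\<close>

definition mk2 :: "real => real => real => real => real^2^2" where
 "mk2 a b c d = vector [vector [a, b], vector [c, d]]"

lemma mk2_nth [simp]:
 "mk2 a b c d $ 1 $ 1 = a" "mk2 a b c d $ 1 $ 2 = b" "mk2 a b c d $ 2 $ 1 = c" "mk2 a b c d $ 2 $ 2 = d"
 by (auto simp: mk2_def)

lemma mk2_eta: "mk2 (A$1$1) (A$1$2) (A$2$1) (A$2$2) = A"
 by (auto simp: vec_eq_iff forall_2)

lemma mk2_cases:
 obtains a b c d where "A = mk2 a b c d"
 using mk2_eta by metis

lemma mk2_eq_iff [simp]: "mk2 a b c d = mk2 a' b' c' d' \<longleftrightarrow> a = a' & b = b' & c = c' & d = d'"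
 by (auto simp: vec_eq_iff forall_2)

lemma borel_measurable_nth2 [measurable]: "(%A::real^2^2. A $ i $ j) : borel_measurable borel"
 by (intro borel_measurable_continuous_onI continuous_intros)

lemma borel_measurable_vec2:
 fixes f :: "'a => real^2^2"
 assumes "\<And>i j. (%x. f x $ i $ j) : borel_measurable M"
 shows "f : borel_measurable M"
proof -
 have "(%x. f x \<bullet> b) : borel_measurable M" if b: "b : Basis" for b :: "real^2^2"
 proof -
  obtain i j where "b = axis i (axis j 1)"
   using b by (auto simp: Basis_vec_def)
  then have "(%x. f x \<bullet> b) = (%x. f x $ i $ j)"
   by (auto simp: inner_axis)
  then show ?thesis using assms by simp
 qed
 then show ?thesis by (subst borel_measurable_euclidean_space) auto
qed

lemma borel_measurable_mk2 [measurable]: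
 assumes [measurable]: "f1 : borel_measurable M" "f2 : borel_measurable M"
  "f3 : borel_measurable M" "f4 : borel_measurable M"
 shows "(%x. mk2 (f1 x) (f2 x) (f3 x) (f4 x)) : borel_measurable M"
proof (rule borel_measurable_vec2)
 fix i j :: 2
 show "(%x. mk2 (f1 x) (f2 x) (f3 x) (f4 x) $ i $ j) : borel_measurable M"
  using exhaust_2[of i] exhaust_2[of j] by auto
qed

definition mat_code :: "real^2^2 => real" where
 "mat_code A = pair_code (pair_code (A$1$1, A$1$2), pair_code (A$2$1, A$2$2))"

definition mat_decode :: "real => real^2^2" where
 "mat_decode z = (let (u, v) = pair_decode z; (a, b) = pair_decode u; (c, d) = pair_decode v in mk2 a b c d)"

lemma mat_decode_code: "mat_decode (mat_code A) = A"
 by (simp add: mat_decode_def mat_code_def pair_decode_code mk2_eta)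

text \<open>Injectivity matters beyond the coding: \<open>mat_code\<close> also breaks ties between
  matrices of equal norm when the fundamental domain is chosen.\<close>

lemma inj_mat_code: "inj mat_code"
 by (metis injI mat_decode_code)

lemma measurable_mat_code [measurable]: "mat_code : borel_measurable borel"
 unfolding mat_code_def[abs_def] by measurable

lemma measurable_mat_decode [measurable]: "mat_decode : borel_measurable borel"
 unfolding mat_decode_def[abs_def] Let_def case_prod_beta by measurable

definition point_code :: "(real^2^2) \<times> real => real" where
 "point_code x = pair_code (mat_code (fst x), snd x)"

definition point_decode :: "real => (real^2^2) \<times> real" where
 "point_decode z = (mat_decode (fst (pair_decode z)), snd (pair_decode z))"

lemma point_decode_code: "point_decode (point_code x) = x"
 by (simp add: point_decode_def point_code_def pair_decode_code mat_decode_code)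

lemma measurable_point_code [measurable]: "point_code : borel_measurable (borel \<Otimes>\<^sub>M borel)"
 unfolding point_code_def[abs_def] by measurable

lemma measurable_point_decode [measurable]: "point_decode : measurable borel (borel \<Otimes>\<^sub>M borel)"
 unfolding point_decode_def[abs_def] by measurable

section \<open>Two by two matrices\<close>

lemma det_mk2 [simp]: "det (mk2 a b c d) = a * d - b * c"
 by (simp add: det_2)

lemma mk2_mult [simp]:
 "mk2 a b c d ** mk2 a' b' c' d' = mk2 (a*a' + b*c') (a*b' + b*d') (c*a' + d*c') (c*b' + d*d')"
 by (auto simp: vec_eq_iff forall_2 matrix_matrix_mult_def sum_2)

lemma mat_1_mk2: "mat 1 = mk2 1 0 0 1"
 by (auto simp: vec_eq_iff forall_2 mat_def)

lemma uminus_mk2: "- mk2 a b c d = mk2 (-a) (-b) (-c) (-d)"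
 by (auto simp: vec_eq_iff forall_2)

lemma scaleR_mk2: "r *\<^sub>R mk2 a b c d = mk2 (r*a) (r*b) (r*c) (r*d)"
 by (auto simp: vec_eq_iff forall_2)

lemma transpose_mk2 [simp]: "transpose (mk2 a b c d) = mk2 a c b d"
 by (auto simp: vec_eq_iff forall_2 transpose_def)

lemma mk2_in_SL2 [simp]: "mk2 a b c d : SL2 \<longleftrightarrow> a * d - b * c = 1"
 by (simp add: SL2_def)

lemma SL2_cases:
 assumes "A : SL2"
 obtains a b c d where "A = mk2 a b c d" "a * d - b * c = 1"
 using assms by (metis mk2_cases mk2_in_SL2)

lemma SL2_mult [simp, intro]: "A : SL2 ==> B : SL2 ==> A ** B : SL2"
 by (simp add: SL2_def det_mul)

lemma mat_1_in_SL2 [simp, intro]: "mat 1 : SL2"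
 by (simp add: SL2_def)

lemma transpose_in_SL2 [simp]: "transpose A : SL2 \<longleftrightarrow> A : SL2"
 by (simp add: SL2_def det_transpose)

text \<open>The adjugate, which is the inverse on \<open>SL2\<close>. Its entries are linear in
  those of the matrix, so measurability and invariance of the norm hold for all matrices.\<close>

definition adj2 :: "real^2^2 => real^2^2" where
 "adj2 A = mk2 (A$2$2) (- A$1$2) (- A$2$1) (A$1$1)"

lemma adj2_mk2 [simp]: "adj2 (mk2 a b c d) = mk2 d (-b) (-c) a"
 by (simp add: adj2_def)

lemma adj2_adj2 [simp]: "adj2 (adj2 A) = A"
 by (cases A rule: mk2_cases) simp

lemma adj2_in_SL2 [simp]: "adj2 A : SL2 \<longleftrightarrow> A : SL2"
 by (cases A rule: mk2_cases) (simp add: algebra_simps)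

lemma adj2_mult: "adj2 (A ** B) = adj2 B ** adj2 A"
 by (cases A rule: mk2_cases; cases B rule: mk2_cases) (simp add: algebra_simps)

lemma adj2_left [simp]: "A : SL2 ==> adj2 A ** A = mat 1"
 by (erule SL2_cases) (simp add: mat_1_mk2 algebra_simps)

lemma adj2_right [simp]: "A : SL2 ==> A ** adj2 A = mat 1"
 by (erule SL2_cases) (simp add: mat_1_mk2 algebra_simps)

lemma adj2_cancel_left [simp]: "A : SL2 ==> adj2 A ** (A ** B) = B" "A : SL2 ==> A ** (adj2 A ** B) = B"
 by (simp_all add: matrix_mul_assoc)

lemma adj2_cancel_right [simp]: "A : SL2 ==> B ** adj2 A ** A = B" "A : SL2 ==> B ** A ** adj2 A = B"
 by (simp_all flip: matrix_mul_assoc)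

text \<open>On \<open>SL2\<close> this squared Frobenius norm is \<open>2 * cosh\<close> of the
  hyperbolic distance by which the matrix moves the point i; its sublevel sets are the balls around
  that base point.\<close>

definition frob2 :: "real^2^2 => real" where
 "frob2 A = (A$1$1)^2 + (A$1$2)^2 + (A$2$1)^2 + (A$2$2)^2"

lemma frob2_mk2 [simp]: "frob2 (mk2 a b c d) = a^2 + b^2 + c^2 + d^2"
 by (simp add: frob2_def)

lemma frob2_adj2 [simp]: "frob2 (adj2 A) = frob2 A"
 by (cases A rule: mk2_cases) simp

lemma frob2_transpose [simp]: "frob2 (transpose A) = frob2 A"
 by (cases A rule: mk2_cases) simp

lemma frob2_eq_norm: "frob2 A = (norm A)^2"
 by (simp add: frob2_def norm_vec_def L2_set_def sum_2 sum_nonneg add_nonneg_nonneg)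

text \<open>Shears generate the group: a matrix with nonzero lower left entry is a product of an
  upper, a lower and an upper shear, and in the remaining case adding the first row to the second
  creates such an entry. Invariance thus needs to be checked for shears only.\<close>

lemma SL2_induct [consumes 1, case_names upper lower mult]:
 assumes A: "A : SL2"
  and up: "\<And>s. P (mk2 1 s 0 1)" and lo: "\<And>s. P (mk2 1 0 s 1)"
  and mult: "\<And>A B. A : SL2 ==> B : SL2 ==> P A ==> P B ==> P (A ** B)"
 shows "P A"
proof -
 have *: "P B" if B: "B = mk2 a b c d" "a * d - b * c = 1" "c ~= 0" for B a b c d
 proof -
  have "B = mk2 1 ((a - 1) / c) 0 1 ** (mk2 1 0 c 1 ** mk2 1 ((d - 1) / c) 0 1)"
   using B by (simp add: field_simps)
  moreover have "P (mk2 1 ((a - 1) / c) 0 1 ** (mk2 1 0 c 1 ** mk2 1 ((d - 1) / c) 0 1))"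
   by (intro mult up lo) auto
  ultimately show ?thesis by simp
 qed
 obtain a b c d where eq: "A = mk2 a b c d" "a * d - b * c = 1"
  using A by (rule SL2_cases)
 show ?thesis
 proof (cases "c = 0")
  case False
  then show ?thesis using * eq by blast
 next
  case True
  have "P (mk2 a b (c + a) (d + b))"
   using True eq by (intro *[of _ a b "c + a" "d + b"]) (auto simp: algebra_simps)
  then have "P (mk2 1 0 (-1) 1 ** mk2 a b (c + a) (d + b))"
   using eq by (intro mult lo) (auto simp: algebra_simps)
  then show ?thesis using eq by simp
 qed
qed

lemma borel_measurable_mult2 [measurable]:
 fixes f g :: "'a => real^2^2"
 assumes [measurable]: "f : borel_measurable M" "g : borel_measurable M"
 shows "(%x. f x ** g x) : borel_measurable M"
proof -
 have [measurable]: "(%x. f x $ i $ j) : borel_measurable M" "(%x. g x $ i $ j) : borel_measurable M" for i j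
  using measurable_compose[OF assms(1) borel_measurable_nth2] measurable_compose[OF assms(2) borel_measurable_nth2]
  by auto
 show ?thesis
  by (intro borel_measurable_vec2) (simp add: matrix_matrix_mult_def sum_2)
qed

lemma borel_measurable_det2 [measurable]: "(det :: real^2^2 => real) : borel_measurable borel"
 unfolding det_2[abs_def] by measurable

lemma borel_measurable_frob2 [measurable]: "frob2 : borel_measurable borel"
 unfolding frob2_def[abs_def] by measurable

lemma borel_measurable_adj2 [measurable]: "adj2 : borel_measurable borel"
 unfolding adj2_def[abs_def] by measurable

lemma borel_measurable_transpose2 [measurable]: "(transpose :: real^2^2 => real^2^2) : borel_measurable borel"
 by (intro borel_measurable_vec2) (simp add: transpose_def)

lemma SL2_sets [measurable]: "SL2 : sets borel"
 unfolding SL2_def by measurable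

lemma space_SL2_borel [simp]: "space SL2_borel = SL2"
 by (simp add: SL2_borel_def space_restrict_space)

lemma measurable_SL2_borelI:
 assumes "f : borel_measurable M" "\<And>x. x : space M ==> f x : SL2"
 shows "f : measurable M SL2_borel"
 unfolding SL2_borel_def using assms by (intro measurable_restrict_space2) auto

lemma measurable_ident_SL2 [measurable]: "(%x. x) : measurable SL2_borel borel"
 unfolding SL2_borel_def by (rule measurable_restrict_space1) simp

lemma measurable_from_SL2 [measurable_dest]: "f : measurable M SL2_borel ==> f : borel_measurable M"
 using measurable_compose[OF _ measurable_ident_SL2] by simp

lemma measurable_mult_SL2 [measurable]:
 assumes f: "f : measurable M SL2_borel" and g: "g : measurable M SL2_borel"
 shows "(%x. f x ** g x) : measurable M SL2_borel"
proof (rule measurable_SL2_borelI)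
 show "(%x. f x ** g x) : borel_measurable M"
  using f g by (intro borel_measurable_mult2) (auto dest: measurable_from_SL2)
 show "f x ** g x : SL2" if "x : space M" for x
  using measurable_space[OF f that] measurable_space[OF g that] by simp
qed

lemma measurable_adj2_SL2 [measurable]:
 assumes f: "f : measurable M SL2_borel"
 shows "(%x. adj2 (f x)) : measurable M SL2_borel"
proof (rule measurable_SL2_borelI)
 show "(%x. adj2 (f x)) : borel_measurable M"
  using measurable_from_SL2[OF f] by measurable
 show "adj2 (f x) : SL2" if "x : space M" for x
  using measurable_space[OF f that] by simp
qed

lemma measurable_const_SL2: "g : SL2 ==> (%x. g) : measurable M SL2_borel"
 by (rule measurable_const) simp

lemma measurable_mult_left_SL2: "g : SL2 ==> (%x. g ** x) : measurable SL2_borel SL2_borel"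
 by (intro measurable_mult_SL2 measurable_const_SL2) auto

lemma measurable_mult_right_SL2: "g : SL2 ==> (%x. x ** g) : measurable SL2_borel SL2_borel"
 by (intro measurable_mult_SL2 measurable_const_SL2) auto

section \<open>Lebesgue measure on matrices\<close>

lemma prod_Basis_mat2:
 fixes f :: "real^2^2 => 'a::comm_monoid_mult"
 shows "(\<Prod>b\<in>Basis. f b) = f (axis 1 (axis 1 1)) * f (axis 1 (axis 2 1)) * (f (axis 2 (axis 1 1)) * f (axis 2 (axis 2 1)))"
proof -
 have B: "(Basis :: (real^2^2) set) = {axis 1 (axis 1 1), axis 1 (axis 2 1), axis 2 (axis 1 1), axis 2 (axis 2 1)}"
  by (auto simp: Basis_vec_def UNIV_2)
 show ?thesis
  unfolding B by (simp add: axis_eq_axis mult.assoc)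
qed

lemma lborel_rows:
 "lborel = distr (lborel :: ((real \<times> real) \<times> (real \<times> real)) measure) borel
   (%(x, y). mk2 (fst x) (snd x) (fst y) (snd y))" (is "_ = ?M")
proof (rule lborel_eqI)
 have meas: "(%(x, y). mk2 (fst x) (snd x) (fst y) (snd y)) : borel_measurable (borel :: ((real \<times> real) \<times> (real \<times> real)) measure)"
  unfolding borel_prod[symmetric] by measurable
 fix l u :: "real^2^2" assume le: "\<And>b. b : Basis ==> l \<bullet> b <= u \<bullet> b"
 have le': "l $ i $ j <= u $ i $ j" for i j
  using le[of "axis i (axis j 1)"] by (simp add: inner_axis axis_in_Basis_iff)
 have "emeasure ?M (box l u) = emeasure lborel ((%(x, y). mk2 (fst x) (snd x) (fst y) (snd y)) -` box l u)"
  using meas by (subst emeasure_distr) auto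
 also have "(%(x, y). mk2 (fst x) (snd x) (fst y) (snd y)) -` box l u =
   box ((l$1$1, l$1$2), (l$2$1, l$2$2)) ((u$1$1, u$1$2), (u$2$1, u$2$2))"
  
  by (auto simp: mem_box Basis_prod_def Basis_vec_def UNIV_2 inner_axis)
 also have "emeasure lborel ... = (\<Prod>b\<in>Basis. (u - l) \<bullet> b)"
 proof -
  have B: "(Basis :: ((real \<times> real) \<times> (real \<times> real)) set) = {((1,0),(0,0)), ((0,1),(0,0)), ((0,0),(1,0)), ((0,0),(0,1))}"
   by (auto simp: Basis_prod_def zero_prod_def)
  show ?thesis
   using le' unfolding prod_Basis_mat2
   by (subst emeasure_lborel_box) (auto simp: B inner_axis mult.assoc)
 qed
 finally show "emeasure ?M (box l u) = (\<Prod>b\<in>Basis. (u - l) \<bullet> b)" .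
qed simp

lemma nn_integral_rows:
 fixes f :: "real^2^2 => ennreal"
 assumes [measurable]: "f : borel_measurable borel"
 shows "(\<integral>\<^sup>+B. f B \<partial>lborel) = (\<integral>\<^sup>+x. (\<integral>\<^sup>+y. f (mk2 (fst x) (snd x) (fst y) (snd y)) \<partial>lborel) \<partial>lborel)" (is "_ = ?A")
  and "(\<integral>\<^sup>+B. f B \<partial>lborel) = (\<integral>\<^sup>+y. (\<integral>\<^sup>+x. f (mk2 (fst x) (snd x) (fst y) (snd y)) \<partial>lborel) \<partial>lborel)" (is "_ = ?B")
proof -
 have meas: "(%(x, y). mk2 (fst x) (snd x) (fst y) (snd y)) : borel_measurable ((borel :: (real \<times> real) measure) \<Otimes>\<^sub>M (borel :: (real \<times> real) measure))"
  unfolding borel_prod[symmetric] by measurable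
 have meas2 [measurable]: "(%(x, y). f (mk2 (fst x) (snd x) (fst y) (snd y))) : borel_measurable ((lborel :: (real \<times> real) measure) \<Otimes>\<^sub>M (lborel :: (real \<times> real) measure))"
  using measurable_compose[OF meas assms] by (simp add: case_prod_beta')
 have "(\<integral>\<^sup>+B. f B \<partial>lborel) = (\<integral>\<^sup>+z. f ((%(x, y). mk2 (fst x) (snd x) (fst y) (snd y)) z) \<partial>lborel)"
  using meas by (subst lborel_rows, subst nn_integral_distr) (auto simp: borel_prod)
 also have "... = (\<integral>\<^sup>+z. (%(x, y). f (mk2 (fst x) (snd x) (fst y) (snd y))) z \<partial>(lborel \<Otimes>\<^sub>M lborel))"
  by (simp add: lborel_prod case_prod_beta')
 finally have *: "(\<integral>\<^sup>+B. f B \<partial>lborel) = ..." .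
 show "(\<integral>\<^sup>+B. f B \<partial>lborel) = ?A"
  unfolding * by (subst lborel.nn_integral_fst[symmetric]) auto
 show "(\<integral>\<^sup>+B. f B \<partial>lborel) = ?B"
  unfolding * by (subst lborel_pair.nn_integral_snd[symmetric]) auto
qed

lemma nn_integral_lborel_prod:
 fixes f :: "real \<times> real => ennreal"
 assumes [measurable]: "f : borel_measurable borel"
 shows "(\<integral>\<^sup>+z. f z \<partial>lborel) = (\<integral>\<^sup>+x. (\<integral>\<^sup>+y. f (x, y) \<partial>lborel) \<partial>lborel)"
proof -
 have [measurable]: "f : borel_measurable (lborel \<Otimes>\<^sub>M lborel)"
  using assms unfolding borel_prod[symmetric] by simp
 show ?thesis
  by (subst lborel_prod[symmetric], subst lborel.nn_integral_fst[symmetric]) auto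
qed

lemma nn_integral_entries:
 fixes f :: "real^2^2 => ennreal"
 assumes [measurable]: "f : borel_measurable borel"
 shows "(\<integral>\<^sup>+B. f B \<partial>lborel) = (\<integral>\<^sup>+a. \<integral>\<^sup>+b. \<integral>\<^sup>+c. \<integral>\<^sup>+d. f (mk2 a b c d) \<partial>lborel \<partial>lborel \<partial>lborel \<partial>lborel)"
proof -
 have m1: "(%x. mk2 a b (fst x) (snd x)) : borel_measurable (borel :: (real \<times> real) measure)" for a b
  unfolding borel_prod[symmetric] by measurable
 have "(%((x::real \<times> real), (y::real \<times> real)). f (mk2 (fst x) (snd x) (fst y) (snd y))) : borel_measurable (borel \<Otimes>\<^sub>M borel)"
  unfolding borel_prod[symmetric] by measurable
 then have m2: "(%x. \<integral>\<^sup>+y. f (mk2 (fst x) (snd x) (fst y) (snd y)) \<partial>lborel) : borel_measurable (borel :: (real \<times> real) measure)"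
  by (intro lborel.borel_measurable_nn_integral) (simp add: case_prod_beta' borel_prod cong: measurable_cong_sets)
 show ?thesis
  unfolding nn_integral_rows(1)[OF assms]
  by (subst nn_integral_lborel_prod[OF m2]) (simp add: nn_integral_lborel_prod measurable_compose[OF m1 assms])
qed

lemma nn_integral_lborel_shift:
 fixes f :: "'a::euclidean_space => ennreal"
 assumes [measurable]: "f : borel_measurable borel"
 shows "(\<integral>\<^sup>+x. f (x + c) \<partial>lborel) = (\<integral>\<^sup>+x. f x \<partial>lborel)"
proof -
 have "(\<integral>\<^sup>+x. f x \<partial>lborel) = (\<integral>\<^sup>+x. f x \<partial>distr lborel borel ((+) c))"
  by (simp add: lborel_distr_plus)
 also have "... = (\<integral>\<^sup>+x. f (c + x) \<partial>lborel)"
  by (subst nn_integral_distr) auto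
 finally show ?thesis by (simp add: add.commute)
qed

text \<open>In the iterated integral over the four entries, transposition merely exchanges the two
  middle variables.\<close>

lemma nn_integral_lborel_transpose:
 fixes f :: "real^2^2 => ennreal"
 assumes [measurable]: "f : borel_measurable borel"
 shows "(\<integral>\<^sup>+B. f (transpose B) \<partial>lborel) = (\<integral>\<^sup>+B. f B \<partial>lborel)"
 apply (subst (1 2) nn_integral_entries)
  apply (measurable)
 apply (subst (2) lborel_pair.Fubini')
  apply measurable
 done

text \<open>A shear on the left adds a multiple of one row to the other. With the unchanged row held
  fixed this is a translation of a plane, and the shears generate the group.\<close>

lemma nn_integral_lborel_mult_left:
 fixes f :: "real^2^2 => ennreal"
 assumes "g : SL2" "f : borel_measurable borel"
 shows "(\<integral>\<^sup>+B. f (g ** B) \<partial>lborel) = (\<integral>\<^sup>+B. f B \<partial>lborel)"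
 using assms
proof (induction g arbitrary: f rule: SL2_induct)
 case (upper s)
 note [measurable] = upper
 have m: "(%x. f (mk2 (fst x) (snd x) c d)) : borel_measurable (borel :: (real \<times> real) measure)" for c d
  unfolding borel_prod[symmetric] by measurable
 have "(\<integral>\<^sup>+B. f (mk2 1 s 0 1 ** B) \<partial>lborel) =
   (\<integral>\<^sup>+y. (\<integral>\<^sup>+x. (%x. f (mk2 (fst x) (snd x) (fst y) (snd y))) (x + s *\<^sub>R y) \<partial>lborel) \<partial>lborel)"
  by (subst nn_integral_rows(2)) (auto simp: fst_add snd_add)
 also have "... = (\<integral>\<^sup>+B. f B \<partial>lborel)"
  by (subst nn_integral_lborel_shift[OF m]) (simp add: nn_integral_rows(2))
 finally show ?case .
next
 case (lower s)
 note [measurable] = lower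
 have m: "(%x. f (mk2 a b (fst x) (snd x))) : borel_measurable (borel :: (real \<times> real) measure)" for a b
  unfolding borel_prod[symmetric] by measurable
 have "(\<integral>\<^sup>+B. f (mk2 1 0 s 1 ** B) \<partial>lborel) =
   (\<integral>\<^sup>+x. (\<integral>\<^sup>+y. (%y. f (mk2 (fst x) (snd x) (fst y) (snd y))) (y + s *\<^sub>R x) \<partial>lborel) \<partial>lborel)"
  by (subst nn_integral_rows(1)) (auto simp: fst_add snd_add add.commute)
 also have "... = (\<integral>\<^sup>+B. f B \<partial>lborel)"
  by (subst nn_integral_lborel_shift[OF m]) (simp add: nn_integral_rows(1))
 finally show ?case .
next
 case (mult A B)
 note [measurable] = mult.prems
 have "(%C. f (A ** C)) : borel_measurable borel" by measurable
 from mult.IH(2)[OF this] mult.IH(1)[OF mult.prems] show ?case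
  by (simp add: matrix_mul_assoc)
qed

lemma nn_integral_lborel_mult_right:
 fixes f :: "real^2^2 => ennreal"
 assumes g: "g : SL2" and [measurable]: "f : borel_measurable borel"
 shows "(\<integral>\<^sup>+B. f (B ** g) \<partial>lborel) = (\<integral>\<^sup>+B. f B \<partial>lborel)"
proof -
 have "(\<integral>\<^sup>+B. f (B ** g) \<partial>lborel) = (\<integral>\<^sup>+B. f (transpose (transpose g ** transpose B)) \<partial>lborel)"
  by (simp add: matrix_transpose_mul)
 also have "... = (\<integral>\<^sup>+B. f (transpose (transpose g ** B)) \<partial>lborel)"
  by (subst nn_integral_lborel_transpose) auto
 also have "... = (\<integral>\<^sup>+B. f (transpose B) \<partial>lborel)"
  using g by (subst nn_integral_lborel_mult_left[where f = "%B. f (transpose B)"]) auto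
 also have "... = (\<integral>\<^sup>+B. f B \<partial>lborel)"
  by (rule nn_integral_lborel_transpose) fact
 finally show ?thesis .
qed

section \<open>Haar measure as a cone measure\<close>

definition cone_part :: "(real^2^2) set" where
 "cone_part = {B. 0 < det B & det B <= 1}"

text \<open>The value \<open>mat 1\<close> off the cone is a default that keeps the map total,
  measurable and \<open>SL2\<close>-valued; the measure pushed forward lives on
  \<open>cone_part\<close>.\<close>

definition nrm :: "real^2^2 => real^2^2" where
 "nrm B = (if 0 < det B then (1 / sqrt (det B)) *\<^sub>R B else mat 1)"

text \<open>A set receives the Lebesgue volume of the cone over it, cut off at determinant one.
  Invariance under both translations and under transposition is inherited from Lebesgue measure, and
  so are explicit volume bounds.\<close>

definition haar :: "(real^2^2) measure" where
 "haar = distr (density lborel (indicator cone_part)) SL2_borel nrm"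

lemma nrm_in_SL2 [simp]: "nrm B : SL2"
proof (cases B rule: mk2_cases)
 case (1 a b c d)
 have "a / sqrt e * (d / sqrt e) - b / sqrt e * (c / sqrt e) = 1" if "e = a * d - b * c" "0 < e" for e
  using that by (simp add: field_simps)
 then show ?thesis
  using 1 by (auto simp: nrm_def scaleR_mk2)
qed

lemma cone_part_sets [measurable]: "cone_part : sets borel"
 unfolding cone_part_def by measurable

lemma measurable_nrm [measurable]: "nrm : measurable borel SL2_borel"
proof (rule measurable_SL2_borelI)
 show "nrm : borel_measurable borel"
  unfolding nrm_def[abs_def] by measurable
qed simp

lemma sets_haar [simp, measurable_cong]: "sets haar = sets SL2_borel"
 by (simp add: haar_def)

lemma space_haar [simp]: "space haar = SL2"
 by (simp add: haar_def)

lemma nn_integral_haar: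
 assumes [measurable]: "f : borel_measurable SL2_borel"
 shows "(\<integral>\<^sup>+g. f g \<partial>haar) = (\<integral>\<^sup>+B. indicator cone_part B * f (nrm B) \<partial>lborel)"
proof -
 have [measurable]: "(%B. f (nrm B)) : borel_measurable borel" by measurable
 show ?thesis
  unfolding haar_def by (subst nn_integral_distr) (auto simp: nn_integral_density)
qed

lemma scaleR_mult2:
 fixes A B :: "real^2^2"
 shows "r *\<^sub>R (A ** B) = A ** (r *\<^sub>R B)" "r *\<^sub>R (A ** B) = (r *\<^sub>R A) ** B"
 by (cases A rule: mk2_cases; cases B rule: mk2_cases; simp add: scaleR_mk2 algebra_simps)+

lemma nrm_mult_left: "g : SL2 ==> B : cone_part ==> nrm (g ** B) = g ** nrm B"
 by (simp add: nrm_def cone_part_def SL2_def det_mul scaleR_mult2(1))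

lemma nrm_mult_right: "g : SL2 ==> B : cone_part ==> nrm (B ** g) = nrm B ** g"
 by (simp add: nrm_def cone_part_def SL2_def det_mul scaleR_mult2(2))

lemma nrm_transpose: "nrm (transpose B) = transpose (nrm B)"
 by (cases B rule: mk2_cases) (simp add: nrm_def scaleR_mk2 mat_1_mk2 mult.commute)

lemma cone_part_mult [simp]: "g : SL2 ==> g ** B : cone_part \<longleftrightarrow> B : cone_part"
 "g : SL2 ==> B ** g : cone_part \<longleftrightarrow> B : cone_part"
 by (simp_all add: cone_part_def SL2_def det_mul)

lemma nn_integral_haar_left:
 assumes f [measurable]: "f : borel_measurable SL2_borel" and g: "g : SL2"
 shows "(\<integral>\<^sup>+x. f (g ** x) \<partial>haar) = (\<integral>\<^sup>+x. f x \<partial>haar)"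
proof -
 have "(%x. f (g ** x)) : borel_measurable SL2_borel"
  by (rule measurable_compose[OF measurable_mult_left_SL2[OF g] f])
 then have "(\<integral>\<^sup>+x. f (g ** x) \<partial>haar) = (\<integral>\<^sup>+B. indicator cone_part B * f (g ** nrm B) \<partial>lborel)"
  by (rule nn_integral_haar)
 also have "... = (\<integral>\<^sup>+B. indicator cone_part (g ** B) * f (nrm (g ** B)) \<partial>lborel)"
  using g by (intro nn_integral_cong) (auto simp: nrm_mult_left split: split_indicator)
 also have "... = (\<integral>\<^sup>+B. indicator cone_part B * f (nrm B) \<partial>lborel)"
  by (rule nn_integral_lborel_mult_left[OF g]) measurable
 finally show ?thesis by (simp add: nn_integral_haar)
qed

lemma nn_integral_haar_right:
 assumes f [measurable]: "f : borel_measurable SL2_borel" and g: "g : SL2"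
 shows "(\<integral>\<^sup>+x. f (x ** g) \<partial>haar) = (\<integral>\<^sup>+x. f x \<partial>haar)"
proof -
 have "(%x. f (x ** g)) : borel_measurable SL2_borel"
  by (rule measurable_compose[OF measurable_mult_right_SL2[OF g] f])
 then have "(\<integral>\<^sup>+x. f (x ** g) \<partial>haar) = (\<integral>\<^sup>+B. indicator cone_part B * f (nrm B ** g) \<partial>lborel)"
  by (rule nn_integral_haar)
 also have "... = (\<integral>\<^sup>+B. indicator cone_part (B ** g) * f (nrm (B ** g)) \<partial>lborel)"
  using g by (intro nn_integral_cong) (auto simp: nrm_mult_right split: split_indicator)
 also have "... = (\<integral>\<^sup>+B. indicator cone_part B * f (nrm B) \<partial>lborel)"
  by (rule nn_integral_lborel_mult_right[OF g]) measurable
 finally show ?thesis by (simp add: nn_integral_haar)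
qed

lemma nn_integral_haar_transpose:
 assumes f [measurable]: "f : borel_measurable SL2_borel"
 shows "(\<integral>\<^sup>+x. f (transpose x) \<partial>haar) = (\<integral>\<^sup>+x. f x \<partial>haar)"
proof -
 have "transpose : measurable SL2_borel SL2_borel"
  by (rule measurable_SL2_borelI) auto
 then have "(%x. f (transpose x)) : borel_measurable SL2_borel"
  by (rule measurable_compose) fact
 then have "(\<integral>\<^sup>+x. f (transpose x) \<partial>haar) = (\<integral>\<^sup>+B. indicator cone_part B * f (transpose (nrm B)) \<partial>lborel)"
  by (rule nn_integral_haar)
 also have "... = (\<integral>\<^sup>+B. indicator cone_part (transpose B) * f (nrm (transpose B)) \<partial>lborel)"
  by (intro nn_integral_cong) (auto simp: nrm_transpose cone_part_def det_transpose split: split_indicator)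
 also have "... = (\<integral>\<^sup>+B. indicator cone_part B * f (nrm B) \<partial>lborel)"
  by (rule nn_integral_lborel_transpose) measurable
 finally show ?thesis by (simp add: nn_integral_haar)
qed

definition fball :: "real => (real^2^2) set" where
 "fball s = {g : SL2. frob2 g <= s}"

lemma SL2_borel_CollectI:
 assumes [measurable]: "Measurable.pred borel P"
 shows "{g : SL2. P g} : sets SL2_borel"
proof -
 have "Measurable.pred SL2_borel P"
  using measurable_compose[OF measurable_ident_SL2 assms] by simp
 then show ?thesis by (simp add: pred_def)
qed

lemma fball_sets [measurable]: "fball s : sets SL2_borel"
 unfolding fball_def by (rule SL2_borel_CollectI) measurable

lemma emeasure_haar:
 assumes [measurable]: "A : sets SL2_borel"
 shows "emeasure haar A = emeasure lborel (cone_part \<inter> nrm -` A)"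
proof -
 have "nrm -` A \<inter> space borel : sets borel" by measurable
 then have [measurable]: "nrm -` A : sets borel" by simp
 have "emeasure haar A = (\<integral>\<^sup>+B. indicator cone_part B * indicator A (nrm B) \<partial>lborel)"
  using nn_integral_haar[of "indicator A"] by simp
 also have "... = (\<integral>\<^sup>+B. indicator (cone_part \<inter> nrm -` A) B \<partial>lborel)"
  by (intro nn_integral_cong) (auto split: split_indicator)
 finally show ?thesis by simp
qed

lemma frob2_nrm: "B : cone_part ==> frob2 (nrm B) = frob2 B / det B"
 by (cases B rule: mk2_cases)
   (auto simp: cone_part_def nrm_def scaleR_mk2 power_divide add_divide_distrib)

lemma frob2_nonneg [simp]: "0 <= frob2 A"
 by (simp add: frob2_eq_norm)

text \<open>The determinant is at most one on the cone, so the cone over a norm ball stays inside a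
  Euclidean ball.\<close>

lemma emeasure_haar_fball_finite: "emeasure haar (fball s) < \<infinity>"
proof -
 have "emeasure haar (fball s) = emeasure lborel (cone_part \<inter> nrm -` fball s)"
  by (simp add: emeasure_haar)
 also have "... <= emeasure lborel (cball (0 :: real^2^2) (sqrt \<bar>s\<bar>))"
 proof (rule emeasure_mono)
  show "cone_part \<inter> nrm -` fball s \<subseteq> cball 0 (sqrt \<bar>s\<bar>)"
  proof (rule subsetI)
   fix B assume "B : cone_part \<inter> nrm -` fball s"
   then have B: "B : cone_part" and "frob2 B / det B <= s"
    by (auto simp: frob2_nrm[symmetric] fball_def)
   then have "frob2 B <= s * det B" by (simp add: cone_part_def divide_le_eq)
   also have "... <= \<bar>s\<bar> * 1"
    using B by (intro mult_mono) (auto simp: cone_part_def)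
   finally have "norm B <= sqrt \<bar>s\<bar>"
    by (simp add: frob2_eq_norm real_le_rsqrt)
   then show "B : cball 0 (sqrt \<bar>s\<bar>)" by simp
  qed
 qed auto
 also have "... < \<infinity>" by (intro emeasure_bounded_finite) auto
 finally show ?thesis .
qed

lemma SL2_eq_Union_fball: "SL2 = (\<Union>n::nat. fball (real n))"
 unfolding fball_def using real_arch_simple by auto

lemma sigma_finite_on_SL2:
 assumes "sets M = sets SL2_borel" "\<And>s. emeasure M (fball s) < \<infinity>"
 shows "sigma_finite_measure M"
proof
 show "\<exists>A. countable A & A \<subseteq> sets M & \<Union> A = space M & (\<forall>a\<in>A. emeasure M a ~= \<infinity>)"
  using assms sets_eq_imp_space_eq[OF assms(1)]
  by (intro exI[of _ "range (%n::nat. fball (real n))"])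
    (auto simp: SL2_eq_Union_fball less_top)
qed

interpretation haar: sigma_finite_measure haar
 by (rule sigma_finite_on_SL2) (use emeasure_haar_fball_finite in auto)

subsection \<open>Uniqueness\<close>

lemma compact_fball: "compact (fball s)"
proof -
 have cont: "continuous_on UNIV (det :: real^2^2 => real)" "continuous_on UNIV frob2"
  unfolding det_2[abs_def] frob2_def[abs_def] by (intro continuous_intros)+
 have "closed ({A. det A = 1} \<inter> {A::real^2^2. frob2 A <= s})"
  by (intro closed_Int closed_Collect_eq closed_Collect_le cont continuous_on_const)
 then have "closed (fball s)"
  by (simp add: fball_def SL2_def Collect_conj_eq)
 moreover have "bounded (fball s)"
  unfolding bounded_iff
  by (rule exI[of _ "sqrt s"]) (auto simp: fball_def frob2_eq_norm real_le_rsqrt)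
 ultimately show ?thesis by (simp add: compact_eq_bounded_closed)
qed

lemma haar_SL2_pos: "0 < emeasure haar SL2"
proof -
 let ?U = "{B::real^2^2. 0 < det B} \<inter> {B. det B < 1}"
 have cont: "continuous_on UNIV (det :: real^2^2 => real)"
  unfolding det_2[abs_def] by (intro continuous_intros)
 have "open ?U"
  by (intro open_Int open_Collect_less cont continuous_on_const)
 moreover have "mk2 (1/2) 0 0 (1/2) : ?U" by simp
 ultimately have "\<not> negligible ?U"
  using open_not_negligible by blast
 then have "emeasure lborel ?U ~= 0"
  using \<open>open ?U\<close> by (auto simp: negligible_iff_emeasure0 borel_open)
 moreover have "emeasure lborel ?U <= emeasure lborel cone_part"
  by (rule emeasure_mono) (auto simp: cone_part_def)
 moreover have "emeasure haar SL2 = emeasure lborel (cone_part \<inter> nrm -` SL2)"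
  by (rule emeasure_haar) (metis sets.top space_SL2_borel)
 moreover have "nrm -` SL2 = UNIV" by auto
 ultimately show ?thesis by (auto simp: zero_less_iff_neq_zero)
qed

context
 fixes lam :: "(real^2^2) measure"
 assumes lam: "haar_measure_SL2 lam"
begin

lemma sets_lam: "sets lam = sets SL2_borel" and space_lam: "space lam = SL2"
 using lam by (auto simp: haar_measure_SL2_def)

lemma measurable_lam: "borel_measurable lam = borel_measurable SL2_borel"
 by (rule measurable_cong_sets) (simp_all add: sets_lam)

lemma lam_fball_finite: "emeasure lam (fball s) < \<infinity>"
 using lam compact_fball by (auto simp: haar_measure_SL2_def fball_def)

lemma lam_sigma_finite: "sigma_finite_measure lam"
 by (rule sigma_finite_on_SL2) (use lam_fball_finite sets_lam in auto)

lemma nn_integral_lam_left: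
 assumes f: "f : borel_measurable SL2_borel" and g: "g : SL2"
 shows "(\<integral>\<^sup>+x. f (g ** x) \<partial>lam) = (\<integral>\<^sup>+x. f x \<partial>lam)"
proof -
 have m: "(%x. g ** x) : measurable lam lam"
  using measurable_mult_left_SL2[OF g] by (simp add: sets_lam cong: measurable_cong_sets)
 have "distr lam lam (%x. g ** x) = lam"
 proof (rule measure_eqI)
  fix A assume "A : sets (distr lam lam ((**) g))"
  then have A: "A : sets lam" by simp
  then have sub: "A \<subseteq> SL2" using sets.sets_into_space space_lam by blast
  have "emeasure (distr lam lam ((**) g)) A = emeasure lam ((**) g -` A \<inter> SL2)"
   using m A by (simp add: emeasure_distr space_lam)
  also have "(**) g -` A \<inter> SL2 = (**) (adj2 g) ` A"
   using g sub by (force simp: image_iff)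
  also have "emeasure lam ... = emeasure lam A"
   using lam A g by (auto simp: haar_measure_SL2_def)
  finally show "emeasure (distr lam lam ((**) g)) A = emeasure lam A" .
 qed simp
 then have "(\<integral>\<^sup>+x. f x \<partial>lam) = (\<integral>\<^sup>+x. f x \<partial>distr lam lam ((**) g))" by simp
 also have "... = (\<integral>\<^sup>+x. f (g ** x) \<partial>lam)"
  using f by (intro nn_integral_distr[OF m]) (simp add: measurable_lam)
 finally show ?thesis by simp
qed

text \<open>The usual uniqueness argument: the double integral of \<open>f x * h (y ** x)\<close> is
  evaluated in both orders, using left invariance of \<open>lam\<close> and invariance of
  \<open>haar\<close> on both sides.\<close>

lemma lam_haar_exchange:
 assumes f [measurable]: "f : borel_measurable SL2_borel" and h [measurable]: "h : borel_measurable SL2_borel"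
 shows "(\<integral>\<^sup>+x. f x \<partial>lam) * (\<integral>\<^sup>+y. h y \<partial>haar) = (\<integral>\<^sup>+x. h x \<partial>lam) * (\<integral>\<^sup>+y. f (adj2 y) \<partial>haar)"
proof -
 interpret L: sigma_finite_measure lam by (rule lam_sigma_finite)
 interpret P: pair_sigma_finite lam haar ..
 note [measurable_cong] = sets_lam
 have "(\<integral>\<^sup>+x. f x \<partial>lam) * (\<integral>\<^sup>+y. h y \<partial>haar) = (\<integral>\<^sup>+x. f x * (\<integral>\<^sup>+y. h y \<partial>haar) \<partial>lam)"
  by (subst nn_integral_multc) auto
 also have "... = (\<integral>\<^sup>+x. f x * (\<integral>\<^sup>+y. h (y ** x) \<partial>haar) \<partial>lam)"
  by (intro nn_integral_cong) (simp add: nn_integral_haar_right[OF h] space_lam)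
 also have "... = (\<integral>\<^sup>+x. (\<integral>\<^sup>+y. f x * h (y ** x) \<partial>haar) \<partial>lam)"
 proof (intro nn_integral_cong)
  fix x assume "x : space lam"
  then have "(%y. h (y ** x)) : borel_measurable haar"
   using measurable_compose[OF measurable_mult_right_SL2 h] by (simp add: space_lam)
  then show "f x * (\<integral>\<^sup>+y. h (y ** x) \<partial>haar) = (\<integral>\<^sup>+y. f x * h (y ** x) \<partial>haar)"
   by (simp add: nn_integral_cmult)
 qed
 also have "... = (\<integral>\<^sup>+y. (\<integral>\<^sup>+x. f x * h (y ** x) \<partial>lam) \<partial>haar)"
  by (rule P.Fubini'[symmetric]) measurable
 also have "... = (\<integral>\<^sup>+y. (\<integral>\<^sup>+x. f (adj2 y ** x) * h x \<partial>lam) \<partial>haar)"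
 proof (rule nn_integral_cong)
  fix y assume "y : space haar"
  then have y: "y : SL2" by simp
  have m: "(%x. f (adj2 y ** x) * h x) : borel_measurable SL2_borel"
   using measurable_compose[OF measurable_mult_left_SL2 f, of "adj2 y"] y by simp
  have "(\<integral>\<^sup>+x. f (adj2 y ** x) * h x \<partial>lam) = (\<integral>\<^sup>+x. f (adj2 y ** (y ** x)) * h (y ** x) \<partial>lam)"
   by (rule nn_integral_lam_left[OF m y, symmetric])
  then show "(\<integral>\<^sup>+x. f x * h (y ** x) \<partial>lam) = (\<integral>\<^sup>+x. f (adj2 y ** x) * h x \<partial>lam)"
   using y by simp
 qed
 also have "... = (\<integral>\<^sup>+x. (\<integral>\<^sup>+y. f (adj2 y ** x) * h x \<partial>haar) \<partial>lam)"
  by (rule P.Fubini') measurable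
 also have "... = (\<integral>\<^sup>+x. (\<integral>\<^sup>+y. f (adj2 y) \<partial>haar) * h x \<partial>lam)"
 proof (intro nn_integral_cong)
  fix x assume "x : space lam"
  then have x: "x : SL2" by (simp add: space_lam)
  have m: "(%y. f (adj2 y ** x)) : borel_measurable SL2_borel"
   by (rule measurable_compose[OF _ f]) (intro measurable_mult_SL2 measurable_adj2_SL2 measurable_const_SL2 x measurable_ident_sets refl)
  have "(\<integral>\<^sup>+y. f (adj2 y ** x) \<partial>haar) = (\<integral>\<^sup>+y. f (adj2 (x ** y) ** x) \<partial>haar)"
   by (rule nn_integral_haar_left[OF m x, symmetric])
  also have "... = (\<integral>\<^sup>+y. f (adj2 y) \<partial>haar)"
   using x by (simp add: adj2_mult)
  finally show "(\<integral>\<^sup>+y. f (adj2 y ** x) * h x \<partial>haar) = (\<integral>\<^sup>+y. f (adj2 y) \<partial>haar) * h x"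
   using m by (simp add: nn_integral_multc)
 qed
 also have "... = (\<integral>\<^sup>+x. h x \<partial>lam) * (\<integral>\<^sup>+y. f (adj2 y) \<partial>haar)"
  by (subst nn_integral_cmult) (auto simp: mult.commute)
 finally show ?thesis .
qed

lemma lam_fball_pos:
 assumes "2 < s"
 shows "0 < emeasure lam (fball s)"
proof -
 have cont: "continuous_on UNIV frob2"
  unfolding frob2_def[abs_def] by (intro continuous_intros)
 have "open {A. frob2 A < s}"
  by (intro open_Collect_less cont continuous_on_const)
 then have "openin (top_of_set SL2) (SL2 \<inter> {A. frob2 A < s})"
  by (simp add: openin_open_Int)
 moreover have "mat 1 : SL2 \<inter> {A. frob2 A < s}"
  using assms by (simp add: mat_1_mk2)
 ultimately have "0 < emeasure lam (SL2 \<inter> {A. frob2 A < s})"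
  using lam unfolding haar_measure_SL2_def by blast
 also have "... <= emeasure lam (fball s)"
  by (rule emeasure_mono) (use fball_sets in \<open>auto simp: fball_def sets_lam\<close>)
 finally show ?thesis .
qed

text \<open>The exchange formula is applied to a norm ball, which is stable under inversion. The
  bound 3 exceeds \<open>frob2 (mat 1) = 2\<close>, so the ball contains a neighbourhood of the
  identity and has positive \<open>lam\<close> measure.\<close>

lemma lam_proportional_haar:
 obtains c :: real where "0 < c"
  "\<And>h. h : borel_measurable SL2_borel ==> (\<integral>\<^sup>+x. h x \<partial>lam) = ennreal c * (\<integral>\<^sup>+x. h x \<partial>haar)"
proof -
 let ?S = "fball 3"
 have ex: "emeasure lam ?S * (\<integral>\<^sup>+y. h y \<partial>haar) = (\<integral>\<^sup>+x. h x \<partial>lam) * emeasure haar ?S"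
  if "h : borel_measurable SL2_borel" for h
 proof -
  have "(\<integral>\<^sup>+y. indicator ?S (adj2 y) \<partial>haar) = (\<integral>\<^sup>+y. indicator ?S y \<partial>haar)"
   by (intro nn_integral_cong) (auto simp: fball_def split: split_indicator)
  then show ?thesis
   using lam_haar_exchange[OF _ that, of "indicator ?S"] by (simp add: sets_lam)
 qed
 have pos: "emeasure lam ?S ~= 0" using lam_fball_pos[of 3] by auto
 have "emeasure haar ?S ~= 0"
 proof
  assume "emeasure haar ?S = 0"
  then have "emeasure lam ?S * (\<integral>\<^sup>+y. 1 \<partial>haar) = 0"
   using ex[of "%_. 1"] by simp
  then show False using pos haar_SL2_pos by simp
 qed
 then obtain b where b: "0 < b" "emeasure haar ?S = ennreal b"
  using emeasure_haar_fball_finite[of 3]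
  by (metis ennreal_cases infinity_ennreal_def less_irrefl less_le_not_le order_le_less ennreal_0)
 obtain a where a: "0 < a" "emeasure lam ?S = ennreal a"
  using pos lam_fball_finite[of 3]
  by (metis ennreal_cases infinity_ennreal_def less_irrefl less_le_not_le order_le_less ennreal_0)
 show thesis
 proof (rule that[of "a / b"])
  show "0 < a / b" using a b by simp
  fix h :: "real^2^2 => ennreal" assume "h : borel_measurable SL2_borel"
  then have eq: "ennreal a * (\<integral>\<^sup>+y. h y \<partial>haar) = (\<integral>\<^sup>+x. h x \<partial>lam) * ennreal b"
   using ex a b by simp
  have "ennreal (a / b) * (\<integral>\<^sup>+y. h y \<partial>haar) = ennreal (1 / b) * (ennreal a * (\<integral>\<^sup>+y. h y \<partial>haar))"
   using a b by (simp add: mult.assoc[symmetric] ennreal_mult'[symmetric])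
  also have "... = (\<integral>\<^sup>+x. h x \<partial>lam) * (ennreal (1 / b) * ennreal b)"
   unfolding eq by (simp add: mult_ac)
  also have "ennreal (1 / b) * ennreal b = 1"
   using b by (simp add: ennreal_mult'[symmetric])
  finally show "(\<integral>\<^sup>+x. h x \<partial>lam) = ennreal (a / b) * (\<integral>\<^sup>+x. h x \<partial>haar)" by simp
 qed
qed

end

section \<open>Volume estimates\<close>

lemma ennreal_divide_left_mono: "b <= c ==> a / c <= a / (b::ennreal)"
proof -
 assume "b <= c"
 then have "inverse c <= inverse b"
  by (simp add: less_eq_ennreal.rep_eq inverse_ennreal.rep_eq ereal_inverse_antimono)
 then show ?thesis
  unfolding divide_ennreal_def by (rule mult_left_mono) simp
qed

text \<open>Elements of a ball whose first row is short. Up to a transposition and a rotation these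
  are the elements that contract a given vector.\<close>

definition row_ball :: "real => real => (real^2^2) set" where
 "row_ball k s = {g : SL2. frob2 g <= s & (g$1$1)\<^sup>2 + (g$1$2)^2 < k\<^sup>2}"

lemma row_ball_sets [measurable]: "row_ball k s : sets SL2_borel"
 unfolding row_ball_def by (rule SL2_borel_CollectI) measurable

definition row_cone :: "real => real => (real^2^2) set" where
 "row_cone k s = {B : cone_part. frob2 B <= s * det B & (B$1$1)\<^sup>2 + (B$1$2)^2 < k\<^sup>2 * det B}"

lemma row_cone_sets [measurable]: "row_cone k s : sets borel"
 unfolding row_cone_def by measurable

lemma emeasure_row_ball: "emeasure haar (row_ball k s) = emeasure lborel (row_cone k s)"
proof -
 have "cone_part \<inter> nrm -` row_ball k s = row_cone k s"
 proof -
  have "B : nrm -` row_ball k s \<longleftrightarrow> B : row_cone k s" if B: "B : cone_part" for B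
  proof -
   have d: "0 < det B" using B by (simp add: cone_part_def)
   have "(nrm B $ 1 $ 1)^2 + (nrm B $ 1 $ 2)^2 = ((B$1$1)^2 + (B$1$2)^2) / det B"
    using d by (simp add: nrm_def power_divide add_divide_distrib)
   then show ?thesis
    using B d by (simp add: row_ball_def row_cone_def frob2_nrm pos_divide_le_eq pos_divide_less_eq)
  qed
  then show ?thesis by (auto simp: row_cone_def)
 qed
 then show ?thesis by (simp add: emeasure_haar)
qed

lemma nn_integral_slab:
 fixes a b c lo hi :: real
 assumes "0 < a" "lo <= hi"
 shows "(\<integral>\<^sup>+d. indicator {d. lo <= a * d - b * c & a * d - b * c <= hi} d \<partial>lborel) = ennreal ((hi - lo) / a)"
proof -
 have "{d. lo <= a * d - b * c & a * d - b * c <= hi} = {(lo + b * c) / a..(hi + b * c) / a}"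
  using assms by (auto simp: field_simps)
 moreover have "(lo + b * c) / a <= (hi + b * c) / a"
  using assms by (intro divide_right_mono) auto
 ultimately show ?thesis by (simp add: diff_divide_distrib add_divide_distrib)
qed

text \<open>The determinant condition leaves an interval of length \<open>(hi - lo) / a\<close> for
  the last entry, and the second entry runs through length \<open>(b1 - b0) * a\<close>. The factors
  \<open>a\<close> cancel, hence the plain product.\<close>

lemma slab_volume:
 fixes a0 a1 b0 b1 c0 c1 lo hi :: real
 assumes "0 <= a0" "a0 <= a1" "b0 <= b1" "c0 <= c1" "lo <= hi"
 defines "W \<equiv> {B::real^2^2. a0 < B$1$1 & B$1$1 < a1 & b0 * B$1$1 <= B$1$2 & B$1$2 <= b1 * B$1$1 \<and>
   c0 <= B$2$1 & B$2$1 <= c1 & lo <= det B & det B <= hi}"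
 shows "W : sets borel" "emeasure lborel W = ennreal ((a1 - a0) * (b1 - b0) * (c1 - c0) * (hi - lo))"
proof -
 show W [measurable]: "W : sets borel"
  unfolding W_def by measurable
 let ?K = "(b1 - b0) * (c1 - c0) * (hi - lo)"
 have "emeasure lborel W = (\<integral>\<^sup>+a. \<integral>\<^sup>+b. \<integral>\<^sup>+c. \<integral>\<^sup>+d. indicator W (mk2 a b c d) \<partial>lborel \<partial>lborel \<partial>lborel \<partial>lborel)"
  by (subst nn_integral_entries[symmetric]) auto
 also have "... = (\<integral>\<^sup>+a. ennreal ?K * indicator {a0<..<a1} a \<partial>lborel)"
 proof (rule nn_integral_cong)
  fix a :: real
  show "(\<integral>\<^sup>+b. \<integral>\<^sup>+c. \<integral>\<^sup>+d. indicator W (mk2 a b c d) \<partial>lborel \<partial>lborel \<partial>lborel) = ennreal ?K * indicator {a0<..<a1} a"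
  proof (cases "a0 < a & a < a1")
   case True
   then have a: "0 < a" using assms by simp
   have d: "(\<integral>\<^sup>+d. indicator W (mk2 a b c d) \<partial>lborel)
     = ennreal ((hi - lo) / a) * indicator {b0 * a..b1 * a} b * indicator {c0..c1} c" for b c
   proof (cases "c : {c0..c1} & b : {b0 * a..b1 * a}")
    case bc: True
    then have "(\<integral>\<^sup>+d. indicator W (mk2 a b c d) \<partial>lborel)
      = (\<integral>\<^sup>+d. indicator {d. lo <= a * d - b * c & a * d - b * c <= hi} d \<partial>lborel)"
     using True by (intro nn_integral_cong) (auto simp: W_def split: split_indicator)
    then show ?thesis using bc nn_integral_slab[OF a assms(5), of b c] by simp
   next
    case False
    then have "indicator W (mk2 a b c d) = (0::ennreal)" for d
     by (auto simp: W_def split: split_indicator)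
    then show ?thesis using False by (auto split: split_indicator)
   qed
   have "(\<integral>\<^sup>+b. \<integral>\<^sup>+c. \<integral>\<^sup>+d. indicator W (mk2 a b c d) \<partial>lborel \<partial>lborel \<partial>lborel)
     = (\<integral>\<^sup>+b. ennreal ((hi - lo) / a) * indicator {b0 * a..b1 * a} b * ennreal (c1 - c0) \<partial>lborel)"
    unfolding d using assms by (intro nn_integral_cong) (simp add: nn_integral_cmult)
   also have "... = (\<integral>\<^sup>+b. ennreal ((hi - lo) / a * (c1 - c0)) * indicator {b0 * a..b1 * a} b \<partial>lborel)"
   proof (rule nn_integral_cong)
    have "ennreal ((hi - lo) / a * (c1 - c0)) = ennreal ((hi - lo) / a) * ennreal (c1 - c0)"
     using a assms by (intro ennreal_mult) auto
    then show "ennreal ((hi - lo) / a) * indicator {b0 * a..b1 * a} b * ennreal (c1 - c0)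
      = ennreal ((hi - lo) / a * (c1 - c0)) * indicator {b0 * a..b1 * a} b" for b
     by (simp add: mult_ac)
   qed
   also have "... = ennreal ((hi - lo) / a * (c1 - c0)) * ennreal (b1 * a - b0 * a)"
    using a assms by (simp add: nn_integral_cmult mult_right_mono)
   also have "... = ennreal ((hi - lo) / a * (c1 - c0) * (b1 * a - b0 * a))"
    using a assms by (intro ennreal_mult[symmetric]) (auto intro: mult_right_mono)
   also have "(hi - lo) / a * (c1 - c0) * (b1 * a - b0 * a) = ?K"
    using a by (simp add: field_simps)
   finally show ?thesis using True by simp
  next
   case False
   then show ?thesis by (auto simp: W_def)
  qed
 qed
 also have "... = ennreal ((a1 - a0) * (b1 - b0) * (c1 - c0) * (hi - lo))"
 proof -
  have "0 <= ?K" using assms by (intro mult_nonneg_nonneg) auto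
  then have "ennreal ?K * ennreal (a1 - a0) = ennreal (?K * (a1 - a0))"
   using assms by (intro ennreal_mult[symmetric]) auto
  also have "?K * (a1 - a0) = (a1 - a0) * (b1 - b0) * (c1 - c0) * (hi - lo)" by (simp add: mult_ac)
  finally show ?thesis using assms by (simp add: nn_integral_cmult)
 qed
 finally show "emeasure lborel W = ennreal ((a1 - a0) * (b1 - b0) * (c1 - c0) * (hi - lo))" .
qed

lemma emeasure_lborel_mult_right:
 assumes g: "g : SL2" and [measurable]: "A : sets borel"
 shows "emeasure lborel {B. B ** g : A} = emeasure lborel (A :: (real^2^2) set)"
proof -
 have "emeasure lborel {B. B ** g : A} = (\<integral>\<^sup>+B. indicator {B. B ** g : A} B \<partial>lborel)"
  by (rule nn_integral_indicator[symmetric]) measurable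
 also have "... = (\<integral>\<^sup>+B. indicator A (B ** g) \<partial>lborel)"
  by (intro nn_integral_cong) (auto split: split_indicator)
 also have "... = emeasure lborel A"
  using g by (subst nn_integral_lborel_mult_right) auto
 finally show ?thesis .
qed

text \<open>Quarter turns on the right rotate the first row, so four copies of the sector where the
  first entry dominates the second cover everything; each has volume at most
  \<open>k * 2 * (2 * sqrt s)\<close>.\<close>

lemma row_ball_upper:
 assumes k: "0 <= k" and s: "0 <= s"
 shows "emeasure haar (row_ball k s) <= ennreal (16 * k * sqrt s)"
proof -
 define W where "W = {B::real^2^2. 0 < B$1$1 & B$1$1 < k & (-1) * B$1$1 <= B$1$2 & B$1$2 <= 1 * B$1$1 \<and>
   - sqrt s <= B$2$1 & B$2$1 <= sqrt s & 0 <= det B & det B <= 1}"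
 have W [measurable]: "W : sets borel" and eW: "emeasure lborel W = ennreal (4 * k * sqrt s)"
  unfolding W_def using slab_volume[of 0 k "-1" 1 "- sqrt s" "sqrt s" 0 1] k s by (auto simp: mult_ac)
 define J where "J = mk2 0 1 (-1) 0"
 have J: "J : SL2" by (simp add: J_def)
 let ?R = "%g. {B::real^2^2. B ** g : W}"
 have main: "B : W" if B: "B : row_cone k s" "0 < B$1$1" "\<bar>B$1$2\<bar> <= B$1$1" for B
 proof -
  have d: "0 < det B" "det B <= 1" "frob2 B <= s * det B" "(B$1$1)^2 + (B$1$2)^2 < k\<^sup>2 * det B"
   using B by (auto simp: row_cone_def cone_part_def)
  have "(B$2$1)^2 <= frob2 B" by (simp add: frob2_def)
  also have "... <= s" using d mult_left_mono[OF d(2) s] by simp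
  finally have "\<bar>B$2$1\<bar> <= sqrt s" by (simp add: real_le_rsqrt)
  moreover have "B$1$1 < k"
  proof -
   have "(B$1$1)^2 <= (B$1$1)^2 + (B$1$2)^2" by simp
   also have "... < k\<^sup>2 * det B" by (rule d(4))
   also have "... <= k^2" using mult_left_mono[OF d(2), of "k^2"] by simp
   finally show ?thesis using k by (rule power_less_imp_less_base)
  qed
  ultimately show ?thesis using B d by (auto simp: W_def)
 qed
 have rot: "B ** g : row_cone k s" if "B : row_cone k s" "g = J \<or> g = J ** J \<or> g = J ** (J ** J)" for B g
  using that by (cases B rule: mk2_cases) (auto simp: J_def row_cone_def cone_part_def add.commute add.left_commute)
 have sub: "row_cone k s \<subseteq> (W \<union> ?R J) \<union> (?R (J ** J) \<union> ?R (J ** (J ** J)))"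
 proof
  fix B assume B: "B : row_cone k s"
  obtain a b c d where Bm: "B = mk2 a b c d" by (rule mk2_cases)
  have ne: "a ~= 0 \<or> b ~= 0" using B Bm by (auto simp: row_cone_def cone_part_def)
  consider "0 < a" "\<bar>b\<bar> <= a" | "0 < - b" "\<bar>a\<bar> <= - b" | "0 < - a" "\<bar>b\<bar> <= - a" | "0 < b" "\<bar>a\<bar> <= b"
   using ne by argo
  then show "B : (W \<union> ?R J) \<union> (?R (J ** J) \<union> ?R (J ** (J ** J)))"
  proof cases
   case 1 then show ?thesis using main[OF B] Bm by auto
  next
   case 2 then show ?thesis using main[OF rot[OF B, of J]] Bm by (auto simp: J_def)
  next
   case 3 then show ?thesis using main[OF rot[OF B, of "J ** J"]] Bm by (auto simp: J_def)
  next
   case 4 then show ?thesis using main[OF rot[OF B, of "J ** (J ** J)"]] Bm by (auto simp: J_def)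
  qed
 qed
 have [measurable]: "?R g : sets borel" for g
  by measurable
 have R: "emeasure lborel (?R g) = ennreal (4 * k * sqrt s)" if "g : SL2" for g
  using emeasure_lborel_mult_right[OF that W] eW by simp
 have "emeasure haar (row_ball k s) <= emeasure lborel ((W \<union> ?R J) \<union> (?R (J ** J) \<union> ?R (J ** (J ** J))))"
  unfolding emeasure_row_ball by (rule emeasure_mono[OF sub]) measurable
 also have "... <= (emeasure lborel W + emeasure lborel (?R J)) + (emeasure lborel (?R (J ** J)) + emeasure lborel (?R (J ** (J ** J))))"
  by (intro order_trans[OF emeasure_subadditive] add_mono emeasure_subadditive) measurable
 also have "... = ennreal (16 * k * sqrt s)"
  using J k s by (simp add: R eW ennreal_plus[symmetric] del: ennreal_plus)
 finally show ?thesis .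
qed

lemma row_ball_lower_aux:
 assumes s: "0 < s" and a01: "sqrt (12 / s) <= a1" "a1 <= k / 2" "a1 <= sqrt (s / 12)"
 shows "ennreal ((a1 - sqrt (12 / s)) * sqrt (s / 18) / 2) <= emeasure haar (row_ball k s)"
proof -
 let ?a0 = "sqrt (12 / s)"
 \<comment> \<open>The constants are tuned to the norm: the squares of the four entries are bounded
   by \<open>s / 12\<close>, \<open>s / 12\<close>, \<open>s / 18\<close> and
   \<open>s / 6 + s / 9\<close>, which add up to \<open>s / 2\<close>; this is at most
   \<open>s * det B\<close> because the determinant is at least one half.\<close>
 define W where "W = {B::real^2^2. ?a0 < B$1$1 & B$1$1 < a1 & 0 * B$1$1 <= B$1$2 & B$1$2 <= 1 * B$1$1 \<and>
   0 <= B$2$1 & B$2$1 <= sqrt (s / 18) & 1/2 <= det B & det B <= 1}"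
 have eW: "emeasure lborel W = ennreal ((a1 - ?a0) * sqrt (s / 18) / 2)"
  unfolding W_def using slab_volume(2)[of ?a0 a1 0 1 0 "sqrt (s/18)" "1/2" 1] assms by (auto simp: mult_ac)
 have "W \<subseteq> row_cone k s"
 proof
  fix B assume BW: "B : W"
  obtain a b c d where Bm: "B = mk2 a b c d" by (rule mk2_cases)
  have h: "?a0 < a" "a < a1" "0 <= b" "b <= a" "0 <= c" "c <= sqrt (s/18)" "1/2 <= a * d - b * c" "a * d - b * c <= 1"
   using BW unfolding W_def Bm by auto
  have apos: "0 < a" using h(1) s by (meson divide_nonneg_nonneg le_less_trans less_imp_le real_sqrt_ge_zero zero_le_numeral)
  have a2: "12 / s < a\<^sup>2" using power_strict_mono[OF h(1), of 2] s by simp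
  have a3: "a^2 <= s / 12"
   using power_mono[of a "sqrt (s / 12)" 2] h(2) a01(3) apos s by simp
  have c2: "c^2 <= s / 18"
   using power_mono[OF h(6) h(5), of 2] s by simp
  have b2: "b^2 <= a^2" using h by (intro power_mono) auto
  have "d <= 1 / a + c"
  proof -
   have "a * d <= 1 + a * c" using h(8) mult_right_mono[OF h(4) h(5)] by simp
   then show ?thesis using apos by (simp add: field_simps)
  qed
  moreover have "0 <= d"
  proof (rule ccontr)
   assume "\<not> 0 <= d"
   then have "a * d < 0" using apos by (simp add: mult_pos_neg)
   then show False using h(7) mult_nonneg_nonneg[OF h(3) h(5)] by simp
  qed
  ultimately have "d^2 <= (1 / a + c)^2" by (intro power_mono) auto
  also have "... <= 2 * (1 / a)^2 + 2 * c^2"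
   using zero_le_power2[of "1 / a - c"] by (simp add: power2_eq_square algebra_simps)
  also have "(1 / a)^2 = 1 / a^2" by (simp add: power_divide)
  also have "1 / a^2 <= s / 12" using a2 s apos by (simp add: field_simps)
  finally have "d^2 <= 2 * (s / 12) + 2 * c^2" by simp
  then have "frob2 B <= s / 2"
   using a3 b2 c2 unfolding Bm by simp
  also have "... <= s * det B" using h s mult_left_mono[OF h(7), of s] unfolding Bm by simp
  finally have 1: "frob2 B <= s * det B" .
  have "a < k / 2" using h a01 by simp
  then have "a^2 < (k / 2)\<^sup>2" using apos by (intro power_strict_mono) auto
  then have "a^2 + b^2 < k\<^sup>2 * (1/2)" using b2 by (simp add: power_divide)
  also have "... <= k^2 * (a * d - b * c)" using h by (intro mult_left_mono) auto
  finally show "B : row_cone k s"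
   using 1 h unfolding row_cone_def cone_part_def Bm by auto
 qed
 then show ?thesis
  unfolding emeasure_row_ball eW[symmetric] by (intro emeasure_mono) auto
qed

text \<open>12 * 18 = 216 is below 15 * 15 = 225. This is the origin of the 60 in the lower volume
  bounds.\<close>

lemma sqrt_216_bound: "sqrt (s / 12) * sqrt (s / 18) / 4 \<ge> s / 60" if "0 <= s"
proof -
 have "s / 15 = sqrt ((s / 15)^2)" using that by simp
 also have "... <= sqrt (s / 12 * (s / 18))"
  using that by (intro real_sqrt_le_mono) (simp add: power2_eq_square field_simps)
 finally have "s / 15 <= sqrt (s / 12) * sqrt (s / 18)" unfolding real_sqrt_mult .
 then show ?thesis by simp
qed

text \<open>Both numerical hypotheses make the upper end of the slab at least twice its lower end
  \<open>sqrt (12 / s)\<close>: 192 = 16 * 12 comes from comparing with \<open>k / 2\<close>, and 24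
  * 24 = 48 * 12 from comparing with \<open>sqrt (s / 12)\<close>. The threshold 24 for balls has
  its origin here.\<close>

lemma row_ball_lower:
 assumes s: "24 <= s" and k: "0 < k" "192 / s <= k^2"
 shows "ennreal (min k (sqrt s) * sqrt s / 60) <= emeasure haar (row_ball k s)"
proof -
 let ?a0 = "sqrt (12 / s)" and ?a1 = "min (k / 2) (sqrt (s / 12))"
 have "4 * ?a0 = sqrt (16 * (12 / s))" by (subst real_sqrt_mult) simp
 also have "... <= sqrt (k^2)" using k by (intro real_sqrt_le_mono) simp
 finally have 1: "2 * ?a0 <= k / 2" using k by simp
 have "2 * ?a0 = sqrt (4 * (12 / s))" by (subst real_sqrt_mult) simp
 also have "... <= sqrt (s / 12)"
 proof (intro real_sqrt_le_mono)
  have "576 <= s * s" using mult_mono[OF s s] s by simp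
  then show "4 * (12 / s) <= s / 12" using s by (simp add: field_simps)
 qed
 finally have 2: "2 * ?a0 <= ?a1" using 1 by simp
 have a0: "0 <= ?a0" using s by simp
 have "min k (sqrt s) * sqrt (1 / 12) <= ?a1"
 proof -
  have "sqrt (1/12) <= sqrt ((1/2)^2)" by (intro real_sqrt_le_mono) (simp add: power2_eq_square)
  then have "sqrt (1/12) <= 1/2" by simp
  then have "min k (sqrt s) * sqrt (1 / 12) <= k * (1/2)" using k by (intro mult_mono) auto
  moreover have "min k (sqrt s) * sqrt (1/12) <= sqrt s * sqrt (1/12)" by (intro mult_right_mono) auto
  moreover have "sqrt s * sqrt (1/12) = sqrt (s / 12)" by (simp flip: real_sqrt_mult)
  ultimately show ?thesis by simp
 qed
 then have "min k (sqrt s) * sqrt (1/12) * sqrt (s / 18) / 4 <= ?a1 * sqrt (s / 18) / 4"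
  using s by (intro divide_right_mono mult_right_mono) auto
 moreover have "min k (sqrt s) * sqrt s / 60 <= min k (sqrt s) * sqrt (1/12) * sqrt (s / 18) / 4"
 proof -
  have "sqrt (1/12) * sqrt (s / 18) / 4 = sqrt s * (sqrt (1/12) * sqrt (1/18) / 4)"
   by (simp add: real_sqrt_divide)
  moreover have "1 / 60 <= sqrt (1/12) * sqrt (1/18) / 4" using sqrt_216_bound[of 1] by simp
  ultimately have "sqrt s * (1 / 60) <= sqrt (1/12) * sqrt (s / 18) / 4"
   using s mult_left_mono[of "1/60" _ "sqrt s"] by simp
  from mult_left_mono[OF this, of "min k (sqrt s)"] show ?thesis using k s by (simp add: mult_ac)
 qed
 moreover have "?a1 * sqrt (s / 18) / 4 <= (?a1 - ?a0) * sqrt (s / 18) / 2"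
 proof -
  have "?a1 / 2 <= ?a1 - ?a0" using 2 by linarith
  then have "?a1 / 2 * (sqrt (s / 18) / 2) <= (?a1 - ?a0) * (sqrt (s / 18) / 2)"
   using s by (intro mult_right_mono) auto
  then show ?thesis by simp
 qed
 ultimately have "ennreal (min k (sqrt s) * sqrt s / 60) <= ennreal ((?a1 - ?a0) * sqrt (s / 18) / 2)"
  by (intro ennreal_leI) linarith
 also have "... <= emeasure haar (row_ball k s)"
 proof (rule row_ball_lower_aux)
  show "?a0 <= ?a1" using 2 a0 by linarith
 qed (use s in auto)
 finally show ?thesis .
qed

text \<open>The factor 2 in \<open>2 * sqrt s\<close> only makes the strict bound on the first row
  automatic.\<close>

lemma fball_upper:
 assumes s: "0 < s"
 shows "emeasure haar (fball s) <= ennreal (32 * s)"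
proof -
 have "fball s \<subseteq> row_ball (2 * sqrt s) s"
 proof
  fix g assume "g : fball s"
  then have g: "g : SL2" "frob2 g <= s" by (auto simp: fball_def)
  have "(g$1$1)^2 + (g$1$2)^2 <= frob2 g" by (simp add: frob2_def)
  also have "... < 4 * s" using g s by simp
  finally show "g : row_ball (2 * sqrt s) s"
   using g s by (simp add: row_ball_def power_mult_distrib)
 qed
 then have "emeasure haar (fball s) <= emeasure haar (row_ball (2 * sqrt s) s)"
  by (intro emeasure_mono) auto
 also have "... <= ennreal (16 * (2 * sqrt s) * sqrt s)"
  using s by (intro row_ball_upper) auto
 also have "16 * (2 * sqrt s) * sqrt s = 32 * s" using s by simp
 finally show ?thesis .
qed

lemma fball_lower:
 assumes s: "24 <= s"
 shows "ennreal (s / 60) <= emeasure haar (fball s)"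
proof -
 have "192 / s <= s"
 proof -
  have "192 <= s * s" using mult_mono[OF s s] s by simp
  then show ?thesis using s by (simp add: field_simps)
 qed
 then have "ennreal (min (sqrt s) (sqrt s) * sqrt s / 60) <= emeasure haar (row_ball (sqrt s) s)"
  using s by (intro row_ball_lower) auto
 also have "... <= emeasure haar (fball s)"
  by (intro emeasure_mono) (use fball_sets in \<open>auto simp: row_ball_def fball_def\<close>)
 finally show ?thesis using s by simp
qed

subsection \<open>Matrices contracting a vector\<close>

definition lensq :: "real^2^2 => real => real => real" where
 "lensq g x y = (g$1$1 * x + g$1$2 * y)^2 + (g$2$1 * x + g$2$2 * y)^2"

lemma lensq_mk2 [simp]: "lensq (mk2 a b c d) x y = (a * x + b * y)^2 + (c * x + d * y)^2"
 by (simp add: lensq_def)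

lemma borel_measurable_lensq [measurable]: "(%g. lensq g x y) : borel_measurable borel"
 unfolding lensq_def[abs_def] by measurable

text \<open>The vector is recovered from its image by the inverse matrix, which has the same norm;
  then the Cauchy-Schwarz inequality applies.\<close>

lemma lensq_lower:
 assumes "g : SL2"
 shows "x^2 + y^2 <= frob2 g * lensq g x y"
proof -
 obtain a b c d where g: "g = mk2 a b c d" "a * d - b * c = 1"
  using assms by (rule SL2_cases)
 let ?u = "a * x + b * y" and ?v = "c * x + d * y"
 have "x = d * ?u - b * ?v" "y = a * ?v - c * ?u" using g(2) by algebra+
 then have "x^2 + y^2 = (d * ?u - b * ?v)^2 + (a * ?v - c * ?u)^2" by metis
 also have "... <= (d^2 + b^2) * (?u\<^sup>2 + ?v\<^sup>2) + (a^2 + c^2) * (?u\<^sup>2 + ?v\<^sup>2)"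
 proof (rule add_mono)
  have "(d^2 + b^2) * (?u\<^sup>2 + ?v\<^sup>2) - (d * ?u - b * ?v)\<^sup>2 = (d * ?v + b * ?u)^2" by algebra
  then show "(d * ?u - b * ?v)^2 <= (d^2 + b^2) * (?u\<^sup>2 + ?v\<^sup>2)"
   using zero_le_power2[of "d * ?v + b * ?u"] by linarith
  have "(a^2 + c^2) * (?u\<^sup>2 + ?v\<^sup>2) - (a * ?v - c * ?u)\<^sup>2 = (a * ?u + c * ?v)^2" by algebra
  then show "(a * ?v - c * ?u)^2 <= (a^2 + c^2) * (?u\<^sup>2 + ?v\<^sup>2)"
   using zero_le_power2[of "a * ?u + c * ?v"] by linarith
 qed
 also have "... = frob2 g * lensq g x y" unfolding g by (simp add: algebra_simps)
 finally show ?thesis .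
qed

definition vec_ball :: "real => real => real => real => (real^2^2) set" where
 "vec_ball e s x y = {g : fball s. lensq g x y < e\<^sup>2}"

lemma vec_ball_sets [measurable]: "vec_ball e s x y : sets SL2_borel"
proof -
 have "vec_ball e s x y = {g : SL2. frob2 g <= s & lensq g x y < e\<^sup>2}"
  by (auto simp: vec_ball_def fball_def)
 also have "... : sets SL2_borel" by (rule SL2_borel_CollectI) measurable
 finally show ?thesis .
qed

text \<open>The rotation \<open>k\<close> turns the vector to the first axis, and a transposed
  matrix sends the first basis vector to its own first row. Neither transposition nor right
  multiplication is noticed by \<open>haar\<close>, and neither of the two used here changes the
  norm.\<close>

lemma emeasure_vec_ball:
 assumes xy: "x ~= 0 \<or> y ~= 0"
 shows "emeasure haar (vec_ball e s x y) = emeasure haar (row_ball (e / sqrt (x^2 + y^2)) s)"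
proof -
 let ?l = "sqrt (x^2 + y^2)"
 have l: "0 < ?l" using xy by (simp add: sum_power2_gt_zero_iff)
 define u v where "u = x / ?l" and "v = y / ?l"
 have x: "x = ?l * u" and y: "y = ?l * v" using l by (auto simp: u_def v_def)
 have "u^2 + v^2 = (x^2 + y^2) / ?l\<^sup>2" unfolding u_def v_def power_divide add_divide_distrib ..
 moreover have "?l\<^sup>2 = x^2 + y^2" by simp
 moreover have "x^2 + y^2 ~= 0" using xy by (simp add: sum_power2_eq_zero_iff)
 ultimately have uv: "u^2 + v^2 = 1" by (metis divide_self)
 define k where "k = mk2 u v (- v) u"
 have k: "k : SL2" using uv by (simp add: k_def power2_eq_square)
 let ?R = "row_ball (e / ?l) s"
 have in_iff: "transpose g ** k : vec_ball e s x y \<longleftrightarrow> g : ?R" if gS: "g : SL2" for g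
 proof -
  obtain a b c d where g: "g = mk2 a b c d" "a * d - b * c = 1" using gS by (rule SL2_cases)
  have tg: "transpose g ** k : SL2" using that k by simp
  have f: "frob2 (transpose g ** k) = frob2 g"
  proof -
   have "frob2 (transpose g ** k) = (a^2 + b^2 + c^2 + d^2) * (u^2 + v^2)"
    unfolding g k_def by (simp add: power2_eq_square algebra_simps)
   then show ?thesis using uv unfolding g by simp
  qed
  have "lensq (transpose g ** k) (r * u) (r * v) = (r * a * (u^2 + v^2))^2 + (r * b * (u^2 + v^2))^2" for r
   unfolding g k_def by (simp add: power2_eq_square algebra_simps)
  from this[of ?l] have "lensq (transpose g ** k) x y = (?l * a * (u^2 + v^2))^2 + (?l * b * (u^2 + v^2))^2"
   by (simp only: x[symmetric] y[symmetric])
  then have "lensq (transpose g ** k) x y = ?l\<^sup>2 * (a^2 + b^2)"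
   unfolding uv by (simp add: power_mult_distrib distrib_left)
  then have "lensq (transpose g ** k) x y < e\<^sup>2 \<longleftrightarrow> a\<^sup>2 + b^2 < (e / ?l)\<^sup>2"
   unfolding power_divide using l by (subst pos_less_divide_eq) (auto simp: mult.commute)
  then show ?thesis
   using that tg f g by (simp add: vec_ball_def row_ball_def fball_def)
 qed
 have "emeasure haar (vec_ball e s x y) = (\<integral>\<^sup>+g. indicator (vec_ball e s x y) g \<partial>haar)" by simp
 also have "... = (\<integral>\<^sup>+g. indicator (vec_ball e s x y) (g ** k) \<partial>haar)"
  by (rule nn_integral_haar_right[OF _ k, symmetric]) measurable
 also have "... = (\<integral>\<^sup>+g. indicator (vec_ball e s x y) (transpose g ** k) \<partial>haar)"
 proof (rule nn_integral_haar_transpose[symmetric])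
  show "(%g. indicator (vec_ball e s x y) (g ** k)) : borel_measurable SL2_borel"
   by (rule measurable_compose[OF measurable_mult_right_SL2[OF k]]) measurable
 qed
 also have "... = (\<integral>\<^sup>+g. indicator ?R g \<partial>haar)"
  by (intro nn_integral_cong) (auto simp: in_iff split: split_indicator)
 finally show ?thesis by simp
qed

text \<open>The probability that a uniform random element of the ball brings the vector
  \<open>(x, y)\<close> into the disc of radius \<open>e\<close>.\<close>

definition kern :: "real => real => real => real => ennreal" where
 "kern e s x y = emeasure haar (vec_ball e s x y) / emeasure haar (fball s)"

text \<open>Up to a constant factor, contracting a vector to size of order \<open>T powr (-1/2)\<close> inside a ball of
  \<open>T\<close> times the volume has \<open>T\<close> times smaller probability. Hence a function concentrated far out in
  the cusp behaves after a long time like a delayed copy of one concentrated near its boundary.\<close>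

lemma kern_delay:
 assumes s: "24 <= s" and T: "1 <= T" and s': "T * s / 2 <= s'" "s' <= T * s" "24 <= s'" and xy: "x ~= 0 \<or> y ~= 0"
 shows "ennreal (1 / 92160) * kern (1 / 40) s x y <= ennreal T * kern (1 / (2 * sqrt T)) s' x y"
proof -
 let ?l = "sqrt (x^2 + y^2)"
 have l: "0 < ?l" using xy by (simp add: sum_power2_gt_zero_iff)
 define k0 k where "k0 = (1 / 40) / ?l" and "k = (1 / (2 * sqrt T)) / ?l"
 have k0: "0 < k0" and k: "0 < k" using l T by (auto simp: k0_def k_def)
 show ?thesis
 proof (cases "vec_ball (1 / 40) s x y = {}")
  case True
  then show ?thesis by (simp add: kern_def)
 next
  case False
  then obtain g where g: "g : SL2" "frob2 g <= s" "lensq g x y < (1/40)\<^sup>2"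
   by (auto simp: vec_ball_def fball_def)
  have "x^2 + y^2 <= s * lensq g x y"
   using lensq_lower[OF g(1), of x y] mult_right_mono[OF g(2), of "lensq g x y"] by (simp add: lensq_def)
  also have "... <= s * (1/40)^2" using g s by (intro mult_left_mono) auto
  finally have l2: "?l\<^sup>2 <= s / 1600" using l by (simp add: power2_eq_square)
  have sq: "sqrt s * sqrt s = s" "sqrt s' * sqrt s' = s'" using s s' by auto
  have sp: "0 < sqrt s" "0 < sqrt s'" using s s' by auto
  have up: "kern (1/40) s x y <= ennreal (min 1 (960 * k0 / sqrt s))"
  proof -
   have "kern (1/40) s x y <= emeasure haar (vec_ball (1/40) s x y) / ennreal (s / 60)"
    unfolding kern_def using s fball_lower by (intro ennreal_divide_left_mono) auto
   also have "... <= ennreal (16 * k0 * sqrt s) / ennreal (s / 60)"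
    unfolding emeasure_vec_ball[OF xy] k0_def using s l
    by (intro divide_right_mono_ennreal row_ball_upper) auto
   also have "... = ennreal (960 * k0 / sqrt s)"
    using s k0 sq sp by (subst divide_ennreal) (auto simp: field_simps)
   finally have 1: "kern (1/40) s x y <= ennreal (960 * k0 / sqrt s)" .
   have "kern (1/40) s x y <= emeasure haar (fball s) / emeasure haar (fball s)"
    unfolding kern_def by (intro divide_right_mono_ennreal emeasure_mono) (auto simp: vec_ball_def)
   also have "... = 1"
    using fball_lower[OF s] s emeasure_haar_fball_finite[of s]
    by (intro ennreal_divide_self) (auto simp: top_unique)
   finally show ?thesis using 1 by (simp add: min_def)
  qed
  have lo: "ennreal (min (k / sqrt s') 1 / 1920) <= kern (1 / (2 * sqrt T)) s' x y"
  proof -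
   \<comment> \<open>The lower volume bound applies only if the vector is not too long. Since some
     element of the smaller ball contracts it below 1/40, its squared length is at most
     \<open>s / 1600\<close>, and 192 * 4 / 1600 = 0.48 is below one half. This fixes the radius
     1/40.\<close>
   have "192 / s' <= k^2"
   proof -
    have "k^2 = 1 / (4 * T * ?l\<^sup>2)" using T unfolding k_def by (simp add: power_divide power_mult_distrib)
    moreover have "192 * (4 * T * ?l\<^sup>2) <= 192 * (4 * T * (s / 1600))"
     using l2 T by (intro mult_left_mono) auto
    moreover have "192 * (4 * T * (s / 1600)) <= s'"
    proof -
     have "0 <= T * s" using T s by simp
     then show ?thesis using s'(1) by simp
    qed
    ultimately have "k^2 = 1 / (4 * T * ?l\<^sup>2)" "192 * (4 * T * ?l\<^sup>2) <= s'" by auto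
    moreover have "0 < 4 * T * ?l\<^sup>2" using T l by (intro mult_pos_pos) auto
    moreover have "192 / s' <= 1 / z" if "0 < z" "192 * z <= s'" for z
     using that s' by (simp add: field_simps)
    ultimately show ?thesis by metis
   qed
   then have "ennreal (min k (sqrt s') * sqrt s' / 60) <= emeasure haar (row_ball k s')"
    using s' k by (intro row_ball_lower) auto
   then have "ennreal (min k (sqrt s') * sqrt s' / 60) / ennreal (32 * s')
     <= emeasure haar (row_ball k s') / emeasure haar (fball s')"
    using s' fball_upper[of s'] by (intro order_trans[OF divide_right_mono_ennreal ennreal_divide_left_mono]) auto
   moreover have "min k (sqrt s') * sqrt s' / 60 / (32 * s') = min (k / sqrt s') 1 / 1920"
    using sq sp by (auto simp: min_def field_simps)
   moreover have "ennreal (min k (sqrt s') * sqrt s' / 60) / ennreal (32 * s')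
     = ennreal (min k (sqrt s') * sqrt s' / 60 / (32 * s'))"
    using s' k by (intro divide_ennreal) auto
   ultimately show ?thesis
    unfolding kern_def emeasure_vec_ball[OF xy] k_def[symmetric] by metis
  qed
  \<comment> \<open>The upper bound has 960 = 16 * 60 and the lower one 1920 = 32 * 60. As
    \<open>k = 20 * k0 / sqrt T\<close> and 960 = 48 * 20, the total loss is 48 * 1920 =
    92160.\<close>
  have "min 1 (960 * k0 / sqrt s) / 92160 <= T * (min (k / sqrt s') 1 / 1920)"
  proof -
   have "sqrt s' <= sqrt T * sqrt s" using s' by (simp flip: real_sqrt_mult)
   then have "k / (sqrt T * sqrt s) <= k / sqrt s'" using k sp T s by (intro divide_left_mono) auto
   moreover have "k / (sqrt T * sqrt s) = 20 * k0 / sqrt s / T"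
    using T by (simp add: k_def k0_def field_simps)
   ultimately have "20 * k0 / sqrt s / T <= k / sqrt s'" by simp
   then have "20 * k0 / sqrt s <= T * (k / sqrt s')" using T by (subst (asm) pos_divide_le_eq) (auto simp: mult.commute)
   moreover have "T * min (k / sqrt s') 1 = min (T * (k / sqrt s')) T" using T by (simp add: min_mult_distrib_left)
   ultimately have "min (20 * k0 / sqrt s) 1 <= T * min (k / sqrt s') 1" using T by (simp add: min.coboundedI1 min.coboundedI2)
   moreover have "min 1 (960 * k0 / sqrt s) <= 48 * min (20 * k0 / sqrt s) 1" by simp
   ultimately show ?thesis by simp
  qed
  then have *: "ennreal (min 1 (960 * k0 / sqrt s) / 92160) <= ennreal (T * (min (k / sqrt s') 1 / 1920))"
   by (rule ennreal_leI)
  have "ennreal (1 / 92160) * kern (1/40) s x y <= ennreal (1 / 92160) * ennreal (min 1 (960 * k0 / sqrt s))"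
   by (intro mult_left_mono up) auto
  also have "... = ennreal (min 1 (960 * k0 / sqrt s) / 92160)" by (simp add: ennreal_mult'[symmetric])
  also have "... <= ennreal (T * (min (k / sqrt s') 1 / 1920))" by (rule *)
  also have "... = ennreal T * ennreal (min (k / sqrt s') 1 / 1920)" using T by (intro ennreal_mult') auto
  also have "... <= ennreal T * kern (1 / (2 * sqrt T)) s' x y" by (intro mult_left_mono lo) auto
  finally show ?thesis .
 qed
qed

section \<open>Continuity of translations\<close>

lemma tendsto_0_ennrealI:
 fixes f :: "'a => ennreal"
 assumes "\<And>e::real. 0 < e ==> \<forall>\<^sub>F x in F. f x <= ennreal e"
 shows "(f \<longlongrightarrow> 0) F"
proof (rule order_tendstoI)
 fix a :: ennreal assume "0 < a"
 then obtain b where b: "0 < b" "b < a" using dense by blast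
 then obtain e where e: "b = ennreal e" "0 < e"
  by (cases b) auto
 show "\<forall>\<^sub>F x in F. f x < a"
  using assms[OF e(2)] by eventually_elim (use b e in auto)
qed auto

text \<open>A measurable function is almost everywhere a limit of continuous ones, for which the
  claim is dominated convergence; as each \<open>L i\<close> preserves Lebesgue measure, the
  approximation error is the same after moving. General maps are allowed because both matrix
  multiplication and translations of the line are needed.\<close>

lemma L1_translation_continuity:
 fixes k :: "'a::euclidean_space => real" and L :: "nat => 'a => 'a"
 assumes k [measurable]: "k : borel_measurable borel" and C: "\<And>x. \<bar>k x\<bar> <= C"
  and L [measurable]: "\<And>i. L i : borel_measurable borel" and dist: "\<And>i. distr lborel borel (L i) = lborel"
  and lim: "\<And>x. (%i. L i x) \<longlonglongrightarrow> x"
  and S [measurable]: "S : sets borel" "S' : sets borel"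
  and fin: "emeasure lborel S' < \<infinity>" and sub: "S \<subseteq> S'" "\<And>i x. x : S ==> L i x : S'"
 shows "(%i. \<integral>\<^sup>+x. ennreal \<bar>k (L i x) - k x\<bar> * indicator S x \<partial>lborel) \<longlonglongrightarrow> 0"
proof (rule tendsto_0_ennrealI)
 have C0: "0 <= C" using C[of undefined] by linarith
 have "k measurable_on UNIV"
 proof (rule lebesgue_measurable_imp_measurable_on_real)
  have "k : borel_measurable lborel" by simp
  then show "k : borel_measurable lebesgue" by (rule measurable_completion)
 qed simp
 then obtain N g0 where N: "negligible N" and g0: "\<And>n. continuous_on UNIV (g0 n)" "\<And>x. x \<notin> N ==> (%n. g0 n x) \<longlonglongrightarrow> k x"
  unfolding measurable_on_def by auto
 \<comment> \<open>Truncating at \<open>C\<close> supplies a dominating constant and keeps both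
   continuity and the limit.\<close>
 define g where "g n x = max (- C) (min C (g0 n x))" for n x
 have gc: "continuous_on UNIV (g n)" for n
  unfolding g_def by (intro continuous_intros g0)
 have g [measurable]: "g n : borel_measurable borel" for n
  by (rule borel_measurable_continuous_onI[OF gc])
 have gC: "\<bar>g n x\<bar> <= C" for n x unfolding g_def using C0 by auto
 have gk: "(%n. g n x) \<longlonglongrightarrow> k x" if "x \<notin> N" for x
 proof -
  have "(%n. g n x) \<longlonglongrightarrow> max (- C) (min C (k x))"
   unfolding g_def using that by (intro tendsto_intros g0)
  moreover have "max (- C) (min C (k x)) = k x" using C[of x] by auto
  ultimately show ?thesis by simp
 qed
 have AE_N: "AE x in lborel. x \<notin> N"
  using AE_not_in[of N lebesgue] N by (simp add: negligible_iff_null_sets AE_completion_iff)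
 have bnd_fin: "(\<integral>\<^sup>+x. ennreal (2 * C) * indicator S' x \<partial>lborel) < \<infinity>"
  using fin by (simp add: nn_integral_cmult ennreal_mult_less_top)
 define J where "J n = (\<integral>\<^sup>+x. ennreal \<bar>k x - g n x\<bar> * indicator S' x \<partial>lborel)" for n
 have Jlim: "J \<longlonglongrightarrow> 0"
 proof -
  have "J \<longlonglongrightarrow> (\<integral>\<^sup>+x. 0 \<partial>(lborel :: 'a measure))"
   unfolding J_def
  proof (rule nn_integral_dominated_convergence[where w = "%x. ennreal (2 * C) * indicator S' x"])
   show "AE x in lborel. ennreal \<bar>k x - g n x\<bar> * indicator S' x <= ennreal (2 * C) * indicator S' x" for n
   proof (rule AE_I2)
    fix x
    have "\<bar>k x - g n x\<bar> <= 2 * C" using C[of x] gC[of n x] by linarith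
    then show "ennreal \<bar>k x - g n x\<bar> * indicator S' x <= ennreal (2 * C) * indicator S' x"
     by (intro mult_right_mono ennreal_leI) auto
   qed
   show "AE x in lborel. (%n. ennreal \<bar>k x - g n x\<bar> * indicator S' x) \<longlonglongrightarrow> 0"
    using AE_N
   proof eventually_elim
    fix x assume "x \<notin> N"
    then have "(%n. \<bar>k x - g n x\<bar>) \<longlonglongrightarrow> \<bar>k x - k x\<bar>" by (intro tendsto_intros gk)
    then have "(%n. ennreal \<bar>k x - g n x\<bar>) \<longlonglongrightarrow> ennreal 0" by (intro tendsto_ennrealI) simp
    then show "(%n. ennreal \<bar>k x - g n x\<bar> * indicator S' x) \<longlonglongrightarrow> 0"
     by (auto split: split_indicator)
   qed
  qed (use bnd_fin in auto)
  then show ?thesis by simp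
 qed
 fix e :: real assume e: "0 < e"
 have "\<forall>\<^sub>F n in sequentially. J n < ennreal (e / 3)"
  using e by (intro order_tendstoD(2)[OF Jlim]) auto
 then obtain n where n: "J n < ennreal (e / 3)" by (auto dest: eventually_happens)
 define I where "I i = (\<integral>\<^sup>+x. ennreal \<bar>g n (L i x) - g n x\<bar> * indicator S x \<partial>lborel)" for i
 have Ilim: "I \<longlonglongrightarrow> 0"
 proof -
  have "I \<longlonglongrightarrow> (\<integral>\<^sup>+x. 0 \<partial>(lborel :: 'a measure))"
   unfolding I_def
  proof (rule nn_integral_dominated_convergence[where w = "%x. ennreal (2 * C) * indicator S' x"])
   show "AE x in lborel. ennreal \<bar>g n (L i x) - g n x\<bar> * indicator S x <= ennreal (2 * C) * indicator S' x" for i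
   proof (rule AE_I2)
    fix x
    have "\<bar>g n (L i x) - g n x\<bar> <= 2 * C" using gC[of n x] gC[of n "L i x"] by linarith
    then show "ennreal \<bar>g n (L i x) - g n x\<bar> * indicator S x <= ennreal (2 * C) * indicator S' x"
     using sub by (intro mult_mono ennreal_leI) (auto split: split_indicator)
   qed
   show "AE x in lborel. (%i. ennreal \<bar>g n (L i x) - g n x\<bar> * indicator S x) \<longlonglongrightarrow> 0"
   proof (rule AE_I2)
    fix x
    have "isCont (g n) x" using gc[of n] by (simp add: continuous_on_eq_continuous_at)
    then have "(%i. g n (L i x)) \<longlonglongrightarrow> g n x" using lim by (rule isCont_tendsto_compose)
    then have "(%i. \<bar>g n (L i x) - g n x\<bar>) \<longlonglongrightarrow> \<bar>g n x - g n x\<bar>" by (intro tendsto_intros)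
    then have "(%i. ennreal \<bar>g n (L i x) - g n x\<bar>) \<longlonglongrightarrow> ennreal 0" by (intro tendsto_ennrealI) simp
    then show "(%i. ennreal \<bar>g n (L i x) - g n x\<bar> * indicator S x) \<longlonglongrightarrow> 0"
     by (auto split: split_indicator)
   qed
  qed (use bnd_fin in auto)
  then show ?thesis by simp
 qed
 have "\<forall>\<^sub>F i in sequentially. I i < ennreal (e / 3)"
  using e by (intro order_tendstoD(2)[OF Ilim]) auto
 then show "\<forall>\<^sub>F i in sequentially. (\<integral>\<^sup>+x. ennreal \<bar>k (L i x) - k x\<bar> * indicator S x \<partial>lborel) <= ennreal e"
 proof eventually_elim
  case (elim i)
  have "(\<integral>\<^sup>+x. ennreal \<bar>k (L i x) - k x\<bar> * indicator S x \<partial>lborel) \<le>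
   (\<integral>\<^sup>+x. (ennreal \<bar>k (L i x) - g n (L i x)\<bar> * indicator S' (L i x) + ennreal \<bar>g n (L i x) - g n x\<bar> * indicator S x)
     + ennreal \<bar>k x - g n x\<bar> * indicator S' x \<partial>lborel)"
  proof (rule nn_integral_mono)
   fix x
   have "\<bar>k (L i x) - k x\<bar> <= \<bar>k (L i x) - g n (L i x)\<bar> + \<bar>g n (L i x) - g n x\<bar> + \<bar>k x - g n x\<bar>" by linarith
   then have "ennreal \<bar>k (L i x) - k x\<bar> <= ennreal \<bar>k (L i x) - g n (L i x)\<bar> + ennreal \<bar>g n (L i x) - g n x\<bar> + ennreal \<bar>k x - g n x\<bar>"
    by (simp add: ennreal_plus[symmetric] del: ennreal_plus)
   then show "ennreal \<bar>k (L i x) - k x\<bar> * indicator S x \<le>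
     (ennreal \<bar>k (L i x) - g n (L i x)\<bar> * indicator S' (L i x) + ennreal \<bar>g n (L i x) - g n x\<bar> * indicator S x)
     + ennreal \<bar>k x - g n x\<bar> * indicator S' x"
    using sub by (auto split: split_indicator)
  qed
  also have "... = (\<integral>\<^sup>+x. ennreal \<bar>k (L i x) - g n (L i x)\<bar> * indicator S' (L i x) \<partial>lborel) + I i + J n"
   unfolding I_def J_def by (simp add: nn_integral_add)
  also have "(\<integral>\<^sup>+x. ennreal \<bar>k (L i x) - g n (L i x)\<bar> * indicator S' (L i x) \<partial>lborel)
    = (\<integral>\<^sup>+x. ennreal \<bar>k x - g n x\<bar> * indicator S' x \<partial>distr lborel borel (L i))"
   by (subst nn_integral_distr) auto
  also have "... = J n" unfolding dist J_def ..
  also have "J n + I i + J n <= ennreal (e / 3) + ennreal (e / 3) + ennreal (e / 3)"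
   using n elim by (intro add_mono) auto
  also have "... = ennreal e" using e by (simp add: ennreal_plus[symmetric] del: ennreal_plus)
  finally show ?case .
 qed
qed

lemma frob2_mult_le: "frob2 (A ** B) <= frob2 A * frob2 B"
proof -
 obtain a b c d where A: "A = mk2 a b c d" by (rule mk2_cases)
 obtain a' b' c' d' where B: "B = mk2 a' b' c' d'" by (rule mk2_cases)
 have CS: "(x * y + z * w)^2 <= (x^2 + z^2) * (y^2 + w^2)" for x y z w :: real
 proof -
  have "(x^2 + z^2) * (y^2 + w^2) - (x * y + z * w)\<^sup>2 = (x * w - z * y)^2" by algebra
  then show ?thesis using zero_le_power2[of "x * w - z * y"] by linarith
 qed
 have "frob2 (A ** B) = (a * a' + b * c')^2 + (a * b' + b * d')^2 + (c * a' + d * c')^2 + (c * b' + d * d')^2"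
  by (simp add: A B)
 also have "... <= (a^2 + b^2) * (a'\<^sup>2 + c'\<^sup>2) + (a^2 + b^2) * (b'\<^sup>2 + d'\<^sup>2)
   + (c^2 + d^2) * (a'\<^sup>2 + c'\<^sup>2) + (c^2 + d^2) * (b'\<^sup>2 + d'\<^sup>2)"
  by (intro add_mono CS)
 also have "... = frob2 A * frob2 B" by (simp add: A B algebra_simps)
 finally show ?thesis .
qed

section \<open>Mixing for actions of the group\<close>

abbreviation up :: "real => real^2^2" where "up s \<equiv> mk2 1 s 0 1"
abbreviation lo :: "real => real^2^2" where "lo s \<equiv> mk2 1 0 s 1"

locale SL2_pmp = prob_space Y for Y :: "'y measure" +
 fixes act :: "real^2^2 => 'y => 'y"
 assumes act_meas: "(%(g, x). act g x) : measurable (SL2_borel \<Otimes>\<^sub>M Y) Y"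
  and act_one: "\<And>x. x : space Y ==> act (mat 1) x = x"
  and act_mult: "\<And>g h x. g : SL2 ==> h : SL2 ==> x : space Y ==> act (g ** h) x = act g (act h x)"
  and act_distr: "\<And>g. g : SL2 ==> distr Y Y (act g) = Y"
begin

lemma act_measurable: "g : SL2 ==> act g : measurable Y Y"
proof -
 assume "g : SL2"
 then have "(%x. (g, x)) : measurable Y (SL2_borel \<Otimes>\<^sub>M Y)"
  by (intro measurable_Pair1') simp
 from measurable_compose[OF this act_meas] show ?thesis unfolding prod.case .
qed

lemma act_in_space [simp]: "g : SL2 ==> x : space Y ==> act g x : space Y"
 by (rule measurable_space[OF act_measurable])

lemma act_pair_measurable:
 "h : borel_measurable Y ==> (%(g, x). h (act g x)) : borel_measurable (SL2_borel \<Otimes>\<^sub>M Y)"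
 by (rule measurable_compose[OF act_meas, of h borel, unfolded prod.case_distrib[of h]])

lemma act_fn_measurable: "h : borel_measurable Y ==> g : SL2 ==> (%x. h (act g x)) : borel_measurable Y"
 by (rule measurable_compose[OF act_measurable])

lemma orbit_measurable:
 assumes h: "h : borel_measurable Y" and x: "x : space Y"
 shows "(%g. h (act g x)) : borel_measurable SL2_borel"
 using measurable_compose[OF measurable_Pair2'[OF x] act_pair_measurable[OF h]] unfolding prod.case .

lemma nn_integral_act:
 assumes h: "h : borel_measurable Y" and g: "g : SL2"
 shows "(\<integral>\<^sup>+x. h (act g x) \<partial>Y) = (\<integral>\<^sup>+x. h x \<partial>Y)"
proof -
 have "(\<integral>\<^sup>+x. h x \<partial>Y) = (\<integral>\<^sup>+x. h x \<partial>distr Y Y (act g))" by (simp add: act_distr[OF g])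
 also have "... = (\<integral>\<^sup>+x. h (act g x) \<partial>Y)" using h by (intro nn_integral_distr act_measurable g) simp
 finally show ?thesis by simp
qed

lemma integral_act:
 fixes h :: "'y => real"
 assumes h: "h : borel_measurable Y" and g: "g : SL2"
 shows "(\<integral>x. h (act g x) \<partial>Y) = (\<integral>x. h x \<partial>Y)"
proof -
 have "(\<integral>x. h x \<partial>Y) = (\<integral>x. h x \<partial>distr Y Y (act g))" by (simp add: act_distr[OF g])
 also have "... = (\<integral>x. h (act g x) \<partial>Y)" by (intro integral_distr act_measurable g h)
 finally show ?thesis by simp
qed

text \<open>The bound is required at every point and not just almost everywhere, so that it also
  holds along each single orbit.\<close>

definition bfun :: "real => ('y => real) => bool" where
 "bfun C h \<longleftrightarrow> h : borel_measurable Y & (\<forall>x\<in>space Y. \<bar>h x\<bar> <= C)"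

lemma bfun_integrable: "bfun C h ==> integrable Y h"
 by (rule integrable_const_bound[of _ C]) (auto simp: bfun_def)

lemma bfun_nonneg: "bfun C h ==> 0 <= C"
 using not_empty by (force simp: bfun_def)

lemma bfun_measurable: "bfun C h ==> h : borel_measurable Y"
 by (simp add: bfun_def)

lemma bfun_bound: "bfun C h ==> x : space Y ==> \<bar>h x\<bar> <= C"
 by (simp add: bfun_def)

lemma bfun_act: "bfun C h ==> g : SL2 ==> bfun C (%x. h (act g x))"
 by (auto simp: bfun_def intro: act_fn_measurable)

lemma bfun_diff: "bfun C h ==> bfun C' h' ==> bfun (C + C') (%x. h x - h' x)"
 unfolding bfun_def by (auto intro: abs_triangle_ineq4[THEN order_trans] add_mono)

lemma bfun_mult: "bfun C h ==> bfun C' h' ==> bfun (C * C') (%x. h x * h' x)"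
 unfolding bfun_def by (auto simp: abs_mult intro!: mult_mono)

lemma bfun_abs: "bfun C h ==> bfun C (%x. \<bar>h x\<bar>)"
 unfolding bfun_def by auto

text \<open>The displacement of \<open>h\<close> in mean. It is subadditive and symmetric under
  inversion, so the elements with displacement zero form a subgroup.\<close>

definition shift :: "('y => real) => real^2^2 => real" where
 "shift h g = (\<integral>x. \<bar>h (act g x) - h x\<bar> \<partial>Y)"

lemma shift_nonneg [simp]: "0 <= shift h g"
 by (simp add: shift_def)

lemma bfun_shift: "bfun C h ==> g : SL2 ==> bfun (C + C) (%x. \<bar>h (act g x) - h x\<bar>)"
 by (intro bfun_abs bfun_diff bfun_act)

lemma shift_mult:
 assumes h: "bfun C h" and g: "g : SL2" "g' : SL2"
 shows "shift h (g ** g') <= shift h g + shift h g'"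
proof -
 have i1: "bfun (C + C) (%x. \<bar>h (act g (act g' x)) - h (act g' x)\<bar>)"
  using bfun_act[OF bfun_shift[OF h g(1)] g(2)] .
 have "shift h (g ** g') <= (\<integral>x. \<bar>h (act g (act g' x)) - h (act g' x)\<bar> + \<bar>h (act g' x) - h x\<bar> \<partial>Y)"
  unfolding shift_def
 proof (rule integral_mono)
  show "integrable Y (%x. \<bar>h (act (g ** g') x) - h x\<bar>)"
   using g by (intro bfun_integrable[OF bfun_shift[OF h]]) auto
  show "integrable Y (%x. \<bar>h (act g (act g' x)) - h (act g' x)\<bar> + \<bar>h (act g' x) - h x\<bar>)"
   by (intro Bochner_Integration.integrable_add bfun_integrable[OF i1] bfun_integrable[OF bfun_shift[OF h g(2)]])
 qed (use g in \<open>simp add: act_mult\<close>)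
 also have "... = (\<integral>x. \<bar>h (act g (act g' x)) - h (act g' x)\<bar> \<partial>Y) + shift h g'"
  unfolding shift_def
  by (intro Bochner_Integration.integral_add bfun_integrable[OF i1] bfun_integrable[OF bfun_shift[OF h g(2)]])
 also have "(\<integral>x. \<bar>h (act g (act g' x)) - h (act g' x)\<bar> \<partial>Y) = shift h g"
  unfolding shift_def using integral_act[OF bfun_measurable[OF bfun_shift[OF h g(1)]] g(2)] .
 finally show ?thesis .
qed

lemma shift_adj2:
 assumes h: "bfun C h" and g: "g : SL2"
 shows "shift h (adj2 g) = shift h g"
proof -
 have ag: "adj2 g : SL2" using g by simp
 have "shift h (adj2 g) = (\<integral>x. \<bar>h (act (adj2 g) (act g x)) - h (act g x)\<bar> \<partial>Y)"
  unfolding shift_def using integral_act[OF bfun_measurable[OF bfun_shift[OF h ag]] g] by simp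
 also have "... = shift h g"
  unfolding shift_def
  by (rule Bochner_Integration.integral_cong) (use g ag in \<open>auto simp: act_mult[symmetric] act_one abs_minus_commute\<close>)
 finally show ?thesis .
qed

text \<open>Replacing the point by its image under \<open>g'\<close> does not change the
  displacement, so one may average over \<open>g'\<close> in a fixed ball. After exchanging
  integrals each point contributes an integral along its own orbit, where continuity of translations
  on the space of matrices applies.\<close>

lemma shift_continuous:
 assumes h: "bfun C h" and g: "\<And>i. g i : SL2" and lim: "g \<longlonglongrightarrow> mat 1"
 shows "(%i. shift h (g i)) \<longlonglongrightarrow> 0"
proof -
 note hm = bfun_measurable[OF h]
 have C0: "0 <= C" using bfun_nonneg[OF h] .
 let ?F = "fball 24"
 define v where "v = emeasure haar ?F"
 have v: "v ~= 0" "v < \<infinity>"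
  using fball_lower[of 24] emeasure_haar_fball_finite[of 24] by (auto simp: v_def)
 obtain K where K: "0 < K" "\<And>i. norm (g i) <= K"
  using convergent_imp_Bseq[of g] lim by (auto simp: convergent_def Bseq_def)
 define In where "In i x = (\<integral>\<^sup>+g'. ennreal \<bar>h (act (g i ** g') x) - h (act g' x)\<bar> * indicator ?F g' \<partial>haar)" for i x
 have pm: "(%(x, g'). ennreal \<bar>h (act (g i ** g') x) - h (act g' x)\<bar> * indicator ?F g') : borel_measurable (Y \<Otimes>\<^sub>M haar)" for i
 proof -
  have 1: "(%z. h (act (snd z) (fst z))) : borel_measurable (Y \<Otimes>\<^sub>M haar)"
   using measurable_compose[OF _ act_pair_measurable[OF hm], of "%z. (snd z, fst z)" "Y \<Otimes>\<^sub>M haar"] by simp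
  have "(%z. (g i ** snd z, fst z)) : measurable (Y \<Otimes>\<^sub>M haar) (SL2_borel \<Otimes>\<^sub>M Y)"
   by (intro measurable_Pair measurable_mult_SL2 measurable_const_SL2 g) auto
  from measurable_compose[OF this act_pair_measurable[OF hm]]
  have 2: "(%z. h (act (g i ** snd z) (fst z))) : borel_measurable (Y \<Otimes>\<^sub>M haar)" by simp
  show ?thesis using 1 2 unfolding case_prod_beta' by measurable
 qed
 have Inm: "In i : borel_measurable Y" for i
  unfolding In_def by (rule haar.borel_measurable_nn_integral[OF pm])
 have eq: "v * ennreal (shift h (g i)) = (\<integral>\<^sup>+x. In i x \<partial>Y)" for i
 proof -
  interpret P: pair_sigma_finite Y haar ..
  have "(\<integral>\<^sup>+x. In i x \<partial>Y) = (\<integral>\<^sup>+g'. (\<integral>\<^sup>+x. ennreal \<bar>h (act (g i ** g') x) - h (act g' x)\<bar> * indicator ?F g' \<partial>Y) \<partial>haar)"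
   unfolding In_def by (rule P.Fubini'[OF pm, symmetric])
  also have "... = (\<integral>\<^sup>+g'. ennreal (shift h (g i)) * indicator ?F g' \<partial>haar)"
  proof (rule nn_integral_cong)
   fix g' assume "g' : space haar"
   then have g': "g' : SL2" by simp
   have bs: "bfun (C + C) (%x. \<bar>h (act (g i) x) - h x\<bar>)" by (rule bfun_shift[OF h g])
   have "(\<integral>\<^sup>+x. ennreal \<bar>h (act (g i ** g') x) - h (act g' x)\<bar> \<partial>Y)
     = (\<integral>\<^sup>+x. ennreal \<bar>h (act (g i) (act g' x)) - h (act g' x)\<bar> \<partial>Y)"
    by (rule nn_integral_cong) (simp add: act_mult g g')
   also have "... = (\<integral>\<^sup>+x. ennreal \<bar>h (act (g i) x) - h x\<bar> \<partial>Y)"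
    using nn_integral_act[OF _ g', of "%x. ennreal \<bar>h (act (g i) x) - h x\<bar>"] bfun_measurable[OF bs] by simp
   also have "... = ennreal (shift h (g i))"
    unfolding shift_def by (intro nn_integral_eq_integral bfun_integrable[OF bs]) auto
   finally show "(\<integral>\<^sup>+x. ennreal \<bar>h (act (g i ** g') x) - h (act g' x)\<bar> * indicator ?F g' \<partial>Y)
     = ennreal (shift h (g i)) * indicator ?F g'"
    by (auto split: split_indicator)
  qed
  also have "... = v * ennreal (shift h (g i))"
   by (simp add: nn_integral_cmult v_def mult.commute)
  finally show ?thesis by simp
 qed
 have Inlim: "(%i. In i x) \<longlonglongrightarrow> 0" if x: "x : space Y" for x
 proof -
  \<comment> \<open>The orbit function is spread radially over the cone, where left multiplication
    is linear and preserves Lebesgue measure.\<close>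
  define k where "k B = h (act (nrm B) x)" for B
  have km: "k : borel_measurable borel"
   unfolding k_def by (rule measurable_compose[OF measurable_nrm orbit_measurable[OF hm x]])
  let ?S = "cone_part \<inter> nrm -` ?F"
  have S: "?S : sets borel"
  proof -
   have "nrm -` ?F \<inter> space borel : sets borel" by measurable
   then show ?thesis by simp
  qed
  have "(%i. \<integral>\<^sup>+B. ennreal \<bar>k (g i ** B) - k B\<bar> * indicator ?S B \<partial>lborel) \<longlonglongrightarrow> 0"
  proof (rule L1_translation_continuity[where k = k and L = "%i B. g i ** B" and S = ?S and S' = "cball 0 (sqrt 24 + K * sqrt 24)" and C = C])
   show "\<bar>k B\<bar> <= C" for B
    unfolding k_def using x by (intro bfun_bound[OF h]) auto
   show "distr lborel borel ((**) (g i)) = (lborel :: (real^2^2) measure)" for i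
   proof (rule measure_eqI)
    fix A :: "(real^2^2) set" assume "A : sets (distr lborel borel ((**) (g i)))"
    then have A [measurable]: "A : sets borel" by simp
    have "emeasure (distr lborel borel ((**) (g i))) A = (\<integral>\<^sup>+B. indicator A B \<partial>distr lborel borel ((**) (g i)))"
     by simp
    also have "... = (\<integral>\<^sup>+B. indicator A (g i ** B) \<partial>lborel)" by (subst nn_integral_distr) auto
    also have "... = emeasure lborel A" by (subst nn_integral_lborel_mult_left[OF g]) auto
    finally show "emeasure (distr lborel borel ((**) (g i))) A = emeasure lborel A" .
   qed simp
   show "(%i. g i ** B) \<longlonglongrightarrow> B" for B :: "real^2^2"
   proof -
    have "(%i. g i ** B) \<longlonglongrightarrow> mat 1 ** B"
     unfolding matrix_matrix_mult_def
     by (intro tendsto_vec_lambda tendsto_sum tendsto_mult tendsto_vec_nth lim tendsto_const)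
    then show ?thesis by simp
   qed
   have nB: "norm B <= sqrt 24" if "B : ?S" for B
   proof -
    have B: "B : cone_part" and "frob2 B / det B <= 24"
     using that by (auto simp: frob2_nrm[symmetric] fball_def)
    then have "frob2 B <= 24" by (auto simp: cone_part_def divide_le_eq)
    then show ?thesis by (simp add: frob2_eq_norm real_le_rsqrt)
   qed
   show "?S \<subseteq> cball 0 (sqrt 24 + K * sqrt 24)"
   proof
    fix B assume "B : ?S"
    moreover have "0 <= K * sqrt 24" using K by simp
    ultimately show "B : cball 0 (sqrt 24 + K * sqrt 24)" using nB[of B] by simp
   qed
   show "g i ** B : cball 0 (sqrt 24 + K * sqrt 24)" if "B : ?S" for i B
   proof -
    have "(norm (g i ** B))^2 <= (norm (g i) * norm B)^2"
     using frob2_mult_le[of "g i" B] by (simp add: frob2_eq_norm power_mult_distrib)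
    then have "norm (g i ** B) <= norm (g i) * norm B"
     by (rule power2_le_imp_le) simp
    also have "... <= K * sqrt 24" using K nB[OF that] by (intro mult_mono) auto
    finally show ?thesis by (simp add: add_increasing)
   qed
   show "emeasure lborel (cball 0 (sqrt 24 + K * sqrt 24) :: (real^2^2) set) < \<infinity>"
    by (intro emeasure_bounded_finite) auto
  qed (use km S in auto)
  moreover have "In i x = (\<integral>\<^sup>+B. ennreal \<bar>k (g i ** B) - k B\<bar> * indicator ?S B \<partial>lborel)" for i
  proof -
   have m: "(%g'. ennreal \<bar>h (act (g i ** g') x) - h (act g' x)\<bar> * indicator ?F g') : borel_measurable SL2_borel"
    using measurable_Pair2[OF pm x] by simp
   show ?thesis
    unfolding In_def nn_integral_haar[OF m]
    by (rule nn_integral_cong) (auto simp: k_def nrm_mult_left g split: split_indicator)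
  qed
  ultimately show ?thesis by simp
 qed
 have "(%i. \<integral>\<^sup>+x. In i x \<partial>Y) \<longlonglongrightarrow> (\<integral>\<^sup>+x. 0 \<partial>Y)"
 proof (rule nn_integral_dominated_convergence[where w = "%x. ennreal (2 * C) * v"])
  show "AE x in Y. In i x <= ennreal (2 * C) * v" for i
  proof (rule AE_I2)
   fix x assume x: "x : space Y"
   have "In i x <= (\<integral>\<^sup>+g'. ennreal (2 * C) * indicator ?F g' \<partial>haar)"
    unfolding In_def
   proof (rule nn_integral_mono)
    fix g' assume "g' : space haar"
    then have "\<bar>h (act (g i ** g') x)\<bar> <= C" "\<bar>h (act g' x)\<bar> <= C"
     using x g by (auto intro!: bfun_bound[OF h])
    then have "\<bar>h (act (g i ** g') x) - h (act g' x)\<bar> <= 2 * C" by linarith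
    then show "ennreal \<bar>h (act (g i ** g') x) - h (act g' x)\<bar> * indicator ?F g' <= ennreal (2 * C) * indicator ?F g'"
     by (intro mult_right_mono ennreal_leI) auto
   qed
   then show "In i x <= ennreal (2 * C) * v" by (simp add: nn_integral_cmult v_def)
  qed
  show "(\<integral>\<^sup>+x. ennreal (2 * C) * v \<partial>Y) < \<infinity>"
   using v by (simp add: emeasure_space_1 ennreal_mult_less_top)
  show "AE x in Y. (%i. In i x) \<longlonglongrightarrow> 0" using Inlim by (intro AE_I2)
 qed (use Inm in auto)
 then have "(%i. v * ennreal (shift h (g i))) \<longlonglongrightarrow> 0" by (simp add: eq)
 then have "(%i. inverse v * (v * ennreal (shift h (g i)))) \<longlonglongrightarrow> inverse v * 0"
  using v by (intro ennreal_tendsto_cmult) (simp add: less_top[symmetric])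
 moreover have "inverse v * (v * z) = z" for z
 proof -
  have "inverse v * v = 1" using ennreal_divide_self[of v] v by (simp add: divide_ennreal_def mult.commute)
  then show ?thesis by (simp add: mult.assoc[symmetric])
 qed
 ultimately have "(%i. ennreal (shift h (g i))) \<longlonglongrightarrow> ennreal 0" by simp
 then show ?thesis by (subst (asm) tendsto_ennreal_iff) auto
qed

text \<open>Displacement zero defines a subgroup that is closed, by continuity. It contains
  \<open>up 1\<close>, hence all integral upper shears; these produce a diagonal element in the
  limit, conjugation by which contracts real shears to the identity. Shears generate the
  group.\<close>

lemma Mautner:
 assumes h: "bfun C h" and 1: "shift h (up 1) = 0" and g: "g : SL2"
 shows "shift h g = 0"
proof -
 have nat: "shift h (up (real n)) = 0" for n
 proof (induction n)
  case 0
  have "shift h (mat 1) = (\<integral>x. 0 \<partial>Y)"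
   unfolding shift_def by (rule Bochner_Integration.integral_cong) (auto simp: act_one)
  then show ?case by (simp add: mat_1_mk2)
 next
  case (Suc n)
  have "shift h (up (real (Suc n))) <= shift h (up (real n)) + shift h (up 1)"
   using shift_mult[OF h, of "up (real n)" "up 1"] by (simp add: add.commute)
  then show ?case using Suc 1 shift_nonneg[of h "up (real (Suc n))"] by linarith
 qed
 have neg: "shift h (up (- real n)) = 0" for n
  using shift_adj2[OF h, of "up (real n)"] nat[of n] by simp
 have cont: "(%n. shift h (mk2 1 (a n) (b n) 1)) \<longlonglongrightarrow> 0"
  if "a \<longlonglongrightarrow> 0" "b \<longlonglongrightarrow> 0" "\<And>n. a n * b n = 0" for a b
 proof (rule shift_continuous[OF h])
  show "mk2 1 (a n) (b n) 1 : SL2" for n using that by simp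
  have "(%n. mk2 1 (a n) (b n) 1) \<longlonglongrightarrow> mk2 1 0 0 1"
  proof (intro vec_tendstoI)
   fix i j :: 2
   show "(%n. mk2 1 (a n) (b n) 1 $ i $ j) \<longlonglongrightarrow> mk2 1 0 0 1 $ i $ j"
    using exhaust_2[of i] exhaust_2[of j] that by auto
  qed
  then show "(%n. mk2 1 (a n) (b n) 1) \<longlonglongrightarrow> mat 1" by (simp add: mat_1_mk2)
 qed
 define A where "A j = mk2 (2 ^ j) 0 0 (1 / 2 ^ j)" for j :: nat
 have ASL: "A j : SL2" for j by (simp add: A_def)
 have A1: "shift h (A 1) = 0"
 proof -
  have le: "shift h (A 1) <= shift h (lo (- 1 / (4 * real (Suc n)))) + shift h (lo (1 / (2 * real (Suc n))))" for n
  proof -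
   let ?M = "real (Suc n)"
   \<comment> \<open>The diagonal matrix with entries 2 and 1/2 is a product of two integral upper
     shears and two lower shears, and the lower ones tend to the identity as \<open>?M\<close>
     grows.\<close>
   have eq: "A 1 = lo (- 1 / (4 * ?M)) ** (up (2 * ?M) ** (lo (1 / (2 * ?M)) ** up (- ?M)))"
   proof -
    have *: "lo (1 / (2 * M)) ** up (- M) = mk2 1 (- M) (1 / (2 * M)) (1 / 2)"
     "up (2 * M) ** mk2 1 (- M) (1 / (2 * M)) (1 / 2) = mk2 2 0 (1 / (2 * M)) (1 / 2)"
     "lo (- 1 / (4 * M)) ** mk2 2 0 (1 / (2 * M)) (1 / 2) = mk2 2 0 0 (1 / 2)" if "0 < M" for M :: real
     using that by (auto simp: field_simps)
    have M: "0 < ?M" by simp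
    show ?thesis unfolding *(1)[OF M] *(2)[OF M] *(3)[OF M] by (simp add: A_def)
   qed
   have "shift h (up (2 * ?M)) = 0" using nat[of "2 * Suc n"] by simp
   moreover have "shift h (up (- ?M)) = 0" by (rule neg)
   moreover have "shift h (lo (1 / (2 * ?M)) ** up (- ?M)) <= shift h (lo (1 / (2 * ?M))) + shift h (up (- ?M))"
    by (rule shift_mult[OF h]; (intro SL2_mult)?; simp)
   moreover have "shift h (up (2 * ?M) ** (lo (1 / (2 * ?M)) ** up (- ?M))) <= shift h (up (2 * ?M)) + shift h (lo (1 / (2 * ?M)) ** up (- ?M))"
    by (rule shift_mult[OF h]; (intro SL2_mult)?; simp)
   moreover have "shift h (A 1) <= shift h (lo (- 1 / (4 * ?M))) + shift h (up (2 * ?M) ** (lo (1 / (2 * ?M)) ** up (- ?M)))"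
    unfolding eq by (rule shift_mult[OF h]; (intro SL2_mult)?; simp)
   ultimately show ?thesis by linarith
  qed
  have z: "(%n. c / real (Suc n)) \<longlonglongrightarrow> 0" for c
   using LIMSEQ_Suc[OF lim_const_over_n[of c]] by simp
  have "(%n. shift h (lo (- 1 / (4 * real (Suc n)))) + shift h (lo (1 / (2 * real (Suc n))))) \<longlonglongrightarrow> 0 + 0"
   using z[of "-1/4"] z[of "1/2"]
   by (intro tendsto_add cont) (auto simp: field_simps)
  then have "shift h (A 1) <= 0 + 0"
   by (rule tendsto_lowerbound) (use le in auto)
  then show ?thesis using shift_nonneg[of h "A 1"] by linarith
 qed
 have A: "shift h (A j) = 0" for j
 proof (induction j)
  case 0
  have "A 0 = mat 1" by (simp add: A_def mat_1_mk2)
  then show ?case using nat[of 0] by (simp add: mat_1_mk2)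
 next
  case (Suc j)
  have "A (Suc j) = A 1 ** A j" by (simp add: A_def)
  then have "shift h (A (Suc j)) <= shift h (A 1) + shift h (A j)" using shift_mult[OF h ASL ASL, of 1 j] by simp
  then show ?case using Suc A1 shift_nonneg[of h "A (Suc j)"] by linarith
 qed
 have A': "shift h (adj2 (A j)) = 0" for j using shift_adj2[OF h ASL] A by simp
 have pw: "(%j. s / 4 ^ j) \<longlonglongrightarrow> 0" for s :: real
  using tendsto_mult_right_zero[OF LIMSEQ_realpow_zero[of "1/4::real"], of s] by (simp add: power_one_over)
 have sq: "(2::real) ^ j * 2 ^ j = 4 ^ j" for j by (simp flip: power_mult_distrib)
 have up0: "shift h (up s) = 0" for s
 proof -
  have le: "shift h (up s) <= shift h (up (s / 4 ^ j))" for j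
  proof -
   \<comment> \<open>Conjugation by the powers \<open>A j\<close> costs nothing and shrinks the
     shear by the factor \<open>4 ^ j\<close>.\<close>
   have eq: "up s = A j ** (up (s / 4 ^ j) ** adj2 (A j))"
    by (simp add: A_def field_simps sq)
   have "shift h (up s) <= shift h (A j) + (shift h (up (s / 4 ^ j)) + shift h (adj2 (A j)))"
    by (subst eq, rule order_trans[OF shift_mult[OF h]])
     (auto simp: ASL intro!: shift_mult[OF h])
   then show ?thesis by (simp add: A A')
  qed
  have "(%j. shift h (up (s / 4 ^ j))) \<longlonglongrightarrow> 0" by (intro cont pw) auto
  then have "shift h (up s) <= 0" by (rule tendsto_lowerbound) (use le in auto)
  then show ?thesis using shift_nonneg[of h "up s"] by linarith
 qed
 have lo0: "shift h (lo s) = 0" for s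
 proof -
  have le: "shift h (lo s) <= shift h (lo (s / 4 ^ j))" for j
  proof -
   have eq: "lo s = adj2 (A j) ** (lo (s / 4 ^ j) ** A j)"
    by (simp add: A_def field_simps sq)
   have "shift h (lo s) <= shift h (adj2 (A j)) + (shift h (lo (s / 4 ^ j)) + shift h (A j))"
    by (subst eq, rule order_trans[OF shift_mult[OF h]])
     (auto simp: ASL intro!: shift_mult[OF h])
   then show ?thesis by (simp add: A A')
  qed
  have "(%j. shift h (lo (s / 4 ^ j))) \<longlonglongrightarrow> 0" by (intro cont pw) auto
  then have "shift h (lo s) <= 0" by (rule tendsto_lowerbound) (use le in auto)
  then show ?thesis using shift_nonneg[of h "lo s"] by linarith
 qed
 show ?thesis
  using g
 proof (induction g rule: SL2_induct)
  case (mult A B)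
  then show ?case using shift_mult[OF h, of A B] shift_nonneg[of h "A ** B"] by simp
 qed (auto simp: up0 lo0)
qed

end

section \<open>The mean ergodic theorem for a unipotent element\<close>

lemma up_in_SL2: "up a : SL2"
 by simp

context SL2_pmp
begin

definition uavg :: "('y => real) => nat => 'y => real" where
 "uavg h N x = (\<Sum>k<N. h (act (up (real k)) x)) / real N"

lemma uavg_measurable: "h : borel_measurable Y ==> uavg h N : borel_measurable Y"
 unfolding uavg_def[abs_def] by (rule borel_measurable_divide, rule borel_measurable_sum, rule act_fn_measurable) auto

lemma bfun_uavg:
 assumes h: "bfun C h"
 shows "bfun C (uavg h N)"
 unfolding bfun_def
proof (intro conjI ballI)
 show "uavg h N : borel_measurable Y" by (rule uavg_measurable[OF bfun_measurable[OF h]])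
 fix x assume x: "x : space Y"
 have "\<bar>\<Sum>k<N. h (act (up (real k)) x)\<bar> <= (\<Sum>k<N. C)"
  using x by (intro order_trans[OF sum_abs] sum_mono bfun_bound[OF h]) auto
 then show "\<bar>uavg h N x\<bar> <= C"
  using bfun_nonneg[OF h] by (cases "N = 0") (auto simp: uavg_def field_simps)
qed

lemma uavg_sq:
 assumes h: "bfun C h" and N: "0 < N"
 shows "(\<integral>x. (uavg h N x)\<^sup>2 \<partial>Y) <= (\<integral>x. (h x)\<^sup>2 \<partial>Y)"
proof -
 have hs: "bfun (C * C) (%x. (h x)\<^sup>2)" using bfun_mult[OF h h] by (simp add: power2_eq_square)
 have iss: "integrable Y (%x. (\<Sum>k<N. (h (act (up (real k)) x))\<^sup>2) / real N)"
  by (intro integrable_divide Bochner_Integration.integrable_sum bfun_integrable[OF bfun_act[OF hs]]) auto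
 have iu: "integrable Y (%x. (uavg h N x)\<^sup>2)"
  using bfun_integrable[OF bfun_mult[OF bfun_uavg[OF h] bfun_uavg[OF h]]] by (simp add: power2_eq_square)
 have "(\<integral>x. (uavg h N x)\<^sup>2 \<partial>Y) <= (\<integral>x. (\<Sum>k<N. (h (act (up (real k)) x))\<^sup>2) / real N \<partial>Y)"
 proof (rule integral_mono[OF iu iss])
  fix x
  have "(\<Sum>k<N. h (act (up (real k)) x))^2 <= (\<Sum>k<N. (h (act (up (real k)) x))\<^sup>2) * real N"
   using sum_squared_le_sum_of_squares[of "%k. h (act (up (real k)) x)" "{..<N}"] by simp
  then show "(uavg h N x)^2 <= (\<Sum>k<N. (h (act (up (real k)) x))\<^sup>2) / real N"
   using N by (simp add: uavg_def power_divide field_simps power2_eq_square)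
 qed
 also have "... = (\<Sum>k<N. \<integral>x. (h (act (up (real k)) x))\<^sup>2 \<partial>Y) / real N"
  by (simp, subst Bochner_Integration.integral_sum) (auto intro!: bfun_integrable[OF bfun_act[OF hs]])
 also have "... = (\<Sum>k<N. \<integral>x. (h x)\<^sup>2 \<partial>Y) / real N"
  using integral_act[OF bfun_measurable[OF hs]] by simp
 also have "... = (\<integral>x. (h x)\<^sup>2 \<partial>Y)" using N by simp
 finally show ?thesis .
qed

text \<open>Advancing the window by one step exchanges a single term, whatever the length of the
  window.\<close>

lemma shifted_sum_bound:
 fixes u :: "nat => real"
 assumes "\<And>k. \<bar>u k\<bar> <= C"
 shows "\<bar>(\<Sum>k<L. u (j + k)) - (\<Sum>k<L. u k)\<bar> <= 2 * C * real j"
proof (induction j)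
 case (Suc j)
 have "(\<Sum>k<L. u (Suc j + k)) - (\<Sum>k<L. u (j + k)) = u (j + L) - u j"
  using sum_lessThan_telescope[of "%k. u (j + k)" L] by (simp add: sum_subtractf)
 moreover have "\<bar>u (j + L) - u j\<bar> <= 2 * C" using assms[of "j + L"] assms[of j] by linarith
 ultimately show ?case using Suc by (simp add: algebra_simps)
qed simp

lemma uavg_uavg:
 assumes h: "bfun C h" and N: "0 < N" and L: "0 < L" and x: "x : space Y"
 shows "\<bar>uavg (uavg h N) L x - uavg h L x\<bar> <= 2 * C * real N / real L"
proof -
 define u where "u k = h (act (up (real k)) x)" for k
 have uC: "\<bar>u k\<bar> <= C" for k unfolding u_def using x by (intro bfun_bound[OF h]) auto
 have C0: "0 <= C" by (rule bfun_nonneg[OF h])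
 have act2: "h (act (up (real j)) (act (up (real k)) x)) = u (j + k)" for j k
  unfolding u_def by (subst act_mult[symmetric]) (auto simp: x add.commute)
 have "uavg (uavg h N) L x - uavg h L x
   = ((\<Sum>k<L. \<Sum>j<N. u (j + k)) / real N - (\<Sum>k<L. u k)) / real L"
  unfolding uavg_def act2 by (simp add: u_def sum_divide_distrib[symmetric] diff_divide_distrib)
 also have "(\<Sum>k<L. \<Sum>j<N. u (j + k)) = (\<Sum>j<N. \<Sum>k<L. u (j + k))" by (rule sum.swap)
 also have "(\<Sum>j<N. \<Sum>k<L. u (j + k)) / real N - (\<Sum>k<L. u k) = (\<Sum>j<N. (\<Sum>k<L. u (j + k)) - (\<Sum>k<L. u k)) / real N"
  using N by (simp add: sum_subtractf field_simps)
 finally have eq: "uavg (uavg h N) L x - uavg h L x = (\<Sum>j<N. (\<Sum>k<L. u (j + k)) - (\<Sum>k<L. u k)) / real N / real L" .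
 have "\<bar>\<Sum>j<N. (\<Sum>k<L. u (j + k)) - (\<Sum>k<L. u k)\<bar> <= (\<Sum>j<N. 2 * C * real N)"
 proof (intro order_trans[OF sum_abs] sum_mono)
  fix j assume "j : {..<N}"
  then have "2 * C * real j <= 2 * C * real N" using C0 by (intro mult_left_mono) auto
  then show "\<bar>(\<Sum>k<L. u (j + k)) - (\<Sum>k<L. u k)\<bar> <= 2 * C * real N"
   using shifted_sum_bound[of u C j L] uC by fastforce
 qed
 then have "\<bar>\<Sum>j<N. (\<Sum>k<L. u (j + k)) - (\<Sum>k<L. u k)\<bar> / real N / real L <= (\<Sum>j<N. 2 * C * real N) / real N / real L"
  by (intro divide_right_mono) auto
 then show ?thesis unfolding eq using N L by (simp add: abs_divide)
qed

text \<open>A long average of \<open>h\<close> almost coincides with the long average of any shorter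
  average, hence also of the midpoint of two of them, and averaging does not increase the norm in
  square mean.\<close>

lemma uavg_energy:
 assumes h: "bfun C h" and N: "0 < N" "0 < M" "0 < L"
 shows "(\<integral>x. (uavg h L x)\<^sup>2 \<partial>Y) <= (\<integral>x. ((uavg h N x + uavg h M x) / 2)\<^sup>2 \<partial>Y) + 4 * C^2 * real (N + M) / real L"
proof -
 define w where "w x = (uavg h N x + uavg h M x) / 2" for x
 have C0: "0 <= C" by (rule bfun_nonneg[OF h])
 have w: "bfun C w"
  unfolding bfun_def
 proof (intro conjI ballI)
  show "w : borel_measurable Y"
   unfolding w_def[abs_def] using uavg_measurable[OF bfun_measurable[OF h]]
   by (intro borel_measurable_divide borel_measurable_add) auto
  fix x assume x: "x : space Y"
  show "\<bar>w x\<bar> <= C"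
   unfolding w_def using bfun_bound[OF bfun_uavg[OF h, of N] x] bfun_bound[OF bfun_uavg[OF h, of M] x]
    abs_triangle_ineq[of "uavg h N x" "uavg h M x"] by (simp add: abs_divide)
 qed
 let ?e = "4 * C^2 * real (N + M) / real L"
 have sq: "integrable Y (%x. (uavg k L x)\<^sup>2)" if "bfun C k" for k
  using bfun_integrable[OF bfun_mult[OF bfun_uavg[OF that] bfun_uavg[OF that]]] by (simp add: power2_eq_square)
 have "(\<integral>x. (uavg h L x)\<^sup>2 \<partial>Y) <= (\<integral>x. (uavg w L x)\<^sup>2 + ?e \<partial>Y)"
 proof (rule integral_mono)
  show "integrable Y (%x. (uavg h L x)\<^sup>2)" by (rule sq[OF h])
  show "integrable Y (%x. (uavg w L x)\<^sup>2 + ?e)" by (intro Bochner_Integration.integrable_add sq[OF w]) auto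
  fix x assume x: "x : space Y"
  have split: "uavg w L x = (uavg (uavg h N) L x + uavg (uavg h M) L x) / 2"
   unfolding uavg_def[of w] uavg_def[of "uavg h N" L] uavg_def[of "uavg h M" L] w_def
   by (simp add: sum_divide_distrib[symmetric] sum.distrib add_divide_distrib)
  have d: "\<bar>uavg w L x - uavg h L x\<bar> <= 2 * C * real (N + M) / real L"
  proof -
   have "\<bar>uavg w L x - uavg h L x\<bar> <= (2 * C * real N / real L + 2 * C * real M / real L) / 2"
   proof -
    have "\<bar>(a + b) / 2 - c\<bar> <= (\<bar>a - c\<bar> + \<bar>b - c\<bar>) / 2" for a b c :: real
     by (simp add: abs_if field_simps)
    from this[of "uavg (uavg h N) L x" "uavg (uavg h M) L x" "uavg h L x"] show ?thesis
     unfolding split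
     by (rule order_trans) (intro divide_right_mono add_mono uavg_uavg[OF h N(1,3) x] uavg_uavg[OF h N(2,3) x], simp)
   qed
   also have "... <= 2 * C * real N / real L + 2 * C * real M / real L"
   proof -
    have *: "z / 2 <= z" if "0 <= z" for z :: real using that by simp
    show ?thesis using C0 by (intro *) auto
   qed
   finally show ?thesis by (simp add: distrib_left add_divide_distrib)
  qed
  define a b where "a = uavg h L x" and "b = uavg w L x"
  have ab: "\<bar>a\<bar> <= C" "\<bar>b\<bar> <= C"
   unfolding a_def b_def using x by (auto intro!: bfun_bound bfun_uavg h w)
  have "a^2 - b\<^sup>2 = (a - b) * (a + b)" by (simp add: power2_eq_square algebra_simps)
  also have "... <= \<bar>b - a\<bar> * (2 * C)"
  proof -
   have "(a - b) * (a + b) <= \<bar>a - b\<bar> * \<bar>a + b\<bar>" by (simp flip: abs_mult)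
   also have "... <= \<bar>b - a\<bar> * (2 * C)" using ab by (intro mult_mono) auto
   finally show ?thesis .
  qed
  also have "... <= (2 * C * real (N + M) / real L) * (2 * C)"
   using d C0 unfolding a_def b_def by (intro mult_right_mono) auto
  also have "... = ?e" by (simp add: power2_eq_square)
  finally show "(uavg h L x)^2 <= (uavg w L x)^2 + ?e" unfolding a_def b_def by simp
 qed
 also have "... = (\<integral>x. (uavg w L x)\<^sup>2 \<partial>Y) + ?e"
  using sq[OF w] by (simp add: prob_space)
 also have "(\<integral>x. (uavg w L x)\<^sup>2 \<partial>Y) <= (\<integral>x. (w x)\<^sup>2 \<partial>Y)" by (rule uavg_sq[OF w N(3)])
 finally show ?thesis unfolding w_def by simp
qed

text \<open>Von Neumann's theorem by the parallelogram law. Long averages have energy close to the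
  infimum \<open>c\<close>, while the midpoint of any two averages has energy at least
  \<open>c\<close>; so two long averages must be close to each other.\<close>

lemma uavg_Cauchy:
 assumes h: "bfun C h" and e: "0 < e"
 shows "\<exists>N0>0. \<forall>N\<ge>N0. \<forall>M\<ge>N0. (\<integral>x. (uavg h N x - uavg h M x)\<^sup>2 \<partial>Y) <= e"
proof -
 define I where "I N = (\<integral>x. (uavg h N x)\<^sup>2 \<partial>Y)" for N
 define J where "J N M = (\<integral>x. ((uavg h N x + uavg h M x) / 2)\<^sup>2 \<partial>Y)" for N M
 have I0: "0 <= I N" for N unfolding I_def by simp
 define c where "c = Inf (I ` {0<..})"
 have bb: "bdd_below (I ` {0<..})" by (rule bdd_belowI[of _ 0]) (use I0 in auto)
 have cle: "c <= I N" if "0 < N" for N unfolding c_def using bb that by (intro cInf_lower) auto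
 have "\<exists>y\<in>I ` {0<..}. y < c + e / 16"
  unfolding c_def by (rule cInf_lessD) (use e in auto)
 then obtain N1 where N1: "0 < N1" "I N1 < c + e / 16" by auto
 have z: "(%L. a + b / real L) \<longlonglongrightarrow> a" for a b :: real
  using tendsto_add[OF tendsto_const lim_const_over_n[of b], of a] by simp
 have JN: "J N N = I N" for N unfolding I_def J_def by simp
 have en: "I L <= J N M + 4 * C^2 * real (N + M) / real L" if "0 < N" "0 < M" "0 < L" for N M L
  unfolding I_def J_def by (rule uavg_energy[OF h that])
 have "\<forall>\<^sub>F L in sequentially. I N1 + (4 * C^2 * real (N1 + N1)) / real L < c + e / 8"
  using N1 e by (intro order_tendstoD(2)[OF z]) auto
 then obtain L0 where L0: "\<And>L. L \<ge> L0 ==> I N1 + (4 * C^2 * real (N1 + N1)) / real L < c + e / 8"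
  by (auto simp: eventually_sequentially)
 define N0 where "N0 = Suc L0"
 have small: "I L <= c + e / 8" if "L \<ge> N0" for L
  using en[of N1 N1 L] L0[of L] N1 that unfolding JN N0_def by simp
 have cJ: "c <= J N M" if NM: "0 < N" "0 < M" for N M
 proof (rule tendsto_lowerbound[OF z])
  show "\<forall>\<^sub>F L in sequentially. c <= J N M + (4 * C^2 * real (N + M)) / real L"
   using eventually_gt_at_top[of 0]
  proof eventually_elim
   case (elim L)
   then show ?case using en[OF NM elim] cle[OF elim] by linarith
  qed
 qed simp
 have pm: "(\<integral>x. (uavg h N x - uavg h M x)\<^sup>2 \<partial>Y) = 2 * I N + 2 * I M - 4 * J N M" for N M
 proof -
  have i1: "integrable Y (%x. (uavg h N x)\<^sup>2)" for N
   using bfun_integrable[OF bfun_mult[OF bfun_uavg[OF h] bfun_uavg[OF h]]] by (simp add: power2_eq_square)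
  have i2: "integrable Y (%x. uavg h N x * uavg h M x)"
   by (rule bfun_integrable[OF bfun_mult[OF bfun_uavg[OF h] bfun_uavg[OF h]]])
  have i3: "integrable Y (%x. ((uavg h N x + uavg h M x) / 2)\<^sup>2)"
  proof -
   have "(%x. ((uavg h N x + uavg h M x) / 2)\<^sup>2) = (%x. (uavg h N x)\<^sup>2 / 4 + (uavg h M x)^2 / 4 + uavg h N x * uavg h M x / 2)"
    by (rule ext) (simp add: power2_eq_square field_simps)
   then show ?thesis
    using i1 i2 by (simp add: integrable_divide)
  qed
  have "(%x. (uavg h N x - uavg h M x)\<^sup>2) = (%x. (2 * (uavg h N x)^2 + 2 * (uavg h M x)^2) - 4 * ((uavg h N x + uavg h M x) / 2)^2)"
   by (rule ext) (simp add: power2_eq_square field_simps)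
  then show ?thesis unfolding I_def J_def using i1 i3 by simp
 qed
 have "(\<integral>x. (uavg h N x - uavg h M x)\<^sup>2 \<partial>Y) <= e" if "N \<ge> N0" "M \<ge> N0" for N M
  using small[OF that(1)] small[OF that(2)] cJ[of N M] that e unfolding pm N0_def by simp
 then show ?thesis by (intro exI[of _ N0]) (auto simp: N0_def)
qed

lemma L1_le_L2:
 assumes h: "bfun C h"
 shows "(\<integral>x. \<bar>h x\<bar> \<partial>Y)^2 <= (\<integral>x. (h x)\<^sup>2 \<partial>Y)"
proof -
 have i: "integrable Y (%x. \<bar>h x\<bar>)" by (rule bfun_integrable[OF bfun_abs[OF h]])
 have i2: "integrable Y (%x. (h x)\<^sup>2)"
  using bfun_integrable[OF bfun_mult[OF h h]] by (simp add: power2_eq_square)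
 let ?m = "\<integral>x. \<bar>h x\<bar> \<partial>Y"
 have "0 <= (\<integral>x. (\<bar>h x\<bar> - ?m)\<^sup>2 \<partial>Y)" by simp
 also have "... = (\<integral>x. ((h x)^2 - 2 * ?m * \<bar>h x\<bar>) + ?m\<^sup>2 \<partial>Y)"
  by (intro Bochner_Integration.integral_cong refl) (simp add: power2_eq_square algebra_simps)
 also have "... = (\<integral>x. (h x)\<^sup>2 \<partial>Y) - 2 * ?m * ?m + ?m\<^sup>2"
  using i i2 by (simp add: prob_space)
 finally show ?thesis by (simp add: power2_eq_square)
qed

end

text \<open>Ergodicity in functional form. Invariance is demanded for each group element separately,
  with an exceptional null set that may depend on it.\<close>

locale SL2_ergodic = SL2_pmp +
 assumes erg: "\<And>C P. bfun C P ==> (\<And>g. g : SL2 ==> AE x in Y. P (act g x) = P x) ==> \<exists>c. AE x in Y. P x = c"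
begin

text \<open>A fast subsequence of the averages converges almost everywhere. Its limit is invariant
  under \<open>up 1\<close>, hence by Mautner's argument under the whole group, hence constant:
  ergodicity passes to a single unipotent element.\<close>

lemma uavg_mean:
 assumes h: "bfun C h" and e: "0 < e"
 shows "\<exists>N>0. (\<integral>x. \<bar>uavg h N x - (\<integral>x. h x \<partial>Y)\<bar> \<partial>Y) < e"
proof -
 note hm = bfun_measurable[OF h]
 have "\<forall>n. \<exists>N0>0. \<forall>N\<ge>N0. \<forall>M\<ge>N0. (\<integral>x. (uavg h N x - uavg h M x)\<^sup>2 \<partial>Y) <= ((1/2) ^ n)^2"
  by (intro allI uavg_Cauchy[OF h]) auto
 then obtain K where K: "\<And>n. K n > 0" "\<And>n N M. K n <= N ==> K n <= M ==> (\<integral>x. (uavg h N x - uavg h M x)\<^sup>2 \<partial>Y) <= ((1/2) ^ n)^2"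
  by metis
 \<comment> \<open>Both \<open>r n\<close> and \<open>r (Suc n)\<close> are at least
   \<open>K n\<close>, so consecutive terms differ by at most \<open>(1/2) ^ n\<close> in mean; the
   summand \<open>n\<close> makes the sequence tend to infinity.\<close>
 define r where "r n = (\<Sum>i\<le>n. K i) + n" for n
 have rK: "K n <= r n" "K n <= r (Suc n)" for n
  unfolding r_def using member_le_sum[of n "{..n}" K] by (auto intro: trans_le_add1)
 have rn: "n <= r n" for n by (simp add: r_def)
 have r0: "0 < r n" for n using rK(1)[of n] K(1)[of n] by simp
 define V where "V n = uavg h (r n)" for n
 have V: "bfun C (V n)" for n unfolding V_def by (rule bfun_uavg[OF h])
 have Vm: "V n : borel_measurable Y" for n by (rule bfun_measurable[OF V])
 have d1: "(\<integral>\<^sup>+x. ennreal \<bar>V (Suc n) x - V n x\<bar> \<partial>Y) <= ennreal ((1/2) ^ n)" for n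
 proof -
  have bd: "bfun (C + C) (%x. V (Suc n) x - V n x)" by (intro bfun_diff V)
  have "(\<integral>x. \<bar>V (Suc n) x - V n x\<bar> \<partial>Y)^2 <= ((1/2) ^ n)^2"
   using order_trans[OF L1_le_L2[OF bd]] K(2)[OF rK(2) rK(1)] unfolding V_def by blast
  then have "(\<integral>x. \<bar>V (Suc n) x - V n x\<bar> \<partial>Y) <= (1/2) ^ n" by (rule power2_le_imp_le) simp
  moreover have "(\<integral>\<^sup>+x. ennreal \<bar>V (Suc n) x - V n x\<bar> \<partial>Y) = ennreal (\<integral>x. \<bar>V (Suc n) x - V n x\<bar> \<partial>Y)"
   by (intro nn_integral_eq_integral bfun_integrable[OF bfun_abs[OF bd]]) auto
  ultimately show ?thesis by (simp add: ennreal_leI)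
 qed
 have conv: "AE x in Y. convergent (%n. V n x)"
 proof -
  have "(\<integral>\<^sup>+x. (\<Sum>n. ennreal \<bar>V (Suc n) x - V n x\<bar>) \<partial>Y) = (\<Sum>n. \<integral>\<^sup>+x. ennreal \<bar>V (Suc n) x - V n x\<bar> \<partial>Y)"
   using Vm by (intro nn_integral_suminf) auto
  also have "... <= (\<Sum>n. ennreal ((1/2) ^ n))" by (intro suminf_le d1) auto
  also have "... = ennreal (\<Sum>n. (1/2) ^ n)" by (intro suminf_ennreal2) (auto intro: summable_geometric)
  also have "... < \<infinity>" by simp
  finally have "AE x in Y. (\<Sum>n. ennreal \<bar>V (Suc n) x - V n x\<bar>) ~= \<infinity>"
   using Vm by (intro nn_integral_noteq_infinite) auto
  then show ?thesis
  proof eventually_elim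
   case (elim x)
   then have "summable (%n. \<bar>V (Suc n) x - V n x\<bar>)"
    by (intro summable_suminf_not_top) auto
   then have "summable (%n. V (Suc n) x - V n x)" by (rule summable_rabs_cancel)
   then have "convergent (%n. V n x - V 0 x)"
    using sum_lessThan_telescope[of "%n. V n x"] by (simp add: summable_iff_convergent)
   then show ?case by (simp add: convergent_diff_const_right_iff)
  qed
 qed
 \<comment> \<open>The set of convergence is itself invariant under \<open>up 1\<close>, so with the
   default 0 the function \<open>P\<close> is invariant at every point.\<close>
 define P where "P x = (if convergent (%n. V n x) then lim (%n. V n x) else 0)" for x
 have cm: "Measurable.pred Y (%x. convergent (%n. V n x))"
  using Vm unfolding Cauchy_convergent_iff[symmetric] by measurable
 have Pm: "P : borel_measurable Y"
  unfolding P_def[abs_def] using cm Vm by (intro measurable_If borel_measurable_lim_metric) auto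
 have Plim: "(%n. V n x) \<longlonglongrightarrow> P x" if "convergent (%n. V n x)" for x
  using that by (simp add: P_def convergent_LIMSEQ_iff)
 have P: "bfun C P"
  unfolding bfun_def
 proof (intro conjI ballI Pm)
  fix x assume x: "x : space Y"
  show "\<bar>P x\<bar> <= C"
  proof (cases "convergent (%n. V n x)")
   case True
   have "(%n. \<bar>V n x\<bar>) \<longlonglongrightarrow> \<bar>P x\<bar>" by (intro tendsto_rabs Plim True)
   then show ?thesis by (rule tendsto_upperbound) (use bfun_bound[OF V x] in auto)
  qed (use bfun_nonneg[OF h] in \<open>simp add: P_def\<close>)
 qed
 have inv: "P (act (up 1) x) = P x" if x: "x : space Y" for x
 proof -
  have le: "\<bar>V n (act (up 1) x) - V n x\<bar> <= 2 * C / real n" if n: "0 < n" for n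
  proof -
   define u where "u k = h (act (up (real k)) x)" for k
   have uC: "\<bar>u k\<bar> <= C" for k unfolding u_def using x by (intro bfun_bound[OF h]) auto
   have "h (act (up (real k)) (act (up 1) x)) = u (1 + k)" for k
    unfolding u_def by (subst act_mult[symmetric]) (auto simp: x add.commute)
   then have "V n (act (up 1) x) - V n x = ((\<Sum>k<r n. u (1 + k)) - (\<Sum>k<r n. u k)) / real (r n)"
    unfolding V_def uavg_def by (simp add: u_def diff_divide_distrib)
   moreover have "\<bar>(\<Sum>k<r n. u (1 + k)) - (\<Sum>k<r n. u k)\<bar> <= 2 * C"
    using shifted_sum_bound[of u C 1 "r n"] uC by simp
   ultimately have "\<bar>V n (act (up 1) x) - V n x\<bar> <= 2 * C / real (r n)"
    by (simp add: abs_divide divide_right_mono)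
   also have "... <= 2 * C / real n"
    using n rn[of n] r0[of n] bfun_nonneg[OF h] by (intro divide_left_mono) auto
   finally show ?thesis .
  qed
  have "(%n. V n (act (up 1) x) - V n x) \<longlonglongrightarrow> 0"
  proof (rule Lim_null_comparison[OF _ lim_const_over_n[of "2 * C"]])
   show "\<forall>\<^sub>F n in sequentially. norm (V n (act (up 1) x) - V n x) <= 2 * C / real n"
    using eventually_gt_at_top[of 0] by eventually_elim (use le in auto)
  qed
  then have t: "(%n. V n (act (up 1) x)) \<longlonglongrightarrow> l \<longleftrightarrow> (%n. V n x) \<longlonglongrightarrow> l" for l
   by (rule Lim_transform_eq)
  then have "convergent (%n. V n (act (up 1) x)) \<longleftrightarrow> convergent (%n. V n x)" by (simp add: convergent_def)
  moreover have "lim (%n. V n (act (up 1) x)) = lim (%n. V n x)" using t by (simp add: lim_def)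
  ultimately show ?thesis by (simp add: P_def)
 qed
 have "shift P (up 1) = (\<integral>x. 0 \<partial>Y)"
  unfolding shift_def by (rule Bochner_Integration.integral_cong) (auto simp: inv)
 then have "shift P g = 0" if "g : SL2" for g using Mautner[OF P _ that] by simp
 then have "AE x in Y. P (act g x) = P x" if g: "g : SL2" for g
 proof -
  have "(\<integral>x. \<bar>P (act g x) - P x\<bar> \<partial>Y) = 0" using \<open>\<And>g. g : SL2 ==> shift P g = 0\<close> g by (simp add: shift_def)
  then have "AE x in Y. \<bar>P (act g x) - P x\<bar> = 0"
   using bfun_integrable[OF bfun_shift[OF P g]] by (subst (asm) integral_nonneg_eq_0_iff_AE) auto
  then show ?thesis by eventually_elim simp
 qed
 then obtain c where c: "AE x in Y. P x = c" using erg[OF P] by blast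
 have VI: "(\<integral>x. V n x \<partial>Y) = (\<integral>x. h x \<partial>Y)" for n
 proof -
  have "(\<integral>x. V n x \<partial>Y) = (\<Sum>k<r n. \<integral>x. h (act (up (real k)) x) \<partial>Y) / real (r n)"
   unfolding V_def uavg_def
   by (simp, subst Bochner_Integration.integral_sum) (auto intro!: bfun_integrable[OF bfun_act[OF h]])
  also have "... = (\<integral>x. h x \<partial>Y)" using r0[of n] by (simp add: integral_act[OF hm])
  finally show ?thesis .
 qed
 have Vc: "AE x in Y. (%n. V n x) \<longlonglongrightarrow> c"
  using conv c by eventually_elim (use Plim in fastforce)
 have "(%n. \<integral>x. V n x \<partial>Y) \<longlonglongrightarrow> (\<integral>x. c \<partial>Y)"
  by (rule integral_dominated_convergence[where w = "%_. C"])
    (use Vm Vc bfun_bound[OF V] in auto)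
 then have cI: "c = (\<integral>x. h x \<partial>Y)" by (simp add: VI prob_space LIMSEQ_const_iff)
 have "(%n. \<integral>x. \<bar>V n x - c\<bar> \<partial>Y) \<longlonglongrightarrow> (\<integral>x. 0 \<partial>Y)"
 proof (rule integral_dominated_convergence[where w = "%_. C + \<bar>c\<bar>"])
  show "AE x in Y. (%n. \<bar>V n x - c\<bar>) \<longlonglongrightarrow> 0"
   using Vc by eventually_elim (simp add: tendsto_rabs_zero LIM_zero)
  show "AE x in Y. norm \<bar>V n x - c\<bar> <= C + \<bar>c\<bar>" for n
  proof (rule AE_I2)
   fix x assume "x : space Y"
   from bfun_bound[OF V this, of n] show "norm \<bar>V n x - c\<bar> <= C + \<bar>c\<bar>"
    using abs_triangle_ineq4[of "V n x" c] by simp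
  qed
 qed (use Vm in auto)
 then have "\<forall>\<^sub>F n in sequentially. (\<integral>x. \<bar>V n x - c\<bar> \<partial>Y) < e"
  using e by (intro order_tendstoD(2)) auto
 then obtain n where "(\<integral>x. \<bar>V n x - c\<bar> \<partial>Y) < e" by (auto dest: eventually_happens)
 then show ?thesis unfolding V_def cI using r0 by blast
qed

lemma shift_up_small:
 assumes h: "bfun C h" and e: "0 < e"
 shows "\<exists>d>0. \<forall>s. \<bar>s\<bar> < d \<longrightarrow> shift h (up s) < e"
proof (rule ccontr)
 assume "\<not> ?thesis"
 then have "\<exists>s. \<bar>s\<bar> < 1 / real (Suc n) & e <= shift h (up s)" for n
  by (force simp: not_less dest!: spec[of _ "1 / real (Suc n)"])
 then obtain s where s: "\<And>n. \<bar>s n\<bar> < 1 / real (Suc n)" "\<And>n. e <= shift h (up (s n))" by metis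
 have "s \<longlonglongrightarrow> 0"
  by (rule Lim_null_comparison[OF _ LIMSEQ_Suc[OF lim_const_over_n[of 1]]]) (rule always_eventually, use s(1) in \<open>auto intro: less_imp_le\<close>)
 then have "(%n. up (s n)) \<longlonglongrightarrow> mk2 1 0 0 1"
 proof (intro vec_tendstoI)
  fix i j :: 2
  assume "s \<longlonglongrightarrow> 0"
  then show "(%n. up (s n) $ i $ j) \<longlonglongrightarrow> mk2 1 0 0 1 $ i $ j"
   using exhaust_2[of i] exhaust_2[of j] by auto
 qed
 then have "(%n. shift h (up (s n))) \<longlonglongrightarrow> 0"
  by (intro shift_continuous[OF h]) (auto simp: mat_1_mk2)
 then have "e <= 0" by (rule tendsto_lowerbound) (use s(2) in auto)
 then show False using e by simp
qed

text \<open>The diagonal matrix conjugates \<open>up k\<close> to \<open>up (k / t^2)\<close>, which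
  hardly moves \<open>h\<close> when \<open>t\<close> is large. So the second factor may be replaced
  by its translates under \<open>up k\<close> for \<open>k < N\<close>, thus by their average, which
  is close to the mean zero.\<close>

lemma diag_mixing:
 assumes h: "bfun C h" and mean: "(\<integral>x. h x \<partial>Y) = 0" and e: "0 < e"
 shows "\<exists>T>0. \<forall>t\<ge>T. \<bar>\<integral>x. h (act (mk2 (1 / t) 0 0 t) x) * h x \<partial>Y\<bar> <= e"
proof -
 have C0: "0 <= C" by (rule bfun_nonneg[OF h])
 define e' where "e' = e / (2 * (C + 1))"
 have e': "0 < e'" using e C0 by (simp add: e'_def)
 have Ce: "C * e' <= e / 2" using e C0 by (simp add: e'_def field_simps)
 obtain N where N: "0 < N" "(\<integral>x. \<bar>uavg h N x\<bar> \<partial>Y) < e'"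
  using uavg_mean[OF h e'] unfolding mean by auto
 obtain d where d: "0 < d" "\<And>s. \<bar>s\<bar> < d ==> shift h (up s) < e'"
  using shift_up_small[OF h e'] by blast
 define T where "T = max 1 (real N / d)"
 show ?thesis
 proof (intro exI[of _ T] conjI allI impI)
  show "0 < T" by (simp add: T_def)
  fix t assume t: "T <= t"
  then have t1: "1 <= t" "real N / d <= t" by (auto simp: T_def)
  define b where "b = mk2 (1 / t) 0 0 t"
  have b: "b : SL2" using t1 by (simp add: b_def)
  have hb: "bfun C (%x. h (act b x))" by (rule bfun_act[OF h b])
  have k: "\<bar>(\<integral>x. h (act b x) * h x \<partial>Y) - (\<integral>x. h (act b x) * h (act (up (real k)) x) \<partial>Y)\<bar> <= C * e'" if "k < N" for k
  proof -
   let ?s = "real k / t^2"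
   have hk: "bfun C (%x. h (act (up (real k)) x))" by (rule bfun_act[OF h up_in_SL2])
   have comm: "b ** up (real k) = up ?s ** b" using t1 by (simp add: b_def power2_eq_square)
   have "h (act b (act (up (real k)) x)) = h (act (up ?s) (act b x))" if "x : space Y" for x
    using that b comm by (simp add: act_mult[symmetric])
   then have eq: "(\<integral>x. h (act b x) * h x \<partial>Y) = (\<integral>x. h (act (up ?s) (act b x)) * h (act (up (real k)) x) \<partial>Y)"
    using integral_act[OF bfun_measurable[OF bfun_mult[OF hb h]] up_in_SL2[of "real k"]]
    by (simp cong: Bochner_Integration.integral_cong)
   have hs: "bfun C (%x. h (act (up ?s) (act b x)))"
    by (rule bfun_act[OF bfun_act[OF h up_in_SL2] b])
   have bs: "bfun (C + C) (%x. \<bar>h (act (up ?s) (act b x)) - h (act b x)\<bar>)"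
    using bfun_act[OF bfun_shift[OF h up_in_SL2] b] .
   have "(\<integral>x. h (act b x) * h x \<partial>Y) - (\<integral>x. h (act b x) * h (act (up (real k)) x) \<partial>Y)
     = (\<integral>x. (h (act (up ?s) (act b x)) - h (act b x)) * h (act (up (real k)) x) \<partial>Y)"
    unfolding eq using bfun_integrable[OF bfun_mult[OF hs hk]] bfun_integrable[OF bfun_mult[OF hb hk]]
    by (simp add: left_diff_distrib)
   also have "\<bar>...\<bar> <= (\<integral>x. \<bar>h (act (up ?s) (act b x)) - h (act b x)\<bar> * C \<partial>Y)"
   proof (rule order_trans[OF integral_abs_bound integral_mono])
    show "integrable Y (%x. \<bar>(h (act (up ?s) (act b x)) - h (act b x)) * h (act (up (real k)) x)\<bar>)"
     by (rule bfun_integrable[OF bfun_abs[OF bfun_mult[OF bfun_diff[OF hs hb] hk]]])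
    show "integrable Y (%x. \<bar>h (act (up ?s) (act b x)) - h (act b x)\<bar> * C)"
     using bfun_integrable[OF bs] by simp
    fix x assume "x : space Y"
    then show "\<bar>(h (act (up ?s) (act b x)) - h (act b x)) * h (act (up (real k)) x)\<bar>
      <= \<bar>h (act (up ?s) (act b x)) - h (act b x)\<bar> * C"
     using bfun_bound[OF hk] by (simp add: abs_mult mult_left_mono)
   qed
   also have "... = shift h (up ?s) * C"
    unfolding shift_def using integral_act[OF bfun_measurable[OF bfun_shift[OF h up_in_SL2[of ?s]]] b] by simp
   also have "... <= e' * C"
   proof (rule mult_right_mono[OF _ C0])
    have "real k < t * d" using \<open>k < N\<close> t1 d by (simp add: field_simps)
    also have "... <= t^2 * d" using t1 d by (simp add: power2_eq_square)
    finally have "?s < d" using t1 by (simp add: field_simps)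
    then show "shift h (up ?s) <= e'" using d(2)[of ?s] by simp
   qed
   finally show ?thesis by (simp add: mult.commute)
  qed
  have av: "(\<integral>x. h (act b x) * uavg h N x \<partial>Y) = (\<Sum>k<N. \<integral>x. h (act b x) * h (act (up (real k)) x) \<partial>Y) / real N"
  proof -
   have "(\<integral>x. h (act b x) * uavg h N x \<partial>Y) = (\<integral>x. (\<Sum>k<N. h (act b x) * h (act (up (real k)) x)) / real N \<partial>Y)"
    by (simp add: uavg_def sum_distrib_left)
   also have "... = (\<Sum>k<N. \<integral>x. h (act b x) * h (act (up (real k)) x) \<partial>Y) / real N"
    by (simp, subst Bochner_Integration.integral_sum)
      (auto intro!: bfun_integrable[OF bfun_mult[OF hb bfun_act[OF h up_in_SL2]]])
   finally show ?thesis .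
  qed
  let ?F = "\<integral>x. h (act b x) * h x \<partial>Y"
  have "?F = (\<Sum>k<N. ?F - (\<integral>x. h (act b x) * h (act (up (real k)) x) \<partial>Y)) / real N + (\<integral>x. h (act b x) * uavg h N x \<partial>Y)"
   unfolding av using N by (simp add: sum_subtractf diff_divide_distrib)
  also have "\<bar>...\<bar> <= C * e' + C * e'"
  proof (rule order_trans[OF abs_triangle_ineq add_mono])
   have "\<bar>\<Sum>k<N. ?F - (\<integral>x. h (act b x) * h (act (up (real k)) x) \<partial>Y)\<bar> <= (\<Sum>k<N. C * e')"
    using k by (intro order_trans[OF sum_abs] sum_mono) auto
   then have "\<bar>\<Sum>k<N. ?F - (\<integral>x. h (act b x) * h (act (up (real k)) x) \<partial>Y)\<bar> / real N <= (\<Sum>k<N. C * e') / real N"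
    by (intro divide_right_mono) auto
   then show "\<bar>(\<Sum>k<N. ?F - (\<integral>x. h (act b x) * h (act (up (real k)) x) \<partial>Y)) / real N\<bar> <= C * e'"
    using N by (simp add: abs_divide)
   have "\<bar>\<integral>x. h (act b x) * uavg h N x \<partial>Y\<bar> <= (\<integral>x. C * \<bar>uavg h N x\<bar> \<partial>Y)"
   proof (rule order_trans[OF integral_abs_bound integral_mono])
    show "integrable Y (%x. \<bar>h (act b x) * uavg h N x\<bar>)"
     by (rule bfun_integrable[OF bfun_abs[OF bfun_mult[OF hb bfun_uavg[OF h]]]])
    show "integrable Y (%x. C * \<bar>uavg h N x\<bar>)"
     using bfun_integrable[OF bfun_abs[OF bfun_uavg[OF h]]] by simp
    fix x assume "x : space Y"
    then show "\<bar>h (act b x) * uavg h N x\<bar> <= C * \<bar>uavg h N x\<bar>"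
     using bfun_bound[OF hb] by (simp add: abs_mult mult_right_mono)
   qed
   also have "... = C * (\<integral>x. \<bar>uavg h N x\<bar> \<partial>Y)" by simp
   also have "... <= C * e'" using N C0 by (intro mult_left_mono) auto
   finally show "\<bar>\<integral>x. h (act b x) * uavg h N x \<partial>Y\<bar> <= C * e'" .
  qed
  finally show "\<bar>\<integral>x. h (act (mk2 (1 / t) 0 0 t) x) * h x \<partial>Y\<bar> <= e"
   using Ce unfolding b_def by simp
 qed
qed

end

section \<open>Cartan decomposition and random elements of balls\<close>

definition rot2 :: "(real^2^2) set" where
 "rot2 = {mk2 c (- s) s c | c s. c\<^sup>2 + s^2 = 1}"

lemma rot2_SL2: "k : rot2 ==> k : SL2"
 by (auto simp: rot2_def power2_eq_square)

text \<open>With the plane as the complex numbers, the matrix acts as z to \<open>p\<close> times z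
  minus \<open>q\<close> times the conjugate of z. Its singular values are the sum and the
  difference of the moduli \<open>P\<close> and \<open>Q\<close>, mutually inverse since the
  determinant is \<open>P^2 - Q^2 = 1\<close>; half sum and half difference of the arguments give
  the two rotations.\<close>

lemma singular_values:
 assumes "g : SL2"
 obtains k k' t where "k : rot2" "k' : rot2" "1 <= t" "frob2 g <= 2 * t^2" "g = k ** mk2 (1 / t) 0 0 t ** k'"
proof -
 obtain a b c d where g: "g = mk2 a b c d" "a * d - b * c = 1" using assms by (rule SL2_cases)
 define p q where "p = Complex ((a + d) / 2) ((c - b) / 2)" and "q = Complex ((d - a) / 2) (- (b + c) / 2)"
 define x y where "x = (Arg p + Arg q) / 2" and "y = (Arg p - Arg q) / 2"
 define P Q where "P = cmod p" and "Q = cmod q"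
 have "P^2 - Q\<^sup>2 = (((a + d) / 2)^2 + ((c - b) / 2)^2) - (((d - a) / 2)^2 + (- (b + c) / 2)^2)"
  by (simp add: P_def Q_def p_def q_def cmod_def)
 also have "... = a * d - b * c" by (simp add: power2_eq_square field_simps)
 finally have PQ: "P^2 - Q\<^sup>2 = 1" using g by simp
 have P0: "0 <= P" "0 <= Q" by (simp_all add: P_def Q_def)
 have P1: "1 <= P" using PQ P0 by (metis add.commute diff_add_cancel le_add_same_cancel1 one_power2 power2_le_imp_le zero_le_power2)
 define t where "t = P + Q"
 have t1: "1 <= t" using P1 P0 by (simp add: t_def)
 have inv: "1 / t = P - Q" using PQ t1 by (simp add: t_def field_simps power2_eq_square)
 have xy: "x + y = Arg p" "x - y = Arg q" by (simp_all add: x_def y_def field_simps)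
 have p: "(a + d) / 2 = P * cos (x + y)" "(c - b) / 2 = P * sin (x + y)"
  using rcis_cmod_Arg[of p] unfolding xy P_def by (auto simp: p_def complex_eq_iff)
 have q: "(d - a) / 2 = Q * cos (x - y)" "- (b + c) / 2 = Q * sin (x - y)"
  using rcis_cmod_Arg[of q] unfolding xy Q_def by (auto simp: q_def complex_eq_iff)
 define k k' where "k = mk2 (cos x) (- sin x) (sin x) (cos x)" and "k' = mk2 (cos y) (- sin y) (sin y) (cos y)"
 have k: "k : rot2" and k': "k' : rot2" unfolding k_def k'_def rot2_def
  by (rule CollectI, intro exI conjI, rule refl, simp)+
 have e: "a = P * cos (x + y) - Q * cos (x - y)" "d = P * cos (x + y) + Q * cos (x - y)"
  "b = - P * sin (x + y) - Q * sin (x - y)" "c = P * sin (x + y) - Q * sin (x - y)"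
  using p q by (auto simp: field_simps)
 have eq: "g = k ** mk2 (1 / t) 0 0 t ** k'"
  unfolding g k_def k'_def inv unfolding t_def
  by (simp add: e cos_add sin_add cos_diff sin_diff algebra_simps)
 have "frob2 g = 2 * (P^2 * ((cos (x + y))^2 + (sin (x + y))^2) + Q^2 * ((cos (x - y))^2 + (sin (x - y))^2))"
 proof -
  have "(P * u - Q * u')^2 + (- P * w - Q * w')^2 + (P * w - Q * w')^2 + (P * u + Q * u')^2
    = 2 * (P^2 * (u^2 + w^2) + Q^2 * (u'\<^sup>2 + w'\<^sup>2))" for u w u' w'
   by (simp add: power2_eq_square algebra_simps)
  then show ?thesis unfolding g frob2_mk2 e .
 qed
 then have "frob2 g = 2 * (P^2 + Q^2)" by simp
 also have "... <= 2 * t^2" using P0 by (simp add: t_def power2_eq_square algebra_simps)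
 finally show thesis using that[OF k k' t1 _ eq] by simp
qed

definition ball_law :: "real => (real^2^2) measure" where
 "ball_law s = uniform_measure haar (fball s)"

lemma sets_ball_law [simp, measurable_cong]: "sets (ball_law s) = sets SL2_borel"
 by (simp add: ball_law_def)

lemma space_ball_law [simp]: "space (ball_law s) = SL2"
 by (simp add: ball_law_def)

lemma emeasure_fball_nontrivial: "24 <= s ==> emeasure haar (fball s) ~= 0" "emeasure haar (fball s) ~= \<infinity>"
 using fball_lower[of s] emeasure_haar_fball_finite[of s] by auto

lemma prob_space_ball_law: "24 <= s ==> prob_space (ball_law s)"
 unfolding ball_law_def by (intro prob_space_uniform_measure emeasure_fball_nontrivial)

context SL2_ergodic
begin

text \<open>For a rotation invariant \<open>h\<close> the correlation depends only on the diagonal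
  part of \<open>g\<close>, and a large norm forces a large \<open>t\<close> there.\<close>

lemma correlation_decay:
 assumes h: "bfun C h" and mean: "(\<integral>x. h x \<partial>Y) = 0" and e: "0 < e"
  and K: "\<And>k x. k : rot2 ==> x : space Y ==> h (act k x) = h x"
 shows "\<exists>S. \<forall>g\<in>SL2. S < frob2 g \<longrightarrow> \<bar>\<integral>x. h (act g x) * h x \<partial>Y\<bar> <= e"
proof -
 obtain T where T: "0 < T" "\<And>t. T <= t ==> \<bar>\<integral>x. h (act (mk2 (1 / t) 0 0 t) x) * h x \<partial>Y\<bar> <= e"
  using diag_mixing[OF h mean e] by blast
 show ?thesis
 proof (intro exI[of _ "2 * T^2"] ballI impI)
  fix g assume g: "g : SL2" "2 * T^2 < frob2 g"
  obtain k k' t where kt: "k : rot2" "k' : rot2" "1 <= t" "frob2 g <= 2 * t^2" "g = k ** mk2 (1 / t) 0 0 t ** k'"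
   using singular_values[OF g(1)] by metis
  define b where "b = mk2 (1 / t) 0 0 t"
  have b: "b : SL2" using kt by (simp add: b_def)
  have "T^2 < t\<^sup>2" using g kt by simp
  then have Tt: "T <= t" using kt(3) by (meson less_imp_le order_trans power_less_imp_less_base zero_le_one)
  have "(\<integral>x. h (act g x) * h x \<partial>Y) = (\<integral>x. h (act b (act k' x)) * h (act k' x) \<partial>Y)"
  proof (rule Bochner_Integration.integral_cong[OF refl])
   fix x assume x: "x : space Y"
   have "act g x = act k (act b (act k' x))"
    unfolding kt(5) b_def[symmetric] using x b kt by (simp add: act_mult rot2_SL2)
   then show "h (act g x) * h x = h (act b (act k' x)) * h (act k' x)"
    using x b kt by (simp add: K rot2_SL2)
  qed
  also have "... = (\<integral>x. h (act b x) * h x \<partial>Y)"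
   using integral_act[OF bfun_measurable[OF bfun_mult[OF bfun_act[OF h b] h]] rot2_SL2[OF kt(2)]] by simp
  finally show "\<bar>\<integral>x. h (act g x) * h x \<partial>Y\<bar> <= e" using T(2)[OF Tt] unfolding b_def by simp
 qed
qed

text \<open>The squared norm of a ball average is the mean correlation at
  \<open>g ** adj2 g'\<close> for two independent elements of the ball. By right invariance this
  quotient lies in a fixed ball with probability of order \<open>1 / s\<close>; elsewhere the
  correlation is small.\<close>

lemma ball_mean_zero:
 assumes h: "bfun C h" and mean: "(\<integral>x. h x \<partial>Y) = 0" and e: "0 < e"
  and K: "\<And>k x. k : rot2 ==> x : space Y ==> h (act k x) = h x"
 shows "\<forall>\<^sub>F s in at_top. (\<integral>x. (\<integral>g. h (act g x) \<partial>ball_law s)\<^sup>2 \<partial>Y) <= e"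
proof -
 note hm = bfun_measurable[OF h]
 have C0: "0 <= C" by (rule bfun_nonneg[OF h])
 obtain S where S: "\<And>g. g : SL2 ==> S < frob2 g ==> \<bar>\<integral>x. h (act g x) * h x \<partial>Y\<bar> <= e / 2"
  using correlation_decay[OF h mean _ K, of "e / 2"] e by auto
 define v where "v = measure haar (fball S)"
 have v: "emeasure haar (fball S) = ennreal v"
  unfolding v_def using emeasure_fball_nontrivial(2) by (simp add: emeasure_eq_ennreal_measure)
 \<comment> \<open>Nearby pairs have probability at most \<open>60 * v / s\<close>, so beyond this
   bound they contribute at most \<open>e / 2\<close>.\<close>
 define s0 where "s0 = max 24 (120 * (C^2 * v) / e)"
 show ?thesis
  using eventually_ge_at_top[of s0]
 proof eventually_elim
  case (elim s)
  then have s: "24 <= s" "120 * (C^2 * v) / e <= s" by (auto simp: s0_def)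
  interpret U: prob_space "ball_law s" by (rule prob_space_ball_law[OF s(1)])
  interpret UU: pair_prob_space "ball_law s" "ball_law s" ..
  interpret UUY: pair_prob_space "ball_law s \<Otimes>\<^sub>M ball_law s" Y ..
  have m1: "(%z. h (act (fst (fst z)) (snd z))) : borel_measurable ((ball_law s \<Otimes>\<^sub>M ball_law s) \<Otimes>\<^sub>M Y)"
   by (rule measurable_compose[OF _ act_pair_measurable[OF hm], of "%z. (fst (fst z), snd z)", unfolded prod.case]) measurable
  have m2: "(%z. h (act (snd (fst z)) (snd z))) : borel_measurable ((ball_law s \<Otimes>\<^sub>M ball_law s) \<Otimes>\<^sub>M Y)"
   by (rule measurable_compose[OF _ act_pair_measurable[OF hm], of "%z. (snd (fst z), snd z)", unfolded prod.case]) measurable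
  have m: "(%(z, x). h (act (fst z) x) * h (act (snd z) x)) : borel_measurable ((ball_law s \<Otimes>\<^sub>M ball_law s) \<Otimes>\<^sub>M Y)"
   unfolding case_prod_beta' by (rule borel_measurable_times[OF m1 m2])
  have int: "integrable ((ball_law s \<Otimes>\<^sub>M ball_law s) \<Otimes>\<^sub>M Y) (%(z, x). h (act (fst z) x) * h (act (snd z) x))"
  proof (rule UUY.P.integrable_const_bound[OF _ m, where B = "C * C"], rule AE_I2)
   fix w assume "w : space ((ball_law s \<Otimes>\<^sub>M ball_law s) \<Otimes>\<^sub>M Y)"
   then show "norm (case w of (z, x) => h (act (fst z) x) * h (act (snd z) x)) <= C * C"
    by (auto simp: space_pair_measure abs_mult intro!: mult_mono bfun_bound[OF h] C0)
  qed
  have orb: "(%g. h (act g x)) : borel_measurable (ball_law s)" if "x : space Y" for x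
   using orbit_measurable[OF hm that] by (simp cong: measurable_cong_sets)
  have iorb: "integrable (ball_law s) (%g. h (act g x))" if "x : space Y" for x
   by (rule U.integrable_const_bound[OF _ orb[OF that], where B = C]) (rule AE_I2, use that in \<open>auto intro!: bfun_bound[OF h]\<close>)
  have sq: "(\<integral>g. h (act g x) \<partial>ball_law s)^2 = (\<integral>z. h (act (fst z) x) * h (act (snd z) x) \<partial>(ball_law s \<Otimes>\<^sub>M ball_law s))"
   if x: "x : space Y" for x
  proof -
   have "integrable (ball_law s \<Otimes>\<^sub>M ball_law s) (%(g, g'). h (act g x) * h (act g' x))"
   proof (rule UU.P.integrable_const_bound[where B = "C * C"])
    show "(%(g, g'). h (act g x) * h (act g' x)) : borel_measurable (ball_law s \<Otimes>\<^sub>M ball_law s)"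
     using orb[OF x] by measurable
    show "AE w in ball_law s \<Otimes>\<^sub>M ball_law s. norm (case w of (g, g') => h (act g x) * h (act g' x)) <= C * C"
     by (rule AE_I2) (auto simp: space_pair_measure abs_mult x intro!: mult_mono bfun_bound[OF h] C0)
   qed
   from UU.integral_fst'[OF this]
   show ?thesis by (simp add: power2_eq_square case_prod_beta')
  qed
  define F where "F g = (\<integral>x. h (act g x) * h x \<partial>Y)" for g
  have FF: "(\<integral>x. h (act (fst z) x) * h (act (snd z) x) \<partial>Y) = F (fst z ** adj2 (snd z))"
   if "z : space (ball_law s \<Otimes>\<^sub>M ball_law s)" for z
  proof -
   have z: "fst z : SL2" "snd z : SL2" using that by (auto simp: space_pair_measure)
   then have z': "fst z ** adj2 (snd z) : SL2" by simp
   have "F (fst z ** adj2 (snd z)) = (\<integral>x. h (act (fst z ** adj2 (snd z)) (act (snd z) x)) * h (act (snd z) x) \<partial>Y)"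
    unfolding F_def by (rule integral_act[OF bfun_measurable[OF bfun_mult[OF bfun_act[OF h z'] h]] z(2), symmetric])
   also have "... = (\<integral>x. h (act (fst z) x) * h (act (snd z) x) \<partial>Y)"
    by (rule Bochner_Integration.integral_cong[OF refl]) (use z z' in \<open>simp add: act_mult[symmetric]\<close>)
   finally show ?thesis by simp
  qed
  have Fle: "F g <= e / 2 + C^2 * indicator (fball S) g" if g: "g : SL2" for g
  proof (cases "S < frob2 g")
   case True
   then show ?thesis using S[OF g True] unfolding F_def by (simp add: abs_le_iff add_increasing2)
  next
   case False
   have "F g <= (\<integral>x. C * C \<partial>Y)"
    unfolding F_def
   proof (rule integral_mono[OF bfun_integrable[OF bfun_mult[OF bfun_act[OF h g] h]]])
    show "h (act g x) * h x <= C * C" if "x : space Y" for x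
     using bfun_bound[OF bfun_mult[OF bfun_act[OF h g] h] that] by simp
   qed simp
   then show ?thesis using False g e by (simp add: fball_def prob_space power2_eq_square)
  qed
  have mi: "(%z. indicator (fball S) (fst z ** adj2 (snd z)) :: real) : borel_measurable (ball_law s \<Otimes>\<^sub>M ball_law s)"
   by measurable
  have small: "(\<integral>z. indicator (fball S) (fst z ** adj2 (snd z)) \<partial>(ball_law s \<Otimes>\<^sub>M ball_law s)) <= v * 60 / s"
  proof -
   have "(\<integral>\<^sup>+z. indicator (fball S) (fst z ** adj2 (snd z)) \<partial>(ball_law s \<Otimes>\<^sub>M ball_law s))
     = (\<integral>\<^sup>+g'. \<integral>\<^sup>+g. indicator (fball S) (g ** adj2 g') \<partial>ball_law s \<partial>ball_law s)"
    by (subst UU.nn_integral_snd[symmetric]) (auto simp: case_prod_beta')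
   also have "... <= (\<integral>\<^sup>+g'. ennreal (v * 60 / s) \<partial>ball_law s)"
   proof (rule nn_integral_mono)
    fix g' assume "g' : space (ball_law s)"
    then have g': "adj2 g' : SL2" by simp
    have mm: "(%g. indicator (fball S) (g ** adj2 g') :: ennreal) : borel_measurable SL2_borel"
     by (rule measurable_compose[OF measurable_mult_right_SL2[OF g']]) measurable
    have "(\<integral>\<^sup>+g. indicator (fball S) (g ** adj2 g') \<partial>ball_law s)
      = (\<integral>\<^sup>+g. indicator (fball S) (g ** adj2 g') * indicator (fball s) g \<partial>haar) / emeasure haar (fball s)"
     unfolding ball_law_def by (rule nn_integral_uniform_measure) (use mm in \<open>auto cong: measurable_cong_sets\<close>)
    also have "... <= (\<integral>\<^sup>+g. indicator (fball S) (g ** adj2 g') \<partial>haar) / emeasure haar (fball s)"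
     by (intro divide_right_mono_ennreal nn_integral_mono) (auto split: split_indicator)
    also have "(\<integral>\<^sup>+g. indicator (fball S) (g ** adj2 g') \<partial>haar) = (\<integral>\<^sup>+g. indicator (fball S) g \<partial>haar)"
     by (rule nn_integral_haar_right[OF _ g']) measurable
    also have "... = ennreal v" by (simp add: v)
    also have "ennreal v / emeasure haar (fball s) <= ennreal v / ennreal (s / 60)"
     using fball_lower[OF s(1)] by (rule ennreal_divide_left_mono)
    also have "... = ennreal (v / (s / 60))" using s by (intro divide_ennreal) (auto simp: v_def)
    finally show "(\<integral>\<^sup>+g. indicator (fball S) (g ** adj2 g') \<partial>ball_law s) <= ennreal (v * 60 / s)" by simp
   qed
   also have "... = ennreal (v * 60 / s)" using U.emeasure_space_1 by simp
   finally have *: "(\<integral>\<^sup>+z. indicator (fball S) (fst z ** adj2 (snd z)) \<partial>(ball_law s \<Otimes>\<^sub>M ball_law s)) <= ennreal (v * 60 / s)" .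
   have "(\<integral>z. indicator (fball S) (fst z ** adj2 (snd z)) \<partial>(ball_law s \<Otimes>\<^sub>M ball_law s))
     = enn2real (\<integral>\<^sup>+z. ennreal (indicator (fball S) (fst z ** adj2 (snd z))) \<partial>(ball_law s \<Otimes>\<^sub>M ball_law s))"
    by (rule integral_eq_nn_integral) (use mi in auto)
   also have "... <= enn2real (ennreal (v * 60 / s))"
    using * by (intro enn2real_mono) (auto simp: ennreal_indicator)
   also have "... = v * 60 / s" using s by (simp add: v_def)
   finally show ?thesis .
  qed
  have ii: "integrable (ball_law s \<Otimes>\<^sub>M ball_law s) (%z. indicator (fball S) (fst z ** adj2 (snd z)) :: real)"
   by (rule UU.P.integrable_const_bound[OF _ mi, where B = 1]) auto
  have "(\<integral>x. (\<integral>g. h (act g x) \<partial>ball_law s)\<^sup>2 \<partial>Y)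
    = (\<integral>x. (\<integral>z. h (act (fst z) x) * h (act (snd z) x) \<partial>(ball_law s \<Otimes>\<^sub>M ball_law s)) \<partial>Y)"
   by (rule Bochner_Integration.integral_cong[OF refl sq])
  also have "... = (\<integral>z. (\<integral>x. h (act (fst z) x) * h (act (snd z) x) \<partial>Y) \<partial>(ball_law s \<Otimes>\<^sub>M ball_law s))"
   by (rule UUY.Fubini_integral[OF int])
  also have "... = (\<integral>z. F (fst z ** adj2 (snd z)) \<partial>(ball_law s \<Otimes>\<^sub>M ball_law s))"
   by (rule Bochner_Integration.integral_cong[OF refl FF])
  also have "... <= (\<integral>z. e / 2 + C^2 * indicator (fball S) (fst z ** adj2 (snd z)) \<partial>(ball_law s \<Otimes>\<^sub>M ball_law s))"
  proof (rule integral_mono)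
   have "integrable (ball_law s \<Otimes>\<^sub>M ball_law s) (%z. \<integral>x. h (act (fst z) x) * h (act (snd z) x) \<partial>Y)"
    using UUY.integrable_fst'[OF int] by simp
   moreover have "integrable (ball_law s \<Otimes>\<^sub>M ball_law s) (%z. \<integral>x. h (act (fst z) x) * h (act (snd z) x) \<partial>Y)
     \<longleftrightarrow> integrable (ball_law s \<Otimes>\<^sub>M ball_law s) (%z. F (fst z ** adj2 (snd z)))"
    by (rule Bochner_Integration.integrable_cong[OF refl]) (rule FF)
   ultimately show "integrable (ball_law s \<Otimes>\<^sub>M ball_law s) (%z. F (fst z ** adj2 (snd z)))" by blast
   show "integrable (ball_law s \<Otimes>\<^sub>M ball_law s) (%z. e / 2 + C^2 * indicator (fball S) (fst z ** adj2 (snd z)))"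
    using ii by simp
   show "F (fst z ** adj2 (snd z)) <= e / 2 + C^2 * indicator (fball S) (fst z ** adj2 (snd z))"
    if "z : space (ball_law s \<Otimes>\<^sub>M ball_law s)" for z
    using that by (intro Fle) (auto simp: space_pair_measure)
  qed
  also have "... = e / 2 + C^2 * (\<integral>z. indicator (fball S) (fst z ** adj2 (snd z)) \<partial>(ball_law s \<Otimes>\<^sub>M ball_law s))"
   using ii by (simp add: UU.P.prob_space)
  also have "... <= e / 2 + C^2 * (v * 60 / s)"
   using small by (intro add_left_mono mult_left_mono) auto
  also have "... <= e" using s e by (simp add: field_simps)
  finally show ?case .
 qed
qed

lemma ball_mean_ergodic:
 assumes h: "bfun C h" and e: "0 < e"
  and K: "\<And>k x. k : rot2 ==> x : space Y ==> h (act k x) = h x"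
 shows "\<forall>\<^sub>F s in at_top. (\<integral>x. ((\<integral>g. h (act g x) \<partial>ball_law s) - (\<integral>x. h x \<partial>Y))\<^sup>2 \<partial>Y) <= e"
proof -
 let ?m = "\<integral>x. h x \<partial>Y"
 define h0 where "h0 x = h x - ?m" for x
 have h0: "bfun (C + \<bar>?m\<bar>) h0"
  unfolding h0_def by (intro bfun_diff h) (simp add: bfun_def)
 have "(\<integral>x. h0 x \<partial>Y) = 0" unfolding h0_def using bfun_integrable[OF h] by (simp add: prob_space)
 then have "\<forall>\<^sub>F s in at_top. (\<integral>x. (\<integral>g. h0 (act g x) \<partial>ball_law s)\<^sup>2 \<partial>Y) <= e"
  by (rule ball_mean_zero[OF h0 _ e]) (simp add: h0_def K)
 then show ?thesis
  using eventually_ge_at_top[of 24]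
 proof eventually_elim
  case (elim s)
  interpret U: prob_space "ball_law s" by (rule prob_space_ball_law[OF elim(2)])
  have "(\<integral>g. h0 (act g x) \<partial>ball_law s) = (\<integral>g. h (act g x) \<partial>ball_law s) - ?m" if x: "x : space Y" for x
  proof -
   have "integrable (ball_law s) (%g. h (act g x))"
   proof (rule U.integrable_const_bound[where B = C])
    show "(%g. h (act g x)) : borel_measurable (ball_law s)"
     using orbit_measurable[OF bfun_measurable[OF h] x] by (simp cong: measurable_cong_sets)
    show "AE g in ball_law s. norm (h (act g x)) <= C"
     by (rule AE_I2) (use x in \<open>auto intro!: bfun_bound[OF h]\<close>)
   qed
   then show ?thesis using U.prob_space by (simp add: h0_def)
  qed
  then show ?case using elim(1) by (simp cong: Bochner_Integration.integral_cong)
 qed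
qed

end

section \<open>The principal congruence subgroup of level two\<close>

definition mki :: "int => int => int => int => real^2^2" where
 "mki a b c d = mk2 (of_int a) (of_int b) (of_int c) (of_int d)"

definition Gam :: "(real^2^2) set" where
 "Gam = {mki a b c d | a b c d. odd a & even b & even c & odd d & a * d - b * c = 1}"

lemma Gam_cases:
 assumes "g : Gam"
 obtains a b c d where "g = mki a b c d" "odd a" "even b" "even c" "odd d" "a * d - b * c = 1"
 using assms by (auto simp: Gam_def)

lemma mki_in_Gam: "odd a ==> even b ==> even c ==> odd d ==> a * d - b * c = 1 ==> mki a b c d : Gam"
 by (auto simp: Gam_def)

lemma mki_mult: "mki a b c d ** mki a' b' c' d' = mki (a*a' + b*c') (a*b' + b*d') (c*a' + d*c') (c*b' + d*d')"
 by (simp add: mki_def)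

lemma adj2_mki: "adj2 (mki a b c d) = mki d (-b) (-c) a"
 by (simp add: mki_def)

lemma mki_SL2: "a * d - b * c = 1 ==> mki a b c d : SL2"
proof -
 assume "a * d - b * c = 1"
 then have "real_of_int (a * d - b * c) = 1" by simp
 then show ?thesis by (simp add: mki_def)
qed

lemma Gam_SL2: "g : Gam ==> g : SL2"
 by (auto elim!: Gam_cases intro: mki_SL2)

lemma Gam_one: "mat 1 : Gam"
 using mki_in_Gam[of 1 0 0 1] by (simp add: mki_def mat_1_mk2)

lemma Gam_neg_one: "- mat 1 : Gam"
 using mki_in_Gam[of "-1" 0 0 "-1"] by (simp add: mki_def mat_1_mk2 uminus_mk2)

lemma Gam_mult: "g : Gam ==> h : Gam ==> g ** h : Gam"
proof (elim Gam_cases)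
 fix a b c d a' b' c' d' :: int
 assume *: "g = mki a b c d" "odd a" "even b" "even c" "odd d" "a * d - b * c = 1"
  "h = mki a' b' c' d'" "odd a'" "even b'" "even c'" "odd d'" "a' * d' - b' * c' = 1"
 have "(a*a' + b*c') * (c*b' + d*d') - (a*b' + b*d') * (c*a' + d*c') = (a * d - b * c) * (a' * d' - b' * c')"
  by (simp add: algebra_simps)
 then show ?thesis
  unfolding *(1,7) mki_mult using * by (intro mki_in_Gam) auto
qed

lemma Gam_adj2: "g : Gam ==> adj2 g : Gam"
 by (elim Gam_cases) (auto simp: adj2_mki mult.commute intro!: mki_in_Gam)

lemma countable_Gam: "countable Gam"
proof -
 have "Gam \<subseteq> (%(a, b, c, d). mki a b c d) ` UNIV"
 proof
  fix x assume "x : Gam"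
  then obtain a b c d where "x = mki a b c d" by (auto simp: Gam_def)
  then show "x : (%(a, b, c, d). mki a b c d) ` UNIV" by (intro image_eqI[of _ _ "(a, b, c, d)"]) auto
 qed
 then show ?thesis by (rule countable_subset) auto
qed

text \<open>The norm of \<open>c\<close> is controlled by that of \<open>g ** c\<close>, which
  confines its integral entries to a box.\<close>

lemma finite_Gam_ball:
 assumes g: "g : SL2"
 shows "finite {c : Gam. frob2 (g ** c) <= s}"
proof -
 define K where "K = \<lceil>frob2 g * \<bar>s\<bar>\<rceil>"
 have "{c : Gam. frob2 (g ** c) <= s} \<subseteq> (%(a, b, c, d). mki a b c d) ` ({-K..K} \<times> {-K..K} \<times> {-K..K} \<times> {-K..K})"
 proof
  fix x assume "x : {c : Gam. frob2 (g ** c) <= s}"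
  then have x: "x : Gam" "frob2 (g ** x) <= s" by auto
  obtain a b c d where abcd: "x = mki a b c d" using x(1) by (auto simp: Gam_def)
  have "frob2 x = frob2 (adj2 g ** (g ** x))" using g by simp
  also have "... <= frob2 g * frob2 (g ** x)" using frob2_mult_le[of "adj2 g" "g ** x"] by simp
  also have "... <= frob2 g * \<bar>s\<bar>" using x(2) by (intro mult_left_mono) auto
  also have "... <= K" unfolding K_def by linarith
  finally have "real_of_int (a^2 + b^2 + c^2 + d^2) <= K" unfolding abcd mki_def by simp
  then have K: "a^2 + b^2 + c^2 + d^2 <= K" by linarith
  have le: "\<bar>z\<bar> <= z^2" for z :: int
   using self_le_power[of "\<bar>z\<bar>" 2] by (cases "z = 0") auto
  have "\<bar>a\<bar> <= K & \<bar>b\<bar> <= K & \<bar>c\<bar> <= K & \<bar>d\<bar> <= K"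
   using K le[of a] le[of b] le[of c] le[of d] zero_le_power2[of a] zero_le_power2[of b] zero_le_power2[of c] zero_le_power2[of d]
   by linarith
  then show "x : (%(a, b, c, d). mki a b c d) ` ({-K..K} \<times> {-K..K} \<times> {-K..K} \<times> {-K..K})"
   unfolding abcd by (intro image_eqI[of _ _ "(a, b, c, d)"]) (auto simp: abs_le_iff)
 qed
 then show ?thesis by (rule finite_subset) auto
qed

subsection \<open>A homomorphism to the integers\<close>

text \<open>The elements of \<open>BB\<close> are the indefinite forms \<open>al X\<^sup>2 + be X Y + ga Y\<^sup>2\<close> in the orbit of \<open>X Y\<close>; they
  correspond to the oriented geodesics of the hyperbolic plane in the orbit of the imaginary axis, and
  the sign of \<open>side B g\<close> tells on which side of the geodesic the point given by \<open>g\<close> lies. Hence \<open>cross\<close> counts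
  crossings with sign.\<close>

definition BB :: "(int \<times> int \<times> int) set" where
 "BB = {(al, be, ga). be\<^sup>2 - 4 * al * ga = 1 & even al & even ga & be mod 4 = 1}"

text \<open>\<open>qE\<close>, \<open>qF\<close> and \<open>qG\<close> are the entries of the Gram
  matrix \<open>transpose g ** g\<close>, a positive form of determinant one. Left multiplication by
  a rotation does not change it, so it represents a point of the hyperbolic plane.\<close>

definition qE :: "real^2^2 => real" where "qE g = (g$1$1)^2 + (g$2$1)^2"
definition qF :: "real^2^2 => real" where "qF g = g$1$1 * g$1$2 + g$2$1 * g$2$2"
definition qG :: "real^2^2 => real" where "qG g = (g$1$2)^2 + (g$2$2)^2"

definition side :: "int \<times> int \<times> int => real^2^2 => real" where
 "side B g = (case B of (al, be, ga) => al * qE g + be * qF g + ga * qG g)"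

definition separ :: "real^2^2 => real^2^2 => (int \<times> int \<times> int) set" where
 "separ g g' = {B : BB. (0 < side B g) ~= (0 < side B g')}"

definition cross :: "real^2^2 => real^2^2 => int" where
 "cross g g' = (\<Sum>B\<in>separ g g'. of_bool (0 < side B g') - of_bool (0 < side B g))"

lemma q_det: "g : SL2 ==> qE g * qG g - (qF g)\<^sup>2 = 1"
proof (elim SL2_cases)
 fix a b c d assume g: "g = mk2 a b c d" "a * d - b * c = 1"
 have "qE g * qG g - (qF g)\<^sup>2 = (a * d - b * c)^2"
  unfolding g(1) qE_def qF_def qG_def by (simp add: power2_eq_square algebra_simps)
 also have "... = 1" unfolding g(2) by simp
 finally show ?thesis .
qed

lemma q_nonneg: "0 <= qE g" "0 <= qG g"
 by (auto simp: qE_def qG_def)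

text \<open>Completing the square: vanishing of the pairing together with discriminant one makes a
  sum of two nonnegative terms equal to \<open>E^2 / 4\<close>.\<close>

lemma form_coeff_bound:
 fixes al be ga E F G D :: real
 assumes z: "al * E + be * F + ga * G = 0" and disc: "be^2 - 4 * al * ga = 1" and D: "1 / 2 <= E * G - F\<^sup>2"
 shows "ga^2 <= E^2 / 2"
proof -
 have "E * ga * (al * E + be * F + ga * G) = ga^2 * (E * G - F\<^sup>2) + (ga * F + be * E / 2)^2 - E\<^sup>2 * (be^2 - 4 * al * ga) / 4"
  by (simp add: power2_eq_square field_simps)
 then have eq: "ga^2 * (E * G - F\<^sup>2) + (ga * F + be * E / 2)^2 = E^2 / 4" unfolding z disc by simp
 have "ga^2 * (1/2) <= ga^2 * (E * G - F\<^sup>2)" using D by (intro mult_left_mono) auto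
 also have "... <= E^2 / 4" using eq zero_le_power2[of "ga * F + be * E / 2"] by linarith
 finally show ?thesis by simp
qed

text \<open>A separating form pairs to zero with some convex combination of the two Gram matrices,
  the point where the geodesic is met. Along the segment the determinant stays at least one half, so
  the integral coefficients are bounded.\<close>

lemma finite_separ:
 assumes g: "g : SL2" and g': "g' : SL2"
 shows "finite (separ g g')"
proof -
 define M where "M = qE g + qE g' + qG g + qG g'"
 define K where "K = \<lceil>M\<^sup>2\<rceil>"
 have "separ g g' \<subseteq> {-K..K} \<times> {-(1 + 4 * K * K)..1 + 4 * K * K} \<times> {-K..K}"
 proof
  fix B assume B: "B : separ g g'"
  obtain al be ga where B3: "B = (al, be, ga)" by (cases B)
  have disc: "be^2 - 4 * al * ga = 1" using B unfolding B3 by (auto simp: separ_def BB_def)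
  then have "real_of_int (be^2 - 4 * al * ga) = 1" by simp
  then have rdisc: "(real_of_int be)^2 - 4 * real_of_int al * real_of_int ga = 1" by simp
  define u v where "u = side B g" and "v = side B g'"
  have uv: "(0 < u) ~= (0 < v)" using B by (auto simp: separ_def u_def v_def)
  then have "u - v ~= 0" by auto
  define t where "t = u / (u - v)"
  have t: "0 <= t" "t <= 1" "(1 - t) * u + t * v = 0"
   using uv by (auto simp: t_def field_simps zero_le_divide_iff divide_le_eq)
  define E F G where "E = (1 - t) * qE g + t * qE g'" and "F = (1 - t) * qF g + t * qF g'"
   and "G = (1 - t) * qG g + t * qG g'"
  have z: "al * E + be * F + ga * G = 0"
   using t(3) unfolding u_def v_def side_def B3 E_def F_def G_def by (simp add: algebra_simps)
  have D: "1 / 2 <= E * G - F\<^sup>2"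
  proof -
   define c where "c = qE g * qG g' + qE g' * qG g - 2 * qF g * qF g'"
   have "0 <= c"
   proof -
    have "(qF g)^2 <= qE g * qG g" "(qF g')^2 <= qE g' * qG g'"
     using q_det[OF g] q_det[OF g'] by auto
    then have "(qF g)^2 * (qF g')^2 <= (qE g * qG g) * (qE g' * qG g')"
     by (intro mult_mono) (auto intro!: mult_nonneg_nonneg q_nonneg)
    moreover have "4 * (qE g * qG g') * (qE g' * qG g) <= (qE g * qG g' + qE g' * qG g)^2"
     using zero_le_power2[of "qE g * qG g' - qE g' * qG g"] by (simp add: power2_eq_square algebra_simps)
    ultimately have "(2 * qF g * qF g')^2 <= (qE g * qG g' + qE g' * qG g)^2"
     by (simp add: power_mult_distrib mult_ac)
    then have "2 * qF g * qF g' <= qE g * qG g' + qE g' * qG g"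
     by (rule power2_le_imp_le) (auto intro!: add_nonneg_nonneg mult_nonneg_nonneg q_nonneg)
    then show ?thesis by (simp add: c_def)
   qed
   have "E * G - F\<^sup>2 = (1 - t)^2 * (qE g * qG g - (qF g)\<^sup>2) + t^2 * (qE g' * qG g' - (qF g')\<^sup>2) + t * (1 - t) * c"
    unfolding E_def F_def G_def c_def by (simp add: power2_eq_square algebra_simps)
   then have "E * G - F\<^sup>2 = (1 - t)^2 + t^2 + t * (1 - t) * c" using q_det g g' by simp
   moreover have "0 <= t * (1 - t) * c" using t \<open>0 <= c\<close> by (intro mult_nonneg_nonneg) auto
   moreover have "1 / 2 <= (1 - t)^2 + t^2"
    using zero_le_power2[of "2 * t - 1"] by (simp add: power2_eq_square algebra_simps)
   ultimately show ?thesis by linarith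
  qed
  have cvx: "(1 - t) * x + t * y <= x + y" if "0 <= x" "0 <= y" for x y
  proof -
   have "(1 - t) * x <= 1 * x" "t * y <= 1 * y" using t that by (intro mult_right_mono; simp)+
   then show ?thesis by simp
  qed
  have EG: "0 <= E" "E <= M" "0 <= G" "G <= M"
   using cvx[of "qE g" "qE g'"] cvx[of "qG g" "qG g'"] t q_nonneg[of g] q_nonneg[of g']
   by (auto simp: E_def G_def M_def)
  have ga2: "(real_of_int ga)^2 <= E^2 / 2" by (rule form_coeff_bound[OF z rdisc D])
  have al2: "(real_of_int al)^2 <= G^2 / 2"
   by (rule form_coeff_bound[of ga _ be F _ E]) (use z rdisc D in \<open>auto simp: algebra_simps\<close>)
  have "E^2 <= M^2" "G^2 <= M^2" using EG by (auto intro: power_mono)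
  then have "(real_of_int ga)^2 <= M^2" "(real_of_int al)^2 <= M^2"
   using ga2 al2 zero_le_power2[of M] zero_le_power2[of E] zero_le_power2[of G] by linarith+
  moreover have "z^2 <= K" if "(real_of_int z)^2 <= M^2" for z
  proof -
   have "real_of_int (z^2) = (real_of_int z)^2" by simp
   also note that
   also have "M^2 <= real_of_int K" unfolding K_def by (rule le_of_int_ceiling)
   finally show ?thesis by linarith
  qed
  ultimately have K: "ga^2 <= K" "al^2 <= K" by auto
  have le: "\<bar>z\<bar> <= z^2" for z :: int
   using self_le_power[of "\<bar>z\<bar>" 2] by (cases "z = 0") auto
  have ga: "\<bar>ga\<bar> <= K" and al: "\<bar>al\<bar> <= K" using K le[of ga] le[of al] by linarith+
  have "al * ga <= \<bar>al\<bar> * \<bar>ga\<bar>" by (simp flip: abs_mult)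
  also have "... <= K * K" using ga al by (intro mult_mono) auto
  finally have "be^2 <= 1 + 4 * K * K" using disc by simp
  then have "\<bar>be\<bar> <= 1 + 4 * K * K" using le[of be] by linarith
  then show "B : {-K..K} \<times> {-(1 + 4 * K * K)..1 + 4 * K * K} \<times> {-K..K}"
   unfolding B3 using ga al by (auto simp: abs_le_iff)
 qed
 then show ?thesis by (rule finite_subset) auto
qed

text \<open>Forms that do not separate contribute zero, so several counts can be compared over one
  common finite set.\<close>

lemma cross_eq_sum:
 assumes "finite S" "separ g g' \<subseteq> S" "S \<subseteq> BB"
 shows "cross g g' = (\<Sum>B\<in>S. of_bool (0 < side B g') - of_bool (0 < side B g))"
 unfolding cross_def
 by (rule sum.mono_neutral_left) (use assms in \<open>auto simp: separ_def\<close>)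

lemma cross_add:
 assumes "g : SL2" "g' : SL2" "g'' : SL2"
 shows "cross g g' + cross g' g'' = cross g g''"
proof -
 let ?S = "separ g g' \<union> separ g' g'' \<union> separ g g''"
 have S: "finite ?S" "?S \<subseteq> BB" using assms by (simp_all add: finite_separ) (auto simp: separ_def)
 have "cross g g' = (\<Sum>B\<in>?S. of_bool (0 < side B g') - of_bool (0 < side B g))"
  "cross g' g'' = (\<Sum>B\<in>?S. of_bool (0 < side B g'') - of_bool (0 < side B g'))"
  "cross g g'' = (\<Sum>B\<in>?S. of_bool (0 < side B g'') - of_bool (0 < side B g))"
  using S by (auto intro!: cross_eq_sum)
 then show ?thesis by (simp add: sum.distrib[symmetric])
qed

lemma cross_self: "cross g g = 0"
 by (simp add: cross_def separ_def)

lemma cross_swap: "g : SL2 ==> g' : SL2 ==> cross g' g = - cross g g'"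
 using cross_add[of g g' g] cross_self[of g] by simp

definition tw :: "int => int => int => int => int \<times> int \<times> int => int \<times> int \<times> int" where
 "tw a b c d B = (case B of (al, be, ga) =>
   (al * a^2 + be * (a * b) + ga * b^2, 2 * a * c * al + (a * d + b * c) * be + 2 * b * d * ga, al * c^2 + be * (c * d) + ga * d^2))"

lemma side_mult: "side B (g ** mki a b c d) = side (tw a b c d B) g"
 by (cases g rule: mk2_cases; cases B)
   (simp add: side_def tw_def mki_def qE_def qF_def qG_def power2_eq_square algebra_simps)

text \<open>The congruence \<open>be mod 4 = 1\<close> picks exactly one of a form and its negative,
  that is, one orientation of each geodesic. That the level two group respects this choice is what
  makes a count with sign invariant.\<close>

lemma tw_BB:
 assumes "B : BB" and h: "odd a" "even b" "even c" "odd d" "a * d - b * c = 1"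
 shows "tw a b c d B : BB"
proof -
 obtain al be ga where B: "B = (al, be, ga)" and B': "be^2 - 4 * al * ga = 1" "even al" "even ga" "be mod 4 = 1"
  using assms(1) by (auto simp: BB_def)
 let ?al = "al * a^2 + be * (a * b) + ga * b^2" and ?be = "2 * a * c * al + (a * d + b * c) * be + 2 * b * d * ga"
  and ?ga = "al * c^2 + be * (c * d) + ga * d^2"
 have "?be\<^sup>2 - 4 * ?al * ?ga = (a * d - b * c)^2 * (be^2 - 4 * al * ga)"
  by (simp add: power2_eq_square algebra_simps)
 then have 1: "?be\<^sup>2 - 4 * ?al * ?ga = 1" using h B' by simp
 obtain b' c' al' ga' be' where e: "b = 2 * b'" "c = 2 * c'" "al = 2 * al'" "ga = 2 * ga'" "be = 4 * be' + 1"
  using h B' by (metis evenE mult_div_mod_eq)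
 have "a * d = 1 + 4 * b' * c'" using h e by simp
 then have "?be = 4 * (2 * a * c' * al' + be' * (1 + 8 * b' * c') + 2 * b' * c' + 2 * b' * d * ga') + 1"
  unfolding e by (simp add: algebra_simps)
 then have "?be mod 4 = 1" by presburger
 then show ?thesis
  using 1 h B' unfolding B tw_def BB_def by simp
qed

lemma tw_inverse:
 assumes "a * d - b * c = 1"
 shows "tw d (-b) (-c) a (tw a b c d B) = B"
proof -
 obtain al be ga where B: "B = (al, be, ga)" by (cases B)
 have "al = (al * a^2 + be * (a * b) + ga * b^2) * d^2 + (2 * a * c * al + (a * d + b * c) * be + 2 * b * d * ga) * (d * (-b))
   + (al * c^2 + be * (c * d) + ga * d^2) * (-b)^2"
  "be = 2 * d * (-c) * (al * a^2 + be * (a * b) + ga * b^2) + (d * a + (-b) * (-c)) * (2 * a * c * al + (a * d + b * c) * be + 2 * b * d * ga)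
   + 2 * (-b) * a * (al * c^2 + be * (c * d) + ga * d^2)"
  "ga = (al * a^2 + be * (a * b) + ga * b^2) * (-c)^2 + (2 * a * c * al + (a * d + b * c) * be + 2 * b * d * ga) * (-c * a)
   + (al * c^2 + be * (c * d) + ga * d^2) * a^2"
  using assms by algebra+
 then show ?thesis unfolding B tw_def by simp
qed

text \<open>An element of \<open>Gam\<close> permutes \<open>BB\<close>, so it only renames the
  separating forms. Together with additivity this makes \<open>hom\<close> a homomorphism.\<close>

lemma cross_mult:
 assumes "x : Gam"
 shows "cross (g ** x) (g' ** x) = cross g g'"
proof -
 obtain a b c d where x: "x = mki a b c d" and h: "odd a" "even b" "even c" "odd d" "a * d - b * c = 1"
  using assms by (rule Gam_cases)
 have h': "d * a - (-b) * (-c) = 1" using h by (simp add: mult.commute)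
 have inv: "tw a b c d (tw d (-b) (-c) a B) = B" for B using tw_inverse[OF h', of B] by simp
 have "bij_betw (tw a b c d) (separ (g ** x) (g' ** x)) (separ g g')"
 proof (rule bij_betwI[where g = "tw d (-b) (-c) a"])
  show "tw a b c d : separ (g ** x) (g' ** x) \<rightarrow> separ g g'"
   using h by (auto simp: separ_def x side_mult tw_BB)
  show "tw d (-b) (-c) a : separ g g' \<rightarrow> separ (g ** x) (g' ** x)"
   using h h' by (auto simp: separ_def x side_mult inv intro!: tw_BB)
 qed (use tw_inverse[OF h(5)] inv in auto)
 from sum.reindex_bij_betw[OF this, of "%B. of_bool (0 < side B g') - of_bool (0 < side B g)"] show ?thesis
  unfolding cross_def by (simp add: x side_mult)
qed

definition hom :: "real^2^2 => int" where
 "hom x = cross (mat 1) x"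

lemma cross_hom: "x : Gam ==> g : SL2 ==> cross (mat 1) (g ** x) = hom x + cross (mat 1) g"
 using cross_add[of "mat 1" x "g ** x"] cross_mult[of x "mat 1" g] by (simp add: hom_def Gam_SL2)

lemma hom_mult: "x : Gam ==> y : Gam ==> hom (x ** y) = hom x + hom y"
 using cross_hom[of y x] by (simp add: hom_def Gam_SL2)

lemma hom_one: "hom (mat 1) = 0"
 by (simp add: hom_def cross_self)

lemma hom_neg_one: "hom (- mat 1) = 0"
proof -
 have "side B (- mat 1) = side B (mat 1)" for B
  by (simp add: side_def qE_def qF_def qG_def)
 then show ?thesis by (simp add: hom_def cross_def separ_def)
qed

lemma hom_adj2: "x : Gam ==> hom (adj2 x) = - hom x"
 using hom_mult[of "adj2 x" x] by (simp add: Gam_adj2 Gam_SL2 hom_one)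

text \<open>Points deep in the horoball at the cusp \<open>(i, j)\<close> lie on the same side of each geodesic that does not end there.\<close>

lemma side_horoball:
 fixes i j :: int
 assumes B: "(al, be, ga) : BB" and g: "g : SL2" and len: "lensq g i j < 2" and nz: "al * j^2 - be * (i * j) + ga * i^2 ~= 0"
 shows "0 < side (al, be, ga) g \<longleftrightarrow> 0 < al * j^2 - be * (i * j) + ga * i^2"
proof -
 define b where "b = al * j^2 - be * (i * j) + ga * i^2"
 define q where "q = lensq g i j"
 define e where "e = side (al, be, ga) g"
 have "i ~= 0 \<or> j ~= 0" using nz by auto
 then have "0 < (real_of_int i)\<^sup>2 + (real_of_int j)^2" by (simp add: sum_power2_gt_zero_iff)
 then have "0 < frob2 g * q" using lensq_lower[OF g, of i j] unfolding q_def by linarith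
 then have q0: "0 < q" using frob2_nonneg[of g] by (simp add: zero_less_mult_iff)
 have disc: "be^2 - 4 * al * ga = 1" using B by (auto simp: BB_def)
 then have "real_of_int (be^2 - 4 * al * ga) = 1" by simp
 then have rdisc: "(real_of_int be)^2 - 4 * real_of_int al * real_of_int ga = 1" by simp
 define E F G where "E = qE g" and "F = qF g" and "G = qG g"
 have det: "E * G - F\<^sup>2 = 1" unfolding E_def F_def G_def by (rule q_det[OF g])
 have qq: "q = E * (real_of_int i)^2 + 2 * F * (real_of_int i * real_of_int j) + G * (real_of_int j)^2"
  unfolding q_def E_def F_def G_def lensq_def qE_def qF_def qG_def by (simp add: power2_eq_square algebra_simps)
 have ee: "e = al * E + be * F + ga * G" unfolding e_def side_def E_def F_def G_def by simp
 have bb: "real_of_int b = al * (real_of_int j)^2 - be * (real_of_int i * real_of_int j) + ga * (real_of_int i)^2"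
  unfolding b_def by simp
 define w where "w = - (al * real_of_int j * (E * i + F * j)) + be * (real_of_int i * (E * i + F * j) - real_of_int j * (F * i + G * j)) / 2
   + ga * (real_of_int i * (F * i + G * j))"
 \<comment> \<open>Here \<open>b\<close> is the value of the form at the cusp, nonzero unless the
   geodesic ends there, and \<open>q\<close> is the squared length of the cusp vector. As
   \<open>b\<close> is an integer, the right side is at least \<open>1 - q^2 / 4\<close>, which is
   positive for \<open>q < 2\<close>.\<close>
 have key: "q * (b * e) = (real_of_int b)^2 * (E * G - F\<^sup>2) + w^2 - q\<^sup>2 * ((real_of_int be)^2 - 4 * real_of_int al * real_of_int ga) / 4"
  unfolding qq ee bb w_def by (simp add: power2_eq_square field_simps)
 have "1 <= b^2" using nz unfolding b_def[symmetric] by (simp add: int_one_le_iff_zero_less)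
 then have "1 <= real_of_int (b^2)" by linarith
 then have b2: "1 <= (real_of_int b)^2" by simp
 have "q^2 < 2\<^sup>2" using q0 len unfolding q_def by (intro power_strict_mono) auto
 then have "q^2 < 4" by simp
 then have "0 < q * (b * e)" unfolding key det rdisc using b2 zero_le_power2[of w] by linarith
 then have "0 < b * e" using q0 by (simp add: zero_less_mult_iff)
 then show ?thesis unfolding e_def[symmetric] b_def[symmetric] by (auto simp: zero_less_mult_iff)
qed

lemma Gam_up2: "up 2 : Gam"
 using mki_in_Gam[of 1 2 0 1] by (simp add: mki_def)

text \<open>Ergodicity of the extension rests on this value. Along the horocycle from
  \<open>up (-1)\<close> to \<open>up 1\<close> only geodesics ending at infinity can be crossed,
  and among the vertical ones only the imaginary axis lies in between; invariance shifts the count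
  to the segment from 0 to 2.\<close>

lemma hom_up2: "hom (up 2) = 1"
proof -
 have sep: "separ (up (-1)) (up 1) = {(0, 1, 0)}"
 proof -
  have "B = (0, 1, 0)" if B: "B : separ (up (-1)) (up 1)" for B
  proof -
   obtain al be ga where B3: "B = (al, be, ga)" by (cases B)
   have BB: "(al, be, ga) : BB" and ne: "(0 < side (al, be, ga) (up (-1))) ~= (0 < side (al, be, ga) (up 1))"
    using B unfolding B3 separ_def by auto
   have "ga = 0"
   proof (rule ccontr)
    assume "ga ~= 0"
    then show False
     using side_horoball[OF BB, of "up (-1)" 1 0] side_horoball[OF BB, of "up 1" 1 0] ne by simp
   qed
   then have "be = 1" using BB by (auto simp: BB_def power2_eq_1_iff)
   moreover have "even al" using BB by (auto simp: BB_def)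
   moreover have "(0 < real_of_int al - 1) ~= (0 < real_of_int al + 1)"
    using ne \<open>ga = 0\<close> \<open>be = 1\<close> by (simp add: side_def qE_def qF_def)
   then have "(1 < al) ~= (-1 < al)" by linarith
   ultimately show ?thesis using \<open>ga = 0\<close> B3 by (auto elim!: evenE)
  qed
  moreover have "(0, 1, 0) : separ (up (-1)) (up 1)"
   by (simp add: separ_def BB_def side_def qE_def qF_def qG_def)
  ultimately show ?thesis by blast
 qed
 have "cross (up (-1)) (up 1) = 1"
  unfolding cross_def sep by (simp add: side_def qE_def qF_def qG_def)
 moreover have "cross (up 1) (up 2) = cross (up (-1)) (mat 1)"
  using cross_mult[OF Gam_up2, of "up (-1)" "mat 1"] by simp
 moreover have "cross (up (-1)) (mat 1) = - cross (mat 1) (up (-1))" by (rule cross_swap) auto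
 moreover have "cross (mat 1) (up (-1)) + cross (up (-1)) (up 1) = cross (mat 1) (up 1)" by (rule cross_add) auto
 moreover have "cross (mat 1) (up 1) + cross (up 1) (up 2) = cross (mat 1) (up 2)" by (rule cross_add) auto
 ultimately show ?thesis by (simp add: hom_def)
qed

subsection \<open>The cusp vectors\<close>

text \<open>These vectors represent, up to sign, one of the three classes of cusps. At a vector with
  both entries odd every form in \<open>BB\<close> has an odd value, so no counted geodesic ends at
  these cusps.\<close>

definition VV :: "(int \<times> int) set" where
 "VV = {(i, j). odd i & odd j & coprime i j}"

definition len2 :: "real^2^2 => int \<times> int => real" where
 "len2 g p = lensq g (fst p) (snd p)"

text \<open>Elements of \<open>Gam\<close> are stored as real matrices with integral entries; the
  floors only change the type.\<close>

definition vact :: "real^2^2 => int \<times> int => int \<times> int" where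
 "vact x p = (\<lfloor>x$1$1\<rfloor> * fst p + \<lfloor>x$1$2\<rfloor> * snd p, \<lfloor>x$2$1\<rfloor> * fst p + \<lfloor>x$2$2\<rfloor> * snd p)"

lemma vact_mki [simp]: "vact (mki a b c d) p = (a * fst p + b * snd p, c * fst p + d * snd p)"
 by (simp add: vact_def mki_def)

lemma len2_mult: "x : Gam ==> len2 (g ** x) p = len2 g (vact x p)"
 by (elim Gam_cases, cases g rule: mk2_cases) (simp add: len2_def, simp add: mki_def algebra_simps)

lemma vact_VV: "x : Gam ==> p : VV ==> vact x p : VV"
proof (elim Gam_cases)
 fix a b c d assume x: "x = mki a b c d" "odd a" "even b" "even c" "odd d" "a * d - b * c = 1" and p: "p : VV"
 obtain i j where p': "p = (i, j)" "odd i" "odd j" "coprime i j" using p by (auto simp: VV_def)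
 have "coprime (a * i + b * j) (c * i + d * j)"
 proof (rule coprimeI)
  fix e assume e: "e dvd a * i + b * j" "e dvd c * i + d * j"
  have "i = d * (a * i + b * j) - b * (c * i + d * j)" "j = a * (c * i + d * j) - c * (a * i + b * j)"
   using x(6) by algebra+
  then have "e dvd i" "e dvd j" using e by (metis dvd_diff dvd_mult)+
  then show "e dvd 1" using p'(4) coprime_common_divisor by blast
 qed
 then show ?thesis using x p' by (simp add: VV_def)
qed

lemma vact_mult: "x : Gam ==> y : Gam ==> vact x (vact y p) = vact (x ** y) p"
 by (elim Gam_cases) (simp add: mki_mult algebra_simps)

lemma vact_one: "vact (mat 1) p = p"
 by (simp add: vact_def mat_def)

lemma bij_vact: "x : Gam ==> bij_betw (vact x) VV VV"
 by (rule bij_betwI[where g = "vact (adj2 x)"])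
   (auto simp: vact_VV Gam_adj2 vact_mult Gam_SL2 vact_one)

lemma countable_VV: "countable VV"
 by simp

lemma len2_pos: "g : SL2 ==> p : VV ==> 0 < len2 g p"
proof -
 assume g: "g : SL2" and p: "p : VV"
 have "fst p ~= 0" using p by (auto simp: VV_def)
 then have "0 < (real_of_int (fst p))\<^sup>2 + (real_of_int (snd p))^2" by (simp add: sum_power2_gt_zero_iff)
 then have "0 < frob2 g * len2 g p" using lensq_lower[OF g, of "fst p" "snd p"] unfolding len2_def by linarith
 then show ?thesis using frob2_nonneg[of g] by (simp add: zero_less_mult_iff)
qed

text \<open>Two vectors with images shorter than one span a parallelogram of area below one. Their
  determinant is an integer, hence zero, and primitive proportional vectors agree up to
  sign.\<close>

lemma short_unique:
 assumes g: "g : SL2" and p: "p : VV" "p' : VV" and l: "len2 g p < 1" "len2 g p' < 1"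
 shows "p' = p \<or> p' = (- fst p, - snd p)"
proof -
 obtain a b c d where gm: "g = mk2 a b c d" "a * d - b * c = 1" using g by (rule SL2_cases)
 obtain i j where ij: "p = (i, j)" "odd i" "odd j" "coprime i j" using p by (auto simp: VV_def)
 obtain i' j' where ij': "p' = (i', j')" "odd i'" "odd j'" "coprime i' j'" using p by (auto simp: VV_def)
 let ?u = "a * i + b * j" and ?v = "c * i + d * j" and ?u' = "a * i' + b * j'" and ?v' = "c * i' + d * j'"
 have "real_of_int (i * j' - i' * j) = (a * d - b * c) * (i * j' - i' * j)" using gm by simp
 also have "... = ?u * ?v' - ?u' * ?v" by (simp add: algebra_simps)
 finally have det: "real_of_int (i * j' - i' * j) = ?u * ?v' - ?u' * ?v" .
 have "(?u * ?v' - ?u' * ?v)^2 = (?u\<^sup>2 + ?v\<^sup>2) * (?u'\<^sup>2 + ?v'\<^sup>2) - (?u * ?u' + ?v * ?v')\<^sup>2" by algebra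
 also have "... <= (?u\<^sup>2 + ?v\<^sup>2) * (?u'\<^sup>2 + ?v'\<^sup>2)" by simp
 also have "... < 1 * 1"
  using l unfolding len2_def gm ij ij' by (intro mult_strict_mono') (auto intro: add_nonneg_nonneg)
 finally have "(real_of_int (i * j' - i' * j))^2 < 1" unfolding det by simp
 then have "(i * j' - i' * j)^2 < 1" by (metis of_int_less_1_iff of_int_power)
 then have eq: "i * j' = i' * j" using zero_less_power2[of "i * j' - i' * j"] by linarith
 then have "\<bar>i\<bar> * \<bar>j'\<bar> = \<bar>i'\<bar> * \<bar>j\<bar>" by (metis abs_mult)
 then have ab: "\<bar>i\<bar> = \<bar>i'\<bar>" "\<bar>j'\<bar> = \<bar>j\<bar>"
  using coprime_crossproduct_int[of i j i' j'] ij ij' by auto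
 have "i ~= 0" "j ~= 0" using ij by auto
 then show ?thesis using ab eq ij ij' by (auto simp: abs_eq_iff)
qed

lemma finite_short: "g : SL2 ==> e <= 1 ==> finite {p : VV. len2 g p < e}"
 and card_short: "g : SL2 ==> e <= 1 ==> card {p : VV. len2 g p < e} <= 2"
proof -
 assume g: "g : SL2" and e: "e <= 1"
 have "\<exists>q. {p : VV. len2 g p < e} \<subseteq> {q, (- fst q, - snd q)}"
 proof (cases "{p : VV. len2 g p < e} = {}")
  case False
  then obtain q where "q : VV" "len2 g q < e" by auto
  then show ?thesis using short_unique[OF g, of q] e by (intro exI[of _ q]) force
 next
  case True
  show ?thesis unfolding True by blast
 qed
 then obtain q where q: "{p : VV. len2 g p < e} \<subseteq> {q, (- fst q, - snd q)}" by blast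
 then show "finite {p : VV. len2 g p < e}" by (rule finite_subset) auto
 show "card {p : VV. len2 g p < e} <= 2"
  by (rule order_trans[OF card_mono[OF _ q]]) (auto simp: card_insert_if)
qed

text \<open>The colour of a cusp vector: the value of \<open>cross\<close> on the corresponding horoball.\<close>

definition kap :: "int \<times> int => int" where
 "kap p = cross (mat 1) (SOME g. g : SL2 & len2 g p < 1)"

text \<open>The value of a counted form at a vector of \<open>VV\<close> is odd and so nonzero.
  Hence no form separates two points of the horoball, and the choice inside \<open>kap\<close> is
  immaterial.\<close>

lemma kap_eq:
 assumes g: "g : SL2" and p: "p : VV" and l: "len2 g p < 1"
 shows "kap p = cross (mat 1) g"
proof -
 define g' where "g' = (SOME g. g : SL2 & len2 g p < 1)"
 have g': "g' : SL2" "len2 g' p < 1" unfolding g'_def using someI_ex[of "%g. g : SL2 & len2 g p < 1"] g l by auto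
 obtain i j where ij: "p = (i, j)" "odd i" "odd j" using p by (auto simp: VV_def)
 have "separ g' g = {}"
 proof -
  have "(0 < side (al, be, ga) g') = (0 < side (al, be, ga) g)" if B: "(al, be, ga) : BB" for al be ga
  proof -
   have "odd be" using B unfolding BB_def by (auto, presburger)
   then have "odd (al * j^2 - be * (i * j) + ga * i^2)" using B ij by (auto simp: BB_def)
   then have "al * j^2 - be * (i * j) + ga * i^2 ~= 0" by (metis even_zero)
   then show ?thesis
    using side_horoball[OF B g'(1), of i j] side_horoball[OF B g, of i j] g'(2) l unfolding len2_def ij by simp
  qed
  then show ?thesis by (auto simp: separ_def)
 qed
 then have "cross g' g = 0" by (simp add: cross_def)
 then show ?thesis using cross_add[of "mat 1" g' g] g g' by (simp add: kap_def g'_def[symmetric])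
qed

lemma kap_vact:
 assumes x: "x : Gam" and g: "g : SL2" and p: "p : VV" and l: "len2 g (vact x p) < 1"
 shows "kap p = hom x + kap (vact x p)"
proof -
 have "kap p = cross (mat 1) (g ** x)"
  using x g p l by (intro kap_eq) (auto simp: len2_mult Gam_SL2)
 also have "... = hom x + cross (mat 1) g" by (rule cross_hom[OF x g])
 also have "cross (mat 1) g = kap (vact x p)"
  using x g p l by (intro kap_eq[symmetric] vact_VV)
 finally show ?thesis .
qed

section \<open>An irrational rotation\<close>

lemma frac_add_int [simp]: "frac (x + of_int n) = frac (x::real)"
 by (simp add: frac_def)

lemma frac_frac_add: "frac (frac x + y) = frac (x + y :: real)"
proof -
 have "x + y = (frac x + y) + of_int \<lfloor>x\<rfloor>" by (simp add: frac_def)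
 then show ?thesis by (metis frac_add_int)
qed

lemma borel_measurable_frac [measurable]: "(frac :: real => real) : borel_measurable borel"
 unfolding frac_def[abs_def] by measurable

lemma nn_integral_period:
 fixes f :: "real => ennreal"
 assumes [measurable]: "(%x. f (frac x)) : borel_measurable borel"
 shows "(\<integral>\<^sup>+x. f (frac x) * indicator {a..<a + 1} x \<partial>lborel) = (\<integral>\<^sup>+x. f (frac x) * indicator {0..<1} x \<partial>lborel)"
proof -
 have sh: "(\<integral>\<^sup>+x. f (frac x) * indicator {b + of_int n..<c + of_int n} x \<partial>lborel) = (\<integral>\<^sup>+x. f (frac x) * indicator {b..<c} x \<partial>lborel)" for b c :: real and n
 proof -
  have "(\<integral>\<^sup>+x. f (frac x) * indicator {b + of_int n..<c + of_int n} x \<partial>lborel)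
    = (\<integral>\<^sup>+x. f (frac (x + of_int n)) * indicator {b + of_int n..<c + of_int n} (x + of_int n) \<partial>lborel)"
   by (subst nn_integral_lborel_shift[where c = "of_int n" and f = "%x. f (frac x) * indicator {b + of_int n..<c + of_int n} x"]) auto
  also have "... = (\<integral>\<^sup>+x. f (frac x) * indicator {b..<c} x \<partial>lborel)"
   by (intro nn_integral_cong) (auto split: split_indicator)
  finally show ?thesis .
 qed
 define r where "r = frac a"
 have r: "0 <= r" "r < 1" by (simp_all add: r_def frac_lt_1)
 have a: "a = r + of_int \<lfloor>a\<rfloor>" by (simp add: r_def frac_def)
 have "(\<integral>\<^sup>+x. f (frac x) * indicator {a..<a + 1} x \<partial>lborel) = (\<integral>\<^sup>+x. f (frac x) * indicator {r + of_int \<lfloor>a\<rfloor>..<(r + 1) + of_int \<lfloor>a\<rfloor>} x \<partial>lborel)"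
  using a by (simp add: add_ac)
 also have "... = (\<integral>\<^sup>+x. f (frac x) * indicator {r..<r + 1} x \<partial>lborel)" by (rule sh)
 also have "... = (\<integral>\<^sup>+x. f (frac x) * indicator {r..<1} x + f (frac x) * indicator {0 + of_int 1..<r + of_int 1} x \<partial>lborel)"
  using r by (intro nn_integral_cong) (auto split: split_indicator)
 also have "... = (\<integral>\<^sup>+x. f (frac x) * indicator {r..<1} x \<partial>lborel) + (\<integral>\<^sup>+x. f (frac x) * indicator {0..<r} x \<partial>lborel)"
  by (subst nn_integral_add) (auto simp only: sh, auto)
 also have "... = (\<integral>\<^sup>+x. f (frac x) * indicator {r..<1} x + f (frac x) * indicator {0..<r} x \<partial>lborel)"
  by (subst nn_integral_add) auto
 also have "... = (\<integral>\<^sup>+x. f (frac x) * indicator {0..<1} x \<partial>lborel)"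
  using r by (intro nn_integral_cong) (auto split: split_indicator)
 finally show ?thesis .
qed

definition Om :: "real measure" where
 "Om = restrict_space lborel {0..<1}"

lemma space_Om [simp]: "space Om = {0..<1}"
 by (simp add: Om_def space_restrict_space)

lemma sets_Om: "sets Om = sets (restrict_space borel {0..<1})"
 by (simp add: Om_def sets_restrict_space)

lemma prob_space_Om: "prob_space Om"
 by (rule prob_spaceI) (simp add: Om_def emeasure_restrict_space space_restrict_space)

interpretation Om: prob_space Om by (rule prob_space_Om)

lemma measurable_Om_borel: "(%x. x) : measurable Om borel"
 unfolding Om_def by (rule measurable_restrict_space1) simp

lemma measurable_to_Om:
 assumes "f : borel_measurable M" "\<And>x. x : space M ==> f x : {0..<1}"
 shows "f : measurable M Om"
proof -
 have "f : measurable M (restrict_space borel {0..<1})"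
  using assms by (intro measurable_restrict_space2) auto
 then show ?thesis using sets_Om by (simp cong: measurable_cong_sets)
qed

lemma measurable_frac_Om [measurable]: "f : borel_measurable M ==> (%x. frac (f x)) : measurable M Om"
 by (rule measurable_to_Om) (auto simp: frac_lt_1)

lemma nn_integral_Om:
 assumes "f : borel_measurable Om"
 shows "(\<integral>\<^sup>+x. f x \<partial>Om) = (\<integral>\<^sup>+x. f (frac x) * indicator {0..<1} x \<partial>lborel)"
proof -
 have "(\<integral>\<^sup>+x. f x \<partial>Om) = (\<integral>\<^sup>+x. f x * indicator {0..<1} x \<partial>lborel)"
  unfolding Om_def by (subst nn_integral_restrict_space) auto
 also have "... = (\<integral>\<^sup>+x. f (frac x) * indicator {0..<1} x \<partial>lborel)"
  by (intro nn_integral_cong) (auto simp: frac_eq split: split_indicator)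
 finally show ?thesis .
qed

definition dil :: "nat => real => real => real" where
 "dil q s x = frac (real q * x + s)"

lemma measurable_dil: "dil q s : measurable Om Om"
 unfolding dil_def[abs_def] using measurable_Om_borel
 by (intro measurable_frac_Om borel_measurable_add borel_measurable_times) auto

text \<open>The map winds the circle \<open>q\<close> times around itself with constant speed
  \<open>q\<close>.\<close>

lemma nn_integral_dil:
 assumes f: "f : borel_measurable Om" and q: "0 < q"
 shows "(\<integral>\<^sup>+x. f (dil q s x) \<partial>Om) = (\<integral>\<^sup>+x. f x \<partial>Om)"
proof -
 have fm [measurable]: "(%x. f (frac x)) : borel_measurable borel"
  by (rule measurable_compose[OF measurable_frac_Om f]) simp
 have "(%x. f (dil q s x)) : borel_measurable Om" by (rule measurable_compose[OF measurable_dil f])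
 then have "(\<integral>\<^sup>+x. f (dil q s x) \<partial>Om) = (\<integral>\<^sup>+x. f (dil q s (frac x)) * indicator {0..<1} x \<partial>lborel)"
  by (rule nn_integral_Om)
 also have "... = (\<integral>\<^sup>+x. f (frac (s + real q * x)) * indicator {s..<s + real q} (s + real q * x) \<partial>lborel)"
  using q by (intro nn_integral_cong) (auto simp: dil_def frac_eq add.commute zero_le_mult_iff split: split_indicator)
 also have "... = (\<integral>\<^sup>+x. f (frac x) * indicator {s..<s + real q} x \<partial>lborel) / real q"
 proof -
  have "(\<integral>\<^sup>+x. f (frac x) * indicator {s..<s + real q} x \<partial>lborel)
   = \<bar>real q\<bar> * (\<integral>\<^sup>+x. f (frac (s + real q * x)) * indicator {s..<s + real q} (s + real q * x) \<partial>lborel)"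
   by (rule nn_integral_real_affine) (use q in auto)
  then show ?thesis
   using q by (simp add: ennreal_divide_times ennreal_of_nat_eq_real_of_nat mult.commute[of "ennreal (real q)"] mult_divide_eq_ennreal)
 qed
 also have "(\<integral>\<^sup>+x. f (frac x) * indicator {s..<s + real q} x \<partial>lborel) = of_nat q * (\<integral>\<^sup>+x. f (frac x) * indicator {0..<1} x \<partial>lborel)"
 proof (induction q)
  case (Suc q)
  have "(\<integral>\<^sup>+x. f (frac x) * indicator {s..<s + real (Suc q)} x \<partial>lborel)
   = (\<integral>\<^sup>+x. f (frac x) * indicator {s..<s + real q} x + f (frac x) * indicator {s + real q..<(s + real q) + 1} x \<partial>lborel)"
   by (intro nn_integral_cong) (auto split: split_indicator)
  also have "... = (\<integral>\<^sup>+x. f (frac x) * indicator {s..<s + real q} x \<partial>lborel) + (\<integral>\<^sup>+x. f (frac x) * indicator {s + real q..<(s + real q) + 1} x \<partial>lborel)"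
   by (rule nn_integral_add) auto
  also have "... = of_nat (Suc q) * (\<integral>\<^sup>+x. f (frac x) * indicator {0..<1} x \<partial>lborel)"
   by (simp only: Suc nn_integral_period[OF fm]) (simp add: distrib_right add.commute)
  finally show ?case .
 qed simp
 also have "... / real q = (\<integral>\<^sup>+x. f x \<partial>Om)"
  using q by (simp add: nn_integral_Om[OF f] ennreal_of_nat_eq_real_of_nat mult.commute[of "ennreal (real q)"] mult_divide_eq_ennreal)
 finally show ?thesis .
qed

definition theta :: real where
 "theta = (SOME x. x \<notin> \<rat>)"

lemma theta_irrational: "theta \<notin> \<rat>"
proof -
 have "\<exists>x::real. x \<notin> \<rat>" using countable_rat uncountable_UNIV_real by (metis UNIV_eq_I)
 then show ?thesis unfolding theta_def by (rule someI_ex)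
qed

definition rot :: "int => real => real" where
 "rot k x = frac (x + of_int k * theta)"

lemma rot_eq_dil: "rot k = dil 1 (of_int k * theta)"
 by (auto simp: rot_def dil_def)

lemma measurable_rot [measurable]: "rot k : measurable Om Om"
 unfolding rot_eq_dil by (rule measurable_dil)

lemma nn_integral_rot: "f : borel_measurable Om ==> (\<integral>\<^sup>+x. f (rot k x) \<partial>Om) = (\<integral>\<^sup>+x. f x \<partial>Om)"
 unfolding rot_eq_dil by (rule nn_integral_dil) auto

lemma rot_rot: "rot k (rot l x) = rot (k + l) x"
 by (simp add: rot_def frac_frac_add algebra_simps)

lemma rot_range [simp]: "0 <= rot k x" "rot k x < 1"
 by (simp_all add: rot_def frac_lt_1)

lemma rot_0: "0 <= x ==> x < 1 ==> rot 0 x = x"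
 by (simp add: rot_def frac_eq)

lemma AE_rot: "AE x in Om. P x ==> AE x in Om. P (rot k x)"
proof -
 have d: "distr Om Om (rot k) = Om"
 proof (rule measure_eqI)
  fix A assume "A : sets (distr Om Om (rot k))"
  then have A: "A : sets Om" by simp
  have "emeasure (distr Om Om (rot k)) A = (\<integral>\<^sup>+x. indicator A x \<partial>distr Om Om (rot k))" using A by simp
  also have "... = (\<integral>\<^sup>+x. indicator A (rot k x) \<partial>Om)" using A by (subst nn_integral_distr) auto
  also have "... = emeasure Om A" using A by (subst nn_integral_rot) auto
  finally show "emeasure (distr Om Om (rot k)) A = emeasure Om A" .
 qed simp
 assume "AE x in Om. P x"
 then have "AE x in distr Om Om (rot k). P x" unfolding d .
 then show ?thesis by (rule AE_distrD[rotated]) measurable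
qed

text \<open>The distance \<open>D s\<close> in mean between the function and its translate by
  \<open>s\<close> is subadditive, has period one, and vanishes at multiples of
  \<open>theta\<close>. These are dense modulo one and \<open>D\<close> is continuous at zero, so it
  vanishes identically; exchanging integrals then yields one point \<open>x\<close> whose value is
  taken almost everywhere.\<close>

lemma rot_ergodic:
 fixes P :: "real => real"
 assumes P: "P : borel_measurable Om" and C: "\<And>x. x : {0..<1} ==> \<bar>P x\<bar> <= C" and inv: "AE x in Om. P (rot 1 x) = P x"
 shows "\<exists>c. AE x in Om. P x = c"
proof -
 define k where "k x = P (frac x)" for x
 have k [measurable]: "k : borel_measurable borel"
  unfolding k_def by (rule measurable_compose[OF measurable_frac_Om P]) simp
 have kC: "\<bar>k x\<bar> <= C" for x unfolding k_def by (rule C) (simp add: frac_lt_1)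
 define D where "D s = (\<integral>\<^sup>+x. ennreal \<bar>k (x + s) - k x\<bar> * indicator {0..<1} x \<partial>lborel)" for s
 have per: "(\<integral>\<^sup>+x. ennreal \<bar>k (x + s) - k x\<bar> * indicator {a..<a + 1} x \<partial>lborel) = D s" for s a
 proof -
  define F where "F u = ennreal \<bar>k (u + s) - k u\<bar>" for u
  have F: "F (frac x) = ennreal \<bar>k (x + s) - k x\<bar>" for x
   by (simp add: F_def k_def frac_frac_add)
  have "(%x. F (frac x)) : borel_measurable borel" unfolding F by measurable
  from nn_integral_period[OF this, of a] show ?thesis unfolding F D_def .
 qed
 have add: "D (s + t) <= D s + D t" for s t
 proof -
  have "D (s + t) <= (\<integral>\<^sup>+x. ennreal \<bar>k ((x + t) + s) - k (x + t)\<bar> * indicator {0..<1} x + ennreal \<bar>k (x + t) - k x\<bar> * indicator {0..<1} x \<partial>lborel)"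
   unfolding D_def
  proof (intro nn_integral_mono)
   fix x
   have "\<bar>k (x + (s + t)) - k x\<bar> <= \<bar>k ((x + t) + s) - k (x + t)\<bar> + \<bar>k (x + t) - k x\<bar>" by (simp add: add_ac)
   then have "ennreal \<bar>k (x + (s + t)) - k x\<bar> <= ennreal \<bar>k ((x + t) + s) - k (x + t)\<bar> + ennreal \<bar>k (x + t) - k x\<bar>"
    by (simp add: ennreal_plus[symmetric] del: ennreal_plus)
   then show "ennreal \<bar>k (x + (s + t)) - k x\<bar> * indicator {0..<1} x
     <= ennreal \<bar>k ((x + t) + s) - k (x + t)\<bar> * indicator {0..<1} x + ennreal \<bar>k (x + t) - k x\<bar> * indicator {0..<1} x"
    by (auto split: split_indicator)
  qed
  also have "... = (\<integral>\<^sup>+x. ennreal \<bar>k ((x + t) + s) - k (x + t)\<bar> * indicator {0..<1} x \<partial>lborel) + D t"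
   unfolding D_def by (rule nn_integral_add) auto
  also have "(\<integral>\<^sup>+x. ennreal \<bar>k ((x + t) + s) - k (x + t)\<bar> * indicator {0..<1} x \<partial>lborel)
    = (\<integral>\<^sup>+x. ennreal \<bar>k ((x + t) + s) - k (x + t)\<bar> * indicator {t..<t + 1} (x + t) \<partial>lborel)"
   by (intro nn_integral_cong) (auto split: split_indicator)
  also have "... = (\<integral>\<^sup>+x. ennreal \<bar>k (x + s) - k x\<bar> * indicator {t..<t + 1} x \<partial>lborel)"
   by (rule nn_integral_lborel_shift) measurable
  also have "... = D s" by (rule per)
  finally show ?thesis .
 qed
 have D_int: "D (s + of_int m) = D s" for s m
  unfolding D_def k_def by (simp add: add.assoc[symmetric])
 have D0: "D 0 = 0" by (simp add: D_def)
 have "D theta = 0"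
 proof -
  have "D theta = (\<integral>\<^sup>+x. ennreal \<bar>P (rot 1 x) - P x\<bar> \<partial>Om)"
  proof -
   have "(%x. ennreal \<bar>P (rot 1 x) - P x\<bar>) : borel_measurable Om"
    using P measurable_compose[OF measurable_rot P, of 1] by measurable
   from nn_integral_Om[OF this] show ?thesis
    unfolding D_def by (auto simp: k_def rot_def frac_frac_add intro!: nn_integral_cong)
  qed
  also have "... = (\<integral>\<^sup>+x. 0 \<partial>Om)"
   by (rule nn_integral_cong_AE) (use inv in eventually_elim, simp)
  finally show ?thesis by simp
 qed
 then have Dn: "D (real n * theta) = 0" for n
 proof (induction n)
  case (Suc n)
  then show ?case using add[of "real n * theta" theta] by (simp add: distrib_right add.commute)
 qed (simp add: D0)
 have cont: "(%i. D (s i)) \<longlonglongrightarrow> 0" if s: "s \<longlonglongrightarrow> 0" "\<And>i. \<bar>s i\<bar> <= 1" for s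
  unfolding D_def
 proof (rule L1_translation_continuity[where C = C and S' = "{-1..2}" and L = "%i x. x + s i"])
  show "distr lborel borel (%x. x + s i) = lborel" for i
   using lborel_distr_plus[of "s i"] by (simp add: add.commute[of _ "s i"])
  show "(%i. x + s i) \<longlonglongrightarrow> x" for x using tendsto_add[OF tendsto_const s(1), of x] by simp
  show "x + s i : {-1..2}" if "x : {0..<1}" for i x using s(2)[of i] that by auto
 qed (use kC in auto)
 have Dz: "D s = 0" for s
 proof -
  have "\<exists>h m. m > 0 & \<bar>of_int m * theta - of_int h - s\<bar> < 1 / real (Suc n)" for n
   using sequence_of_fractional_parts_is_dense[OF theta_irrational, of "1 / real (Suc n)" s] by (metis of_nat_0_less_iff zero_less_Suc zero_less_divide_1_iff)
  then obtain h m where hm: "\<And>n. m n > 0" "\<And>n. \<bar>of_int (m n) * theta - of_int (h n) - s\<bar> < 1 / real (Suc n)" by metis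
  define t where "t n = s - (of_int (m n) * theta - of_int (h n))" for n
  have tb: "\<bar>t n\<bar> < 1 / real (Suc n)" for n using hm(2)[of n] by (simp add: t_def abs_minus_commute)
  have "t \<longlonglongrightarrow> 0"
   by (rule Lim_null_comparison[OF _ LIMSEQ_Suc[OF lim_const_over_n[of 1]]]) (rule always_eventually, use tb in \<open>auto intro: less_imp_le\<close>)
  moreover have "\<bar>t n\<bar> <= 1" for n
  proof -
   have "1 / real (Suc n) <= 1" by simp
   then show ?thesis using tb[of n] by linarith
  qed
  ultimately have lim: "(%n. D (t n)) \<longlonglongrightarrow> 0" by (rule cont)
  have "D s <= D (t n)" for n
  proof -
   have "D s = D (t n + (real (nat (m n)) * theta) + of_int (- h n))" using hm(1)[of n] by (simp add: t_def)
   also have "... = D (t n + (real (nat (m n)) * theta))" by (rule D_int)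
   also have "... <= D (t n) + D (real (nat (m n)) * theta)" by (rule add)
   finally show ?thesis by (simp add: Dn)
  qed
  then have "D s <= 0" by (intro tendsto_lowerbound[OF lim]) auto
  then show ?thesis by simp
 qed
 have "(\<integral>\<^sup>+x. (\<integral>\<^sup>+s. ennreal \<bar>k (x + s) - k x\<bar> * indicator {0..<1} x * indicator {0..<1} s \<partial>lborel) \<partial>lborel)
   = (\<integral>\<^sup>+s. (\<integral>\<^sup>+x. ennreal \<bar>k (x + s) - k x\<bar> * indicator {0..<1} x * indicator {0..<1} s \<partial>lborel) \<partial>lborel)"
  by (rule lborel_pair.Fubini'[symmetric]) measurable
 also have "... = (\<integral>\<^sup>+s. D s * indicator {0..<1} s \<partial>lborel)"
 proof (rule nn_integral_cong)
  fix s :: real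
  have "(%x. ennreal \<bar>k (x + s) - k x\<bar> * indicator {0..<1} x) : borel_measurable lborel" by measurable
  then show "(\<integral>\<^sup>+x. ennreal \<bar>k (x + s) - k x\<bar> * indicator {0..<1} x * indicator {0..<1} s \<partial>lborel) = D s * indicator {0..<1} s"
   unfolding D_def by (rule nn_integral_multc)
 qed
 also have "... = 0" by (simp add: Dz)
 finally have "AE x in lborel. (\<integral>\<^sup>+s. ennreal \<bar>k (x + s) - k x\<bar> * indicator {0..<1} x * indicator {0..<1::real} s \<partial>lborel) = 0"
  by (subst (asm) nn_integral_0_iff_AE) measurable
 then have "AE x in lborel. x : {0..<1} \<longrightarrow> (\<integral>\<^sup>+s. ennreal \<bar>k (x + s) - k x\<bar> * indicator {0..<1::real} s \<partial>lborel) = 0"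
  by eventually_elim auto
 moreover have "\<not> (AE x in lborel. x \<notin> {0..<1::real})"
 proof
  assume "AE x in lborel. x \<notin> {0..<1::real}"
  then have "emeasure lborel {0..<1::real} = 0"
   by (subst (asm) AE_iff_measurable[where N = "{0..<1}"]) auto
  then show False by simp
 qed
 ultimately have "\<exists>x. (\<integral>\<^sup>+s. ennreal \<bar>k (x + s) - k x\<bar> * indicator {0..<1} s \<partial>lborel) = 0"
  by (rule_tac ccontr) (auto elim!: eventually_mono)
 then obtain x where x: "(\<integral>\<^sup>+s. ennreal \<bar>k (x + s) - k x\<bar> * indicator {0..<1} s \<partial>lborel) = 0" by blast
 have "(\<integral>\<^sup>+y. ennreal \<bar>P y - k x\<bar> \<partial>Om) = (\<integral>\<^sup>+y. ennreal \<bar>k y - k x\<bar> * indicator {0..<1} y \<partial>lborel)"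
  unfolding k_def[of "_::real"] by (subst nn_integral_Om) (use P in \<open>auto simp: k_def\<close>)
 also have "... = (\<integral>\<^sup>+y. ennreal \<bar>k y - k x\<bar> * indicator {x..<x + 1} y \<partial>lborel)"
 proof -
  have "(%y. ennreal \<bar>P (frac y) - k x\<bar>) : borel_measurable borel" using k unfolding k_def by measurable
  from nn_integral_period[OF this, of x] show ?thesis by (simp add: k_def)
 qed
 also have "... = (\<integral>\<^sup>+s. ennreal \<bar>k (s + x) - k x\<bar> * indicator {x..<x + 1} (s + x) \<partial>lborel)"
  by (rule nn_integral_lborel_shift[symmetric]) measurable
 also have "... = (\<integral>\<^sup>+s. ennreal \<bar>k (x + s) - k x\<bar> * indicator {0..<1} s \<partial>lborel)"
  by (intro nn_integral_cong) (auto simp: add.commute split: split_indicator)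
 finally have "(\<integral>\<^sup>+y. ennreal \<bar>P y - k x\<bar> \<partial>Om) = 0" using x by simp
 then have "AE y in Om. ennreal \<bar>P y - k x\<bar> = 0" using P by (subst (asm) nn_integral_0_iff_AE) auto
 then have "AE y in Om. P y = k x" by eventually_elim simp
 then show ?thesis by blast
qed

subsection \<open>Slowly varying sets\<close>

text \<open>A pattern of \<open>q\<close> equally spaced arcs filling half of the circle, with phase
  \<open>s\<close>. If \<open>q * theta\<close> is near an integer, the rotation carries the pattern
  almost onto itself.\<close>

definition slow :: "nat => real => real set" where
 "slow q s = {x. dil q s x < 1 / 2}"

lemma slow_pred [measurable]: "Measurable.pred borel (%x. x : slow q s)"
 unfolding slow_def dil_def by simp

lemma frac_half_change:
 fixes u d :: real
 assumes u: "0 <= u" "u < 1" and d: "\<bar>d\<bar> <= 1 / 2" and ne: "(u < 1 / 2) ~= (frac (u + d) < 1 / 2)"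
 shows "\<bar>u - 1 / 2\<bar> <= \<bar>d\<bar> \<or> u <= \<bar>d\<bar> \<or> 1 - \<bar>d\<bar> <= u"
proof (rule ccontr)
 assume "\<not> ?thesis"
 then have h: "\<bar>d\<bar> < \<bar>u - 1 / 2\<bar>" "\<bar>d\<bar> < u" "u < 1 - \<bar>d\<bar>" by auto
 then have "0 <= u + d" "u + d < 1" by auto
 then have "frac (u + d) = u + d" by (simp add: frac_eq)
 then show False using ne h by (auto simp: abs_if split: if_splits)
qed

text \<open>Membership can only change within distance \<open>\<bar>d\<bar>\<close> of the two end
  points 0 and 1/2 of the half circle.\<close>

lemma dil_change_measure:
 assumes q: "0 < q"
 shows "emeasure Om {x : {0..<1}. (dil q s x < 1 / 2) ~= (frac (dil q s x + d) < 1 / 2)} <= ennreal (4 * \<bar>d\<bar>)"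
proof (cases "\<bar>d\<bar> <= 1 / 2")
 case False
 have "emeasure Om {x : {0..<1}. (dil q s x < 1 / 2) ~= (frac (dil q s x + d) < 1 / 2)} <= 1" by (rule Om.measure_le_1)
 also have "1 <= ennreal (4 * \<bar>d\<bar>)" using False by (simp flip: ennreal_1 add: ennreal_leI)
 finally show ?thesis .
next
 case True
 let ?A = "{u. (u < 1 / 2) ~= (frac (u + d) < 1 / 2)}"
 let ?T = "{1/2 - \<bar>d\<bar>..1/2 + \<bar>d\<bar>} \<union> ({0..\<bar>d\<bar>} \<union> {1 - \<bar>d\<bar>..1})"
 have mA [measurable]: "?A : sets borel" by measurable
 have iA: "indicator ?A : borel_measurable Om"
  using measurable_compose[OF measurable_Om_borel, of "indicator ?A" borel] by simp
 have mB: "{x : {0..<1}. (dil q s x < 1 / 2) ~= (frac (dil q s x + d) < 1 / 2)} : sets Om"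
 proof -
  have [measurable]: "dil q s : borel_measurable Om" using measurable_compose[OF measurable_dil measurable_Om_borel] .
  have "{x : space Om. (dil q s x < 1 / 2) ~= (frac (dil q s x + d) < 1 / 2)} : sets Om" by measurable
  then show ?thesis by simp
 qed
 have "emeasure Om {x : {0..<1}. (dil q s x < 1 / 2) ~= (frac (dil q s x + d) < 1 / 2)} = (\<integral>\<^sup>+x. indicator ?A (dil q s x) \<partial>Om)"
  by (subst nn_integral_indicator[OF mB, symmetric]) (auto intro!: nn_integral_cong split: split_indicator)
 also have "... = (\<integral>\<^sup>+x. indicator ?A x \<partial>Om)" by (rule nn_integral_dil[OF iA q])
 also have "... = (\<integral>\<^sup>+x. indicator ?A (frac x) * indicator {0..<1} x \<partial>lborel)" by (rule nn_integral_Om[OF iA])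
 also have "... <= (\<integral>\<^sup>+x. indicator ?T x \<partial>lborel)"
 proof (rule nn_integral_mono)
  fix x :: real
  show "indicator ?A (frac x) * indicator {0..<1} x <= (indicator ?T x :: ennreal)"
   using frac_half_change[of x d] True by (auto simp: frac_eq abs_le_iff split: split_indicator)
 qed
 also have "... = emeasure lborel ?T" by simp
 also have "... <= emeasure lborel {1/2 - \<bar>d\<bar>..1/2 + \<bar>d\<bar>} + (emeasure lborel {0..\<bar>d\<bar>} + emeasure lborel {1 - \<bar>d\<bar>..1})"
  by (intro order_trans[OF emeasure_subadditive] add_left_mono emeasure_subadditive) auto
 also have "... = ennreal (4 * \<bar>d\<bar>)" by (simp add: ennreal_plus[symmetric] del: ennreal_plus)
 finally show ?thesis .
qed

lemma slow_rot_change: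
 assumes q: "0 < q" and e: "\<bar>real q * theta - of_int h\<bar> <= e"
 shows "emeasure Om {x : {0..<1}. (x : slow q s) ~= (rot k x : slow q s)} <= ennreal (4 * (\<bar>of_int k\<bar> * e))"
proof -
 let ?d = "of_int k * (real q * theta - of_int h)"
 have "dil q s (rot k x) = frac (dil q s x + ?d)" for x
 proof -
  have "real q * rot k x + s = real q * x + s + ?d + of_int (k * h - int q * \<lfloor>x + of_int k * theta\<rfloor>)"
   by (simp add: rot_def frac_def algebra_simps)
  then have "dil q s (rot k x) = frac (real q * x + s + ?d)" unfolding dil_def by (metis frac_add_int)
  then show ?thesis by (simp add: dil_def frac_frac_add)
 qed
 then have "emeasure Om {x : {0..<1}. (x : slow q s) ~= (rot k x : slow q s)} <= ennreal (4 * \<bar>?d\<bar>)"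
  using dil_change_measure[OF q, of s ?d] by (simp add: slow_def)
 also have "... <= ennreal (4 * (\<bar>of_int k\<bar> * e))"
  using e by (intro ennreal_leI mult_left_mono) (auto simp: abs_mult intro: mult_left_mono)
 finally show ?thesis .
qed

text \<open>Changing the phase by one half gives the complementary pattern, and the integral is
  Lipschitz in the phase, so some phase captures exactly half of it by the intermediate value
  theorem.\<close>

lemma slow_halving:
 fixes W :: "real => real"
 assumes q: "0 < q" and W: "W : borel_measurable Om" and C: "\<And>x. x : {0..<1} ==> \<bar>W x\<bar> <= C"
 shows "\<exists>s. (\<integral>x. W x * indicator (slow q s) x \<partial>Om) = (\<integral>x. W x \<partial>Om) / 2"
proof -
 have C0: "0 <= C" using C[of 0] by auto
 have im: "(indicator (slow q s) :: real => real) : borel_measurable Om" for s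
  using measurable_compose[OF measurable_Om_borel, of "indicator (slow q s)" borel] by (simp add: borel_measurable_indicator' slow_pred)
 have int: "integrable Om (%x. W x * indicator (slow q s) x)" for s
 proof (rule Om.integrable_const_bound[where B = C])
  show "AE x in Om. norm (W x * indicator (slow q s) x) <= C"
   by (rule AE_I2) (use C C0 in \<open>auto simp: abs_mult split: split_indicator\<close>)
 qed (use W im in auto)
 have intW: "integrable Om W"
  by (rule Om.integrable_const_bound[where B = C]) (use C W in auto)
 define K where "K s = (\<integral>x. W x * indicator (slow q s) x \<partial>Om)" for s
 have lip: "\<bar>K s - K t\<bar> <= 4 * C * \<bar>s - t\<bar>" for s t
 proof -
  define N where "N = {x : {0..<1}. (dil q t x < 1 / 2) ~= (frac (dil q t x + (s - t)) < 1 / 2)}"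
  have eq: "frac (dil q t x + (s - t)) = dil q s x" for x by (simp add: dil_def frac_frac_add)
  have mN: "N : sets Om"
  proof -
   have [measurable]: "dil q t : borel_measurable Om" using measurable_compose[OF measurable_dil measurable_Om_borel] .
   have "{x : space Om. (dil q t x < 1 / 2) ~= (frac (dil q t x + (s - t)) < 1 / 2)} : sets Om" by measurable
   then show ?thesis by (simp add: N_def)
  qed
  have "K s - K t = (\<integral>x. W x * indicator (slow q s) x - W x * indicator (slow q t) x \<partial>Om)"
   unfolding K_def by (rule Bochner_Integration.integral_diff[symmetric, OF int int])
  also have "\<bar>...\<bar> <= (\<integral>x. C * indicator N x \<partial>Om)"
  proof (rule order_trans[OF integral_abs_bound integral_mono])
   show "integrable Om (%x. \<bar>W x * indicator (slow q s) x - W x * indicator (slow q t) x\<bar>)"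
    by (intro integrable_abs Bochner_Integration.integrable_diff int)
   show "integrable Om (%x. C * indicator N x)"
    using mN by (intro integrable_mult_right integrable_real_indicator) (auto simp: less_top[symmetric])
   fix x assume "x : space Om"
   then show "\<bar>W x * indicator (slow q s) x - W x * indicator (slow q t) x\<bar> <= C * indicator N x"
    using C[of x] C0 unfolding N_def eq by (auto simp: slow_def split: split_indicator)
  qed
  also have "... = C * measure Om N"
  proof -
   have "N \<inter> {0..<1} = N" by (auto simp: N_def)
   then show ?thesis using mN by simp
  qed
  also have "... <= C * (4 * \<bar>s - t\<bar>)"
   using dil_change_measure[OF q, of t "s - t"] C0 unfolding N_def[symmetric] by (intro mult_left_mono) (simp_all add: Om.emeasure_eq_measure)
  finally show ?thesis by (simp add: mult_ac)
 qed
 have cont: "continuous_on UNIV K"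
 proof (rule continuous_onI)
  fix x e :: real assume e: "0 < e"
  show "\<exists>d>0. \<forall>x'\<in>UNIV. dist x' x < d \<longrightarrow> dist (K x') (K x) <= e"
  proof (intro exI[of _ "e / (4 * C + 1)"] conjI ballI impI)
   fix x' assume "dist x' x < e / (4 * C + 1)"
   then have "\<bar>x' - x\<bar> * (4 * C + 1) < e" using C0 by (simp add: dist_real_def field_simps)
   moreover have "4 * C * \<bar>x' - x\<bar> <= \<bar>x' - x\<bar> * (4 * C + 1)" by (simp add: algebra_simps)
   ultimately show "dist (K x') (K x) <= e" using lip[of x' x] by (simp add: dist_real_def)
  qed (use e C0 in auto)
 qed
 have anti: "K (1/2) = (\<integral>x. W x \<partial>Om) - K 0"
 proof -
  have "K (1/2) + K 0 = (\<integral>x. W x * indicator (slow q (1/2)) x + W x * indicator (slow q 0) x \<partial>Om)"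
   unfolding K_def by (rule Bochner_Integration.integral_add[symmetric, OF int int])
  also have "... = (\<integral>x. W x \<partial>Om)"
  proof (rule Bochner_Integration.integral_cong[OF refl])
   fix x
   have "(dil q (1/2) x < 1/2) \<longleftrightarrow> \<not> (dil q 0 x < 1/2)"
   proof -
    define u where "u = dil q 0 x"
    have u: "0 <= u" "u < 1" by (simp_all add: u_def dil_def frac_lt_1)
    have "dil q (1/2) x = frac (u + 1/2)" by (simp add: u_def dil_def frac_frac_add)
    also have "... = (if u < 1/2 then u + 1/2 else u - 1/2)"
    proof (cases "u < 1/2")
     case True
     then show ?thesis using u by (simp add: frac_eq)
    next
     case False
     have "frac (u + 1/2) = frac ((u - 1/2) + of_int 1)" by (simp add: add.commute)
     also have "... = u - 1/2" using False u by (subst frac_add_int) (simp add: frac_eq)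
     finally show ?thesis using False by simp
    qed
    finally show ?thesis using u by (auto simp: u_def[symmetric])
   qed
   then show "W x * indicator (slow q (1/2)) x + W x * indicator (slow q 0) x = W x"
    by (auto simp: slow_def split: split_indicator)
  qed
  finally show ?thesis by simp
 qed
 have c01: "continuous_on {0..1/2} K" using cont continuous_on_subset by blast
 have "\<exists>s. K s = (\<integral>x. W x \<partial>Om) / 2"
 proof (cases "K 0 <= (\<integral>x. W x \<partial>Om) / 2")
  case True
  have "\<exists>x\<ge>0. x <= 1/2 & K x = (\<integral>x. W x \<partial>Om) / 2"
   by (rule IVT') (use True anti c01 in auto)
  then show ?thesis by blast
 next
  case False
  have "\<exists>x\<ge>0. x <= 1/2 & K x = (\<integral>x. W x \<partial>Om) / 2"
   by (rule IVT2') (use False anti c01 in auto)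
  then show ?thesis by blast
 qed
 then show ?thesis by (simp add: K_def)
qed

section \<open>A fundamental domain of finite volume\<close>

text \<open>A strict order by norm, with equality of norms resolved by the injective code. The
  Dirichlet domain cut out by it meets every coset exactly once and not just up to boundary
  points.\<close>

definition precedes :: "real^2^2 => real^2^2 => bool" where
 "precedes g h \<longleftrightarrow> frob2 g < frob2 h \<or> (frob2 g = frob2 h & mat_code g < mat_code h)"

definition DD :: "(real^2^2) set" where
 "DD = {g : SL2. \<forall>x\<in>Gam. x ~= mat 1 \<longrightarrow> precedes g (g ** x)}"

lemma DD_SL2: "g : DD ==> g : SL2"
 by (simp add: DD_def)

lemma DD_sets [measurable]: "DD : sets SL2_borel"
proof -
 have eq: "DD = SL2 \<inter> (\<Inter>x\<in>Gam. {g : SL2. x ~= mat 1 \<longrightarrow> precedes g (g ** x)})"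
  by (auto simp: DD_def)
 have 1: "(\<Inter>x\<in>Gam. {g : SL2. x ~= mat 1 \<longrightarrow> precedes g (g ** x)}) : sets SL2_borel"
 proof (rule sets.countable_INT'[OF countable_Gam])
  show "(%x. {g : SL2. x ~= mat 1 \<longrightarrow> precedes g (g ** x)}) ` Gam \<subseteq> sets SL2_borel"
  proof
   fix A assume "A : (%x. {g : SL2. x ~= mat 1 \<longrightarrow> precedes g (g ** x)}) ` Gam"
   then obtain x where A: "A = {g : SL2. x ~= mat 1 \<longrightarrow> precedes g (g ** x)}" by auto
   show "A : sets SL2_borel"
    unfolding A precedes_def by (rule SL2_borel_CollectI) measurable
  qed
 qed (use Gam_one in auto)
 have 2: "SL2 : sets SL2_borel" by (metis sets.top space_SL2_borel)
 show ?thesis unfolding eq by (rule sets.Int[OF 2 1])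
qed

lemma SL2_mult_cancel: "g : SL2 ==> g ** x = g ** y ==> x = y"
 by (metis adj2_cancel_left(1))

text \<open>Finitely many translates have norm at most that of \<open>g\<close>, so a smallest norm
  and then a smallest code exist; two elements of the domain in one coset would each strictly
  precede the other.\<close>

lemma DD_unique:
 assumes "g : SL2"
 shows "\<exists>!x. x : Gam & g ** x : DD"
proof (rule ex_ex1I)
 define F where "F = {x : Gam. frob2 (g ** x) <= frob2 g}"
 have F: "finite F" "mat 1 : F" using finite_Gam_ball[OF assms] Gam_one by (auto simp: F_def)
 define m where "m = Min ((%x. frob2 (g ** x)) ` F)"
 define F' where "F' = {x : F. frob2 (g ** x) = m}"
 have "m : (%x. frob2 (g ** x)) ` F" unfolding m_def using F by (intro Min_in) auto
 then have F': "finite F'" "F' ~= {}" using F by (auto simp: F'_def)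
 define c where "c = Min ((%x. mat_code (g ** x)) ` F')"
 have "c : (%x. mat_code (g ** x)) ` F'" unfolding c_def using F' by (intro Min_in) auto
 then obtain x where x: "x : F'" "mat_code (g ** x) = c" by auto
 then have xG: "x : Gam" "frob2 (g ** x) = m" by (auto simp: F'_def F_def)
 have "g ** x : DD"
  unfolding DD_def
 proof (intro CollectI conjI ballI impI)
  show "g ** x : SL2" using assms xG Gam_SL2 by auto
  fix y assume y: "y : Gam" "y ~= mat 1"
  define z where "z = x ** y"
  have z: "z : Gam" unfolding z_def using xG y by (intro Gam_mult)
  have gz: "g ** x ** y = g ** z" by (simp add: z_def matrix_mul_assoc)
  have "z ~= x" using y SL2_mult_cancel[OF Gam_SL2[OF xG(1)], of y "mat 1"] by (auto simp: z_def)
  then have ne: "g ** z ~= g ** x" using SL2_mult_cancel[OF assms] by blast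
  show "precedes (g ** x) (g ** x ** y)"
  proof (cases "z : F")
   case False
   then have "frob2 g < frob2 (g ** z)" using z by (auto simp: F_def)
   moreover have "m <= frob2 g" using x by (auto simp: F'_def F_def)
   ultimately show ?thesis unfolding precedes_def gz xG(2) by simp
  next
   case True
   then have le: "m <= frob2 (g ** z)" unfolding m_def using F by (intro Min_le) auto
   show ?thesis
   proof (cases "m = frob2 (g ** z)")
    case True
    then have "z : F'" using \<open>z : F\<close> by (simp add: F'_def)
    then have "c <= mat_code (g ** z)" unfolding c_def using F' by (intro Min_le) auto
    moreover have "mat_code (g ** z) ~= c" using ne x(2) inj_mat_code by (metis injD)
    ultimately show ?thesis unfolding precedes_def gz xG(2) x(2) using True by simp
   qed (use le in \<open>simp add: precedes_def gz xG(2)\<close>)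
  qed
 qed
 then show "\<exists>x. x : Gam & g ** x : DD" using xG by blast
next
 fix x y assume x: "x : Gam & g ** x : DD" and y: "y : Gam & g ** y : DD"
 have main: "precedes (g ** x) (g ** y)" if "x : Gam" "y : Gam" "g ** x : DD" "x ~= y" for x y
 proof -
  have xy: "adj2 x ** y : Gam" using that by (intro Gam_mult Gam_adj2)
  have "adj2 x ** y ~= mat 1"
  proof
   assume "adj2 x ** y = mat 1"
   then have "x ** (adj2 x ** y) = x" by simp
   then show False using that Gam_SL2 by simp
  qed
  then have "precedes (g ** x) (g ** x ** (adj2 x ** y))" using that xy by (simp add: DD_def)
  moreover have "g ** x ** (adj2 x ** y) = g ** y" using Gam_SL2[OF that(1)] by (simp flip: matrix_mul_assoc)
  ultimately show ?thesis by simp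
 qed
 show "x = y"
 proof (rule ccontr)
  assume "x ~= y"
  then have "precedes (g ** x) (g ** y)" "precedes (g ** y) (g ** x)" using main x y by auto
  then show False by (auto simp: precedes_def)
 qed
qed

definition sel :: "real^2^2 => real^2^2" where
 "sel g = (THE x. x : Gam & g ** x : DD)"

lemma sel: "g : SL2 ==> sel g : Gam" "g : SL2 ==> g ** sel g : DD"
 using theI'[OF DD_unique] by (auto simp: sel_def)

lemma sel_eqI: "g : SL2 ==> x : Gam ==> g ** x : DD ==> sel g = x"
 using DD_unique sel by blast

lemma sel_DD: "g : DD ==> sel g = mat 1"
 by (rule sel_eqI) (auto simp: DD_SL2 Gam_one)

lemma sel_mult:
 assumes g: "g : SL2" and x: "x : Gam"
 shows "sel (g ** x) = adj2 x ** sel g"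
proof (rule sel_eqI)
 show "g ** x : SL2" using g x Gam_SL2 by auto
 show "adj2 x ** sel g : Gam" using sel g x by (intro Gam_mult Gam_adj2) auto
 have "g ** x ** (adj2 x ** sel g) = g ** sel g" using Gam_SL2[OF x] by (simp flip: matrix_mul_assoc)
 then show "g ** x ** (adj2 x ** sel g) : DD" using sel g by simp
qed

lemma measurable_sel: "sel : measurable SL2_borel (count_space Gam)"
proof (rule measurable_count_space_eq_countable[THEN iffD2, OF countable_Gam], intro conjI ballI)
 show "sel : space SL2_borel \<rightarrow> Gam" using sel by auto
 fix x assume x: "x : Gam"
 have "sel -` {x} \<inter> space SL2_borel = (%g. g ** x) -` DD \<inter> space SL2_borel"
  using sel x sel_eqI by auto
 also have "... : sets SL2_borel"
  by (rule measurable_sets[OF measurable_mult_right_SL2[OF Gam_SL2[OF x]] DD_sets])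
 finally show "sel -` {x} \<inter> space SL2_borel : sets SL2_borel" .
qed

subsection \<open>Finite volume\<close>

definition dotr :: "real^2^2 => real" where "dotr g = g$1$1 * g$2$1 + g$1$2 * g$2$2"
definition row1 :: "real^2^2 => real" where "row1 g = (g$1$1)^2 + (g$1$2)^2"
definition row2 :: "real^2^2 => real" where "row2 g = (g$2$1)^2 + (g$2$2)^2"

text \<open>A cusp neighbourhood: \<open>row1\<close> is the inverse height, bounded above, and
  \<open>dotr g / row1 g\<close> is the horizontal coordinate, confined to an interval of length
  two.\<close>

definition siegel :: "(real^2^2) set" where
 "siegel = {g : SL2. row1 g < 4 & \<bar>dotr g\<bar> <= row1 g}"

lemma rows_measurable [measurable]:
 "dotr : borel_measurable borel" "row1 : borel_measurable borel" "row2 : borel_measurable borel"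
 unfolding dotr_def[abs_def] row1_def[abs_def] row2_def[abs_def] by measurable

lemma siegel_sets [measurable]: "siegel : sets SL2_borel"
 unfolding siegel_def by (rule SL2_borel_CollectI) measurable

text \<open>In the coordinates determinant and inner product with the first row the two conditions
  are independent. The Jacobian is \<open>a^2 + b^2\<close>, so the area is
  \<open>2 * (a^2 + b^2) / (a^2 + b^2)\<close>, independent of the first row.\<close>

lemma siegel_slab:
 fixes a b :: real
 assumes a: "0 < a"
 shows "(\<integral>\<^sup>+c. \<integral>\<^sup>+d. indicator {(c, d). 0 <= a * d - b * c & a * d - b * c <= 1 & \<bar>a * c + b * d\<bar> <= a^2 + b^2} (c, d) \<partial>lborel \<partial>lborel) = 2"
proof -
 define q where "q = a^2 + b^2"
 have q: "0 < q" using a by (simp add: q_def sum_power2_gt_zero_iff)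
 have [measurable]: "{(c, d). 0 <= a * d - b * c & a * d - b * c <= 1 & \<bar>a * c + b * d\<bar> <= q} : sets (borel \<Otimes>\<^sub>M borel)"
 proof -
  have "Measurable.pred (borel \<Otimes>\<^sub>M borel) (%z. 0 <= a * snd z - b * fst z & a * snd z - b * fst z <= 1 & \<bar>a * fst z + b * snd z\<bar> <= q)"
   by measurable
  then show ?thesis by (simp add: pred_def space_pair_measure case_prod_beta')
 qed
 have [measurable]: "{(c, v). 0 <= v & v <= 1 & \<bar>c + b * v / q\<bar> <= a} : sets (borel \<Otimes>\<^sub>M borel)"
 proof -
  have "Measurable.pred (borel \<Otimes>\<^sub>M borel) (%z. 0 <= snd z & snd z <= 1 & \<bar>fst z + b * snd z / q\<bar> <= a)"
   by measurable
  then show ?thesis by (simp add: pred_def space_pair_measure case_prod_beta')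
 qed
 have "(\<integral>\<^sup>+c. \<integral>\<^sup>+d. indicator {(c, d). 0 <= a * d - b * c & a * d - b * c <= 1 & \<bar>a * c + b * d\<bar> <= q} (c, d) \<partial>lborel \<partial>lborel)
   = (\<integral>\<^sup>+c. \<integral>\<^sup>+v. ennreal (1 / a) * indicator {(c, v). 0 <= v & v <= 1 & \<bar>c + b * v / q\<bar> <= a} (c, v) \<partial>lborel \<partial>lborel)"
 proof (rule nn_integral_cong)
  fix c :: real
  have "(\<integral>\<^sup>+d. indicator {(c, d). 0 <= a * d - b * c & a * d - b * c <= 1 & \<bar>a * c + b * d\<bar> <= q} (c, d) \<partial>lborel)
    = \<bar>1 / a\<bar> * (\<integral>\<^sup>+v. indicator {(c, d). 0 <= a * d - b * c & a * d - b * c <= 1 & \<bar>a * c + b * d\<bar> <= q} (c, b * c / a + 1 / a * v) \<partial>lborel)"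
   by (rule nn_integral_real_affine) (use a in auto)
  also have "... = \<bar>1 / a\<bar> * (\<integral>\<^sup>+v. indicator {(c, v). 0 <= v & v <= 1 & \<bar>c + b * v / q\<bar> <= a} (c, v) \<partial>lborel)"
  proof -
   have "a * (b * c / a + 1 / a * v) - b * c = v" for v using a by (simp add: field_simps)
   moreover have "\<bar>a * c + b * (b * c / a + 1 / a * v)\<bar> <= q \<longleftrightarrow> \<bar>c + b * v / q\<bar> <= a" for v
   proof -
    have "a * c + b * (b * c / a + 1 / a * v) = q / a * (c + b * v / q)"
    proof -
     have "q / a * (c + b * v / q) = (q * c + b * v) / a"
      using q a by (simp add: field_simps)
     also have "... = a * c + b * (b * c / a + 1 / a * v)"
      using a by (simp add: q_def field_simps power2_eq_square)
     finally show ?thesis by simp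
    qed
    then have "\<bar>a * c + b * (b * c / a + 1 / a * v)\<bar> = q / a * \<bar>c + b * v / q\<bar>"
     using q a by (simp add: abs_mult)
    then show ?thesis using q a by (simp add: field_simps)
   qed
   ultimately show ?thesis by (simp only: indicator_def mem_Collect_eq prod.case)
  qed
  also have "... = (\<integral>\<^sup>+v. ennreal (1 / a) * indicator {(c, v). 0 <= v & v <= 1 & \<bar>c + b * v / q\<bar> <= a} (c, v) \<partial>lborel)"
   using a by (subst nn_integral_cmult) auto
  finally show "(\<integral>\<^sup>+d. indicator {(c, d). 0 <= a * d - b * c & a * d - b * c <= 1 & \<bar>a * c + b * d\<bar> <= q} (c, d) \<partial>lborel)
    = (\<integral>\<^sup>+v. ennreal (1 / a) * indicator {(c, v). 0 <= v & v <= 1 & \<bar>c + b * v / q\<bar> <= a} (c, v) \<partial>lborel)" .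
 qed
 also have "... = (\<integral>\<^sup>+v. \<integral>\<^sup>+c. ennreal (1 / a) * indicator {(c, v). 0 <= v & v <= 1 & \<bar>c + b * v / q\<bar> <= a} (c, v) \<partial>lborel \<partial>lborel)"
  by (rule lborel_pair.Fubini'[symmetric]) measurable
 also have "... = (\<integral>\<^sup>+v. 2 * indicator {0..1::real} v \<partial>lborel)"
 proof (rule nn_integral_cong)
  fix v :: real
  have "(\<integral>\<^sup>+c. ennreal (1 / a) * indicator {(c, v). 0 <= v & v <= 1 & \<bar>c + b * v / q\<bar> <= a} (c, v) \<partial>lborel)
    = (\<integral>\<^sup>+c. (ennreal (1 / a) * indicator {0..1::real} v) * indicator {- b * v / q - a..- b * v / q + a} c \<partial>lborel)"
   by (intro nn_integral_cong) (auto simp: abs_le_iff split: split_indicator)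
  also have "... = (ennreal (1 / a) * indicator {0..1::real} v) * ennreal (2 * a)"
   using a by (subst nn_integral_cmult) auto
  also have "... = 2 * indicator {0..1::real} v"
  proof -
   have "ennreal (1 / a) * ennreal (2 * a) = ennreal (1 / a * (2 * a))" using a by (intro ennreal_mult[symmetric]) auto
   also have "... = 2" using a by simp
   finally show ?thesis by (auto split: split_indicator)
  qed
  finally show "(\<integral>\<^sup>+c. ennreal (1 / a) * indicator {(c, v). 0 <= v & v <= 1 & \<bar>c + b * v / q\<bar> <= a} (c, v) \<partial>lborel) = 2 * indicator {0..1::real} v" .
 qed
 also have "... = 2" by (simp add: nn_integral_cmult)
 finally show ?thesis unfolding q_def .
qed

lemma siegel_finite: "emeasure haar siegel < \<infinity>"
proof -
 define W where "W = {B::real^2^2. 0 < B$1$1 & B$1$1 < 2 & \<bar>B$1$2\<bar> <= B$1$1 & \<bar>dotr B\<bar> <= row1 B & 0 <= det B & det B <= 1}"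
 have W [measurable]: "W : sets borel" unfolding W_def by measurable
 have "emeasure lborel W = (\<integral>\<^sup>+a. \<integral>\<^sup>+b. \<integral>\<^sup>+c. \<integral>\<^sup>+d. indicator W (mk2 a b c d) \<partial>lborel \<partial>lborel \<partial>lborel \<partial>lborel)"
  by (subst nn_integral_entries[symmetric]) auto
 also have "... <= (\<integral>\<^sup>+a. \<integral>\<^sup>+b. 2 * (indicator {0..2::real} a * indicator {-2..2::real} b) \<partial>lborel \<partial>lborel)"
 proof (intro nn_integral_mono)
  fix a b :: real
  show "(\<integral>\<^sup>+c. \<integral>\<^sup>+d. indicator W (mk2 a b c d) \<partial>lborel \<partial>lborel) <= 2 * (indicator {0..2} a * indicator {-2..2} b)"
  proof (cases "0 < a & a < 2 & \<bar>b\<bar> <= a")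
   case True
   have "(\<integral>\<^sup>+c. \<integral>\<^sup>+d. indicator W (mk2 a b c d) \<partial>lborel \<partial>lborel)
     <= (\<integral>\<^sup>+c. \<integral>\<^sup>+d. indicator {(c, d). 0 <= a * d - b * c & a * d - b * c <= 1 & \<bar>a * c + b * d\<bar> <= a^2 + b^2} (c, d) \<partial>lborel \<partial>lborel)"
    by (intro nn_integral_mono) (auto simp: W_def dotr_def row1_def split: split_indicator)
   also have "... = 2" using True by (intro siegel_slab) auto
   also have "... = 2 * (indicator {0..2} a * indicator {-2..2} b)" using True by (auto simp: indicator_def abs_le_iff)
   finally show ?thesis .
  next
   case False
   then have "indicator W (mk2 a b c d) = (0::ennreal)" for c d by (auto simp: W_def split: split_indicator)
   then show ?thesis by simp
  qed
 qed
 also have "... = 2 * (4 * 2)"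
  by (simp add: nn_integral_cmult nn_integral_multc mult.assoc[symmetric])
 also have "... < \<infinity>" by (simp add: ennreal_mult_less_top)
 finally have finW: "emeasure lborel W < \<infinity>" .
 define J where "J = mk2 0 1 (-1) 0"
 have J: "J : SL2" by (simp add: J_def)
 let ?R = "%g. {B::real^2^2. B ** g : W}"
 define S where "S = {B : cone_part. row1 B < 4 * det B & \<bar>dotr B\<bar> <= row1 B}"
 have main: "B : W" if B: "B : S" "0 < B$1$1" "\<bar>B$1$2\<bar> <= B$1$1" for B
 proof -
  have d: "0 < det B" "det B <= 1" "row1 B < 4 * det B" "\<bar>dotr B\<bar> <= row1 B"
   using B by (auto simp: S_def cone_part_def)
  then have "row1 B < 4" by simp
  then have "(B$1$1)^2 < 2\<^sup>2" using zero_le_power2[of "B$1$2"] unfolding row1_def by (simp, linarith)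
  then have "B$1$1 < 2" by (rule power_less_imp_less_base) simp
  then show ?thesis using B d by (auto simp: W_def)
 qed
 have rot: "B ** g : S" if "B : S" "g = J \<or> g = J ** J \<or> g = J ** (J ** J)" for B g
  using that by (cases B rule: mk2_cases) (auto simp: J_def S_def cone_part_def dotr_def row1_def algebra_simps)
 have sub: "S \<subseteq> (W \<union> ?R J) \<union> (?R (J ** J) \<union> ?R (J ** (J ** J)))"
 proof
  fix B assume B: "B : S"
  obtain a b c d where Bm: "B = mk2 a b c d" by (rule mk2_cases)
  have ne: "a ~= 0 \<or> b ~= 0" using B Bm by (auto simp: S_def cone_part_def)
  consider "0 < a" "\<bar>b\<bar> <= a" | "0 < - b" "\<bar>a\<bar> <= - b" | "0 < - a" "\<bar>b\<bar> <= - a" | "0 < b" "\<bar>a\<bar> <= b"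
   using ne by argo
  then show "B : (W \<union> ?R J) \<union> (?R (J ** J) \<union> ?R (J ** (J ** J)))"
  proof cases
   case 1 then show ?thesis using main[OF B] Bm by auto
  next
   case 2 then show ?thesis using main[OF rot[OF B, of J]] Bm by (auto simp: J_def)
  next
   case 3 then show ?thesis using main[OF rot[OF B, of "J ** J"]] Bm by (auto simp: J_def)
  next
   case 4 then show ?thesis using main[OF rot[OF B, of "J ** (J ** J)"]] Bm by (auto simp: J_def)
  qed
 qed
 have [measurable]: "?R g : sets borel" for g by measurable
 have R: "emeasure lborel (?R g) = emeasure lborel W" if "g : SL2" for g
  using emeasure_lborel_mult_right[OF that W] .
 have "cone_part \<inter> nrm -` siegel \<subseteq> S"
 proof
  fix B assume "B : cone_part \<inter> nrm -` siegel"
  then have B: "B : cone_part" "nrm B : siegel" by auto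
  then have d: "0 < det B" by (simp add: cone_part_def)
  have 1: "row1 (nrm B) = row1 B / det B" using d by (simp add: row1_def nrm_def power_divide add_divide_distrib)
  have 2: "dotr (nrm B) = dotr B / det B" using d by (simp add: dotr_def nrm_def add_divide_distrib)
  show "B : S" using B d unfolding siegel_def S_def by (simp add: 1 2 field_simps)
 qed
 then have "emeasure haar siegel <= emeasure lborel ((W \<union> ?R J) \<union> (?R (J ** J) \<union> ?R (J ** (J ** J))))"
  unfolding emeasure_haar[OF siegel_sets] using sub by (intro emeasure_mono) auto
 also have "... <= (emeasure lborel W + emeasure lborel (?R J)) + (emeasure lborel (?R (J ** J)) + emeasure lborel (?R (J ** (J ** J))))"
  by (intro order_trans[OF emeasure_subadditive] add_mono emeasure_subadditive) measurable
 also have "... < \<infinity>" using finW J by (simp add: R)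
 finally show ?thesis .
qed

text \<open>The six matrices put into first place, up to sign, the first row, the second row, or
  their sum or difference. These account for the directions in which the reduced region reaches a
  cusp.\<close>

lemma reduced_rows:
 assumes g: "g : SL2" and 1: "\<bar>dotr g\<bar> <= row1 g" and 2: "\<bar>dotr g\<bar> <= row2 g"
 shows "\<exists>h\<in>{mat 1, mk2 0 1 (-1) 0, mk2 0 1 (-1) 0 ** lo (-1), mk2 0 1 (-1) 0 ** lo 1, up (-1), up 1}. h ** g : siegel"
proof -
 obtain a b c d where gm: "g = mk2 a b c d" "a * d - b * c = 1" using g by (rule SL2_cases)
 define p x y where "p = dotr g" and "x = row1 g" and "y = row2 g"
 have px: "p = a * c + b * d" "x = a^2 + b^2" "y = c^2 + d^2"
  by (simp_all add: p_def x_def y_def dotr_def row1_def row2_def gm)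
 have xy: "x * y = 1 + p^2"
 proof -
  have "x * y - p\<^sup>2 = (a * d - b * c)^2" unfolding px by algebra
  then show ?thesis using gm by simp
 qed
 have p1: "\<bar>p\<bar> <= x" "\<bar>p\<bar> <= y" using 1 2 by (simp_all add: p_def x_def y_def)
 define e where "e = (if 0 <= p then 1 else -1 :: real)"
 have ee: "e * e = 1" "e * p = \<bar>p\<bar>" "e = 1 \<or> e = -1" by (auto simp: e_def)
 \<comment> \<open>If both rows are long, the relation \<open>u * v = 1 + p^2\<close> forces
   \<open>\<bar>p\<bar>\<close> close to the smaller squared length \<open>u\<close>. The sum or
   difference of the rows, of squared length \<open>v - u + 2 * (u - \<bar>p\<bar>)\<close>, is then
   short.\<close>
 have key: "u - \<bar>p\<bar> <= v - u + 2 * (u - \<bar>p\<bar>) & v - u + 2 * (u - \<bar>p\<bar>) < 4 & 0 <= u - \<bar>p\<bar>"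
  if uv: "u * v = 1 + p^2" "4 <= u" "u <= v" "\<bar>p\<bar> <= u" for u v
 proof -
  define t where "t = u - \<bar>p\<bar>"
  have p: "\<bar>p\<bar> = u - t" by (simp add: t_def)
  have t0: "0 <= t" using uv by (simp add: t_def)
  have "p^2 = (u - t)^2" using p by (metis power2_abs)
  then have uvt: "u * (v - u + 2 * t) = 1 + t^2" using uv(1) by (simp add: power2_eq_square algebra_simps)
  have "u * (2 * t) <= u * (v - u + 2 * t)" using uv by (intro mult_left_mono) auto
  then have "2 * u * t <= 1 + t^2" using uvt by simp
  moreover have "t <= u" using p by linarith
  then have "t^2 <= u * t" using t0 by (simp add: power2_eq_square mult_right_mono)
  ultimately have "u * t <= 1" by simp
  moreover have "4 * t <= u * t" using uv t0 by (intro mult_right_mono) auto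
  ultimately have t1: "t <= 1" by linarith
  then have "t^2 <= 1" using t0 by (simp add: power_le_one)
  then have "u * (v - u + 2 * t) <= 2" using uvt by simp
  moreover have "4 * (v - u + 2 * t) <= u * (v - u + 2 * t)" using uv t0 by (intro mult_right_mono) auto
  ultimately have "4 * (v - u + 2 * t) <= 2" by (rule order_trans[rotated])
  then have "v - u + 2 * t < 4" by argo
  then show ?thesis using t0 uv unfolding t_def[symmetric] by auto
 qed
 consider "x < 4" | "y < 4" | "4 <= x" "x <= y" | "4 <= y" "y <= x" by linarith
 then show ?thesis
 proof cases
  case 1
  then have "mat 1 ** g : siegel" using g p1 by (simp add: siegel_def p_def x_def)
  then show ?thesis by blast
 next
  case 2
  have "mk2 0 1 (-1) 0 ** g : siegel"
   using 2 p1(2) gm unfolding px siegel_def by (auto simp: row1_def dotr_def algebra_simps)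
  then show ?thesis by blast
 next
  case 3
  note k = key[OF xy 3 p1(1)]
  have row: "(c - e * a)^2 + (d - e * b)^2 = y - x + 2 * (x - \<bar>p\<bar>)"
  proof -
   have "(c - e * a)^2 + (d - e * b)^2 = y - 2 * (e * p) + (e * e) * x"
    unfolding px by (simp add: power2_eq_square algebra_simps)
   then show ?thesis unfolding ee by simp
  qed
  have dot: "\<bar>(c - e * a) * a + (d - e * b) * b\<bar> = x - \<bar>p\<bar>"
  proof -
   have "(c - e * a) * a + (d - e * b) * b = p - e * x" unfolding px by (simp add: power2_eq_square algebra_simps)
   also have "\<bar>...\<bar> = x - \<bar>p\<bar>" using p1(1) by (auto simp: e_def)
   finally show ?thesis .
  qed
  have m: "mk2 0 1 (-1) 0 ** lo (-e) ** g = mk2 (c - e * a) (d - e * b) (-a) (-b)"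
   unfolding gm by simp
  have "mk2 0 1 (-1) 0 ** lo (-e) ** g : SL2" using g by (intro SL2_mult) auto
  then have "mk2 0 1 (-1) 0 ** lo (-e) ** g : siegel"
  proof -
   have "(c - e * a) * (- a) + (d - e * b) * (- b) = - ((c - e * a) * a + (d - e * b) * b)" by simp
   then have "\<bar>dotr (mk2 (c - e * a) (d - e * b) (-a) (-b))\<bar> = x - \<bar>p\<bar>" unfolding dotr_def mk2_nth using dot by (simp only: abs_minus_cancel)
   moreover have "row1 (mk2 (c - e * a) (d - e * b) (-a) (-b)) = y - x + 2 * (x - \<bar>p\<bar>)" unfolding row1_def mk2_nth by (rule row)
   moreover assume "mk2 0 1 (-1) 0 ** lo (-e) ** g : SL2"
   ultimately show ?thesis using k unfolding siegel_def m by simp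
  qed
  then show ?thesis using ee(3) by auto
 next
  case 4
  have yx: "y * x = 1 + p^2" using xy by (simp add: mult.commute)
  note k = key[OF yx 4 p1(2)]
  have row: "(a - e * c)^2 + (b - e * d)^2 = x - y + 2 * (y - \<bar>p\<bar>)"
  proof -
   have "(a - e * c)^2 + (b - e * d)^2 = x - 2 * (e * p) + (e * e) * y"
    unfolding px by (simp add: power2_eq_square algebra_simps)
   then show ?thesis unfolding ee by simp
  qed
  have dot: "\<bar>(a - e * c) * c + (b - e * d) * d\<bar> = y - \<bar>p\<bar>"
  proof -
   have "(a - e * c) * c + (b - e * d) * d = p - e * y" unfolding px by (simp add: power2_eq_square algebra_simps)
   also have "\<bar>...\<bar> = y - \<bar>p\<bar>" using p1(2) by (auto simp: e_def)
   finally show ?thesis .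
  qed
  have m: "up (-e) ** g = mk2 (a - e * c) (b - e * d) c d" unfolding gm by simp
  have "up (-e) ** g : SL2" using g by (intro SL2_mult) auto
  then have "up (-e) ** g : siegel"
  proof -
   have "\<bar>dotr (mk2 (a - e * c) (b - e * d) c d)\<bar> = y - \<bar>p\<bar>" unfolding dotr_def mk2_nth by (rule dot)
   moreover have "row1 (mk2 (a - e * c) (b - e * d) c d) = x - y + 2 * (y - \<bar>p\<bar>)" unfolding row1_def mk2_nth by (rule row)
   moreover assume "up (-e) ** g : SL2"
   ultimately show ?thesis using k unfolding siegel_def m by simp
  qed
  then show ?thesis using ee(3) by auto
 qed
qed

text \<open>Passing to a translate by \<open>up 2\<close>, \<open>up (-2)\<close>,
  \<open>lo 2\<close> or \<open>lo (-2)\<close> adds four times a squared column length plus or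
  minus four times the inner product of the columns. Minimality says that none of these changes is
  negative.\<close>

lemma DD_reduced:
 assumes "g : DD"
 shows "\<bar>dotr (transpose g)\<bar> <= row1 (transpose g)" "\<bar>dotr (transpose g)\<bar> <= row2 (transpose g)"
proof -
 obtain a b c d where g: "g = mk2 a b c d" by (rule mk2_cases)
 have le: "frob2 g <= frob2 (g ** x)" if "x : Gam" for x
  using assms that by (cases "x = mat 1") (auto simp: DD_def precedes_def)
 have "up (-2) : Gam" "lo 2 : Gam" "lo (-2) : Gam"
  using mki_in_Gam[of 1 "-2" 0 1] mki_in_Gam[of 1 0 2 1] mki_in_Gam[of 1 0 "-2" 1] by (simp_all add: mki_def)
 then have "frob2 g <= frob2 (g ** up 2)" "frob2 g <= frob2 (g ** up (-2))" "frob2 g <= frob2 (g ** lo 2)" "frob2 g <= frob2 (g ** lo (-2))"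
  using le Gam_up2 by auto
 then show "\<bar>dotr (transpose g)\<bar> <= row1 (transpose g)" "\<bar>dotr (transpose g)\<bar> <= row2 (transpose g)"
  unfolding g by (simp_all add: dotr_def row1_def row2_def power2_eq_square algebra_simps abs_le_iff)
qed

text \<open>The transposed domain lies in the union of six left translates of preimages of the
  Siegel set, and \<open>haar\<close> respects translations and transposition.\<close>

lemma DD_finite: "emeasure haar DD < \<infinity>"
proof -
 define H where "H = {mat 1, mk2 0 1 (-1) 0, mk2 0 1 (-1) 0 ** lo (-1), mk2 0 1 (-1) 0 ** lo 1, up (-1), up 1}"
 have H: "finite H" "\<And>h. h : H ==> h : SL2" by (auto simp: H_def)
 have mt: "transpose : measurable SL2_borel SL2_borel"
  by (rule measurable_SL2_borelI) auto
 have "emeasure haar DD = (\<integral>\<^sup>+g. indicator DD g \<partial>haar)" by simp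
 also have "... <= (\<integral>\<^sup>+g. (\<Sum>h\<in>H. indicator siegel (h ** transpose g)) \<partial>haar)"
 proof (rule nn_integral_mono)
  fix g assume "g : space haar"
  show "indicator DD g <= (\<Sum>h\<in>H. indicator siegel (h ** transpose g) :: ennreal)"
  proof (cases "g : DD")
   case True
   then have "\<exists>h\<in>H. h ** transpose g : siegel"
    unfolding H_def using DD_reduced[OF True] DD_SL2 by (intro reduced_rows) auto
   then obtain h where h: "h : H" "h ** transpose g : siegel" by blast
   have "indicator siegel (h ** transpose g) <= (\<Sum>h\<in>H. indicator siegel (h ** transpose g) :: ennreal)"
    using H h by (intro member_le_sum) auto
   then show ?thesis using h True by simp
  qed simp
 qed
 also have "... = (\<Sum>h\<in>H. \<integral>\<^sup>+g. indicator siegel (h ** transpose g) \<partial>haar)"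
 proof (rule nn_integral_sum)
  fix h assume "h : H"
  then have "(%g. h ** transpose g) : measurable SL2_borel SL2_borel"
   using H mt by (intro measurable_mult_SL2 measurable_const_SL2) auto
  then show "(%g. indicator siegel (h ** transpose g)) : borel_measurable haar"
   by (rule measurable_compose[where N = SL2_borel, THEN measurable_cong_sets[THEN equalityD1, THEN subsetD, rotated 2]]) auto
 qed
 also have "... = (\<Sum>h\<in>H. emeasure haar siegel)"
 proof (rule sum.cong[OF refl])
  fix h assume "h : H"
  then have h: "h : SL2" using H by auto
  have m: "(%g. indicator siegel (h ** g) :: ennreal) : borel_measurable SL2_borel"
   by (rule measurable_compose[OF measurable_mult_left_SL2[OF h]]) measurable
  have "(\<integral>\<^sup>+g. indicator siegel (h ** transpose g) \<partial>haar) = (\<integral>\<^sup>+g. indicator siegel (h ** g) \<partial>haar)"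
   by (rule nn_integral_haar_transpose[OF m])
  also have "... = (\<integral>\<^sup>+g. indicator siegel g \<partial>haar)" by (rule nn_integral_haar_left[OF _ h]) measurable
  finally show "(\<integral>\<^sup>+g. indicator siegel (h ** transpose g) \<partial>haar) = emeasure haar siegel" by simp
 qed
 also have "... < \<infinity>" using siegel_finite by (simp add: ennreal_mult_less_top ennreal_of_nat_eq_real_of_nat)
 finally show ?thesis .
qed

section \<open>The action\<close>

text \<open>Stated for an arbitrary set because invariance of the measure compares \<open>DD\<close>
  with its left translates, which are again of this kind.\<close>

definition fundam :: "(real^2^2) set => bool" where
 "fundam D \<longleftrightarrow> D : sets SL2_borel & (\<forall>g\<in>SL2. \<exists>!x. x : Gam & g ** x : D)"

lemma fundam_DD: "fundam DD"
 by (simp add: fundam_def DD_unique)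

lemma fundam_translate:
 assumes D: "fundam D" and h: "h : SL2"
 shows "fundam {g : SL2. h ** g : D}"
proof -
 have "(%g. h ** g) -` D \<inter> space SL2_borel : sets SL2_borel"
  using D by (intro measurable_sets[OF measurable_mult_left_SL2[OF h]]) (simp add: fundam_def)
 moreover have "(%g. h ** g) -` D \<inter> space SL2_borel = {g : SL2. h ** g : D}" by auto
 moreover have "\<exists>!x. x : Gam & g ** x : {g : SL2. h ** g : D}" if g: "g : SL2" for g
 proof -
  have "\<exists>!x. x : Gam & h ** g ** x : D" using D h g by (simp add: fundam_def)
  moreover have "x : Gam & h ** g ** x : D \<longleftrightarrow> x : Gam & g ** x : {g : SL2. h ** g : D}" for x
   using g Gam_SL2 by (auto simp: matrix_mul_assoc)
  ultimately show ?thesis by simp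
 qed
 ultimately show ?thesis by (simp add: fundam_def)
qed

lemma fundam_count:
 assumes D: "fundam D" and g: "g : SL2"
 shows "(\<integral>\<^sup>+x. indicator D (g ** x) \<partial>count_space Gam) = 1"
proof -
 have "\<exists>!x. x : Gam & g ** x : D" using D g by (simp add: fundam_def)
 then obtain x0 where x0: "x0 : Gam & g ** x0 : D" "\<forall>x. x : Gam & g ** x : D \<longrightarrow> x = x0"
  by (rule ex1E)
 have "(\<integral>\<^sup>+x. indicator D (g ** x) \<partial>count_space Gam) = (\<integral>\<^sup>+x. indicator {x0} x \<partial>count_space Gam)"
 proof (rule nn_integral_cong)
  fix x assume "x : space (count_space Gam)"
  then have "g ** x : D \<longleftrightarrow> x = x0" using x0(1) x0(2)[rule_format, of x] by auto
  then show "indicator D (g ** x) = (indicator {x0} x :: ennreal)" by (simp add: indicator_def)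
 qed
 then show ?thesis using x0(1) by simp
qed

lemma translate_measurable:
 assumes "D : sets SL2_borel" "x : SL2"
 shows "(%g. indicator D (g ** x) :: ennreal) : borel_measurable SL2_borel"
 by (rule measurable_compose[OF measurable_mult_right_SL2[OF assms(2)]]) (use assms in auto)

text \<open>Countably many right translates of the domain cover the group, so it cannot be a null
  set.\<close>

lemma DD_pos: "0 < emeasure haar DD"
proof (rule ccontr)
 assume "\<not> ?thesis"
 then have z: "emeasure haar DD = 0" by simp
 have "emeasure haar SL2 = (\<integral>\<^sup>+g. 1 \<partial>haar)" by simp
 also have "... = (\<integral>\<^sup>+g. (\<integral>\<^sup>+x. indicator DD (g ** x) \<partial>count_space Gam) \<partial>haar)"
  by (intro nn_integral_cong) (simp add: fundam_count[OF fundam_DD])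
 also have "... = (\<integral>\<^sup>+x. (\<integral>\<^sup>+g. indicator DD (g ** x) \<partial>haar) \<partial>count_space Gam)"
  by (rule nn_integral_count_space_nn_integral[OF countable_Gam])
    (use translate_measurable[OF DD_sets Gam_SL2] in \<open>simp cong: measurable_cong_sets\<close>)
 also have "... = (\<integral>\<^sup>+x. 0 \<partial>count_space Gam)"
 proof (rule nn_integral_cong)
  fix x assume "x : space (count_space Gam)"
  then have "(\<integral>\<^sup>+g. indicator DD (g ** x) \<partial>haar) = (\<integral>\<^sup>+g. indicator DD g \<partial>haar)"
   by (intro nn_integral_haar_right) (auto simp: Gam_SL2)
  then show "(\<integral>\<^sup>+g. indicator DD (g ** x) \<partial>haar) = 0" using z by simp
 qed
 finally show False using haar_SL2_pos by simp
qed

lemma fundam_sum: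
 assumes D: "fundam D" and D': "fundam D'" and F: "F : borel_measurable (SL2_borel \<Otimes>\<^sub>M Om)"
 shows "(\<integral>\<^sup>+w. \<integral>\<^sup>+g. indicator D g * F (g, w) \<partial>haar \<partial>Om)
  = (\<integral>\<^sup>+x. (\<integral>\<^sup>+w. \<integral>\<^sup>+g. indicator D g * indicator D' (g ** x) * F (g, w) \<partial>haar \<partial>Om) \<partial>count_space Gam)"
proof -
 have [measurable]: "D : sets SL2_borel" "D' : sets SL2_borel" using D D' by (auto simp: fundam_def)
 have pm: "(%z. indicator D (snd z) * indicator D' (snd z ** x) * F (snd z, fst z)) : borel_measurable (Om \<Otimes>\<^sub>M haar)" if "x : Gam" for x
 proof -
  have "(%z. indicator D' (snd z ** x) :: ennreal) : borel_measurable (Om \<Otimes>\<^sub>M haar)"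
   by (rule measurable_compose[OF _ translate_measurable[OF _ Gam_SL2[OF that]]]) auto
  moreover have "(%z. F (snd z, fst z)) : borel_measurable (Om \<Otimes>\<^sub>M haar)"
   by (rule measurable_compose[OF _ F]) measurable
  ultimately show ?thesis by measurable
 qed
 have gm: "(%g. indicator D g * indicator D' (g ** x) * F (g, w)) : borel_measurable haar" if "x : Gam" "w : space Om" for x w
  using measurable_compose[OF measurable_Pair1'[OF that(2)] pm[OF that(1)]] by simp
 have "(\<integral>\<^sup>+w. \<integral>\<^sup>+g. indicator D g * F (g, w) \<partial>haar \<partial>Om)
   = (\<integral>\<^sup>+w. \<integral>\<^sup>+x. \<integral>\<^sup>+g. indicator D g * indicator D' (g ** x) * F (g, w) \<partial>haar \<partial>count_space Gam \<partial>Om)"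
 proof (rule nn_integral_cong)
  fix w assume w: "w : space Om"
  have "(\<integral>\<^sup>+g. indicator D g * F (g, w) \<partial>haar) = (\<integral>\<^sup>+g. \<integral>\<^sup>+x. indicator D g * indicator D' (g ** x) * F (g, w) \<partial>count_space Gam \<partial>haar)"
  proof (rule nn_integral_cong)
   fix g assume "g : space haar"
   then have g: "g : SL2" by simp
   have "(\<integral>\<^sup>+x. indicator D g * indicator D' (g ** x) * F (g, w) \<partial>count_space Gam)
     = (\<integral>\<^sup>+x. (indicator D g * F (g, w)) * indicator D' (g ** x) \<partial>count_space Gam)"
    by (intro nn_integral_cong) (simp add: mult_ac)
   also have "... = (indicator D g * F (g, w)) * 1"
    by (subst nn_integral_cmult) (auto simp: fundam_count[OF D' g])
   finally show "indicator D g * F (g, w) = (\<integral>\<^sup>+x. indicator D g * indicator D' (g ** x) * F (g, w) \<partial>count_space Gam)" by simp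
  qed
  also have "... = (\<integral>\<^sup>+x. \<integral>\<^sup>+g. indicator D g * indicator D' (g ** x) * F (g, w) \<partial>haar \<partial>count_space Gam)"
   by (rule nn_integral_count_space_nn_integral[OF countable_Gam gm[OF _ w]])
  finally show "(\<integral>\<^sup>+g. indicator D g * F (g, w) \<partial>haar) = (\<integral>\<^sup>+x. \<integral>\<^sup>+g. indicator D g * indicator D' (g ** x) * F (g, w) \<partial>haar \<partial>count_space Gam)" .
 qed
 also have "... = (\<integral>\<^sup>+x. (\<integral>\<^sup>+w. \<integral>\<^sup>+g. indicator D g * indicator D' (g ** x) * F (g, w) \<partial>haar \<partial>Om) \<partial>count_space Gam)"
 proof (rule nn_integral_count_space_nn_integral[OF countable_Gam])
  fix x assume "x : Gam"
  from haar.borel_measurable_nn_integral[of "%w g. indicator D g * indicator D' (g ** x) * F (g, w)" Om] pm[OF this]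
  show "(%w. \<integral>\<^sup>+g. indicator D g * indicator D' (g ** x) * F (g, w) \<partial>haar) : borel_measurable Om"
   by (simp add: case_prod_beta')
 qed
 finally show ?thesis .
qed

text \<open>Either domain is cut into pieces by the translates of the other, and each piece is moved
  across. The twist by a rotation that this causes is absorbed by invariance of the circle
  measure.\<close>

lemma fundam_exchange:
 assumes D: "fundam D" and D': "fundam D'" and F: "F : borel_measurable (SL2_borel \<Otimes>\<^sub>M Om)"
  and inv: "\<And>g x w. g : SL2 ==> x : Gam ==> w : {0..<1} ==> F (g ** x, w) = F (g, rot (hom x) w)"
 shows "(\<integral>\<^sup>+w. \<integral>\<^sup>+g. indicator D g * F (g, w) \<partial>haar \<partial>Om) = (\<integral>\<^sup>+w. \<integral>\<^sup>+g. indicator D' g * F (g, w) \<partial>haar \<partial>Om)"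
proof -
 have [measurable]: "D : sets SL2_borel" "D' : sets SL2_borel" using D D' by (auto simp: fundam_def)
 define U where "U y = (\<integral>\<^sup>+w. \<integral>\<^sup>+g. indicator D' g * indicator D (g ** y) * F (g, w) \<partial>haar \<partial>Om)" for y
 have T: "(\<integral>\<^sup>+w. \<integral>\<^sup>+g. indicator D g * indicator D' (g ** x) * F (g, w) \<partial>haar \<partial>Om) = U (adj2 x)" if x: "x : Gam" for x
 proof -
  note xS = Gam_SL2[OF x]
  have ax: "adj2 x : Gam" "adj2 x : SL2" using Gam_adj2[OF x] Gam_SL2[OF Gam_adj2[OF x]] by auto
  define H where "H w = (\<integral>\<^sup>+g. indicator D' g * indicator D (g ** adj2 x) * F (g, w) \<partial>haar)" for w
  have Hm: "H : borel_measurable Om"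
  proof -
   have 1: "(%z. indicator D (snd z ** adj2 x) :: ennreal) : borel_measurable (Om \<Otimes>\<^sub>M haar)"
    by (rule measurable_compose[OF _ translate_measurable[OF _ ax(2)]]) auto
   have 2: "(%z. F (snd z, fst z)) : borel_measurable (Om \<Otimes>\<^sub>M haar)"
    by (rule measurable_compose[OF _ F]) measurable
   have "(%(w, g). indicator D' g * indicator D (g ** adj2 x) * F (g, w)) : borel_measurable (Om \<Otimes>\<^sub>M haar)"
    unfolding case_prod_beta' using 1 2 by measurable
   then show ?thesis unfolding H_def by (rule haar.borel_measurable_nn_integral)
  qed
  have "(\<integral>\<^sup>+g. indicator D g * indicator D' (g ** x) * F (g, w) \<partial>haar) = H (rot (- hom x) w)" if w: "w : space Om" for w
  proof -
   have m: "(%g. indicator D g * indicator D' (g ** x) * F (g, w)) : borel_measurable SL2_borel"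
   proof -
    have "(%g. F (g, w)) : borel_measurable SL2_borel" using measurable_compose[OF measurable_Pair2'[OF w] F] .
    then show ?thesis using translate_measurable[OF _ xS, of D'] by measurable
   qed
   have "(\<integral>\<^sup>+g. indicator D g * indicator D' (g ** x) * F (g, w) \<partial>haar)
    = (\<integral>\<^sup>+g. indicator D (g ** adj2 x) * indicator D' (g ** adj2 x ** x) * F (g ** adj2 x, w) \<partial>haar)"
    by (rule nn_integral_haar_right[OF m ax(2), symmetric])
   also have "... = H (rot (- hom x) w)"
    unfolding H_def
    by (intro nn_integral_cong) (use w ax xS in \<open>simp add: inv hom_adj2[OF x] mult_ac\<close>)
   finally show ?thesis .
  qed
  then have "(\<integral>\<^sup>+w. \<integral>\<^sup>+g. indicator D g * indicator D' (g ** x) * F (g, w) \<partial>haar \<partial>Om) = (\<integral>\<^sup>+w. H (rot (- hom x) w) \<partial>Om)"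
   by (rule nn_integral_cong)
  also have "... = (\<integral>\<^sup>+w. H w \<partial>Om)" by (rule nn_integral_rot[OF Hm])
  finally show ?thesis unfolding H_def U_def .
 qed
 have "(\<integral>\<^sup>+w. \<integral>\<^sup>+g. indicator D g * F (g, w) \<partial>haar \<partial>Om) = (\<integral>\<^sup>+x. U (adj2 x) \<partial>count_space Gam)"
  unfolding fundam_sum[OF D D' F] by (rule nn_integral_cong) (simp add: T)
 also have "... = (\<integral>\<^sup>+x. U x \<partial>count_space Gam)"
  by (rule nn_integral_bij_count_space) (auto intro!: bij_betwI[where g = adj2] simp: Gam_adj2)
 also have "... = (\<integral>\<^sup>+w. \<integral>\<^sup>+g. indicator D' g * F (g, w) \<partial>haar \<partial>Om)"
  unfolding fundam_sum[OF D' D F] U_def ..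
 finally show ?thesis .
qed

section \<open>The quotient space and the action on it\<close>

definition MD :: "(real^2^2) measure" where
 "MD = restrict_space (uniform_measure haar DD) DD"

lemma space_MD [simp]: "space MD = DD"
 by (auto simp: MD_def space_restrict_space DD_SL2)

lemma sets_MD: "sets MD = sets (restrict_space SL2_borel DD)"
 by (simp add: MD_def sets_restrict_space)

lemma DD_nontrivial: "emeasure haar DD ~= 0" "emeasure haar DD ~= \<infinity>"
 using DD_pos DD_finite by auto

lemma prob_space_MD: "prob_space MD"
proof (rule prob_spaceI)
 have "emeasure MD (space MD) = emeasure (uniform_measure haar DD) DD"
  unfolding MD_def using DD_SL2
  by (subst emeasure_restrict_space) (auto simp: space_restrict_space Int_absorb2 subsetI)
 then show "emeasure MD (space MD) = 1" using emeasure_uniform_measure_1[OF DD_nontrivial] by simp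
qed

interpretation MD: prob_space MD by (rule prob_space_MD)

lemma measurable_MD_SL2: "(%x. x) : measurable MD SL2_borel"
proof -
 have "(%x. x) : measurable (restrict_space SL2_borel DD) SL2_borel" by (rule measurable_restrict_space1) simp
 then show ?thesis using sets_MD by (simp cong: measurable_cong_sets)
qed

lemma measurable_to_MD:
 assumes "f : measurable M SL2_borel" "\<And>x. x : space M ==> f x : DD"
 shows "f : measurable M MD"
proof -
 have "f : measurable M (restrict_space SL2_borel DD)" using assms by (intro measurable_restrict_space2) auto
 then show ?thesis using sets_MD by (simp cong: measurable_cong_sets)
qed

lemma nn_integral_MD:
 assumes f: "f : borel_measurable SL2_borel"
 shows "(\<integral>\<^sup>+g. f g \<partial>MD) = (\<integral>\<^sup>+g. indicator DD g * f g \<partial>haar) / emeasure haar DD"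
proof -
 have fh: "f : borel_measurable haar" using f by (simp cong: measurable_cong_sets)
 have "(\<integral>\<^sup>+g. f g \<partial>MD) = (\<integral>\<^sup>+g. f g * indicator DD g \<partial>uniform_measure haar DD)"
  unfolding MD_def by (subst nn_integral_restrict_space) (auto simp: DD_SL2 Int_absorb2 subsetI)
 also have "... = (\<integral>\<^sup>+g. f g * indicator DD g * indicator DD g \<partial>haar) / emeasure haar DD"
  using fh by (intro nn_integral_uniform_measure) auto
 also have "(%g. f g * indicator DD g * indicator DD g) = (%g. indicator DD g * f g)"
  by (auto split: split_indicator)
 finally show ?thesis .
qed

definition YY :: "((real^2^2) \<times> real) measure" where
 "YY = MD \<Otimes>\<^sub>M Om"

lemma space_YY [simp]: "space YY = DD \<times> {0..<1}"
 by (simp add: YY_def space_pair_measure)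

lemma prob_space_YY: "prob_space YY"
proof -
 interpret pair_prob_space MD Om ..
 show ?thesis unfolding YY_def by (rule P.prob_space_axioms)
qed

text \<open>Chooses the representative in \<open>DD\<close> of a class, where
  \<open>(g ** x, w)\<close> is identified with \<open>(g, rot (hom x) w)\<close> for
  \<open>x\<close> in \<open>Gam\<close>.\<close>

definition proj :: "(real^2^2) \<times> real => (real^2^2) \<times> real" where
 "proj z = (fst z ** sel (fst z), rot (- hom (sel (fst z))) (snd z))"

lemma measurable_proj: "proj : measurable (SL2_borel \<Otimes>\<^sub>M Om) YY"
 unfolding YY_def proj_def[abs_def]
proof (rule measurable_Pair)
 have s: "(%z. sel (fst z)) : measurable (SL2_borel \<Otimes>\<^sub>M Om) (count_space Gam)"
  by (rule measurable_compose[OF measurable_fst measurable_sel])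
 have "(%z. fst z ** sel (fst z)) : measurable (SL2_borel \<Otimes>\<^sub>M Om) SL2_borel"
  by (rule measurable_compose_countable'[OF _ s countable_Gam])
    (intro measurable_mult_SL2 measurable_const_SL2 measurable_fst Gam_SL2)
 then show "(%z. fst z ** sel (fst z)) : measurable (SL2_borel \<Otimes>\<^sub>M Om) MD"
  by (rule measurable_to_MD) (auto simp: space_pair_measure sel)
 show "(%z. rot (- hom (sel (fst z))) (snd z)) : measurable (SL2_borel \<Otimes>\<^sub>M Om) Om"
  by (rule measurable_compose_countable'[OF _ s countable_Gam])
    (rule measurable_compose[OF measurable_snd measurable_rot])
qed

lemma proj_in_space: "g : SL2 ==> proj (g, w) : space YY"
 by (simp add: proj_def sel)

lemma proj_id: "y : space YY ==> proj y = y"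
 by (auto simp: proj_def sel_DD hom_one rot_0)

lemma proj_mult:
 assumes "g : SL2" "x : Gam"
 shows "proj (g ** x, w) = proj (g, rot (hom x) w)"
proof -
 have "g ** x ** (adj2 x ** sel g) = g ** sel g" using Gam_SL2[OF assms(2)] by (simp flip: matrix_mul_assoc)
 moreover have "hom (adj2 x ** sel g) = - hom x + hom (sel g)"
  using assms sel by (simp add: hom_mult Gam_adj2 hom_adj2)
 ultimately show ?thesis using assms by (simp add: proj_def sel_mult rot_rot)
qed

definition actY :: "real^2^2 => (real^2^2) \<times> real => (real^2^2) \<times> real" where
 "actY g y = proj (g ** fst y, snd y)"

lemma actY_proj:
 assumes "g : SL2" "h : SL2"
 shows "actY g (proj (h, w)) = proj (g ** h, w)"
proof -
 have "actY g (proj (h, w)) = proj (g ** h ** sel h, rot (- hom (sel h)) w)"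
  by (simp add: actY_def proj_def[of "(h, w)"] matrix_mul_assoc)
 also have "... = proj (g ** h, rot (hom (sel h)) (rot (- hom (sel h)) w))"
  using assms sel by (intro proj_mult) auto
 also have "... = proj (g ** h, w)" by (simp add: proj_def rot_rot)
 finally show ?thesis .
qed

lemma nn_integral_YY:
 assumes f: "f : borel_measurable YY"
 shows "(\<integral>\<^sup>+y. f y \<partial>YY) = (\<integral>\<^sup>+w. \<integral>\<^sup>+g. indicator DD g * f (proj (g, w)) \<partial>haar \<partial>Om) / emeasure haar DD"
proof -
 interpret pair_prob_space MD Om ..
 have fm: "(%z. f (proj z)) : borel_measurable (SL2_borel \<Otimes>\<^sub>M Om)" by (rule measurable_compose[OF measurable_proj f])
 have "(\<integral>\<^sup>+y. f y \<partial>YY) = (\<integral>\<^sup>+w. \<integral>\<^sup>+g. f (g, w) \<partial>MD \<partial>Om)"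
  unfolding YY_def using f by (subst nn_integral_snd[symmetric]) (auto simp: YY_def)
 also have "... = (\<integral>\<^sup>+w. (\<integral>\<^sup>+g. indicator DD g * f (proj (g, w)) \<partial>haar) / emeasure haar DD \<partial>Om)"
 proof (rule nn_integral_cong)
  fix w assume w: "w : space Om"
  have "(\<integral>\<^sup>+g. f (g, w) \<partial>MD) = (\<integral>\<^sup>+g. f (proj (g, w)) \<partial>MD)"
   by (rule nn_integral_cong) (use w in \<open>simp add: proj_id\<close>)
  also have "... = (\<integral>\<^sup>+g. indicator DD g * f (proj (g, w)) \<partial>haar) / emeasure haar DD"
   by (rule nn_integral_MD) (rule measurable_compose[OF measurable_Pair2'[OF w] fm])
  finally show "(\<integral>\<^sup>+g. f (g, w) \<partial>MD) = (\<integral>\<^sup>+g. indicator DD g * f (proj (g, w)) \<partial>haar) / emeasure haar DD" .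
 qed
 also have "... = (\<integral>\<^sup>+w. \<integral>\<^sup>+g. indicator DD g * f (proj (g, w)) \<partial>haar \<partial>Om) / emeasure haar DD"
 proof (rule nn_integral_divide)
  have "(%z. f (proj (snd z, fst z))) : borel_measurable (Om \<Otimes>\<^sub>M haar)"
   by (rule measurable_compose[OF _ fm]) measurable
  then have "(%(w, g). indicator DD g * f (proj (g, w))) : borel_measurable (Om \<Otimes>\<^sub>M haar)"
   unfolding case_prod_beta' by measurable
  then show "(%w. \<integral>\<^sup>+g. indicator DD g * f (proj (g, w)) \<partial>haar) : borel_measurable Om"
   by (rule haar.borel_measurable_nn_integral)
 qed
 finally show ?thesis .
qed

text \<open>Left translation carries \<open>DD\<close> to another fundamental domain, over which an
  equivariant function has the same integral.\<close>

lemma actY_distr: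
 assumes h: "h : SL2"
 shows "actY h : measurable YY YY" "distr YY YY (actY h) = YY"
proof -
 have "(%y. (h ** fst y, snd y)) : measurable YY (SL2_borel \<Otimes>\<^sub>M Om)"
  unfolding YY_def using h measurable_compose[OF measurable_fst measurable_MD_SL2]
  by (intro measurable_Pair measurable_mult_SL2 measurable_const_SL2) auto
 then show m: "actY h : measurable YY YY"
  unfolding actY_def[abs_def] by (rule measurable_compose[OF _ measurable_proj])
 show "distr YY YY (actY h) = YY"
 proof (rule measure_eqI)
  fix A assume "A : sets (distr YY YY (actY h))"
  then have A [measurable]: "A : sets YY" by simp
  define F where "F z = (indicator A (proj z) :: ennreal)" for z
  have F: "F : borel_measurable (SL2_borel \<Otimes>\<^sub>M Om)"
   unfolding F_def by (rule measurable_compose[OF measurable_proj]) measurable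
  have inv: "F (g ** x, w) = F (g, rot (hom x) w)" if "g : SL2" "x : Gam" for g x w
   unfolding F_def proj_mult[OF that] ..
  define D where "D = {g : SL2. adj2 h ** g : DD}"
  have D: "fundam D" unfolding D_def using h by (intro fundam_translate[OF fundam_DD]) simp
  have Dh: "h ** g : D \<longleftrightarrow> g : DD" if "g : SL2" for g using h that by (simp add: D_def)
  have "emeasure (distr YY YY (actY h)) A = (\<integral>\<^sup>+y. indicator A y \<partial>distr YY YY (actY h))" by simp
  also have "... = (\<integral>\<^sup>+y. indicator A (actY h y) \<partial>YY)" using m by (subst nn_integral_distr) auto
  also have "... = (\<integral>\<^sup>+w. \<integral>\<^sup>+g. indicator DD g * indicator A (actY h (proj (g, w))) \<partial>haar \<partial>Om) / emeasure haar DD"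
   using m by (subst nn_integral_YY) auto
  also have "(\<integral>\<^sup>+w. \<integral>\<^sup>+g. indicator DD g * indicator A (actY h (proj (g, w))) \<partial>haar \<partial>Om)
   = (\<integral>\<^sup>+w. \<integral>\<^sup>+g. indicator D g * F (g, w) \<partial>haar \<partial>Om)"
  proof (rule nn_integral_cong)
   fix w assume w: "w : space Om"
   have "(\<integral>\<^sup>+g. indicator DD g * indicator A (actY h (proj (g, w))) \<partial>haar) = (\<integral>\<^sup>+g. indicator D (h ** g) * F (h ** g, w) \<partial>haar)"
    by (rule nn_integral_cong) (use h in \<open>simp add: actY_proj F_def Dh indicator_def\<close>)
   also have "... = (\<integral>\<^sup>+g. indicator D g * F (g, w) \<partial>haar)"
   proof (rule nn_integral_haar_left[OF _ h])
    have "D : sets SL2_borel" using D unfolding fundam_def by (rule conjunct1)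
    moreover have "(%g. F (g, w)) : borel_measurable SL2_borel" by (rule measurable_compose[OF measurable_Pair2'[OF w] F])
    ultimately show "(%g. indicator D g * F (g, w)) : borel_measurable SL2_borel" by measurable
   qed
   finally show "(\<integral>\<^sup>+g. indicator DD g * indicator A (actY h (proj (g, w))) \<partial>haar) = (\<integral>\<^sup>+g. indicator D g * F (g, w) \<partial>haar)" .
  qed
  also have "... = (\<integral>\<^sup>+w. \<integral>\<^sup>+g. indicator DD g * F (g, w) \<partial>haar \<partial>Om)"
   by (rule fundam_exchange[OF D fundam_DD F inv])
  also have "... / emeasure haar DD = (\<integral>\<^sup>+y. indicator A y \<partial>YY)"
   unfolding F_def by (rule nn_integral_YY[symmetric]) measurable
  finally show "emeasure (distr YY YY (actY h)) A = emeasure YY A" by simp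
 qed simp
qed

interpretation YS: SL2_pmp YY actY
proof (rule SL2_pmp.intro[OF prob_space_YY], unfold_locales)
 have "(%z. (fst z ** fst (snd z), snd (snd z))) : measurable (SL2_borel \<Otimes>\<^sub>M YY) (SL2_borel \<Otimes>\<^sub>M Om)"
  unfolding YY_def using measurable_compose[OF measurable_compose[OF measurable_snd measurable_fst] measurable_MD_SL2]
  by (intro measurable_Pair measurable_mult_SL2) auto
 from measurable_compose[OF this measurable_proj]
 show "(%(g, x). actY g x) : measurable (SL2_borel \<Otimes>\<^sub>M YY) YY"
  by (simp add: actY_def case_prod_beta')
 show "actY (mat 1) x = x" if "x : space YY" for x
  using proj_id[OF that] by (simp add: actY_def)
 show "actY (g ** h) x = actY g (actY h x)" if "g : SL2" "h : SL2" "x : space YY" for g h x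
 proof -
  have "fst x : SL2" using that DD_SL2 by auto
  then have "actY g (actY h x) = proj (g ** (h ** fst x), snd x)"
   unfolding actY_def[of h] using that by (intro actY_proj) auto
  then show ?thesis by (simp add: actY_def matrix_mul_assoc)
 qed
 show "distr YY YY (actY g) = YY" if "g : SL2" for g using actY_distr[OF that] by simp
qed

section \<open>Ergodicity of the extension\<close>

lemma AE_haar_right:
 assumes x: "x : SL2" and P: "Measurable.pred SL2_borel P" and ae: "AE g in haar. P g"
 shows "AE g in haar. P (g ** x)"
proof -
 have N [measurable]: "{g : SL2. \<not> P g} : sets SL2_borel"
 proof -
  have "Measurable.pred SL2_borel (%g. \<not> P g)" using P by measurable
  then show ?thesis by (simp add: pred_def)
 qed
 have "(\<integral>\<^sup>+g. indicator {g : SL2. \<not> P g} (g ** x) \<partial>haar) = (\<integral>\<^sup>+g. indicator {g : SL2. \<not> P g} g \<partial>haar)"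
  using P by (intro nn_integral_haar_right x) (auto simp: pred_def intro!: borel_measurable_indicator)
 also have "... = 0"
  by (subst nn_integral_0_iff_AE) (use P ae in \<open>auto elim!: eventually_mono simp: pred_def\<close>)
 finally have "AE g in haar. indicator {g : SL2. \<not> P g} (g ** x) = (0::ennreal)"
  using P translate_measurable[OF _ x, of "{g : SL2. \<not> P g}"]
  by (subst (asm) nn_integral_0_iff_AE) (auto simp: pred_def cong: measurable_cong_sets)
 then show ?thesis using AE_space by eventually_elim (use x in \<open>auto split: split_indicator_asm\<close>)
qed

lemma AE_const_haar: "(AE g in haar. P) ==> P"
 using haar_SL2_pos by (simp add: eventually_const ae_filter_eq_bot_iff)

lemma AE_const_MD: "(AE g in MD. P) ==> P"
 using MD.emeasure_space_1 by (simp add: eventually_const ae_filter_eq_bot_iff)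

text \<open>Lifted to the group times the circle, an invariant function is almost everywhere
  constant in the group variable. What remains is a function of the circle, and translating by an
  element of \<open>Gam\<close> with \<open>hom\<close> equal to one shows it to be invariant under
  the irrational rotation.\<close>

lemma YY_ergodic:
 assumes P: "YS.bfun C P" and inv: "\<And>g. g : SL2 ==> AE y in YY. P (actY g y) = P y"
 shows "\<exists>c. AE y in YY. P y = c"
proof -
 define Pt where "Pt z = P (proj z)" for z
 have Pm [measurable]: "P : borel_measurable YY" using P by (simp add: YS.bfun_def)
 have Ptm: "Pt : borel_measurable (SL2_borel \<Otimes>\<^sub>M Om)"
  unfolding Pt_def[abs_def] by (rule measurable_compose[OF measurable_proj Pm])
 have Ptw: "(%g. Pt (g, w)) : borel_measurable SL2_borel" if "w : {0..<1}" for w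
  by (rule measurable_compose[OF measurable_Pair2' Ptm]) (use that in simp)
 have PtC: "\<bar>Pt (g, w)\<bar> <= C" if "g : SL2" for g w
  unfolding Pt_def by (rule YS.bfun_bound[OF P proj_in_space[OF that]])
 \<comment> \<open>An auxiliary probability measure with a density for \<open>haar\<close>:
   integrating against it reads off the constant value in the group variable, measurably in the
   circle variable.\<close>
 interpret b: prob_space "ball_law 24" by (rule prob_space_ball_law) simp
 define P0 where "P0 w = (\<integral>g. Pt (g, w) \<partial>ball_law 24)" for w
 have sb: "sets (ball_law 24) = sets SL2_borel" by (simp add: ball_law_def)
 have spb: "space (ball_law 24) = SL2" by (simp add: ball_law_def)
 have P0m: "P0 : borel_measurable Om"
 proof -
  have s: "sets (Om \<Otimes>\<^sub>M ball_law 24) = sets (Om \<Otimes>\<^sub>M SL2_borel)"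
   by (rule sets_pair_measure_cong) (simp_all add: sb)
  have "(%z. Pt (snd z, fst z)) : borel_measurable (Om \<Otimes>\<^sub>M SL2_borel)"
   by (rule measurable_compose[OF _ Ptm]) measurable
  then have "(%(w, g). Pt (g, w)) : borel_measurable (Om \<Otimes>\<^sub>M ball_law 24)"
   unfolding case_prod_beta' using s by (simp cong: measurable_cong_sets)
  then show ?thesis unfolding P0_def by (rule b.borel_measurable_lebesgue_integral)
 qed
 have P0C: "\<bar>P0 w\<bar> <= C" if "w : {0..<1}" for w
 proof -
  have C: "0 <= C" by (rule YS.bfun_nonneg[OF P])
  have "\<bar>P0 w\<bar> <= (\<integral>g. C \<partial>ball_law 24)"
   unfolding P0_def
   by (rule order_trans[OF integral_abs_bound integral_mono'])
     (use PtC C spb in auto)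
  then show ?thesis using b.prob_space spb by simp
 qed
 have P0I: "P0 w = c" if w: "w : {0..<1}" and ae: "AE g in haar. Pt (g, w) = c" for w c
 proof -
  have "AE g in ball_law 24. Pt (g, w) = c"
   unfolding ball_law_def by (rule AE_uniform_measureI) (use ae in auto)
  then have "P0 w = (\<integral>g. c \<partial>ball_law 24)"
   unfolding P0_def using Ptw[OF w] sb by (intro integral_cong_AE) (auto cong: measurable_cong_sets)
  then show ?thesis using b.prob_space spb by simp
 qed
 interpret HY: pair_sigma_finite haar YY
  by (intro pair_sigma_finite.intro haar.sigma_finite_measure_axioms YS.sigma_finite_measure_axioms)
 have "AE g in haar. AE y in YY. P (actY g y) = P y"
  using inv by (intro AE_I2[where M = haar]) simp
 then have ae1: "AE y in YY. AE g in haar. P (actY g y) = P y"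
 proof (subst (asm) HY.AE_commute)
  have "(%z. P (actY (fst z) (snd z))) : borel_measurable (haar \<Otimes>\<^sub>M YY)"
  proof -
   have s: "sets (haar \<Otimes>\<^sub>M YY) = sets (SL2_borel \<Otimes>\<^sub>M YY)" by (rule sets_pair_measure_cong) simp_all
   have "(%z. P (actY (fst z) (snd z))) : borel_measurable (SL2_borel \<Otimes>\<^sub>M YY)"
    using measurable_compose[OF YS.act_meas Pm] by (simp add: case_prod_beta')
   then show ?thesis using s by (simp cong: measurable_cong_sets)
  qed
  then show "{z : space (haar \<Otimes>\<^sub>M YY). P (actY (fst z) (snd z)) = P (snd z)} : sets (haar \<Otimes>\<^sub>M YY)"
   by measurable
 qed
 have ae2: "AE y in YY. P y = P0 (snd y) & (AE g in haar. Pt (g, snd y) = P0 (snd y))"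
  using ae1 AE_space
 proof eventually_elim
  case (elim y)
  then obtain d w where y: "y = (d, w)" "d : DD" "w : {0..<1}" by auto
  have d: "d : SL2" using y DD_SL2 by auto
  have "AE g in haar. Pt (g ** d, w) = P y"
   using elim(1) by (simp add: actY_def y Pt_def)
  then have "AE g in haar. Pt (g ** adj2 d ** d, w) = P y"
  proof (rule AE_haar_right[rotated 2])
   have "(%g. Pt (g ** d, w)) : borel_measurable SL2_borel"
    by (rule measurable_compose[OF measurable_mult_right_SL2[OF d] Ptw[OF y(3)]])
   then show "Measurable.pred SL2_borel (%g. Pt (g ** d, w) = P y)" by measurable
  qed (use d in simp)
  then have 1: "AE g in haar. Pt (g, w) = P y" using d by (simp flip: matrix_mul_assoc)
  then show ?case using P0I[OF y(3) 1] y by simp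
 qed
 interpret MO: pair_sigma_finite MD Om ..
 from ae2 have "AE y in MD \<Otimes>\<^sub>M Om. AE g in haar. Pt (g, snd y) = P0 (snd y)"
  unfolding YY_def[symmetric] by eventually_elim simp
 from MO.AE_pair[OF this] have "AE d in MD. AE w in Om. AE g in haar. Pt (g, w) = P0 w" by simp
 then have ae3: "AE w in Om. AE g in haar. Pt (g, w) = P0 w" by (rule AE_const_MD)
 have "AE w in Om. P0 (rot 1 w) = P0 w"
  using ae3 AE_rot[OF ae3, of 1] AE_space
 proof eventually_elim
  case (elim w)
  then have w: "w : {0..<1}" by simp
  \<comment> \<open>Right translation by \<open>up 2\<close> leaves the constant unchanged but, as
    \<open>hom (up 2) = 1\<close>, amounts to one step of the rotation.\<close>
  have "AE g in haar. Pt (g ** up 2, w) = P0 w"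
  proof (rule AE_haar_right[OF _ _ elim(1)])
   show "Measurable.pred SL2_borel (%g. Pt (g, w) = P0 w)" using Ptw[OF w] by measurable
  qed simp
  then have "AE g in haar. P0 (rot 1 w) = P0 w"
   using elim(2) AE_space
  proof eventually_elim
   case (elim g)
   then have "Pt (g ** up 2, w) = Pt (g, rot 1 w)"
    unfolding Pt_def by (subst proj_mult) (simp_all add: Gam_up2 hom_up2)
   then show ?case using elim by simp
  qed
  then show ?case by (rule AE_const_haar)
 qed
 from rot_ergodic[OF P0m P0C this] obtain c where c: "AE w in Om. P0 w = c" by auto
 have "AE y in YY. P0 (snd y) = c"
  unfolding YY_def
 proof (rule MO.AE_pair_measure)
  show "{y : space (MD \<Otimes>\<^sub>M Om). P0 (snd y) = c} : sets (MD \<Otimes>\<^sub>M Om)" using P0m by measurable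
  show "AE x in MD. AE y in Om. P0 (snd (x, y)) = c" using c by simp
 qed
 with ae2 have "AE y in YY. P y = c" by eventually_elim simp
 then show ?thesis ..
qed

interpretation YS: SL2_ergodic YY actY
 by (intro SL2_ergodic.intro SL2_ergodic_axioms.intro YS.SL2_pmp_axioms YY_ergodic)

section \<open>Sums over primitive vectors\<close>

lemma borel_measurable_count_sum:
 assumes "countable I" "\<And>i. i : I ==> f i : borel_measurable M"
 shows "(%x. \<integral>\<^sup>+i. f i x \<partial>count_space I :: ennreal) : borel_measurable M"
proof -
 interpret sigma_finite_measure "count_space I"
  by (rule sigma_finite_measure_count_space_countable[OF assms(1)])
 have "(%(x, i). f i x) : borel_measurable (M \<Otimes>\<^sub>M count_space I)"
  unfolding case_prod_beta'
  by (rule measurable_compose_countable'[where f = "%i z. f i (fst z)" and g = snd, OF _ measurable_snd assms(1)])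
    (rule measurable_compose[OF measurable_fst assms(2)])
 then show ?thesis by (rule borel_measurable_nn_integral)
qed

lemma measurable_YY_ident: "(%y. y) : measurable YY (SL2_borel \<Otimes>\<^sub>M Om)"
proof -
 have "(%y. (fst y, snd y)) : measurable YY (SL2_borel \<Otimes>\<^sub>M Om)"
  unfolding YY_def
  by (intro measurable_Pair measurable_compose[OF measurable_fst measurable_MD_SL2] measurable_snd)
 then show ?thesis by simp
qed

lemma measurable_YY: "f : borel_measurable (SL2_borel \<Otimes>\<^sub>M Om) ==> f : borel_measurable YY"
 by (rule measurable_compose[OF measurable_YY_ident])

lemma nn_integral_YY_iter:
 assumes "f : borel_measurable YY"
 shows "(\<integral>\<^sup>+y. f y \<partial>YY) = (\<integral>\<^sup>+d. \<integral>\<^sup>+w. f (d, w) \<partial>Om \<partial>MD)"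
 using assms unfolding YY_def by (rule Om.nn_integral_fst[symmetric])

section \<open>Siegel transforms twisted by the circle\<close>

definition mv :: "real^2^2 => real \<times> real => real \<times> real" where
 "mv g v = (g$1$1 * fst v + g$1$2 * snd v, g$2$1 * fst v + g$2$2 * snd v)"

definition iv :: "int \<times> int => real \<times> real" where
 "iv p = (of_int (fst p), of_int (snd p))"

definition disc :: "real => (real \<times> real) set" where
 "disc e = {v. (fst v)\<^sup>2 + (snd v)^2 < e\<^sup>2}"

lemma mv_mult: "mv (g ** h) v = mv g (mv h v)"
 by (cases g rule: mk2_cases; cases h rule: mk2_cases) (simp add: mv_def algebra_simps)

lemma mv_one [simp]: "mv (mat 1) v = v"
 by (simp add: mv_def mat_1_mk2)

lemma iv_vact: "x : Gam ==> iv (vact x p) = mv x (iv p)"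
 by (elim Gam_cases) (simp add: iv_def mv_def, simp add: mki_def)

lemma mv_disc: "mv g (iv p) : disc e \<longleftrightarrow> len2 g p < e\<^sup>2"
 by (simp add: disc_def mv_def iv_def len2_def lensq_def)

lemma mv_nonzero: "g : SL2 ==> p : VV ==> mv g (iv p) ~= (0, 0)"
 using len2_pos[of g p] by (auto simp: mv_def iv_def len2_def lensq_def)

lemma plane_CollectI:
 fixes P :: "real \<times> real => bool"
 shows "Measurable.pred (borel \<Otimes>\<^sub>M borel) P ==> {v. P v} : sets borel"
 by (simp add: pred_def borel_prod)

lemma disc_sets [measurable]: "disc e : sets borel"
 unfolding disc_def by (rule plane_CollectI) measurable

lemma measurable_mv [measurable]: "(%g. mv g v) : measurable SL2_borel borel"
 unfolding mv_def borel_prod[symmetric] by measurable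

lemma measurable_mv2 [measurable]: "mv g : measurable borel borel"
 unfolding mv_def borel_prod[symmetric] by measurable

text \<open>The horoball of a cusp vector is never empty: the matrix \<open>g\<close> sends the
  vector to \<open>(1/2, 0)\<close>.\<close>

lemma kap_vact_VV:
 assumes x: "x : Gam" and p: "p : VV"
 shows "kap p = hom x + kap (vact x p)"
proof -
 obtain i j where q: "vact x p = (i, j)" by force
 then have "odd i" using vact_VV[OF x p] by (simp add: VV_def)
 then have i: "i ~= 0" by auto
 define g where "g = mk2 (1 / (2 * of_int i)) 0 (-2 * of_int j) (2 * of_int i)"
 have "g : SL2" "len2 g (vact x p) < 1"
  using i by (simp_all add: g_def q len2_def power2_eq_square)
 then show ?thesis by (intro kap_vact[OF x _ p])
qed

text \<open>A Siegel transform in which each vector carries the weight evaluated at the circle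
  coordinate rotated by its colour. The rule for \<open>kap\<close> under \<open>Gam\<close>
  compensates the twist of the quotient, so the sum respects the identification.\<close>

definition vsum :: "(real \<times> real) set => (real => ennreal) => (real^2^2) \<times> real => ennreal" where
 "vsum A w z = (\<integral>\<^sup>+p. indicator A (mv (fst z) (iv p)) * w (rot (kap p) (snd z)) \<partial>count_space VV)"

lemma vsum_term_measurable:
 fixes w :: "real => ennreal"
 assumes A [measurable]: "A : sets borel" and w: "w : borel_measurable Om"
 shows "(%z. indicator A (mv (fst z) (iv p)) * w (rot (kap p) (snd z))) : borel_measurable (SL2_borel \<Otimes>\<^sub>M Om)"
proof -
 have "(%z. w (rot (kap p) (snd z))) : borel_measurable (SL2_borel \<Otimes>\<^sub>M Om)"
  by (rule measurable_compose[OF measurable_compose[OF measurable_snd measurable_rot] w])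
 moreover have "(%z. indicator A (mv (fst z) (iv p)) :: ennreal) : borel_measurable (SL2_borel \<Otimes>\<^sub>M Om)"
  by (rule measurable_compose[OF measurable_compose[OF measurable_fst measurable_mv]]) simp
 ultimately show ?thesis by (intro borel_measurable_times_ennreal)
qed

lemma vsum_measurable:
 assumes "A : sets borel" "w : borel_measurable Om"
 shows "vsum A w : borel_measurable (SL2_borel \<Otimes>\<^sub>M Om)"
 unfolding vsum_def[abs_def]
 by (rule borel_measurable_count_sum[OF countable_VV vsum_term_measurable[OF assms]])

lemmas vsum_measurable_YY = measurable_YY[OF vsum_measurable]

lemma vsum_Gam:
 assumes g: "g : SL2" and x: "x : Gam"
 shows "vsum A w (g ** x, t) = vsum A w (g, rot (hom x) t)"
proof -
 have "vsum A w (g ** x, t) = (\<integral>\<^sup>+p. indicator A (mv g (iv (vact x p))) * w (rot (kap (vact x p)) (rot (hom x) t)) \<partial>count_space VV)"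
  unfolding vsum_def
  by (rule nn_integral_cong) (simp add: mv_mult iv_vact[OF x] kap_vact_VV[OF x] rot_rot add.commute)
 also have "... = vsum A w (g, rot (hom x) t)"
  unfolding vsum_def using nn_integral_bij_count_space[OF bij_vact[OF x], of "%p. indicator A (mv g (iv p)) * w (rot (kap p) (rot (hom x) t))"]
  by simp
 finally show ?thesis .
qed

lemma vsum_act:
 assumes g: "g : SL2" and y: "y : space YY"
 shows "vsum A w (actY g y) = vsum A w (g ** fst y, snd y)"
proof -
 let ?h = "g ** fst y" and ?s = "sel (g ** fst y)"
 have h: "?h : SL2" using g y DD_SL2 by auto
 have "vsum A w (actY g y) = vsum A w (?h, rot (hom ?s) (rot (- hom ?s) (snd y)))"
  unfolding actY_def proj_def using sel[OF h] h by (simp add: vsum_Gam)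
 also have "... = vsum A w (?h, snd y)"
  unfolding vsum_def by (simp add: rot_rot)
 finally show ?thesis .
qed

lemma vsum_act_preimage:
 assumes "g : SL2" "y : space YY"
 shows "vsum A w (actY g y) = vsum (mv g -` A) w y"
 unfolding vsum_act[OF assms] by (simp add: vsum_def mv_mult indicator_def)

text \<open>The mean of the untwisted transform is an \<open>SL2\<close>-invariant measure on the
  plane. Upper and lower bounds for discs are all that is used of it.\<close>

definition nu :: "(real \<times> real) set => ennreal" where
 "nu A = (\<integral>\<^sup>+y. vsum A (%_. 1) y \<partial>YY)"

text \<open>For a fixed vector its colour only rotates the weight, which does not change the
  integral over the circle; hence the two factors separate.\<close>

lemma nn_integral_vsum:
 assumes A [measurable]: "A : sets borel" and w: "w : borel_measurable Om"
 shows "(\<integral>\<^sup>+y. vsum A w y \<partial>YY) = nu A * (\<integral>\<^sup>+t. w t \<partial>Om)"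
proof -
 have gen: "(\<integral>\<^sup>+y. vsum A u y \<partial>YY) = (\<integral>\<^sup>+d. \<integral>\<^sup>+p. indicator A (mv d (iv p)) \<partial>count_space VV \<partial>MD) * (\<integral>\<^sup>+t. u t \<partial>Om)"
  if u: "u : borel_measurable Om" for u
 proof -
  have ur: "(%t. u (rot k t)) : borel_measurable Om" for k by (rule measurable_compose[OF measurable_rot u])
  have "(\<integral>\<^sup>+y. vsum A u y \<partial>YY) = (\<integral>\<^sup>+d. \<integral>\<^sup>+t. vsum A u (d, t) \<partial>Om \<partial>MD)"
   by (rule nn_integral_YY_iter[OF vsum_measurable_YY[OF A u]])
  also have "... = (\<integral>\<^sup>+d. \<integral>\<^sup>+p. \<integral>\<^sup>+t. indicator A (mv d (iv p)) * u (rot (kap p) t) \<partial>Om \<partial>count_space VV \<partial>MD)"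
   unfolding vsum_def fst_conv snd_conv
   by (rule nn_integral_cong, rule nn_integral_count_space_nn_integral[OF countable_VV]) (use ur in measurable)
  also have "... = (\<integral>\<^sup>+d. \<integral>\<^sup>+p. indicator A (mv d (iv p)) * (\<integral>\<^sup>+t. u t \<partial>Om) \<partial>count_space VV \<partial>MD)"
   by (intro nn_integral_cong) (simp add: nn_integral_cmult ur nn_integral_rot[OF u])
  also have "... = (\<integral>\<^sup>+d. (\<integral>\<^sup>+p. indicator A (mv d (iv p)) \<partial>count_space VV) * (\<integral>\<^sup>+t. u t \<partial>Om) \<partial>MD)"
   by (intro nn_integral_cong nn_integral_multc) simp
  also have "... = (\<integral>\<^sup>+d. \<integral>\<^sup>+p. indicator A (mv d (iv p)) \<partial>count_space VV \<partial>MD) * (\<integral>\<^sup>+t. u t \<partial>Om)"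
  proof (rule nn_integral_multc, rule borel_measurable_count_sum[OF countable_VV])
   fix p
   have "(%d. indicator A (mv d (iv p)) :: ennreal) : borel_measurable SL2_borel" by measurable
   from measurable_compose[OF measurable_MD_SL2 this]
   show "(%d. indicator A (mv d (iv p)) :: ennreal) : borel_measurable MD" .
  qed
  finally show ?thesis .
 qed
 show ?thesis unfolding nu_def gen[OF w] using gen[of "%_. 1"] by (simp add: Om.emeasure_space_1[simplified])
qed

lemma nu_act:
 assumes g: "g : SL2" and A: "A : sets borel"
 shows "nu (mv g -` A) = nu A"
proof -
 have "nu (mv g -` A) = (\<integral>\<^sup>+y. vsum A (%_. 1) (actY g y) \<partial>YY)"
  unfolding nu_def by (rule nn_integral_cong) (simp add: vsum_act_preimage[OF g])
 also have "... = nu A"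
  unfolding nu_def by (rule YS.nn_integral_act[OF _ g]) (rule vsum_measurable_YY[OF A], simp)
 finally show ?thesis .
qed

lemma nu_subadditive:
 assumes [measurable]: "A : sets borel" "B : sets borel" "C : sets borel"
  and sub: "\<And>v. v : A ==> v ~= (0, 0) ==> v : B \<or> v : C"
 shows "nu A <= nu B + nu C"
proof -
 have "nu A <= (\<integral>\<^sup>+y. vsum B (%_. 1) y + vsum C (%_. 1) y \<partial>YY)"
  unfolding nu_def
 proof (rule nn_integral_mono)
  fix y assume "y : space YY"
  then have y: "fst y : SL2" using DD_SL2 by auto
  have "vsum A (%_. 1) y <= (\<integral>\<^sup>+p. indicator B (mv (fst y) (iv p)) * 1 + indicator C (mv (fst y) (iv p)) * 1 \<partial>count_space VV)"
   unfolding vsum_def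
  proof (rule nn_integral_mono)
   fix p assume "p : space (count_space VV)"
   then show "indicator A (mv (fst y) (iv p)) * 1 <= indicator B (mv (fst y) (iv p)) * 1 + (indicator C (mv (fst y) (iv p)) * 1 :: ennreal)"
    using sub[of "mv (fst y) (iv p)"] mv_nonzero[OF y, of p] by (auto split: split_indicator)
  qed
  also have "... = vsum B (%_. 1) y + vsum C (%_. 1) y"
   unfolding vsum_def by (rule nn_integral_add) auto
  finally show "vsum A (%_. 1) y <= vsum B (%_. 1) y + vsum C (%_. 1) y" .
 qed
 also have "... = nu B + nu C"
  unfolding nu_def by (rule nn_integral_add) (auto intro!: vsum_measurable_YY)
 finally show ?thesis .
qed

lemma nu_mono:
 assumes "A : sets borel" "B : sets borel" "A \<subseteq> B"
 shows "nu A <= nu B"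
 unfolding nu_def vsum_def by (intro nn_integral_mono) (use assms in \<open>auto split: split_indicator\<close>)

lemma vsum_disc_le:
 assumes g: "g : SL2" and e: "e^2 <= 1" and w: "\<And>t. t : {0..<1} ==> w t <= C"
 shows "vsum (disc e) w (g, t) <= 2 * C"
proof -
 define S where "S = {p : VV. len2 g p < e\<^sup>2}"
 have S: "finite S" "card S <= 2" unfolding S_def by (rule finite_short[OF g e], rule card_short[OF g e])
 have "vsum (disc e) w (g, t) <= (\<integral>\<^sup>+p. C * indicator S p \<partial>count_space VV)"
  unfolding vsum_def by (rule nn_integral_mono) (use w in \<open>auto simp: mv_disc S_def split: split_indicator\<close>)
 also have "... = C * emeasure (count_space VV) S"
  by (rule nn_integral_cmult_indicator) (auto simp: S_def)
 also have "... = C * of_nat (card S)" using S by (subst emeasure_count_space) (auto simp: S_def)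
 also have "... <= C * of_nat 2" using S by (intro mult_left_mono of_nat_mono) auto
 finally show ?thesis by (simp add: mult.commute)
qed

lemma nu_disc_1: "nu (disc 1) <= 2"
proof -
 have "nu (disc 1) <= (\<integral>\<^sup>+y. 2 * 1 \<partial>YY)"
  unfolding nu_def
 proof (rule nn_integral_mono)
  fix y assume "y : space YY"
  then obtain d t where "y = (d, t)" "d : SL2" using DD_SL2 by auto
  then show "vsum (disc 1) (%_. 1) y <= 2 * 1" by (simp add: vsum_disc_le[where C = 1, simplified])
 qed
 then show ?thesis using YS.emeasure_space_1 by simp
qed

text \<open>Invariance is averaged over the shears \<open>lo u\<close> with \<open>u\<close> between
  0 and 1. It then suffices to know, vector by vector, for how many \<open>u\<close> the shear
  brings the vector into \<open>A\<close>.\<close>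

lemma nu_shear:
 assumes A [measurable]: "A : sets borel" and B [measurable]: "B : sets borel"
  and le: "\<And>v. (\<integral>\<^sup>+u. indicator {0..1::real} u * indicator A (mv (lo u) v) \<partial>lborel) <= c * indicator B v"
 shows "nu A <= c * nu B"
proof -
 interpret P: pair_sigma_finite lborel YY
  by (intro pair_sigma_finite.intro lborel.sigma_finite_measure_axioms YS.sigma_finite_measure_axioms)
 have lm: "(%(u, v). indicator A (mv (lo u) v) :: ennreal) : borel_measurable (borel \<Otimes>\<^sub>M borel)"
  unfolding mv_def borel_prod[symmetric] case_prod_beta' mk2_nth by measurable
 have lm1: "(%u. indicator A (mv (lo u) v) :: ennreal) : borel_measurable borel" for v
  using measurable_compose[OF measurable_Pair2' lm, of v] by simp
 have m: "(%z. indicator {0..1} (fst z) * indicator A (mv (lo (fst z)) (mv (fst (snd z)) (iv p))) :: ennreal)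
   : borel_measurable (lborel \<Otimes>\<^sub>M YY)" for p
 proof -
  have "(%y. mv (fst y) (iv p)) : measurable YY borel"
   by (rule measurable_compose[OF measurable_compose[OF measurable_YY_ident measurable_fst] measurable_mv])
  from measurable_compose[OF measurable_snd this]
  have "(%z. (fst z, mv (fst (snd z)) (iv p))) : measurable (lborel \<Otimes>\<^sub>M YY) (borel \<Otimes>\<^sub>M borel)"
   by measurable
  from measurable_compose[OF this lm] show ?thesis by simp
 qed
 have "nu A = (\<integral>\<^sup>+u. indicator {0..1::real} u * nu A \<partial>lborel)" by (simp add: nn_integral_multc)
 also have "... = (\<integral>\<^sup>+u. \<integral>\<^sup>+y. \<integral>\<^sup>+p. indicator {0..1} u * indicator A (mv (lo u) (mv (fst y) (iv p))) \<partial>count_space VV \<partial>YY \<partial>lborel)"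
 proof (rule nn_integral_cong)
  fix u :: real
  have u: "lo u : SL2" by simp
  have "(\<integral>\<^sup>+y. \<integral>\<^sup>+p. indicator {0..1} u * indicator A (mv (lo u) (mv (fst y) (iv p))) \<partial>count_space VV \<partial>YY)
    = (\<integral>\<^sup>+y. indicator {0..1} u * vsum (mv (lo u) -` A) (%_. 1) y \<partial>YY)"
   unfolding vsum_def by (subst nn_integral_cmult[symmetric]) (auto simp: indicator_def)
  also have "... = indicator {0..1} u * nu (mv (lo u) -` A)"
   unfolding nu_def
  proof (rule nn_integral_cmult, rule vsum_measurable_YY)
   show "mv (lo u) -` A : sets borel" using measurable_sets[OF measurable_mv2 A, of "lo u"] by simp
  qed simp
  also have "nu (mv (lo u) -` A) = nu A" by (rule nu_act[OF u A])
  finally show "indicator {0..1} u * nu A = (\<integral>\<^sup>+y. \<integral>\<^sup>+p. indicator {0..1} u * indicator A (mv (lo u) (mv (fst y) (iv p))) \<partial>count_space VV \<partial>YY)" ..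
 qed
 also have "... = (\<integral>\<^sup>+y. \<integral>\<^sup>+u. \<integral>\<^sup>+p. indicator {0..1} u * indicator A (mv (lo u) (mv (fst y) (iv p))) \<partial>count_space VV \<partial>lborel \<partial>YY)"
  by (rule P.Fubini'[symmetric], unfold case_prod_beta', rule borel_measurable_count_sum[OF countable_VV m])
 also have "... = (\<integral>\<^sup>+y. \<integral>\<^sup>+p. \<integral>\<^sup>+u. indicator {0..1} u * indicator A (mv (lo u) (mv (fst y) (iv p))) \<partial>lborel \<partial>count_space VV \<partial>YY)"
  by (rule nn_integral_cong, rule nn_integral_count_space_nn_integral[OF countable_VV]) (use lm1 in measurable)
 also have "... <= (\<integral>\<^sup>+y. c * vsum B (%_. 1) y \<partial>YY)"
 proof (rule nn_integral_mono)
  fix y :: "(real^2^2) \<times> real"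
  have "(\<integral>\<^sup>+p. \<integral>\<^sup>+u. indicator {0..1} u * indicator A (mv (lo u) (mv (fst y) (iv p))) \<partial>lborel \<partial>count_space VV)
   <= (\<integral>\<^sup>+p. c * indicator B (mv (fst y) (iv p)) \<partial>count_space VV)"
   by (rule nn_integral_mono) (rule le)
  also have "... = c * vsum B (%_. 1) y" unfolding vsum_def by (subst nn_integral_cmult) auto
  finally show "(\<integral>\<^sup>+p. \<integral>\<^sup>+u. indicator {0..1} u * indicator A (mv (lo u) (mv (fst y) (iv p))) \<partial>lborel \<partial>count_space VV) <= c * vsum B (%_. 1) y" .
 qed
 also have "... = c * nu B" unfolding nu_def by (rule nn_integral_cmult) (auto intro!: vsum_measurable_YY)
 finally show ?thesis .
qed

text \<open>A disc of radius one has measure at most two, as it never holds more than two vectors. A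
  shear brings a given vector into the flat sector \<open>S'\<close> only for a set of parameters of
  length at most \<open>32 * e^2\<close>, so \<open>S'\<close> has small measure. A diagonal matrix
  carries a quarter of the small disc into \<open>S'\<close>, and quarter turns supply the
  rest.\<close>

lemma nu_disc_le:
 assumes e: "0 < e" "e <= 1"
 shows "nu (disc e) <= ennreal (256 * e^2)"
proof (cases "e <= 1 / 4")
 case False
 have "nu (disc e) <= nu (disc 1)"
 proof (rule nu_mono)
  have "e^2 <= 1\<^sup>2" using e by (intro power_mono) auto
  then show "disc e \<subseteq> disc 1" by (auto simp: disc_def)
 qed auto
 also have "... <= 2" by (rule nu_disc_1)
 also have "... <= ennreal (256 * e^2)"
 proof -
  have "(1/4)^2 <= e^2" using False by (intro power_mono) auto
  then have "2 <= 256 * e^2" by (simp add: power2_eq_square)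
  then show ?thesis by (metis ennreal_leI ennreal_numeral)
 qed
 finally show ?thesis .
next
 case True
 define S where "S = {v::real \<times> real. 0 < fst v & fst v < e & \<bar>snd v\<bar> <= fst v}"
 define S' where "S' = {v::real \<times> real. 0 < fst v & fst v < 1 / 4 & \<bar>snd v\<bar> <= 16 * e^2 * fst v}"
 have [measurable]: "S : sets borel" unfolding S_def by (rule plane_CollectI) measurable
 have [measurable]: "S' : sets borel" unfolding S'_def by (rule plane_CollectI) measurable
 have e2: "0 <= 16 * e^2" "16 * e^2 <= 1"
 proof -
  have "e^2 <= (1/4)^2" using e True by (intro power_mono) auto
  then show "16 * e^2 <= 1" by (simp add: power2_eq_square)
 qed simp
 have "nu S' <= ennreal (32 * e^2) * nu (disc 1)"
 proof (rule nu_shear)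
  fix v :: "real \<times> real"
  obtain x y where v: "v = (x, y)" by force
  have mv: "mv (lo u) v = (x, u * x + y)" for u by (simp add: mv_def v)
  show "(\<integral>\<^sup>+u. indicator {0..1} u * indicator S' (mv (lo u) v) \<partial>lborel) <= ennreal (32 * e^2) * indicator (disc 1) v"
  proof (cases "0 < x & x < 1 / 4 & \<bar>y\<bar> <= 2 * x")
   case True
   have "x^2 + y^2 < 1\<^sup>2"
   proof -
    have "\<bar>y\<bar>\<^sup>2 <= (2 * x)^2" using True by (intro power_mono) auto
    moreover have "x^2 <= (1/4)^2" using True by (intro power_mono) auto
    ultimately have "y^2 <= 4 * x^2" "x^2 <= 1 / 16" by (simp_all add: power2_eq_square)
    then show ?thesis by simp
   qed
   then have d: "v : disc 1" by (simp add: disc_def v)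
   have "(\<integral>\<^sup>+u. indicator {0..1} u * indicator S' (mv (lo u) v) \<partial>lborel)
     <= (\<integral>\<^sup>+u. indicator {- y / x - 16 * e^2..- y / x + 16 * e^2} u \<partial>lborel)"
   proof (rule nn_integral_mono)
    fix u :: real
    have "u : {- y / x - 16 * e^2..- y / x + 16 * e^2}" if "\<bar>u * x + y\<bar> <= 16 * e^2 * x"
    proof -
     have "u * x + y = (u + y / x) * x" using True by (simp add: field_simps)
     then have "\<bar>u + y / x\<bar> * x <= 16 * e^2 * x" using that True by (simp add: abs_mult)
     then have "\<bar>u + y / x\<bar> <= 16 * e^2" using True by simp
     then show ?thesis by (auto simp: abs_le_iff)
    qed
    then show "indicator {0..1} u * indicator S' (mv (lo u) v) <= (indicator {- y / x - 16 * e^2..- y / x + 16 * e^2} u :: ennreal)"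
     unfolding mv S'_def by (auto split: split_indicator)
   qed
   also have "... = ennreal (32 * e^2)" using e2 by simp
   finally show ?thesis using d by simp
  next
   case False
   have "indicator {0..1} u * indicator S' (mv (lo u) v) = (0::ennreal)" for u
   proof -
    have "\<not> (0 <= u & u <= 1 & (x, u * x + y) : S')"
    proof
     assume h: "0 <= u & u <= 1 & (x, u * x + y) : S'"
     then have x: "0 < x" "x < 1/4" "\<bar>u * x + y\<bar> <= 16 * e^2 * x" by (auto simp: S'_def)
     have "16 * e^2 * x <= 1 * x" using e2 x by (intro mult_right_mono) auto
     moreover have "0 <= u * x" "u * x <= 1 * x" using h x by (auto intro!: mult_right_mono)
     ultimately have "\<bar>y\<bar> <= 2 * x" using x(3) by (auto simp: abs_le_iff)
     then show False using False x by auto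
    qed
    then show ?thesis unfolding mv by (auto split: split_indicator)
   qed
   then have "(%u. indicator {0..1} u * indicator S' (mv (lo u) v) :: ennreal) = (%_. 0)" by (rule ext)
   then show ?thesis by (simp only: nn_integral_const) simp
  qed
 qed auto
 also have "... <= ennreal (32 * e^2) * 2" by (intro mult_left_mono nu_disc_1) simp
 also have "... = ennreal (64 * e^2)"
  using ennreal_mult[of "32 * e^2" 2] by simp
 finally have S': "nu S' <= ennreal (64 * e^2)" .
 define h where "h = mk2 (1 / (4 * e)) 0 0 (4 * e)"
 have h: "h : SL2" using e by (simp add: h_def)
 have pre: "mv g -` A : sets borel" if "A : sets borel" for A :: "(real \<times> real) set" and g
  using measurable_sets[OF measurable_mv2 that, of g] by simp
 have "nu S <= nu (mv h -` S')"
 proof (rule nu_mono)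
  show "S \<subseteq> mv h -` S'"
   using e by (auto simp: S_def S'_def h_def mv_def field_simps power2_eq_square abs_mult)
 qed (auto intro!: pre)
 also have "... = nu S'" by (rule nu_act[OF h]) simp
 finally have S: "nu S <= ennreal (64 * e^2)" using S' by simp
 define J where "J = mk2 0 1 (-1) 0"
 have J: "J : SL2" "J ** J : SL2" "J ** (J ** J) : SL2" by (auto simp: J_def)
 define S1 S2 S3 where "S1 = mv J -` S" and "S2 = mv (J ** J) -` S" and "S3 = mv (J ** (J ** J)) -` S"
 have [measurable]: "S1 : sets borel" "S2 : sets borel" "S3 : sets borel"
  unfolding S1_def S2_def S3_def by (auto intro!: pre)
 have Si: "nu S1 = nu S" "nu S2 = nu S" "nu S3 = nu S"
  unfolding S1_def S2_def S3_def by (auto intro!: nu_act J)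
 have "nu (disc e) <= nu (S \<union> S1) + nu (S2 \<union> S3)"
 proof (rule nu_subadditive)
  fix v assume v: "v : disc e" "v ~= (0, 0)"
  obtain x y where xy: "v = (x, y)" by force
  have "x^2 + y^2 < e\<^sup>2" using v by (simp add: xy disc_def)
  then have "x^2 < e\<^sup>2" and "y^2 < e\<^sup>2" using zero_le_power2[of x] zero_le_power2[of y] by (linarith, linarith)
  then have b: "\<bar>x\<bar> < e" "\<bar>y\<bar> < e"
   using e power2_less_imp_less[of "\<bar>x\<bar>" e] power2_less_imp_less[of "\<bar>y\<bar>" e] by simp_all
  have "x ~= 0 \<or> y ~= 0" using v xy by auto
  then consider "0 < x" "\<bar>y\<bar> <= x" | "0 < y" "\<bar>x\<bar> <= y" | "0 < - x" "\<bar>y\<bar> <= - x" | "0 < - y" "\<bar>x\<bar> <= - y"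
   by argo
  then show "v : S \<union> S1 \<or> v : S2 \<union> S3"
   by cases (use b in \<open>auto simp: S_def S1_def S2_def S3_def J_def mv_def xy\<close>)
 qed auto
 also have "... <= (nu S + nu S1) + (nu S2 + nu S3)"
  by (intro add_mono nu_subadditive) auto
 also have "... <= (ennreal (64 * e^2) + ennreal (64 * e^2)) + (ennreal (64 * e^2) + ennreal (64 * e^2))"
  unfolding Si by (intro add_mono S)
 also have "... = ennreal (256 * e^2)" by (simp flip: ennreal_plus)
 finally show ?thesis .
qed

text \<open>If the mean vanished, unfolding over the translates of \<open>DD\<close> would make the
  transform zero almost everywhere on the group; but it is at least one on the open condition that
  \<open>(1, 1)\<close> is contracted into the disc.\<close>

lemma nu_disc_pos:
 assumes e: "0 < e"
 shows "0 < nu (disc e)"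
proof (rule ccontr)
 assume "\<not> ?thesis"
 then have z: "nu (disc e) = 0" by simp
 define G where "G g = vsum (disc e) (%_. 1) (g, 0)" for g
 have Gm: "G : borel_measurable SL2_borel"
  unfolding G_def by (rule measurable_compose[OF measurable_Pair2' vsum_measurable]) auto
 have "nu (disc e) = (\<integral>\<^sup>+d. \<integral>\<^sup>+t. vsum (disc e) (%_. 1) (d, t) \<partial>Om \<partial>MD)"
  unfolding nu_def by (rule nn_integral_YY_iter) (auto intro!: vsum_measurable_YY)
 also have "... = (\<integral>\<^sup>+d. G d \<partial>MD)"
  using Om.emeasure_space_1 by (intro nn_integral_cong) (simp add: G_def vsum_def)
 also have "... = (\<integral>\<^sup>+g. indicator DD g * G g \<partial>haar) / emeasure haar DD" by (rule nn_integral_MD[OF Gm])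
 finally have zD: "(\<integral>\<^sup>+g. indicator DD g * G g \<partial>haar) = 0"
  using z DD_nontrivial by (simp add: ennreal_divide_eq_0_iff)
 have Ginv: "G (g ** x) = G g" if "g : SL2" "x : Gam" for g x
  unfolding G_def vsum_Gam[OF that] by (simp add: vsum_def)
 have "(\<integral>\<^sup>+g. G g \<partial>haar) = (\<integral>\<^sup>+g. (\<integral>\<^sup>+x. indicator DD (g ** x) * G g \<partial>count_space Gam) \<partial>haar)"
  by (rule nn_integral_cong) (simp add: nn_integral_multc fundam_count[OF fundam_DD])
 also have "... = (\<integral>\<^sup>+x. (\<integral>\<^sup>+g. indicator DD (g ** x) * G g \<partial>haar) \<partial>count_space Gam)"
 proof (rule nn_integral_count_space_nn_integral[OF countable_Gam])
  fix x assume "x : Gam"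
  from translate_measurable[OF DD_sets Gam_SL2[OF this]]
  show "(%g. indicator DD (g ** x) * G g) : borel_measurable haar" using Gm by measurable
 qed
 also have "... = (\<integral>\<^sup>+x. 0 \<partial>count_space Gam)"
 proof (rule nn_integral_cong)
  fix x assume "x : space (count_space Gam)"
  then have x: "x : Gam" by simp
  have "(\<integral>\<^sup>+g. indicator DD (g ** x) * G g \<partial>haar) = (\<integral>\<^sup>+g. indicator DD (g ** x) * G (g ** x) \<partial>haar)"
   by (rule nn_integral_cong) (simp add: Ginv x)
  also have "... = (\<integral>\<^sup>+g. indicator DD g * G g \<partial>haar)"
   by (rule nn_integral_haar_right[OF _ Gam_SL2[OF x]]) (use Gm DD_sets in measurable)
  finally show "(\<integral>\<^sup>+g. indicator DD (g ** x) * G g \<partial>haar) = 0" using zD by simp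
 qed
 finally have zG: "(\<integral>\<^sup>+g. G g \<partial>haar) = 0" by simp
 \<comment> \<open>384 = 2 * 192, the lower volume bound being applied to the vector
   \<open>(1, 1)\<close> of squared length 2.\<close>
 obtain s where s: "24 <= s" "384 / e^2 <= s" using that[of "max 24 (384 / e^2)"] by simp
 have "0 < emeasure haar (vec_ball e s 1 1)"
 proof -
  have "192 / s <= (e / sqrt 2)^2" using s e by (simp add: power_divide field_simps)
  from row_ball_lower[OF s(1) _ this] e
  have "ennreal (min (e / sqrt 2) (sqrt s) * sqrt s / 60) <= emeasure haar (vec_ball e s 1 1)"
   by (subst emeasure_vec_ball) auto
  moreover have "0 < ennreal (min (e / sqrt 2) (sqrt s) * sqrt s / 60)" using e s by simp
  ultimately show ?thesis by (rule less_le_trans[rotated])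
 qed
 also have "emeasure haar (vec_ball e s 1 1) = (\<integral>\<^sup>+g. indicator (vec_ball e s 1 1) g \<partial>haar)" by simp
 also have "... <= (\<integral>\<^sup>+g. G g \<partial>haar)"
 proof (rule nn_integral_mono)
  fix g
  show "indicator (vec_ball e s 1 1) g <= G g"
  proof (cases "g : vec_ball e s 1 1")
   case True
   have "1 = (\<integral>\<^sup>+p. indicator {(1, 1)} p \<partial>count_space VV)" by (simp add: VV_def)
   also have "... <= G g"
    unfolding G_def vsum_def
    by (rule nn_integral_mono) (use True in \<open>auto simp: vec_ball_def mv_disc len2_def split: split_indicator\<close>)
   finally show ?thesis using True by simp
  qed simp
 qed
 finally show False using zG by simp
qed

section \<open>Delayed ball averages\<close>

text \<open>The measurable exceptional set is part of the definition, so it makes sense for any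
  predicate, measurable or not.\<close>

definition mostly :: "real => ((real^2^2) \<times> real => bool) => bool" where
 "mostly d P \<longleftrightarrow> (\<exists>N\<in>sets YY. emeasure YY N <= ennreal d & (\<forall>y\<in>space YY - N. P y))"

lemma mostly_mono: "mostly d P ==> d <= d' ==> (\<And>y. y : space YY ==> P y ==> Q y) ==> mostly d' Q"
 unfolding mostly_def by (meson DiffD1 ennreal_leI order_trans)

lemma mostly_all: "0 <= d ==> (\<And>y. y : space YY ==> P y) ==> mostly d P"
 unfolding mostly_def by (intro bexI[of _ "{}"]) auto

lemma mostly_conj:
 assumes "mostly a P" "mostly b Q" "0 <= a" "0 <= b"
 shows "mostly (a + b) (%y. P y & Q y)"
proof -
 obtain N N' where N: "N : sets YY" "emeasure YY N <= ennreal a" "\<forall>y\<in>space YY - N. P y"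
  and N': "N' : sets YY" "emeasure YY N' <= ennreal b" "\<forall>y\<in>space YY - N'. Q y"
  using assms(1,2) unfolding mostly_def by blast
 have "emeasure YY (N \<union> N') <= emeasure YY N + emeasure YY N'" using N N' by (intro emeasure_subadditive)
 also have "... <= ennreal (a + b)" using N N' assms by (simp add: add_mono)
 finally show ?thesis unfolding mostly_def using N N' by (intro bexI[of _ "N \<union> N'"]) auto
qed

lemma mostly_Markov:
 assumes F: "F : borel_measurable YY" and le: "(\<integral>\<^sup>+y. F y \<partial>YY) <= ennreal (d * e)" and de: "0 < d" "0 < e"
 shows "mostly d (%y. F y <= ennreal e)"
proof -
 let ?N = "{y : space YY. 1 <= ennreal (1 / e) * F y}"
 have "emeasure YY ?N <= ennreal (1 / e) * (\<integral>\<^sup>+y. F y * indicator (space YY) y \<partial>YY)"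
  using F by (intro nn_integral_Markov_inequality) (auto simp del: space_YY)
 also have "(\<integral>\<^sup>+y. F y * indicator (space YY) y \<partial>YY) = (\<integral>\<^sup>+y. F y \<partial>YY)"
  by (rule nn_integral_cong) simp
 also have "ennreal (1 / e) * ... <= ennreal (1 / e) * ennreal (d * e)" by (intro mult_left_mono le) simp
 also have "... = ennreal d" using de by (simp flip: ennreal_mult)
 finally have "emeasure YY ?N <= ennreal d" .
 moreover have "F y <= ennreal e" if "y : space YY - ?N" for y
 proof (rule ccontr)
  assume "\<not> F y <= ennreal e"
  then have "ennreal (1 / e) * ennreal e <= ennreal (1 / e) * F y" by (intro mult_left_mono) auto
  moreover have "ennreal (1 / e) * ennreal e = 1" using de by (simp flip: ennreal_mult)
  ultimately show False using that by simp
 qed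
 ultimately show ?thesis unfolding mostly_def using F by (intro bexI[of _ ?N]) (auto simp del: space_YY)
qed

definition avg :: "real => ((real^2^2) \<times> real => ennreal) => (real^2^2) \<times> real => ennreal" where
 "avg s F y = (\<integral>\<^sup>+g. F (actY g y) \<partial>ball_law s)"

lemma avg_measurable:
 assumes s: "24 <= s" and F: "F : borel_measurable YY"
 shows "avg s F : borel_measurable YY"
proof -
 interpret U: prob_space "ball_law s" by (rule prob_space_ball_law[OF s])
 have "(%z. F (actY (snd z) (fst z))) : borel_measurable (YY \<Otimes>\<^sub>M SL2_borel)"
  using measurable_compose[OF measurable_pair_swap' YS.act_pair_measurable[OF F]] by (simp add: case_prod_beta')
 moreover have "sets (YY \<Otimes>\<^sub>M ball_law s) = sets (YY \<Otimes>\<^sub>M SL2_borel)" by (rule sets_pair_measure_cong) auto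
 ultimately have "(%(y, g). F (actY g y)) : borel_measurable (YY \<Otimes>\<^sub>M ball_law s)"
  unfolding case_prod_beta' by (simp cong: measurable_cong_sets)
 then show ?thesis unfolding avg_def by (rule U.borel_measurable_nn_integral)
qed

lemma orbit_measurable_ball_law:
 assumes "F : borel_measurable YY" "y : space YY"
 shows "(%g. F (actY g y)) : borel_measurable (ball_law s)"
 using YS.orbit_measurable[OF assms] by (simp cong: measurable_cong_sets)

lemma nn_integral_avg:
 assumes s: "24 <= s" and F: "F : borel_measurable YY"
 shows "(\<integral>\<^sup>+y. avg s F y \<partial>YY) = (\<integral>\<^sup>+y. F y \<partial>YY)"
proof -
 interpret U: prob_space "ball_law s" by (rule prob_space_ball_law[OF s])
 interpret P: pair_sigma_finite "ball_law s" YY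
  by (intro pair_sigma_finite.intro U.sigma_finite_measure_axioms YS.sigma_finite_measure_axioms)
 have "sets (ball_law s \<Otimes>\<^sub>M YY) = sets (SL2_borel \<Otimes>\<^sub>M YY)" by (rule sets_pair_measure_cong) auto
 then have "(%(g, y). F (actY g y)) : borel_measurable (ball_law s \<Otimes>\<^sub>M YY)"
  using YS.act_pair_measurable[OF F] by (simp cong: measurable_cong_sets)
 from P.Fubini'[OF this] have "(\<integral>\<^sup>+y. avg s F y \<partial>YY) = (\<integral>\<^sup>+g. \<integral>\<^sup>+y. F (actY g y) \<partial>YY \<partial>ball_law s)"
  unfolding avg_def .
 also have "... = (\<integral>\<^sup>+g. (\<integral>\<^sup>+y. F y \<partial>YY) \<partial>ball_law s)"
  by (rule nn_integral_cong) (simp add: YS.nn_integral_act[OF F])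
 finally show ?thesis using U.emeasure_space_1 by simp
qed

lemma ball_law_disc:
 "(\<integral>\<^sup>+g. indicator (disc e) (mv g v) \<partial>ball_law s) = kern e s (fst v) (snd v)"
proof -
 have "(%g. indicator (disc e) (mv g v) :: ennreal) : borel_measurable SL2_borel" by measurable
 then have "(\<integral>\<^sup>+g. indicator (disc e) (mv g v) \<partial>ball_law s)
   = (\<integral>\<^sup>+g. indicator (disc e) (mv g v) * indicator (fball s) g \<partial>haar) / emeasure haar (fball s)"
  unfolding ball_law_def by (intro nn_integral_uniform_measure) (auto cong: measurable_cong_sets)
 also have "(\<integral>\<^sup>+g. indicator (disc e) (mv g v) * indicator (fball s) g \<partial>haar) = (\<integral>\<^sup>+g. indicator (vec_ball e s (fst v) (snd v)) g \<partial>haar)"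
  by (rule nn_integral_cong) (auto simp: disc_def mv_def vec_ball_def lensq_def split: split_indicator)
 finally show ?thesis by (simp add: kern_def)
qed

text \<open>Exchanging sum and average leaves for every vector the probability of being brought into
  the disc, so averages of such sums can be compared term by term through
  \<open>kern\<close>.\<close>

lemma avg_vsum:
 fixes w :: "real => ennreal"
 assumes y: "y : space YY"
 shows "avg s (vsum (disc e) w) y
  = (\<integral>\<^sup>+p. kern e s (fst (mv (fst y) (iv p))) (snd (mv (fst y) (iv p))) * w (rot (kap p) (snd y)) \<partial>count_space VV)"
proof -
 have m: "(%g. indicator (disc e) (mv g v) :: ennreal) : borel_measurable (ball_law s)" for v by measurable
 have "avg s (vsum (disc e) w) y
   = (\<integral>\<^sup>+g. \<integral>\<^sup>+p. indicator (disc e) (mv g (mv (fst y) (iv p))) * w (rot (kap p) (snd y)) \<partial>count_space VV \<partial>ball_law s)"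
  unfolding avg_def by (rule nn_integral_cong) (use y in \<open>simp add: vsum_act, simp add: vsum_def mv_mult\<close>)
 also have "... = (\<integral>\<^sup>+p. \<integral>\<^sup>+g. indicator (disc e) (mv g (mv (fst y) (iv p))) * w (rot (kap p) (snd y)) \<partial>ball_law s \<partial>count_space VV)"
  by (rule nn_integral_count_space_nn_integral[OF countable_VV]) (use m in measurable)
 also have "... = (\<integral>\<^sup>+p. kern e s (fst (mv (fst y) (iv p))) (snd (mv (fst y) (iv p))) * w (rot (kap p) (snd y)) \<partial>count_space VV)"
  by (rule nn_integral_cong) (subst nn_integral_multc[OF m], simp add: ball_law_disc)
 finally show ?thesis .
qed

text \<open>Radii whose ball, of size \<open>2 * cosh r\<close> in terms of \<open>frob2\<close>, is
  large enough for the volume bounds.\<close>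

definition late :: "real => bool" where
 "late r \<longleftrightarrow> 0 <= r & 24 <= 2 * cosh r"

text \<open>The average at radius \<open>r\<close> of the function at the boundary of the cusp,
  scaled by the loss in \<open>kern_delay\<close>. Before the threshold it is set to 0, which keeps
  all lower bounds by it true.\<close>

definition delayed :: "real => (real => ennreal) => (real^2^2) \<times> real => ennreal" where
 "delayed r w y = (if late r then ennreal (1 / 92160) * avg (2 * cosh r) (vsum (disc (1 / 40)) w) y else 0)"

text \<open>Height \<open>exp t\<close> on a part of the cusp of measure of order
  \<open>exp (- t)\<close>: the mass is bounded independently of \<open>t\<close>.\<close>

definition spike :: "real => (real => ennreal) => (real^2^2) \<times> real => ennreal" where
 "spike t w y = ennreal (exp t) * vsum (disc (1 / (2 * sqrt (exp t)))) w y"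

lemma spike_measurable: "w : borel_measurable Om ==> spike t w : borel_measurable YY"
 unfolding spike_def[abs_def] by (intro borel_measurable_times_ennreal vsum_measurable_YY) auto

lemma nn_integral_spike:
 assumes w: "w : borel_measurable Om" and t: "0 <= t"
 shows "(\<integral>\<^sup>+y. spike t w y \<partial>YY) <= 64 * (\<integral>\<^sup>+x. w x \<partial>Om)"
proof -
 let ?e = "1 / (2 * sqrt (exp t))"
 have "(\<integral>\<^sup>+y. spike t w y \<partial>YY) = ennreal (exp t) * (nu (disc ?e) * (\<integral>\<^sup>+x. w x \<partial>Om))"
  unfolding spike_def by (subst nn_integral_cmult) (auto intro!: vsum_measurable_YY w simp: nn_integral_vsum w)
 also have "... <= ennreal (exp t) * (ennreal (256 * ?e\<^sup>2) * (\<integral>\<^sup>+x. w x \<partial>Om))"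
 proof (intro mult_left_mono mult_right_mono nu_disc_le)
  have "1 <= sqrt (exp t)" using t by simp
  then have "1 <= 2 * sqrt (exp t)" by linarith
  then show "?e <= 1" by simp
 qed auto
 also have "... = ennreal (exp t * (256 * ?e\<^sup>2)) * (\<integral>\<^sup>+x. w x \<partial>Om)" by (simp add: ennreal_mult mult.assoc)
 also have "exp t * (256 * ?e\<^sup>2) = 64" by (simp add: power_divide power_mult_distrib)
 finally show ?thesis by simp
qed

text \<open>Passing from radius \<open>r - t\<close> to \<open>r\<close> multiplies
  \<open>2 * cosh\<close> by a factor between half of \<open>exp t\<close> and \<open>exp t\<close>,
  which is the range in which \<open>kern_delay\<close> compares the terms of the two sums.\<close>

lemma delayed_le_avg_spike:
 assumes t: "0 <= t" and w: "w : borel_measurable Om" and y: "y : space YY"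
 shows "delayed (r - t) w y <= avg (2 * cosh r) (spike t w) y"
proof (cases "late (r - t)")
 case True
 then have rt: "0 <= r - t" and c: "24 <= 2 * cosh (r - t)" by (auto simp: late_def)
 define a T where "a = exp (r - t)" and "T = exp t"
 have a: "1 <= a" and T: "1 <= T" using rt t by (auto simp: a_def T_def)
 have ch: "2 * cosh z = exp z + 1 / exp z" for z :: real
  by (simp add: cosh_def exp_minus inverse_eq_divide)
 have s: "2 * cosh (r - t) = a + 1 / a" unfolding ch a_def ..
 have "a * T = exp r" by (simp add: a_def T_def flip: exp_add)
 then have s': "2 * cosh r = a * T + 1 / (a * T)" unfolding ch by simp
 have "1 / (a * T) <= T / a"
 proof -
  have "1 <= T * T" using T mult_mono[of 1 T 1 T] by simp
  then show ?thesis using a T by (simp add: field_simps)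
 qed
 then have 2: "2 * cosh r <= T * (2 * cosh (r - t))" unfolding s s' by (simp add: algebra_simps)
 have "T / a <= a * T"
 proof -
  have "1 <= a * a" using a mult_mono[of 1 a 1 a] by simp
  then have "T * 1 <= T * (a * a)" using T by (intro mult_left_mono) auto
  then show ?thesis using a by (simp add: field_simps)
 qed
 moreover have "0 <= 1 / (a * T)" using a T by simp
 moreover have "T * (a + 1 / a) / 2 = (a * T + T / a) / 2" by (simp add: algebra_simps)
 moreover have "0 <= a * T" using a T by simp
 ultimately have 1: "T * (2 * cosh (r - t)) / 2 <= 2 * cosh r" unfolding s s' by argo
 have "cosh (r - t) <= cosh r" using t rt by (subst cosh_real_nonneg_le_iff) auto
 then have 3: "24 <= 2 * cosh r" using c by simp
 have fy: "fst y : SL2" using y DD_SL2 by auto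
 have "delayed (r - t) w y = (\<integral>\<^sup>+p. ennreal (1 / 92160) * (kern (1 / 40) (2 * cosh (r - t)) (fst (mv (fst y) (iv p))) (snd (mv (fst y) (iv p))) * w (rot (kap p) (snd y))) \<partial>count_space VV)"
  unfolding delayed_def avg_vsum[OF y] using True by (simp add: nn_integral_cmult)
 also have "... <= (\<integral>\<^sup>+p. ennreal T * (kern (1 / (2 * sqrt T)) (2 * cosh r) (fst (mv (fst y) (iv p))) (snd (mv (fst y) (iv p))) * w (rot (kap p) (snd y))) \<partial>count_space VV)"
 proof (rule nn_integral_mono)
  fix p assume "p : space (count_space VV)"
  then have nz: "fst (mv (fst y) (iv p)) ~= 0 \<or> snd (mv (fst y) (iv p)) ~= 0"
   using mv_nonzero[OF fy, of p] by (auto simp: prod_eq_iff)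
  show "ennreal (1 / 92160) * (kern (1 / 40) (2 * cosh (r - t)) (fst (mv (fst y) (iv p))) (snd (mv (fst y) (iv p))) * w (rot (kap p) (snd y)))
    <= ennreal T * (kern (1 / (2 * sqrt T)) (2 * cosh r) (fst (mv (fst y) (iv p))) (snd (mv (fst y) (iv p))) * w (rot (kap p) (snd y)))"
   unfolding mult.assoc[symmetric] by (rule mult_right_mono[OF kern_delay[OF c T 1 2 3 nz]]) simp
 qed
 also have "... = ennreal T * avg (2 * cosh r) (vsum (disc (1 / (2 * sqrt T))) w) y"
  unfolding avg_vsum[OF y] by (simp add: nn_integral_cmult)
 also have "... = avg (2 * cosh r) (spike t w) y"
  unfolding avg_def spike_def T_def
  by (rule nn_integral_cmult[symmetric]) (rule orbit_measurable_ball_law[OF vsum_measurable_YY[OF _ w] y], simp)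
 finally show ?thesis .
qed (simp add: delayed_def)

text \<open>The level contributed by a unit of mass once it has equidistributed.\<close>

definition c0 :: real where
 "c0 = enn2real (nu (disc (1 / 40))) / 92160"

lemma nu_disc_40: "nu (disc (1 / 40)) = ennreal (92160 * c0)" "0 < c0"
proof -
 have "nu (disc (1 / 40)) < top" using nu_disc_le[of "1 / 40"] by (auto intro: le_less_trans)
 then have e: "ennreal (enn2real (nu (disc (1 / 40)))) = nu (disc (1 / 40))" by simp
 then show "nu (disc (1 / 40)) = ennreal (92160 * c0)" by (simp add: c0_def)
 have "0 < enn2real (nu (disc (1 / 40)))"
  using nu_disc_pos[of "1 / 40"] e by (metis enn2real_nonneg ennreal_0 less_irrefl order_le_imp_less_or_eq zero_less_divide_1_iff zero_less_numeral)
 then show "0 < c0" by (simp add: c0_def)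
qed

definition weight :: "(real => ennreal) => bool" where
 "weight w \<longleftrightarrow> w : borel_measurable Om & (\<exists>C\<ge>0. \<forall>x\<in>{0..<1}. w x <= ennreal C)"

text \<open>Discs are round, so the transform is invariant under rotations of the plane, and it is
  bounded because at most two vectors are short. The mean ergodic theorem for balls therefore
  applies, and its mean is proportional to the integral of the weight.\<close>

lemma delayed_mixing:
 assumes w: "weight w" and d: "0 < d"
 shows "\<forall>\<^sub>F r in at_top. mostly d (%y. ennreal c0 * (\<integral>\<^sup>+x. w x \<partial>Om) <= delayed r w y + ennreal d)"
proof -
 obtain C where wm: "w : borel_measurable Om" and C: "0 <= C" "\<And>x. x : {0..<1} ==> w x <= ennreal C"
  using w by (auto simp: weight_def)
 define V where "V = vsum (disc (1 / 40)) w"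
 have Vm: "V : borel_measurable YY" unfolding V_def by (rule vsum_measurable_YY[OF _ wm]) simp
 have VC: "V y <= ennreal (2 * C)" if yY: "y : space YY" for y
 proof -
  obtain g t where y: "y = (g, t)" "g : SL2" using yY DD_SL2[of "fst y"] by (cases y) auto
  have "V y <= 2 * ennreal C" unfolding V_def y by (rule vsum_disc_le[OF y(2) _ C(2)]) (simp add: power2_eq_square)
  then show ?thesis using C(1) by (simp add: ennreal_mult')
 qed
 define h where "h y = enn2real (V y)" for y
 have hV: "ennreal (h y) = V y" if "y : space YY" for y
  unfolding h_def using VC[OF that] by (intro ennreal_enn2real) (auto intro: le_less_trans)
 have h0: "0 <= h y" for y by (simp add: h_def)
 have hb: "YS.bfun (2 * C) h"
  unfolding YS.bfun_def
 proof (intro conjI ballI)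
  show "h : borel_measurable YY" unfolding h_def using Vm by measurable
  show "\<bar>h y\<bar> <= 2 * C" if "y : space YY" for y
   using VC[OF that] hV[OF that, symmetric] h0[of y] C(1) by (simp add: ennreal_le_iff)
 qed
 have K: "h (actY k y) = h y" if k: "k : rot2" and y: "y : space YY" for k y
 proof -
  obtain c s where cs: "k = mk2 c (- s) s c" "c^2 + s^2 = 1" using k by (auto simp: rot2_def)
  have "(c * a + - s * b)^2 + (s * a + c * b)^2 = a^2 + b^2" for a b
  proof -
   have "(c * a + - s * b)^2 + (s * a + c * b)^2 = (c^2 + s^2) * (a^2 + b^2)" by algebra
   then show ?thesis using cs by simp
  qed
  then have "mv k -` disc (1 / 40) = disc (1 / 40)" by (auto simp: disc_def mv_def cs)
  then show ?thesis unfolding h_def V_def vsum_act_preimage[OF rot2_SL2[OF k] y] by simp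
 qed
 define m where "m = (\<integral>y. h y \<partial>YY)"
 have m: "ennreal m = ennreal (92160 * c0) * (\<integral>\<^sup>+x. w x \<partial>Om)"
 proof -
  have "ennreal m = (\<integral>\<^sup>+y. ennreal (h y) \<partial>YY)"
   unfolding m_def using YS.bfun_integrable[OF hb] h0 by (intro nn_integral_eq_integral[symmetric]) auto
  also have "... = (\<integral>\<^sup>+y. V y \<partial>YY)" by (rule nn_integral_cong) (rule hV)
  also have "... = nu (disc (1 / 40)) * (\<integral>\<^sup>+x. w x \<partial>Om)" unfolding V_def by (rule nn_integral_vsum[OF _ wm]) simp
  finally show ?thesis unfolding nu_disc_40 .
 qed
 have c0w: "ennreal c0 * (\<integral>\<^sup>+x. w x \<partial>Om) = ennreal (1 / 92160) * ennreal m"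
  unfolding m using nu_disc_40(2) by (simp add: mult.assoc[symmetric] flip: ennreal_mult)
 have m0: "0 <= m" unfolding m_def by (intro integral_nonneg_AE) (simp add: h0)
 have "\<forall>\<^sub>F s in at_top. 24 <= s & (\<integral>y. ((\<integral>g. h (actY g y) \<partial>ball_law s) - m)\<^sup>2 \<partial>YY) <= d * d^2"
  unfolding m_def using eventually_ge_at_top[of 24] YS.ball_mean_ergodic[OF hb _ K, of "d * d^2"] d
  by (auto simp: eventually_conj_iff)
 then have ev: "\<forall>\<^sub>F s in at_top. mostly d (%y. ennreal (1 / 92160) * ennreal m <= ennreal (1 / 92160) * avg s V y + ennreal d)"
 proof eventually_elim
  case (elim s)
  interpret U: prob_space "ball_law s" using elim by (intro prob_space_ball_law) simp
  define H where "H y = (\<integral>g. h (actY g y) \<partial>ball_law s)" for y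
  have oi: "integrable (ball_law s) (%g. h (actY g y))" if y: "y : space YY" for y
  proof (rule U.integrable_const_bound[where B = "2 * C"])
   show "(%g. h (actY g y)) : borel_measurable (ball_law s)"
    using YS.orbit_measurable[OF YS.bfun_measurable[OF hb] y] by (simp cong: measurable_cong_sets)
   have "actY g y : space YY" if "g : SL2" for g
    using measurable_space[OF YS.act_measurable[OF that] y] .
   then show "AE g in ball_law s. norm (h (actY g y)) <= 2 * C"
    by (intro AE_I2) (auto intro!: YS.bfun_bound[OF hb] simp del: space_YY)
  qed
  have H0: "0 <= H y" for y unfolding H_def by (intro integral_nonneg_AE) (simp add: h0)
  have HV: "ennreal (H y) = avg s V y" if y: "y : space YY" for y
  proof -
   have "ennreal (H y) = (\<integral>\<^sup>+g. ennreal (h (actY g y)) \<partial>ball_law s)"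
    unfolding H_def using oi[OF y] h0 by (intro nn_integral_eq_integral[symmetric]) auto
   also have "... = avg s V y"
    unfolding avg_def
    by (rule nn_integral_cong) (use measurable_space[OF YS.act_measurable y] in \<open>simp add: hV del: space_YY\<close>)
   finally show ?thesis .
  qed
  have HC: "H y <= 2 * C" if y: "y : space YY" for y
  proof -
   have "H y <= (\<integral>g. 2 * C \<partial>ball_law s)"
    unfolding H_def
   proof (rule integral_mono[OF oi[OF y]])
    fix g assume "g : space (ball_law s)"
    then have "actY g y : space YY" using measurable_space[OF YS.act_measurable y, of g] by simp
    from YS.bfun_bound[OF hb this] show "h (actY g y) <= 2 * C" by simp
   qed simp
   then show ?thesis using U.prob_space by simp
  qed
  have Hm: "H : borel_measurable YY"
  proof -
   have "avg s V : borel_measurable YY" using elim by (intro avg_measurable Vm) simp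
   then have "(%y. enn2real (avg s V y)) : borel_measurable YY" by measurable
   moreover have "enn2real (avg s V y) = H y" if "y : space YY" for y
    using HV[OF that, symmetric] H0[of y] by simp
   ultimately show ?thesis by (simp cong: measurable_cong del: space_YY)
  qed
  \<comment> \<open>The square mean was made smaller than \<open>d * d^2\<close> so that Markov's
    inequality bounds the deviation by \<open>d\<close> off a set of measure
    \<open>d\<close>.\<close>
  have "mostly d (%y. ennreal ((H y - m)^2) <= ennreal (d^2))"
  proof (rule mostly_Markov)
   show "(%y. ennreal ((H y - m)^2)) : borel_measurable YY" using Hm by measurable
   have "integrable YY (%y. (H y - m)\<^sup>2)"
   proof (rule YS.integrable_const_bound[where B = "(2 * C + m)^2"])
    show "AE y in YY. norm ((H y - m)^2) <= (2 * C + m)^2"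
    proof (rule AE_I2)
     fix y assume "y : space YY"
     then have "\<bar>H y - m\<bar> <= 2 * C + m" using HC[of y] H0[of y] m0 C(1) by linarith
     then have "\<bar>H y - m\<bar>\<^sup>2 <= (2 * C + m)^2" by (intro power_mono) auto
     then show "norm ((H y - m)^2) <= (2 * C + m)^2" by simp
    qed
   qed (use Hm in measurable)
   then have "(\<integral>\<^sup>+y. ennreal ((H y - m)^2) \<partial>YY) = ennreal (\<integral>y. (H y - m)\<^sup>2 \<partial>YY)"
    by (intro nn_integral_eq_integral) auto
   also have "... <= ennreal (d * d^2)" using elim unfolding H_def by (intro ennreal_leI) simp
   finally show "(\<integral>\<^sup>+y. ennreal ((H y - m)^2) \<partial>YY) <= ennreal (d * d^2)" .
  qed (use d in auto)
  then show ?case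
  proof (rule mostly_mono)
   fix y assume y: "y : space YY" and le: "ennreal ((H y - m)^2) <= ennreal (d^2)"
   have "\<bar>H y - m\<bar>\<^sup>2 <= d^2" using le d by (simp add: ennreal_le_iff)
   then have "\<bar>H y - m\<bar> <= d" using d by (simp add: power2_le_iff_abs_le)
   then have "1 / 92160 * m <= 1 / 92160 * H y + d" using d by (simp add: abs_le_iff field_simps)
   then have "ennreal (1 / 92160 * m) <= ennreal (1 / 92160 * H y + d)" by (rule ennreal_leI)
   then show "ennreal (1 / 92160) * ennreal m <= ennreal (1 / 92160) * avg s V y + ennreal d"
    using d m0 H0[of y] by (simp add: HV[OF y, symmetric] flip: ennreal_mult ennreal_plus)
  qed simp
 qed
 have lim: "filterlim (%r::real. 2 * cosh r) at_top at_top"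
  by (rule filterlim_tendsto_pos_mult_at_top[OF tendsto_const _ cosh_real_at_top]) simp
 have "\<forall>\<^sub>F r::real in at_top. 24 <= 2 * cosh r"
  using lim unfolding filterlim_at_top by (rule spec)
 with eventually_compose_filterlim[OF ev lim] eventually_ge_at_top[of 0] show ?thesis
 proof eventually_elim
  case (elim r)
  then show ?case unfolding c0w delayed_def late_def V_def by simp
 qed
qed

section \<open>Localising the weights on slow sets\<close>

lemma kern_measurable:
 assumes s: "24 <= s"
 shows "(%d. kern e s (fst (mv d v)) (snd (mv d v))) : borel_measurable SL2_borel"
proof -
 interpret U: prob_space "ball_law s" by (rule prob_space_ball_law[OF s])
 have "(%z. indicator (disc e) (mv (snd z ** fst z) v) :: ennreal) : borel_measurable (SL2_borel \<Otimes>\<^sub>M ball_law s)"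
 proof (rule measurable_compose[OF measurable_compose[OF _ measurable_mv]])
  have "(%z. snd z ** fst z) : measurable (SL2_borel \<Otimes>\<^sub>M SL2_borel) SL2_borel" by measurable
  moreover have "sets (SL2_borel \<Otimes>\<^sub>M ball_law s) = sets (SL2_borel \<Otimes>\<^sub>M SL2_borel)" by (rule sets_pair_measure_cong) auto
  ultimately show "(%z. snd z ** fst z) : measurable (SL2_borel \<Otimes>\<^sub>M ball_law s) SL2_borel"
   by (simp cong: measurable_cong_sets)
 qed simp
 then have "(%(d, g). indicator (disc e) (mv (g ** d) v) :: ennreal) : borel_measurable (SL2_borel \<Otimes>\<^sub>M ball_law s)"
  by (simp add: case_prod_beta')
 from U.borel_measurable_nn_integral[OF this] show ?thesis
  by (simp add: mv_mult ball_law_disc)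
qed

text \<open>The slow set or its complement, according to \<open>b\<close>. With \<open>b\<close>
  taken from the circle coordinate of a point it is the side on which that point lies.\<close>

definition match :: "nat => real => bool => real set" where
 "match q s b = {x. (x : slow q s) = b}"

lemma match_sets [measurable]: "match q s b : sets borel"
proof -
 have "Measurable.pred borel (%x. (x : slow q s) = b)" by measurable
 then show ?thesis by (simp add: match_def pred_def)
qed

lemma match_measurable: "(%x. indicator (match q s b) x :: ennreal) : borel_measurable Om"
 by (rule measurable_compose[OF measurable_Om_borel]) simp

lemma weight_match: "weight w ==> weight (%x. w x * indicator (match q s b) x)"
proof -
 assume "weight w"
 then obtain C where w: "w : borel_measurable Om" "0 <= C" "\<forall>x\<in>{0..<1}. w x <= ennreal C" by (auto simp: weight_def)
 have "w x * indicator (match q s b) x <= ennreal C" if "x : {0..<1}" for x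
  using w(3) that by (auto split: split_indicator)
 then show ?thesis unfolding weight_def using w match_measurable by (auto intro!: borel_measurable_times_ennreal exI[of _ C])
qed

text \<open>An error bounded by a convergent sum over the primitive vectors; the summand of \<open>p\<close> is small
  because a slow set is almost invariant under the rotation by \<open>kap p\<close>.\<close>

lemma delayed_match:
 assumes w: "weight w" and d: "0 < d"
 shows "\<exists>e>0. \<forall>q h s. 0 < q \<longrightarrow> \<bar>real q * theta - of_int h\<bar> <= e \<longrightarrow>
  mostly d (%y. delayed r w y <= delayed r (%x. w x * indicator (match q s (snd y : slow q s)) x) y + ennreal d)"
proof (cases "late r")
 case False
 then show ?thesis using d by (intro exI[of _ 1]) (auto intro!: mostly_all simp: delayed_def)
next
 case True
 define s0 where "s0 = 2 * cosh r"
 have s0: "24 <= s0" using True by (simp add: late_def s0_def)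
 interpret U: prob_space "ball_law s0" by (rule prob_space_ball_law[OF s0])
 obtain C where wm: "w : borel_measurable Om" and C: "0 <= C" "\<And>x. x : {0..<1} ==> w x <= ennreal C"
  using w by (auto simp: weight_def)
 define k where "k g p = kern (1 / 40) s0 (fst (mv g (iv p))) (snd (mv g (iv p)))" for g p
 have km: "(%g. k g p) : borel_measurable MD" for p
  unfolding k_def by (rule measurable_compose[OF measurable_MD_SL2 kern_measurable[OF s0]])
 define a where "a p = (\<integral>\<^sup>+g. k g p \<partial>MD)" for p
 \<comment> \<open>Every point of an orbit sees at most two short vectors, so the expected kernels
   sum to at most 2. This summable bound permits dominated convergence over the infinitely many
   colours.\<close>
 have suma: "(\<integral>\<^sup>+p. a p \<partial>count_space VV) <= 2"
 proof -
  have "(\<integral>\<^sup>+p. a p \<partial>count_space VV) = (\<integral>\<^sup>+g. \<integral>\<^sup>+p. k g p \<partial>count_space VV \<partial>MD)"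
   unfolding a_def by (rule nn_integral_count_space_nn_integral[OF countable_VV km, symmetric])
  also have "... <= (\<integral>\<^sup>+g. 2 \<partial>MD)"
  proof (rule nn_integral_mono)
   fix g assume g: "g : space MD"
   then have y: "(g, 0) : space YY" by simp
   have gS: "g : SL2" using g DD_SL2 by simp
   have "(\<integral>\<^sup>+p. k g p \<partial>count_space VV) = avg s0 (vsum (disc (1 / 40)) (%_. 1)) (g, 0)"
    unfolding avg_vsum[OF y] by (simp add: k_def)
   also have "... <= (\<integral>\<^sup>+x. 2 * 1 \<partial>ball_law s0)"
    unfolding avg_def
   proof (rule nn_integral_mono)
    fix x assume "x : space (ball_law s0)"
    then have x: "x : SL2" by simp
    show "vsum (disc (1 / 40)) (%_. 1) (actY x (g, 0)) <= 2 * 1"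
     unfolding vsum_act[OF x y] by (rule vsum_disc_le) (use x gS in \<open>auto simp: power2_eq_square\<close>)
   qed
   finally show "(\<integral>\<^sup>+p. k g p \<partial>count_space VV) <= 2" using U.emeasure_space_1 by simp
  qed
  finally show ?thesis using MD.emeasure_space_1 by simp
 qed
 have afin: "a p < top" if "p : VV" for p
 proof -
  have "a p = (\<integral>\<^sup>+x. a x * indicator {p} x \<partial>count_space VV)" using that by (subst nn_integral_indicator_singleton) auto
  also have "... <= (\<integral>\<^sup>+x. a x \<partial>count_space VV)" by (rule nn_integral_mono) (auto split: split_indicator)
  finally have "a p <= 2" using suma by (rule order_trans)
  then show ?thesis by (rule le_less_trans) simp
 qed
 define Psi where "Psi e = (\<integral>\<^sup>+p. a p * ennreal (min 1 (4 * (\<bar>of_int (kap p)\<bar> * e))) \<partial>count_space VV)" for e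
 have "(%n. Psi (inverse (real (Suc n)))) \<longlonglongrightarrow> (\<integral>\<^sup>+p. 0 \<partial>count_space VV)"
  unfolding Psi_def
 proof (rule nn_integral_dominated_convergence[where w = a])
  show "(\<integral>\<^sup>+p. a p \<partial>count_space VV) < \<infinity>" by (rule le_less_trans[OF suma]) simp
  show "AE p in count_space VV. a p * ennreal (min 1 (4 * (\<bar>of_int (kap p)\<bar> * inverse (real (Suc n))))) <= a p" for n
  proof (rule AE_I2)
   fix p
   have "ennreal (min 1 (4 * (\<bar>of_int (kap p)\<bar> * inverse (real (Suc n))))) <= ennreal 1" by (rule ennreal_leI) simp
   from mult_left_mono[OF this, of "a p"]
   show "a p * ennreal (min 1 (4 * (\<bar>of_int (kap p)\<bar> * inverse (real (Suc n))))) <= a p" by simp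
  qed
  show "AE p in count_space VV. (%n. a p * ennreal (min 1 (4 * (\<bar>of_int (kap p)\<bar> * inverse (real (Suc n)))))) \<longlonglongrightarrow> 0"
  proof (rule AE_I2)
   fix p assume "p : space (count_space VV)"
   then have af: "a p < top" by (intro afin) simp
   have "(%n. min 1 (4 * (\<bar>of_int (kap p)\<bar> * inverse (real (Suc n))))) \<longlonglongrightarrow> min 1 (4 * (\<bar>of_int (kap p)\<bar> * 0))"
    by (intro tendsto_min tendsto_const tendsto_mult LIMSEQ_inverse_real_of_nat)
   then have "(%n. ennreal (min 1 (4 * (\<bar>of_int (kap p)\<bar> * inverse (real (Suc n)))))) \<longlonglongrightarrow> ennreal 0"
    by (intro tendsto_ennrealI) simp
   from ennreal_tendsto_cmult[OF af this]
   show "(%n. a p * ennreal (min 1 (4 * (\<bar>of_int (kap p)\<bar> * inverse (real (Suc n)))))) \<longlonglongrightarrow> 0" by simp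
  qed
 qed auto
 moreover have "0 < ennreal (d * d / (C + 1))" using d C by simp
 ultimately have "\<forall>\<^sub>F n in sequentially. Psi (inverse (real (Suc n))) < ennreal (d * d / (C + 1))"
  by (intro order_tendstoD(2)) auto
 then obtain n where n: "Psi (inverse (real (Suc n))) < ennreal (d * d / (C + 1))"
  by (auto simp: eventually_sequentially)
 define e where "e = inverse (real (Suc n))"
 show ?thesis
 proof (intro exI[of _ e] conjI allI impI)
  show "0 < e" by (simp add: e_def)
  fix q h s assume q: "0 < q" and qh: "\<bar>real q * theta - of_int h\<bar> <= e"
  define ch where "ch l = {x : {0..<1}. (x : slow q s) ~= (rot l x : slow q s)}" for l
  have chs: "ch l : sets Om" for l
  proof -
   have 1: "Measurable.pred Om (%x. x : slow q s)" by (rule measurable_compose[OF measurable_Om_borel slow_pred])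
   have 2: "Measurable.pred Om (%x. rot l x : slow q s)" by (rule measurable_compose[OF measurable_rot 1])
   have "Measurable.pred Om (%x. (x : slow q s) ~= (rot l x : slow q s))" using 1 2 by measurable
   then show ?thesis by (simp add: ch_def pred_def)
  qed
  have chm: "(%x. indicator (ch l) x :: ennreal) : borel_measurable Om" for l
   by (rule borel_measurable_indicator[OF chs])
  have chle: "emeasure Om (ch l) <= ennreal (min 1 (4 * (\<bar>of_int l\<bar> * e)))" for l
  proof -
   have "emeasure Om (ch l) <= ennreal 1" using Om.measure_le_1[of "ch l"] by simp
   moreover have "emeasure Om (ch l) <= ennreal (4 * (\<bar>of_int l\<bar> * e))" unfolding ch_def by (rule slow_rot_change[OF q qh])
   ultimately show ?thesis by (simp add: min_def)
  qed
  \<comment> \<open>Collects the kernels of those vectors whose colour moves the circle coordinate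
    across the slow set; only their terms can be lost by cutting the weight.\<close>
  define err where "err y = (\<integral>\<^sup>+p. k (fst y) p * indicator (ch (kap p)) (snd y) \<partial>count_space VV)" for y :: "(real^2^2) \<times> real"
  have tm: "(%y. k (fst y) p * indicator (ch (kap p)) (snd y)) : borel_measurable YY" for p
   unfolding YY_def by (intro borel_measurable_times_ennreal measurable_compose[OF measurable_fst km] measurable_compose[OF measurable_snd chm])
  have errm: "err : borel_measurable YY"
   unfolding err_def[abs_def] by (rule borel_measurable_count_sum[OF countable_VV tm])
  have "(\<integral>\<^sup>+y. err y \<partial>YY) = (\<integral>\<^sup>+p. \<integral>\<^sup>+y. k (fst y) p * indicator (ch (kap p)) (snd y) \<partial>YY \<partial>count_space VV)"
   unfolding err_def by (rule nn_integral_count_space_nn_integral[OF countable_VV tm])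
  also have "... <= Psi e"
   unfolding Psi_def
  proof (rule nn_integral_mono)
   fix p
   have "(\<integral>\<^sup>+y. k (fst y) p * indicator (ch (kap p)) (snd y) \<partial>YY) = (\<integral>\<^sup>+g. \<integral>\<^sup>+x. k g p * indicator (ch (kap p)) x \<partial>Om \<partial>MD)"
    by (subst nn_integral_YY_iter[OF tm]) simp
   also have "... = (\<integral>\<^sup>+g. k g p * (\<integral>\<^sup>+x. indicator (ch (kap p)) x \<partial>Om) \<partial>MD)"
    by (rule nn_integral_cong) (rule nn_integral_cmult[OF chm])
   also have "... = a p * (\<integral>\<^sup>+x. indicator (ch (kap p)) x \<partial>Om)" unfolding a_def by (rule nn_integral_multc[OF km])
   also have "(\<integral>\<^sup>+x. indicator (ch (kap p)) x \<partial>Om) = emeasure Om (ch (kap p))"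
    by (rule nn_integral_indicator[OF chs])
   also have "a p * ... <= a p * ennreal (min 1 (4 * (\<bar>of_int (kap p)\<bar> * e)))" by (intro mult_left_mono chle) simp
   finally show "(\<integral>\<^sup>+y. k (fst y) p * indicator (ch (kap p)) (snd y) \<partial>YY) <= a p * ennreal (min 1 (4 * (\<bar>of_int (kap p)\<bar> * e)))" .
  qed
  also have "... <= ennreal (d * (d / (C + 1)))" using n unfolding e_def by simp
  finally have "mostly d (%y. err y <= ennreal (d / (C + 1)))"
   using d C by (intro mostly_Markov errm) auto
  then show "mostly d (%y. delayed r w y <= delayed r (%x. w x * indicator (match q s (snd y : slow q s)) x) y + ennreal d)"
  proof (rule mostly_mono)
   fix y assume y: "y : space YY" and le: "err y <= ennreal (d / (C + 1))"
   define w' where "w' x = w x * indicator (match q s (snd y : slow q s)) x" for x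
   have sy: "snd y : {0..<1}" using y by auto
   have "avg s0 (vsum (disc (1 / 40)) w) y <= (\<integral>\<^sup>+p. k (fst y) p * w' (rot (kap p) (snd y)) + ennreal C * (k (fst y) p * indicator (ch (kap p)) (snd y)) \<partial>count_space VV)"
    unfolding avg_vsum[OF y] k_def[symmetric]
   proof (rule nn_integral_mono)
    fix p
    let ?x = "rot (kap p) (snd y)"
    have "w ?x <= w' ?x + ennreal C * indicator (ch (kap p)) (snd y)"
    proof (cases "snd y : ch (kap p)")
     case True
     then show ?thesis using C(2)[of ?x] by (simp add: add_increasing)
    next
     case False
     then have "?x : match q s (snd y : slow q s)" using sy by (auto simp: ch_def match_def)
     then show ?thesis by (simp add: w'_def)
    qed
    then have "k (fst y) p * w ?x <= k (fst y) p * (w' ?x + ennreal C * indicator (ch (kap p)) (snd y))" by (rule mult_left_mono) simp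
    then show "k (fst y) p * w ?x <= k (fst y) p * w' ?x + ennreal C * (k (fst y) p * indicator (ch (kap p)) (snd y))"
     by (simp add: distrib_left mult_ac)
   qed
   also have "... = avg s0 (vsum (disc (1 / 40)) w') y + ennreal C * err y"
    unfolding avg_vsum[OF y] k_def[symmetric] err_def by (simp add: nn_integral_add nn_integral_cmult)
   finally have 1: "avg s0 (vsum (disc (1 / 40)) w) y <= avg s0 (vsum (disc (1 / 40)) w') y + ennreal C * err y" .
   have "ennreal C * err y <= ennreal C * ennreal (d / (C + 1))" by (intro mult_left_mono le) simp
   also have "... = ennreal (C * (d / (C + 1)))" using C(1) d by (intro ennreal_mult[symmetric]) auto
   also have "... <= ennreal d" using C d by (intro ennreal_leI) (simp add: field_simps)
   finally have 2: "ennreal C * err y <= ennreal d" .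
   have "delayed r w y <= ennreal (1 / 92160) * (avg s0 (vsum (disc (1 / 40)) w') y + ennreal d)"
    unfolding delayed_def s0_def[symmetric] using True order_trans[OF 1 add_left_mono[OF 2]] by (simp add: mult_left_mono)
   also have "... = delayed r w' y + ennreal (1 / 92160) * ennreal d"
    unfolding delayed_def s0_def[symmetric] using True by (simp add: distrib_left)
   also have "... <= delayed r w' y + ennreal d"
    using d by (intro add_left_mono) (simp flip: ennreal_mult add: ennreal_leI)
   finally show "delayed r w y <= delayed r (%x. w x * indicator (match q s (snd y : slow q s)) x) y + ennreal d"
    unfolding w'_def .
  qed simp
 qed
qed

section \<open>Profiles of small mass\<close>

text \<open>An entry \<open>(t, w)\<close> stands for the weight \<open>w\<close> becoming active
  later by \<open>t\<close>. Splitting, scaling and postponing are carried out on such lists before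
  any function on the space is formed.\<close>

type_synonym delays = "(real \<times> (real => ennreal)) list"

definition admissible :: "delays => bool" where
 "admissible L \<longleftrightarrow> (\<forall>(t, w)\<in>set L. 0 <= t & weight w)"

definition mass :: "delays => ennreal" where
 "mass L = (\<Sum>(t, w)\<leftarrow>L. \<integral>\<^sup>+x. w x \<partial>Om)"

definition level :: "delays => real => (real^2^2) \<times> real => ennreal" where
 "level L r y = (\<Sum>(t, w)\<leftarrow>L. delayed (r - t) w y)"

definition cut :: "(real => ennreal) => delays => delays" where
 "cut u L = map (%(t, w). (t, %x. w x * u x)) L"

lemma level_Cons [simp]: "level ((t, w) # L) r y = delayed (r - t) w y + level L r y"
 by (simp add: level_def)

lemma level_Nil [simp]: "level [] r y = 0"
 by (simp add: level_def)

lemma level_append: "level (L @ L') r y = level L r y + level L' r y"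
 by (simp add: level_def)

lemma mass_simps [simp]: "mass [] = 0" "mass ((t, w) # L) = (\<integral>\<^sup>+x. w x \<partial>Om) + mass L"
 by (simp_all add: mass_def)

lemma mass_append: "mass (L @ L') = mass L + mass L'"
 by (simp add: mass_def)

lemma admissible_simps [simp]: "admissible []" "admissible ((t, w) # L) \<longleftrightarrow> 0 <= t & weight w & admissible L"
 by (auto simp: admissible_def)

lemma cut_simps [simp]: "cut u [] = []" "cut u ((t, w) # L) = (t, %x. w x * u x) # cut u L"
 by (simp_all add: cut_def)

lemma admissible_cut_match: "admissible L ==> admissible (cut (%x. indicator (match q s b) x) L)"
 by (induction L) (auto simp: weight_match)

lemma level_match:
 assumes "admissible L" and "0 < d"
 shows "\<exists>e>0. \<forall>q h s. 0 < q \<longrightarrow> \<bar>real q * theta - of_int h\<bar> <= e \<longrightarrow>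
  mostly d (%y. level L r y <= level (cut (%x. indicator (match q s (snd y : slow q s)) x) L) r y + ennreal d)"
 using assms
proof (induction L arbitrary: d)
 case Nil
 then show ?case by (intro exI[of _ 1]) (auto intro!: mostly_all)
next
 case (Cons a L)
 obtain t w where a: "a = (t, w)" by force
 have d2: "0 < d / 2" using Cons.prems by simp
 obtain e1 where e1: "0 < e1" "\<And>q h s. 0 < q ==> \<bar>real q * theta - of_int h\<bar> <= e1 ==>
  mostly (d / 2) (%y. level L r y <= level (cut (%x. indicator (match q s (snd y : slow q s)) x) L) r y + ennreal (d / 2))"
  using Cons.IH[OF _ d2] Cons.prems a by auto
 obtain e2 where e2: "0 < e2" "\<And>q h s. 0 < q ==> \<bar>real q * theta - of_int h\<bar> <= e2 ==>
  mostly (d / 2) (%y. delayed (r - t) w y <= delayed (r - t) (%x. w x * indicator (match q s (snd y : slow q s)) x) y + ennreal (d / 2))"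
  using delayed_match[OF _ d2, of w "r - t"] Cons.prems a by auto
 show ?case
 proof (intro exI[of _ "min e1 e2"] conjI allI impI)
  show "0 < min e1 e2" using e1 e2 by simp
  fix q h s assume q: "0 < q" "\<bar>real q * theta - of_int h\<bar> <= min e1 e2"
  have "mostly (d / 2 + d / 2) (%y. level L r y <= level (cut (%x. indicator (match q s (snd y : slow q s)) x) L) r y + ennreal (d / 2)
   & delayed (r - t) w y <= delayed (r - t) (%x. w x * indicator (match q s (snd y : slow q s)) x) y + ennreal (d / 2))"
   using q d2 by (intro mostly_conj e1(2)[of q h] e2(2)[of q h]) auto
  then show "mostly d (%y. level (a # L) r y <= level (cut (%x. indicator (match q s (snd y : slow q s)) x) (a # L)) r y + ennreal d)"
  proof (rule mostly_mono, goal_cases)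
   case (2 y)
   have dd: "ennreal d = ennreal (d / 2) + ennreal (d / 2)" using d2 by (simp flip: ennreal_plus)
   show ?case unfolding a level_Cons cut_simps dd using add_mono[OF conjunct2[OF 2(2)] conjunct1[OF 2(2)]] by (simp add: add_ac)
  qed simp
 qed
qed

text \<open>Finitely many radii admit one common tolerance \<open>e\<close>, so a single slow set
  serves all of them.\<close>

lemma level_match_all:
 assumes "finite R" "admissible L" "0 < d"
 shows "\<exists>e>0. \<forall>q h s. 0 < q \<longrightarrow> \<bar>real q * theta - of_int h\<bar> <= e \<longrightarrow>
  mostly d (%y. \<forall>r\<in>R. level L r y <= level (cut (%x. indicator (match q s (snd y : slow q s)) x) L) r y + ennreal d)"
 using assms
proof (induction R arbitrary: d rule: finite_induct)
 case empty
 then show ?case by (intro exI[of _ 1]) (auto intro!: mostly_all)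
next
 case (insert r R)
 have d2: "0 < d / 2" using insert.prems by simp
 obtain e1 where e1: "0 < e1" "\<And>q h s. 0 < q ==> \<bar>real q * theta - of_int h\<bar> <= e1 ==>
  mostly (d / 2) (%y. \<forall>r\<in>R. level L r y <= level (cut (%x. indicator (match q s (snd y : slow q s)) x) L) r y + ennreal (d / 2))"
  using insert.IH[OF insert.prems(1) d2] by auto
 obtain e2 where e2: "0 < e2" "\<And>q h s. 0 < q ==> \<bar>real q * theta - of_int h\<bar> <= e2 ==>
  mostly (d / 2) (%y. level L r y <= level (cut (%x. indicator (match q s (snd y : slow q s)) x) L) r y + ennreal (d / 2))"
  using level_match[OF insert.prems(1) d2] by blast
 have le: "A <= B + ennreal d" if "A <= B + ennreal (d / 2)" for A B
  using that d2 by (auto intro: order_trans[OF _ add_left_mono[OF ennreal_leI]])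
 show ?case
 proof (intro exI[of _ "min e1 e2"] conjI allI impI)
  show "0 < min e1 e2" using e1 e2 by simp
  fix q h s assume q: "0 < q" "\<bar>real q * theta - of_int h\<bar> <= min e1 e2"
  have "mostly (d / 2 + d / 2) (%y. (\<forall>r\<in>R. level L r y <= level (cut (%x. indicator (match q s (snd y : slow q s)) x) L) r y + ennreal (d / 2))
   & level L r y <= level (cut (%x. indicator (match q s (snd y : slow q s)) x) L) r y + ennreal (d / 2))"
   using q d2 by (intro mostly_conj e1(2)[of q h] e2(2)[of q h]) auto
  then show "mostly d (%y. \<forall>r\<in>insert r R. level L r y <= level (cut (%x. indicator (match q s (snd y : slow q s)) x) L) r y + ennreal d)"
   by (rule mostly_mono) (auto intro!: le)
 qed
qed

lemma level_mixing:
 assumes "admissible L" and "0 < d"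
 shows "\<forall>\<^sub>F s in at_top. mostly d (%y. ennreal c0 * mass L <= level L (r + s) y + ennreal d)"
 using assms
proof (induction L arbitrary: d)
 case Nil
 then show ?case by (intro always_eventually allI mostly_all) auto
next
 case (Cons a L)
 obtain t w where a: "a = (t, w)" by force
 have d2: "0 < d / 2" using Cons.prems by simp
 have "filterlim (%s::real. (r - t) + s) at_top at_top"
  by (rule filterlim_tendsto_add_at_top[OF tendsto_const filterlim_ident])
 from eventually_compose_filterlim[OF delayed_mixing[OF _ d2, of w] this] Cons.prems a
 have "\<forall>\<^sub>F s in at_top. mostly (d / 2) (%y. ennreal c0 * (\<integral>\<^sup>+x. w x \<partial>Om) <= delayed (r - t + s) w y + ennreal (d / 2))" by auto
 moreover have "\<forall>\<^sub>F s in at_top. mostly (d / 2) (%y. ennreal c0 * mass L <= level L (r + s) y + ennreal (d / 2))"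
  using Cons.IH[OF _ d2] Cons.prems a by simp
 ultimately show ?case
 proof eventually_elim
  case (elim s)
  have "mostly (d / 2 + d / 2) (%y. ennreal c0 * (\<integral>\<^sup>+x. w x \<partial>Om) <= delayed (r - t + s) w y + ennreal (d / 2)
    & ennreal c0 * mass L <= level L (r + s) y + ennreal (d / 2))"
   using d2 by (intro mostly_conj elim) auto
  then show ?case
  proof (rule mostly_mono, goal_cases)
   case (2 y)
   have dd: "ennreal d = ennreal (d / 2) + ennreal (d / 2)" using d2 by (simp flip: ennreal_plus)
   have rs: "r - t + s = r + s - t" by simp
   show ?case unfolding a level_Cons mass_simps dd distrib_left
    using add_mono[OF conjunct1[OF 2(2)[unfolded rs]] conjunct2[OF 2(2)]] by (simp add: add_ac)
  qed simp
 qed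
qed

lemma level_mixing_all:
 assumes "finite R" "admissible L" "0 < d"
 shows "\<forall>\<^sub>F s in at_top. mostly d (%y. \<forall>r\<in>R. ennreal c0 * mass L <= level L (r + s) y + ennreal d)"
 using assms
proof (induction R arbitrary: d rule: finite_induct)
 case empty
 then show ?case by (intro always_eventually allI mostly_all) auto
next
 case (insert r R)
 have d2: "0 < d / 2" using insert.prems by simp
 have le: "A <= B + ennreal d" if "A <= B + ennreal (d / 2)" for A B
  using that d2 by (auto intro: order_trans[OF _ add_left_mono[OF ennreal_leI]])
 from insert.IH[OF insert.prems(1) d2] level_mixing[OF insert.prems(1) d2, of r] show ?case
 proof eventually_elim
  case (elim s)
  have "mostly (d / 2 + d / 2) (%y. (\<forall>r\<in>R. ennreal c0 * mass L <= level L (r + s) y + ennreal (d / 2))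
    & ennreal c0 * mass L <= level L (r + s) y + ennreal (d / 2))"
   using d2 by (intro mostly_conj elim) auto
  then show ?case by (rule mostly_mono) (auto intro!: le)
 qed
qed

lemma nn_integral_cut:
 assumes "admissible L" and u: "u : borel_measurable Om"
 shows "mass (cut u L) = (\<integral>\<^sup>+x. (\<Sum>(t, w)\<leftarrow>L. w x) * u x \<partial>Om)"
  and "(%x. \<Sum>(t, w)\<leftarrow>L. w x) : borel_measurable Om"
  and "\<exists>C\<ge>0. \<forall>x\<in>{0..<1}. (\<Sum>(t, w)\<leftarrow>L. w x) <= ennreal C"
 using assms(1)
proof (induction L)
 case Nil
 { case 1 show ?case by simp next case 2 show ?case by simp next case 3 show ?case by auto }
next
 case (Cons a L)
 obtain t w where a: "a = (t, w)" by force
 { case 1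
  then have "weight w" "admissible L" by (auto simp: a)
  then have w: "w : borel_measurable Om" and L: "mass (cut u L) = (\<integral>\<^sup>+x. (\<Sum>(t, w)\<leftarrow>L. w x) * u x \<partial>Om)"
   and Lm: "(%x. \<Sum>(t, w)\<leftarrow>L. w x) : borel_measurable Om"
   using Cons.IH by (auto simp: weight_def)
  show ?case using w Lm u by (simp add: a L distrib_right nn_integral_add)
 next
  case 2
  then have "weight w" "admissible L" by (auto simp: a)
  then show ?case using Cons.IH(2) by (auto simp: a weight_def)
 next
  case 3
  then have "weight w" "admissible L" by (auto simp: a)
  then obtain C C' where C: "0 <= C" "\<forall>x\<in>{0..<1}. w x <= ennreal C" and C': "0 <= C'" "\<forall>x\<in>{0..<1}. (\<Sum>(t, w)\<leftarrow>L. w x) <= ennreal C'"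
   using Cons.IH(3) by (auto simp: weight_def)
  then have "w x + (\<Sum>(t, w)\<leftarrow>L. w x) <= ennreal (C + C')" if "x : {0..<1}" for x
   using that by (simp add: add_mono)
  then show ?case using C C' by (intro exI[of _ "C + C'"]) (auto simp: a)
 }
qed

lemma mass_eq:
 assumes "admissible L"
 shows "mass L = (\<integral>\<^sup>+x. (\<Sum>(t, w)\<leftarrow>L. w x) \<partial>Om)"
proof -
 have "cut (%_. 1) L = L" by (induction L) auto
 then show ?thesis using nn_integral_cut(1)[OF assms, of "%_. 1"] by simp
qed

text \<open>A cut multiplies all entries by the same function, so its mass depends only on the total
  weight, and one phase halves the entire list.\<close>

lemma mass_halving:
 assumes L: "admissible L" "mass L = ennreal \<alpha>" "0 <= \<alpha>" and q: "0 < q"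
 shows "\<exists>s. \<forall>b. mass (cut (%x. indicator (match q s b) x) L) = ennreal (\<alpha> / 2)"
proof -
 define W where "W x = (\<Sum>(t, w)\<leftarrow>L. w x)" for x
 have Wm: "W : borel_measurable Om" unfolding W_def by (rule nn_integral_cut(2)[OF L(1), of "%_. 1"]) simp
 obtain C where C: "0 <= C" "\<And>x. x : {0..<1} ==> W x <= ennreal C"
  using nn_integral_cut(3)[OF L(1), of "%_. 1"] unfolding W_def by auto
 define V where "V x = enn2real (W x)" for x
 have VW: "ennreal (V x) = W x" if "x : {0..<1}" for x
  unfolding V_def using C(2)[OF that] by (intro ennreal_enn2real) (auto intro: le_less_trans)
 have V0: "0 <= V x" for x by (simp add: V_def)
 have VC: "\<bar>V x\<bar> <= C" if "x : {0..<1}" for x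
  using C(2)[OF that] VW[OF that, symmetric] V0[of x] C(1) by (simp add: ennreal_le_iff)
 have Vm: "V : borel_measurable Om" unfolding V_def using Wm by measurable
 have int: "integrable Om (%x. V x * u x)" if "u : borel_measurable Om" "\<And>x. 0 <= u x & u x <= 1" for u
 proof (rule Om.integrable_const_bound[where B = C])
  show "AE x in Om. norm (V x * u x) <= C"
  proof (rule AE_I2)
   fix x assume "x : space Om"
   then have "\<bar>V x\<bar> * \<bar>u x\<bar> <= C * 1" using VC[of x] that(2)[of x] C(1) by (intro mult_mono) auto
   then show "norm (V x * u x) <= C" by (simp add: abs_mult)
  qed
 qed (use Vm that in measurable)
 have nn: "(\<integral>\<^sup>+x. W x * ennreal (u x) \<partial>Om) = ennreal (\<integral>x. V x * u x \<partial>Om)" if u: "u : borel_measurable Om" "\<And>x. 0 <= u x & u x <= 1" for u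
 proof -
  have "(\<integral>\<^sup>+x. W x * ennreal (u x) \<partial>Om) = (\<integral>\<^sup>+x. ennreal (V x * u x) \<partial>Om)"
   by (rule nn_integral_cong) (use V0 u in \<open>simp add: VW[symmetric] ennreal_mult\<close>)
  also have "... = ennreal (\<integral>x. V x * u x \<partial>Om)"
   using int[OF u] V0 u by (intro nn_integral_eq_integral) auto
  finally show ?thesis .
 qed
 have "ennreal \<alpha> = ennreal (\<integral>x. V x \<partial>Om)"
  using nn[of "%_. 1"] mass_eq[OF L(1)] L(2) by (simp add: W_def)
 moreover have "0 <= (\<integral>x. V x \<partial>Om)" by (rule integral_nonneg_AE) (simp add: V0)
 ultimately have \<alpha>: "(\<integral>x. V x \<partial>Om) = \<alpha>" using L(3) by simp
 obtain s where s: "(\<integral>x. V x * indicator (slow q s) x \<partial>Om) = \<alpha> / 2"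
  using slow_halving[OF q Vm VC] \<alpha> by auto
 have im: "(%x. indicator (match q s b) x :: real) : borel_measurable Om" for b
  by (rule measurable_compose[OF measurable_Om_borel]) simp
 have T: "(\<integral>x. V x * indicator (match q s True) x \<partial>Om) = \<alpha> / 2"
  using s by (simp add: match_def)
 have "(\<integral>x. V x * indicator (match q s True) x \<partial>Om) + (\<integral>x. V x * indicator (match q s False) x \<partial>Om)
   = (\<integral>x. V x * indicator (match q s True) x + V x * indicator (match q s False) x \<partial>Om)"
  by (rule Bochner_Integration.integral_add[symmetric]) (auto intro!: int im)
 also have "... = \<alpha>"
  unfolding \<alpha>[symmetric] by (rule Bochner_Integration.integral_cong) (auto simp: match_def split: split_indicator)
 finally have I: "(\<integral>x. V x * indicator (match q s b) x \<partial>Om) = \<alpha> / 2" for b using T by (cases b) auto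
 have "mass (cut (%x. indicator (match q s b) x) L) = ennreal (\<alpha> / 2)" for b
  unfolding nn_integral_cut(1)[OF L(1) match_measurable] W_def[symmetric]
  using nn[OF im, of b] unfolding I by (simp add: ennreal_indicator)
 then show ?thesis by blast
qed

definition delay :: "real => ennreal => delays => delays" where
 "delay s c L = map (%(t, w). (t + s, %x. c * w x)) L"

lemma delayed_cmult: "y : space YY ==> delayed r (%x. c * w x) y = c * delayed r w y"
 unfolding delayed_def by (simp add: avg_vsum mult.left_commute nn_integral_cmult)

lemma level_delay: "y : space YY ==> level (delay s c L) r y = c * level L (r - s) y"
proof (induction L)
 case (Cons a L)
 obtain t w where a: "a = (t, w)" by force
 have rs: "r - (t + s) = r - s - t" by simp
 show ?case using Cons unfolding a by (simp add: delay_def delayed_cmult distrib_left rs)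
qed (simp add: delay_def)

lemma mass_delay: "admissible L ==> mass (delay s c L) = c * mass L"
 by (induction L) (auto simp: delay_def weight_def nn_integral_cmult distrib_left)

lemma admissible_delay: "admissible L ==> 0 <= s ==> 0 <= c ==> admissible (delay s (ennreal c) L)"
proof (induction L)
 case (Cons a L)
 obtain t w where a: "a = (t, w)" by force
 obtain C where C: "w : borel_measurable Om" "0 <= C" "\<forall>x\<in>{0..<1}. w x <= ennreal C" using Cons.prems a by (auto simp: weight_def)
 have "ennreal c * w x <= ennreal (c * C)" if "x : {0..<1}" for x
  using C that Cons.prems by (simp add: ennreal_mult mult_left_mono)
 then have "weight (%x. ennreal c * w x)" unfolding weight_def using C Cons.prems by (auto intro!: exI[of _ "c * C"])
 then show ?case using Cons a by (auto simp: delay_def)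
qed (simp add: delay_def)

lemma admissible_append: "admissible (L @ L') \<longleftrightarrow> admissible L & admissible L'"
 by (auto simp: admissible_def)

text \<open>Finiteness of \<open>R\<close> is essential: in the induction step the slow set is
  chosen after the radii and has to be good for all of them.\<close>

definition profile :: "real => bool" where
 "profile \<alpha> \<longleftrightarrow> (\<forall>e>0. \<exists>L R. admissible L & mass L = ennreal \<alpha> & finite R \<and>
   mostly e (%y. \<exists>r\<in>R. 1 <= level L r y + ennreal e))"

text \<open>A constant weight of mass \<open>1 / c0\<close> reaches level one at a single large
  radius by equidistribution.\<close>

lemma profile_base: "profile (1 / c0)"
 unfolding profile_def
proof (intro allI impI)
 fix e :: real assume e: "0 < e"
 define L :: delays where "L = [(0, %_. ennreal (1 / c0))]"
 have L: "admissible L" "mass L = ennreal (1 / c0)"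
  using nu_disc_40(2) Om.emeasure_space_1 by (auto simp: L_def weight_def intro!: exI[of _ "1 / c0"])
 have one: "ennreal c0 * mass L = 1" unfolding L using nu_disc_40(2) by (simp flip: ennreal_mult)
 have "\<exists>s. mostly e (%y. ennreal c0 * mass L <= level L (0 + s) y + ennreal e)"
  using level_mixing[OF L(1) e, of 0] by (rule eventually_happens'[rotated]) simp
 then obtain s where "mostly e (%y. 1 <= level L (0 + s) y + ennreal e)" unfolding one by blast
 then have "mostly e (%y. \<exists>r\<in>{s}. 1 <= level L r y + ennreal e)" by simp
 then show "\<exists>L R. admissible L & mass L = ennreal (1 / c0) & finite R & mostly e (%y. \<exists>r\<in>R. 1 <= level L r y + ennreal e)"
  using L by blast
qed

lemma Dirichlet_theta:
 assumes "0 < e"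
 shows "\<exists>q h. 0 < q & \<bar>real q * theta - of_int h\<bar> <= e"
proof -
 obtain N :: nat where N: "0 < N" "1 / real N < e" using assms by (metis ex_inverse_of_nat_less inverse_eq_divide)
 obtain q p where q: "0 < q" "\<And>i. i < (1::nat) ==> \<bar>of_int q * theta - of_int (p i)\<bar> < 1 / real N"
  using Dirichlet_approx_simult[OF N(1), of 1 "%_. theta"] by blast
 have "\<bar>of_int q * theta - of_int (p 0)\<bar> < 1 / real N" by (rule q(2)) simp
 then have "\<bar>real (nat q) * theta - of_int (p 0)\<bar> <= e" using N(2) q(1) by simp
 moreover have "0 < nat q" using q by simp
 ultimately show ?thesis by blast
qed

text \<open>Half of the weight stays in place on a slow set \<open>E\<close>. The other half is delayed so long that, when it
  becomes active, the first half has already equidistributed and contributes the constant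
  \<open>c0 * \<alpha> / 2\<close>; so the second half may be scaled down by \<open>1 - c0 * \<alpha> / 2\<close>.\<close>

lemma profile_step:
 assumes P: "profile \<alpha>" and \<alpha>: "0 < \<alpha>" "c0 * \<alpha> <= 1"
 shows "profile (\<alpha> - c0 * \<alpha>\<^sup>2 / 4)"
 unfolding profile_def
proof (intro allI impI)
 fix e :: real assume e: "0 < e"
 define d where "d = e / 4"
 have d: "0 < d" using e by (simp add: d_def)
 \<comment> \<open>The order of choices matters: the accuracy fixes the list and its radii, these
   determine how slow the set must be, and only the halves cut by it determine the delay.\<close>
 obtain L R where L: "admissible L" "mass L = ennreal \<alpha>" and R: "finite R"
  and LR: "mostly d (%y. \<exists>r\<in>R. 1 <= level L r y + ennreal d)"
  using P d unfolding profile_def by blast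
 obtain e0 where e0: "0 < e0" "\<And>q h s. 0 < q ==> \<bar>real q * theta - of_int h\<bar> <= e0 ==>
  mostly d (%y. \<forall>r\<in>R. level L r y <= level (cut (%x. indicator (match q s (snd y : slow q s)) x) L) r y + ennreal d)"
  using level_match_all[OF R L(1) d] by blast
 obtain q h where q: "0 < q" "\<bar>real q * theta - of_int h\<bar> <= e0" using Dirichlet_theta[OF e0(1)] by blast
 obtain s where s: "\<And>b. mass (cut (%x. indicator (match q s b) x) L) = ennreal (\<alpha> / 2)"
  using mass_halving[OF L _ q(1)] \<alpha> by auto
 define A where "A b = cut (%x. indicator (match q s b) x) L" for b
 have A: "admissible (A b)" "mass (A b) = ennreal (\<alpha> / 2)" for b
  unfolding A_def by (auto intro: admissible_cut_match L s)
 have slow: "mostly d (%y. \<forall>r\<in>R. level L r y <= level (A (snd y : slow q s)) r y + ennreal d)"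
  unfolding A_def by (rule e0(2)[OF q])
 have "\<exists>s'. mostly d (%y. \<forall>r\<in>R. ennreal c0 * mass (A True) <= level (A True) (r + s') y + ennreal d) & 0 <= s'"
  by (rule eventually_happens'[OF _ eventually_conj[OF level_mixing_all[OF R A(1) d] eventually_ge_at_top]]) simp
 then obtain s' where s': "0 <= s'" "mostly d (%y. \<forall>r\<in>R. ennreal c0 * mass (A True) <= level (A True) (r + s') y + ennreal d)" by blast
 define b where "b = 1 - c0 * \<alpha> / 2"
 have c0: "0 < c0" by (rule nu_disc_40)
 have b: "0 <= b" "b <= 1" using \<alpha> c0 by (simp_all add: b_def)
 have cb: "ennreal c0 * mass (A True) = ennreal (1 - b)" unfolding A b_def using \<alpha> c0 by (simp flip: ennreal_mult)
 define L' where "L' = A True @ delay s' (ennreal b) (A False)"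
 define R' where "R' = R \<union> (%r. r + s') ` R"
 have "admissible L'" unfolding L'_def admissible_append using A b s' by (auto intro: admissible_delay)
 moreover have "mass L' = ennreal (\<alpha> - c0 * \<alpha>\<^sup>2 / 4)"
 proof -
  have "mass L' = ennreal (\<alpha> / 2) + ennreal b * ennreal (\<alpha> / 2)"
   unfolding L'_def mass_append mass_delay[OF A(1)] A(2) ..
  also have "ennreal b * ennreal (\<alpha> / 2) = ennreal (b * (\<alpha> / 2))" using b \<alpha> by (intro ennreal_mult[symmetric]) auto
  also have "ennreal (\<alpha> / 2) + ... = ennreal (\<alpha> / 2 + b * (\<alpha> / 2))" using b \<alpha> by (intro ennreal_plus[symmetric]) auto
  also have "\<alpha> / 2 + b * (\<alpha> / 2) = \<alpha> - c0 * \<alpha>\<^sup>2 / 4" by (simp add: b_def power2_eq_square field_simps)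
  finally show ?thesis .
 qed
 moreover have "finite R'" using R by (simp add: R'_def)
 moreover have "mostly e (%y. \<exists>r\<in>R'. 1 <= level L' r y + ennreal e)"
 proof (rule mostly_mono)
  show "mostly (d + (d + d)) (%y. (\<exists>r\<in>R. 1 <= level L r y + ennreal d) & (\<forall>r\<in>R. level L r y <= level (A (snd y : slow q s)) r y + ennreal d)
    & (\<forall>r\<in>R. ennreal c0 * mass (A True) <= level (A True) (r + s') y + ennreal d))"
   using d by (intro mostly_conj LR slow s') auto
  show "d + (d + d) <= e" using e by (simp add: d_def)
  fix y assume y: "y : space YY" and H: "(\<exists>r\<in>R. 1 <= level L r y + ennreal d) & (\<forall>r\<in>R. level L r y <= level (A (snd y : slow q s)) r y + ennreal d)
    & (\<forall>r\<in>R. ennreal c0 * mass (A True) <= level (A True) (r + s') y + ennreal d)"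
  then obtain r where r: "r : R" "1 <= level L r y + ennreal d" by blast
  have 1: "level L r y <= level (A (snd y : slow q s)) r y + ennreal d" using H r by blast
  have 2: "ennreal (1 - b) <= level (A True) (r + s') y + ennreal d" using H r cb by auto
  have "1 <= level (A (snd y : slow q s)) r y + ennreal d + ennreal d" using r(2) add_right_mono[OF 1] by (rule order_trans)
  then have 3: "1 <= level (A (snd y : slow q s)) r y + ennreal (2 * d)" using d by (simp add: add.assoc flip: ennreal_plus)
  show "\<exists>r\<in>R'. 1 <= level L' r y + ennreal e"
  proof (cases "snd y : slow q s")
   case True
   have "level (A True) r y <= level L' r y" unfolding L'_def level_append by (simp add: add_increasing2)
   moreover have "ennreal (2 * d) <= ennreal e" using e by (intro ennreal_leI) (simp add: d_def)
   ultimately have "level (A True) r y + ennreal (2 * d) <= level L' r y + ennreal e" by (rule add_mono)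
   moreover have "1 <= level (A True) r y + ennreal (2 * d)" using 3 True by simp
   ultimately have "1 <= level L' r y + ennreal e" by (rule order_trans[rotated])
   then show ?thesis using r by (auto simp: R'_def)
  next
   case False
   \<comment> \<open>Off the slow set the radius \<open>r + s'\<close> is used. There the postponed
     half repeats, scaled by \<open>b\<close>, what the original list did at \<open>r\<close>, and
     the equidistributed half supplies the missing \<open>1 - b\<close>.\<close>
   have "1 = ennreal (1 - b) + ennreal b * 1" using b by (simp flip: ennreal_plus)
   also have "... <= (level (A True) (r + s') y + ennreal d) + ennreal b * (level (A False) r y + ennreal (2 * d))"
    using 3 False by (intro add_mono 2 mult_left_mono) auto
   also have "... = level L' (r + s') y + (ennreal d + ennreal b * ennreal (2 * d))"
    unfolding L'_def level_append level_delay[OF y] by (simp add: distrib_left add_ac)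
   also have "... <= level L' (r + s') y + ennreal e"
   proof (rule add_left_mono)
    have "b * (2 * d) <= 1 * (2 * d)" using b d by (intro mult_right_mono) auto
    moreover have "e = 4 * d" by (simp add: d_def)
    ultimately have "d + b * (2 * d) <= e" using d by linarith
    then show "ennreal d + ennreal b * ennreal (2 * d) <= ennreal e"
     using b d by (simp add: ennreal_leI flip: ennreal_mult ennreal_plus)
   qed
   finally show ?thesis using r by (auto simp: R'_def)
  qed
 qed
 ultimately show "\<exists>L R. admissible L & mass L = ennreal (\<alpha> - c0 * \<alpha>\<^sup>2 / 4) & finite R & mostly e (%y. \<exists>r\<in>R. 1 <= level L r y + ennreal e)"
  by blast
qed

text \<open>While the mass exceeds \<open>e\<close>, every step removes at least
  \<open>c0 * e^2 / 4\<close>, so it cannot stay above \<open>e\<close> forever.\<close>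

lemma profile_small:
 assumes e: "0 < e"
 shows "\<exists>\<alpha>. 0 < \<alpha> & \<alpha> <= e & profile \<alpha>"
proof (rule ccontr)
 assume neg: "\<not> ?thesis"
 have c0: "0 < c0" by (rule nu_disc_40)
 define k where "k = c0 * e^2 / 4"
 have k: "0 < k" using c0 e by (simp add: k_def)
 have "\<exists>\<alpha>. 0 < \<alpha> & c0 * \<alpha> <= 1 & profile \<alpha> & \<alpha> <= 1 / c0 - real n * k" for n
 proof (induction n)
  case 0
  then show ?case using profile_base c0 by (intro exI[of _ "1 / c0"]) auto
 next
  case (Suc n)
  then obtain \<alpha> where \<alpha>: "0 < \<alpha>" "c0 * \<alpha> <= 1" "profile \<alpha>" "\<alpha> <= 1 / c0 - real n * k" by blast
  have "e < \<alpha>" using neg \<alpha>(1,3) by (meson not_le)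
  then have "e^2 <= \<alpha>\<^sup>2" using e by (intro power_mono) auto
  then have "c0 * e^2 <= c0 * \<alpha>\<^sup>2" using c0 by (intro mult_left_mono) auto
  then have 1: "k <= c0 * \<alpha>\<^sup>2 / 4" by (simp add: k_def)
  have "c0 * \<alpha> * \<alpha> <= 1 * \<alpha>" using \<alpha> by (intro mult_right_mono) auto
  then have 2: "c0 * \<alpha>\<^sup>2 <= \<alpha>" by (simp add: power2_eq_square mult.assoc)
  have "c0 * (\<alpha> - c0 * \<alpha>\<^sup>2 / 4) <= c0 * \<alpha>" using c0 by (intro mult_left_mono) auto
  then have "c0 * (\<alpha> - c0 * \<alpha>\<^sup>2 / 4) <= 1" using \<alpha> by linarith
  moreover have "0 < \<alpha> - c0 * \<alpha>\<^sup>2 / 4" using 2 \<alpha> by linarith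
  moreover have "\<alpha> - c0 * \<alpha>\<^sup>2 / 4 <= 1 / c0 - real (Suc n) * k" using 1 \<alpha>(4) by (simp add: distrib_right)
  ultimately show ?case using profile_step[OF \<alpha>(3,1,2)] by blast
 qed
 moreover obtain n :: nat where "1 / c0 < real n * k" using reals_Archimedean3[OF k] by blast
 ultimately show False by (smt (verit))
qed

section \<open>A function with unbounded averages\<close>

lemma late_mono: "late (r - t) ==> 0 <= t ==> late r"
 unfolding late_def using cosh_real_nonneg_le_iff[of "r - t" r] by auto

text \<open>The hyperbolic cosine of 1 is far below 12. This connects the threshold with the
  supremum over radii at least one.\<close>

lemma late_ge_1: "late r ==> 1 <= r"
proof (rule ccontr)
 assume r: "late r" and "\<not> 1 <= r"
 then have "cosh r <= cosh 1" by (subst cosh_real_nonneg_le_iff) (auto simp: late_def)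
 moreover have "cosh 1 = (exp 1 + exp (- 1)) / (2::real)" by (simp add: cosh_def)
 moreover have "exp 1 <= (3::real)" by (rule exp_le)
 moreover have "exp (- 1) <= (1::real)" by simp
 moreover have "24 <= 2 * cosh r" using r by (simp add: late_def)
 ultimately show False by argo
qed

definition spikes :: "delays => (real^2^2) \<times> real => ennreal" where
 "spikes L y = (\<Sum>(t, w)\<leftarrow>L. spike t w y)"

lemma spikes_simps [simp]: "spikes [] y = 0" "spikes ((t, w) # L) y = spike t w y + spikes L y"
 by (simp_all add: spikes_def)

lemma spikes_measurable: "admissible L ==> spikes L : borel_measurable YY"
proof (induction L)
 case (Cons a L)
 obtain t w where a: "a = (t, w)" by force
 have "(%y. spike t w y + spikes L y) : borel_measurable YY"
  using Cons a by (intro borel_measurable_add spike_measurable) (auto simp: weight_def)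
 then show ?case by (simp add: a spikes_def)
qed (simp add: spikes_def[abs_def])

lemma nn_integral_spikes: "admissible L ==> (\<integral>\<^sup>+y. spikes L y \<partial>YY) <= 64 * mass L"
proof (induction L)
 case (Cons a L)
 obtain t w where a: "a = (t, w)" by force
 have w: "w : borel_measurable Om" "0 <= t" and L: "admissible L" using Cons.prems a by (auto simp: weight_def)
 have "(\<integral>\<^sup>+y. spikes (a # L) y \<partial>YY) = (\<integral>\<^sup>+y. spike t w y \<partial>YY) + (\<integral>\<^sup>+y. spikes L y \<partial>YY)"
  unfolding a spikes_simps by (rule nn_integral_add[OF spike_measurable[OF w(1)] spikes_measurable[OF L]])
 also have "... <= 64 * (\<integral>\<^sup>+x. w x \<partial>Om) + 64 * mass L" by (intro add_mono nn_integral_spike w Cons.IH L)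
 finally show ?case by (simp add: a distrib_left)
qed (simp add: spikes_def[abs_def])

lemma level_le_avg_spikes:
 assumes y: "y : space YY"
 shows "admissible L ==> level L r y <= avg (2 * cosh r) (spikes L) y"
proof (induction L)
 case (Cons a L)
 obtain t w where a: "a = (t, w)" by force
 have w: "w : borel_measurable Om" "0 <= t" and L: "admissible L" using Cons.prems a by (auto simp: weight_def)
 have "level (a # L) r y <= avg (2 * cosh r) (spike t w) y + avg (2 * cosh r) (spikes L) y"
  unfolding a level_Cons by (intro add_mono delayed_le_avg_spike Cons.IH w L y)
 also have "... = avg (2 * cosh r) (spikes (a # L)) y"
  unfolding avg_def a spikes_simps
  by (rule nn_integral_add[symmetric]) (rule orbit_measurable_ball_law[OF _ y], rule spike_measurable[OF w(1)] spikes_measurable[OF L])+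
 finally show ?case .
qed simp

lemma level_late: "admissible L ==> level L r y ~= 0 ==> late r"
proof (induction L)
 case (Cons a L)
 obtain t w where a: "a = (t, w)" by force
 have "delayed (r - t) w y ~= 0 \<or> level L r y ~= 0" using Cons.prems by (auto simp: a)
 then show ?case
 proof
  assume "delayed (r - t) w y ~= 0"
  then have "late (r - t)" by (auto simp: delayed_def split: if_splits)
  then show ?thesis using Cons.prems by (auto simp: a intro: late_mono)
 qed (use Cons in \<open>auto simp: a\<close>)
qed simp

text \<open>Masses of order \<open>(1/4) ^ k\<close> scaled by \<open>2 ^ k\<close> are summable,
  while the averages they produce grow like \<open>2 ^ k / 2\<close>. The exceptional sets are
  summable too, so by Borel-Cantelli almost every point escapes all but finitely many of
  them.\<close>

lemma unbounded_averages:
 "\<exists>F\<in>borel_measurable YY. (\<integral>\<^sup>+y. F y \<partial>YY) < \<infinity> \<and>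
   (AE y in YY. \<forall>K::nat. \<exists>r. late r & of_nat K <= avg (2 * cosh r) F y)"
proof -
 have "\<exists>L N. admissible L & mass L <= ennreal ((1 / 4) ^ k) & N : sets YY & emeasure YY N <= ennreal ((1 / 2) ^ Suc k) \<and>
   (\<forall>y\<in>space YY - N. \<exists>r. 1 <= level L r y + ennreal (1 / 2))" for k :: nat
 proof -
  obtain \<alpha> where \<alpha>: "0 < \<alpha>" "\<alpha> <= (1 / 4) ^ k" "profile \<alpha>" using profile_small[of "(1 / 4) ^ k"] by auto
  have h: "0 < (1 / 2 :: real) ^ Suc k" by simp
  obtain L R where L: "admissible L" "mass L = ennreal \<alpha>"
   and m: "mostly ((1 / 2) ^ Suc k) (%y. \<exists>r\<in>R. 1 <= level L r y + ennreal ((1 / 2) ^ Suc k))"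
   using \<alpha>(3) h unfolding profile_def by blast
  obtain N where N: "N : sets YY" "emeasure YY N <= ennreal ((1 / 2) ^ Suc k)"
   "\<forall>y\<in>space YY - N. \<exists>r\<in>R. 1 <= level L r y + ennreal ((1 / 2) ^ Suc k)" using m unfolding mostly_def by blast
  have "(1 / 2 :: real) ^ Suc k <= 1 / 2" by (simp add: power_le_one)
  then have le: "A + ennreal ((1 / 2) ^ Suc k) <= A + ennreal (1 / 2)" for A by (intro add_left_mono ennreal_leI)
  have "\<forall>y\<in>space YY - N. \<exists>r. 1 <= level L r y + ennreal (1 / 2)"
   using N(3) order_trans[OF _ le] by blast
  then show ?thesis using L \<alpha> N by (intro exI[of _ L] exI[of _ N]) (auto intro!: ennreal_leI)
 qed
 then have "\<forall>k. \<exists>LN. admissible (fst LN) & mass (fst LN) <= ennreal ((1 / 4) ^ k) & snd LN : sets YY & emeasure YY (snd LN) <= ennreal ((1 / 2) ^ Suc k) \<and>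
   (\<forall>y\<in>space YY - snd LN. \<exists>r. 1 <= level (fst LN) r y + ennreal (1 / 2))"
  by (metis fst_conv snd_conv)
 from choice[OF this] obtain LN where LN: "\<And>k. admissible (fst (LN k)) & mass (fst (LN k)) <= ennreal ((1 / 4) ^ k) & snd (LN k) : sets YY & emeasure YY (snd (LN k)) <= ennreal ((1 / 2) ^ Suc k) \<and>
   (\<forall>y\<in>space YY - snd (LN k). \<exists>r. 1 <= level (fst (LN k)) r y + ennreal (1 / 2))" by blast
 define L N where "L k = fst (LN k)" and "N k = snd (LN k)" for k
 have L: "admissible (L k)" "mass (L k) <= ennreal ((1 / 4) ^ k)" and N: "N k : sets YY" "emeasure YY (N k) <= ennreal ((1 / 2) ^ Suc k)"
  and LNr: "\<And>y. y : space YY - N k ==> \<exists>r. 1 <= level (L k) r y + ennreal (1 / 2)" for k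
  using LN[of k] unfolding L_def N_def by blast+
 define F where "F y = (\<Sum>k. ennreal (2 ^ k) * spikes (L k) y)" for y
 have tm: "(%y. ennreal (2 ^ k) * spikes (L k) y) : borel_measurable YY" for k
  by (intro borel_measurable_times_ennreal spikes_measurable L) simp
 have Fm: "F : borel_measurable YY" unfolding F_def using tm by measurable
 have "(\<integral>\<^sup>+y. F y \<partial>YY) = (\<Sum>k. \<integral>\<^sup>+y. ennreal (2 ^ k) * spikes (L k) y \<partial>YY)"
  unfolding F_def by (rule nn_integral_suminf[OF tm])
 also have "... <= (\<Sum>k. ennreal (64 * (1 / 2) ^ k))"
 proof (rule suminf_le)
  fix k
  have "(\<integral>\<^sup>+y. ennreal (2 ^ k) * spikes (L k) y \<partial>YY) = ennreal (2 ^ k) * (\<integral>\<^sup>+y. spikes (L k) y \<partial>YY)"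
   by (rule nn_integral_cmult[OF spikes_measurable[OF L(1)]])
  also have "... <= ennreal (2 ^ k) * (64 * ennreal ((1 / 4) ^ k))"
   by (intro mult_left_mono order_trans[OF nn_integral_spikes[OF L(1)]] L) auto
  also have "... = ennreal (2 ^ k * (64 * (1 / 4) ^ k))"
   by (subst ennreal_mult, simp, simp) (simp add: ennreal_mult')
  also have "2 ^ k * (64 * (1 / 4) ^ k) = 64 * (1 / 2 :: real) ^ k"
   by (simp add: power_mult_distrib[symmetric])
  finally show "(\<integral>\<^sup>+y. ennreal (2 ^ k) * spikes (L k) y \<partial>YY) <= ennreal (64 * (1 / 2) ^ k)" .
 qed auto
 also have "... = ennreal (\<Sum>k. 64 * (1 / 2) ^ k)"
  by (rule suminf_ennreal2) (auto intro!: summable_mult summable_geometric)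
 also have "... < \<infinity>" by simp
 finally have Ffin: "(\<integral>\<^sup>+y. F y \<partial>YY) < \<infinity>" .
 have "AE y in YY. eventually (%k. y : space YY - N k) sequentially"
 proof (rule borel_cantelli_AE1[OF N(1)])
  show "emeasure YY (N k) < \<infinity>" for k by (simp add: YS.emeasure_eq_measure)
  have "measure YY (N k) <= (1 / 2) ^ Suc k" for k
   using N(2)[of k] by (simp add: YS.emeasure_eq_measure ennreal_le_iff)
  then have "norm (measure YY (N k)) <= (1 / 2) ^ Suc k" for k by simp
  then have le: "\<exists>n0. \<forall>k\<ge>n0. norm (measure YY (N k)) <= (1 / 2) ^ Suc k" by blast
  have "summable (%k. (1 / 2 :: real) ^ k)" by (rule summable_geometric) simp
  then have "summable (%k. (1 / 2 :: real) ^ Suc k)" by (simp only: summable_Suc_iff)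
  then show "summable (%k. measure YY (N k))" by (rule summable_comparison_test[OF le])
 qed
 then have "AE y in YY. \<forall>K::nat. \<exists>r. late r & of_nat K <= avg (2 * cosh r) F y"
  using AE_space
 proof eventually_elim
  case (elim y)
  show ?case
  proof
   fix K :: nat
   obtain n where n: "\<And>k. n <= k ==> y : space YY - N k" using elim(1) unfolding eventually_sequentially by blast
   \<comment> \<open>Then \<open>2 * K <= k < 2 ^ k\<close>, so half of \<open>2 ^ k\<close> is at
     least \<open>K\<close>.\<close>
   define k where "k = max n (2 * K)"
   obtain r where r: "1 <= level (L k) r y + ennreal (1 / 2)" using LNr[OF n[of k]] by (auto simp: k_def)
   have l: "ennreal (1 / 2) <= level (L k) r y"
   proof (cases "level (L k) r y")
    case (real a)
    have "1 <= ennreal a + ennreal (1 / 2)" using r unfolding real(2) .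
    also have "... = ennreal (a + 1 / 2)" using real(1) by (intro ennreal_plus[symmetric]) auto
    finally have "\<not> ennreal (a + 1 / 2) < ennreal 1" unfolding ennreal_1 not_less .
    then have "1 <= a + 1 / 2" using ennreal_lessI[of 1 "a + 1 / 2"] by linarith
    then show ?thesis unfolding real(2) by (intro ennreal_leI) simp
   qed simp
   have lr: "late r" by (rule level_late[OF L(1), of k r y]) (use l in auto)
   have "2 * K <= k" by (simp add: k_def)
   then have "2 * real K <= real k" by linarith
   also have "... <= 2 ^ k" using of_nat_less_two_power[of k, where 'a = real] by simp
   finally have "real K <= 2 ^ k * (1 / 2)" by simp
   then have "ennreal (real K) <= ennreal (2 ^ k * (1 / 2))" by (rule ennreal_leI)
   then have "of_nat K <= ennreal (2 ^ k * (1 / 2))" by (simp add: ennreal_of_nat_eq_real_of_nat)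
   also have "... = ennreal (2 ^ k) * ennreal (1 / 2)" by (rule ennreal_mult) auto
   also have "... <= ennreal (2 ^ k) * avg (2 * cosh r) (spikes (L k)) y"
    using l level_le_avg_spikes[OF elim(2) L(1)] by (intro mult_left_mono) (auto intro: order_trans)
   also have "... = (\<integral>\<^sup>+g. ennreal (2 ^ k) * spikes (L k) (actY g y) \<partial>ball_law (2 * cosh r))"
    unfolding avg_def by (rule nn_integral_cmult[symmetric]) (rule orbit_measurable_ball_law[OF spikes_measurable[OF L(1)] elim(2)])
   also have "... <= avg (2 * cosh r) F y"
    unfolding avg_def F_def
   proof (rule nn_integral_mono)
    fix g
    show "ennreal (2 ^ k) * spikes (L k) (actY g y) <= (\<Sum>k. ennreal (2 ^ k) * spikes (L k) (actY g y))"
     using sum_le_suminf[of "%k. ennreal (2 ^ k) * spikes (L k) (actY g y)" "{k}"] by simp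
   qed
   finally show "\<exists>r. late r & of_nat K <= avg (2 * cosh r) F y" using lr by blast
  qed
 qed
 then show ?thesis using Fm Ffin by blast
qed

definition orb :: "((real^2^2) \<times> real => real) => real => (real^2^2) \<times> real => ennreal" where
 "orb f s y = (\<integral>\<^sup>+g. ennreal (f (actY g y)) * indicator (fball s) g \<partial>haar)"

text \<open>The passage from extended to real values loses nothing: almost everywhere the averages
  over countably many growing balls are finite, so \<open>F\<close> is finite at almost every
  element of the orbit and its truncation has the same ball integrals.\<close>

lemma unbounded_orbit_averages:
 "\<exists>f. f : borel_measurable YY & (\<forall>y. 0 <= f y) & integrable YY f \<and>
  (AE y in YY. (\<forall>s. orb f s y < \<infinity>) \<and>
    (\<forall>K::nat. \<exists>r. late r & of_nat K <= orb f (2 * cosh r) y / emeasure haar (fball (2 * cosh r))))"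
proof -
 obtain F where Fm: "F : borel_measurable YY" and Ffin: "(\<integral>\<^sup>+y. F y \<partial>YY) < \<infinity>"
  and FK: "AE y in YY. \<forall>K::nat. \<exists>r. late r & of_nat K <= avg (2 * cosh r) F y"
  using unbounded_averages by blast
 define f where "f y = enn2real (F y)" for y
 have fm: "f : borel_measurable YY" unfolding f_def using Fm by measurable
 have fF: "ennreal (f y) <= F y" for y unfolding f_def by (cases "F y") auto
 have int: "integrable YY f"
 proof (rule integrableI_nonneg[OF fm])
  show "AE y in YY. 0 <= f y" by (simp add: f_def)
  show "(\<integral>\<^sup>+y. ennreal (f y) \<partial>YY) < \<infinity>" using nn_integral_mono[of YY "%y. ennreal (f y)" F] fF Ffin by (auto intro: le_less_trans)
 qed
 define oF where "oF s y = (\<integral>\<^sup>+g. F (actY g y) * indicator (fball s) g \<partial>haar)" for s y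
 have avgF: "avg s F y = oF s y / emeasure haar (fball s)" if "y : space YY" for s y
  unfolding avg_def ball_law_def oF_def
  by (rule nn_integral_uniform_measure) (use YS.orbit_measurable[OF Fm that] in \<open>auto cong: measurable_cong_sets\<close>)
 have "AE y in YY. \<forall>n::nat. avg (24 + real n) F y ~= \<infinity>"
  unfolding AE_all_countable
 proof
  fix n :: nat
  show "AE y in YY. avg (24 + real n) F y ~= \<infinity>"
   by (rule nn_integral_PInf_AE) (use Ffin in \<open>auto intro!: avg_measurable Fm simp: nn_integral_avg Fm\<close>)
 qed
 then have "AE y in YY. (\<forall>s. orb f s y < \<infinity>) \<and>
    (\<forall>K::nat. \<exists>r. late r & of_nat K <= orb f (2 * cosh r) y / emeasure haar (fball (2 * cosh r)))"
  using FK AE_space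
 proof eventually_elim
  case (elim y)
  have om: "(%g. F (actY g y)) : borel_measurable haar" using YS.orbit_measurable[OF Fm elim(3)] by (simp cong: measurable_cong_sets)
  have fin: "oF s y ~= \<infinity>" for s
  proof -
   obtain n :: nat where n: "s <= 24 + real n" using real_arch_simple[of s] by (metis add_increasing zero_le_numeral)
   have "oF (24 + real n) y / emeasure haar (fball (24 + real n)) ~= \<infinity>" using elim(1) avgF[OF elim(3)] by metis
   then have "oF (24 + real n) y ~= \<infinity>"
    using emeasure_fball_nontrivial(2)[of "24 + real n"] by (auto simp: ennreal_top_divide)
   moreover have "oF s y <= oF (24 + real n) y"
    unfolding oF_def by (intro nn_integral_mono) (use n in \<open>auto simp: fball_def split: split_indicator\<close>)
   ultimately show ?thesis by (auto simp: top_unique)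
  qed
  have eq: "orb f s y = oF s y" for s
   unfolding orb_def oF_def
  proof (rule nn_integral_cong_AE)
   have "AE g in haar. F (actY g y) * indicator (fball s) g ~= \<infinity>"
    by (rule nn_integral_PInf_AE) (use om fin[of s] in \<open>auto simp: oF_def\<close>)
   then show "AE g in haar. ennreal (f (actY g y)) * indicator (fball s) g = F (actY g y) * indicator (fball s) g"
    by eventually_elim (auto simp: f_def less_top split: split_indicator_asm split_indicator)
  qed
  show ?case
  proof (intro conjI allI)
   show "orb f s y < \<infinity>" for s using fin[of s] unfolding eq by (simp add: less_top)
   show "\<exists>r. late r & of_nat K <= orb f (2 * cosh r) y / emeasure haar (fball (2 * cosh r))" for K :: nat
    using elim(2) unfolding eq avgF[OF elim(3)] by blast
  qed
 qed
 moreover have "\<forall>y. 0 <= f y" by (simp add: f_def)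
 ultimately show ?thesis using fm int by blast
qed

section \<open>Balls around an arbitrary base point\<close>

text \<open>The upper triangular element of \<open>SL2\<close> that takes the point i to
  \<open>z\<close>.\<close>

definition base :: "complex => real^2^2" where
 "base z = mk2 (sqrt (Im z)) (Re z / sqrt (Im z)) 0 (1 / sqrt (Im z))"

lemma base_SL2: "z : H2 ==> base z : SL2"
 by (simp add: base_def H2_def)

text \<open>The left side is the hyperbolic cosine of the displacement of \<open>z\<close>.
  Conjugation by \<open>base z\<close> moves the base point to i, where half of \<open>frob2\<close>
  gives this number.\<close>

lemma hdist_mobius:
 assumes z: "z : H2" and g: "g : SL2"
 shows "1 + (cmod (z - mobius g z))^2 / (2 * Im z * Im (mobius g z)) = frob2 (adj2 (base z) ** g ** base z) / 2"
proof -
 obtain a b c d where gm: "g = mk2 a b c d" and det: "a * d - b * c = 1" using g by (rule SL2_cases)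
 define x y where "x = Re z" and "y = Im z"
 have y: "0 < y" using z by (simp add: H2_def y_def)
 have zc: "z = Complex x y" by (simp add: x_def y_def)
 define D where "D = (c * x + d)^2 + (c * y)^2"
 have D: "0 < D"
 proof (cases "c = 0")
  case True
  then have "d ~= 0" using det by auto
  then show ?thesis by (simp add: D_def True)
 next
  case False
  then show ?thesis using y by (simp add: D_def add_nonneg_pos)
 qed
 have D2: "(c * x + d) * (c * x + d) + c * y * (c * y) = D" by (simp add: D_def power2_eq_square)
 have mob: "mobius g z = Complex (((a * x + b) * (c * x + d) + a * y * (c * y)) / D) ((a * y * (c * x + d) - (a * x + b) * (c * y)) / D)"
  by (simp add: mobius_def gm zc complex_eq_iff Re_divide Im_divide D2 power2_eq_square)
 have Im: "Im (mobius g z) = y / D"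
 proof -
  have "a * y * (c * x + d) - (a * x + b) * (c * y) = (a * d - b * c) * y" by (simp add: algebra_simps)
  then show ?thesis unfolding mob det by simp
 qed
 \<comment> \<open>Real and imaginary part of c z^2 + (d - a) z - b, the numerator of
   \<open>z - mobius g z\<close>; the number \<open>D\<close> is the squared modulus of its
   denominator c z + d.\<close>
 define P Q where "P = c * (x^2 - y\<^sup>2) + (d - a) * x - b" and "Q = 2 * c * x * y + (d - a) * y"
 have cm: "(cmod (z - mobius g z))^2 = (P^2 + Q^2) / D"
 proof -
  have "x * D - ((a * x + b) * (c * x + d) + a * y * (c * y)) = P * (c * x + d) + Q * (c * y)"
   unfolding D_def P_def Q_def by algebra
  then have R: "Re (z - mobius g z) = (P * (c * x + d) + Q * (c * y)) / D"
   unfolding mob using D by (simp add: x_def[symmetric] field_simps)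
  have "y * D - (a * y * (c * x + d) - (a * x + b) * (c * y)) = Q * (c * x + d) - P * (c * y)"
   unfolding D_def P_def Q_def by algebra
  then have I: "Im (z - mobius g z) = (Q * (c * x + d) - P * (c * y)) / D"
   unfolding mob using D by (simp add: y_def[symmetric] field_simps)
  have "(cmod (z - mobius g z))^2 = ((P * (c * x + d) + Q * (c * y))^2 + (Q * (c * x + d) - P * (c * y))^2) / D^2"
   unfolding cmod_power2 R I power_divide by (rule add_divide_distrib[symmetric])
  also have "(P * (c * x + d) + Q * (c * y))^2 + (Q * (c * x + d) - P * (c * y))^2 = (P^2 + Q^2) * D"
   unfolding D_def by algebra
  finally show ?thesis using D by (simp add: power2_eq_square)
 qed
 define r where "r = sqrt y"
 have r: "0 < r" "y = r * r" using y by (simp_all add: r_def)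
 have "adj2 (base z) ** g ** base z = mk2 (a - x * c) (((a - x * c) * x + (b - x * d)) / y) (c * y) (c * x + d)"
  unfolding base_def gm x_def[symmetric] y_def[symmetric] r_def[symmetric] using r
  by (simp add: r(2) field_simps)
 then have fr: "frob2 (adj2 (base z) ** g ** base z) = (a - x * c)^2 + (((a - x * c) * x + (b - x * d)) / y)^2 + (c * y)^2 + (c * x + d)^2"
  by simp
 have "2 * y^2 + (P^2 + Q^2) = (a - x * c)^2 * y^2 + ((a - x * c) * x + (b - x * d))^2 + (c * y)^2 * y^2 + (c * x + d)^2 * y^2"
  unfolding P_def Q_def using det by algebra
 then have "2 + (P^2 + Q^2) / y^2 = frob2 (adj2 (base z) ** g ** base z)"
  unfolding fr power_divide using y by (simp add: field_simps)
 moreover have "(cmod (z - mobius g z))^2 / (2 * Im z * Im (mobius g z)) = (P^2 + Q^2) / y^2 / 2"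
  unfolding cm Im y_def[symmetric] using y D by (simp add: field_simps power2_eq_square)
 moreover have "1 + t = F / 2" if "2 + u = F" "t = u / 2" for t u F :: real using that by (simp add: field_simps)
 ultimately show ?thesis by blast
qed

lemma ballF_iff:
 assumes z: "z : H2" and r: "0 <= r" and g: "g : SL2"
 shows "g : ballF z r \<longleftrightarrow> adj2 (base z) ** g ** base z : fball (2 * cosh r)"
proof -
 let ?u = "1 + (cmod (z - mobius g z))^2 / (2 * Im z * Im (mobius g z))"
 let ?k = "adj2 (base z) ** g ** base z"
 have k: "?k : SL2" using base_SL2[OF z] g by simp
 have u: "1 <= ?u"
 proof -
  obtain a b c d where km: "?k = mk2 a b c d" "a * d - b * c = 1" using k by (rule SL2_cases)
  have "0 <= (a - d)^2 + (b + c)^2" by simp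
  then have "2 * (a * d - b * c) <= a^2 + b^2 + c^2 + d^2" by (simp add: power2_eq_square algebra_simps)
  then have "2 <= frob2 ?k" unfolding km by (simp add: km(2))
  then show ?thesis unfolding hdist_mobius[OF z g] by simp
 qed
 have "hdist z (mobius g z) <= r \<longleftrightarrow> cosh (arcosh ?u) <= cosh r"
  unfolding hdist_def using u r by (subst cosh_real_nonneg_le_iff) auto
 also have "... \<longleftrightarrow> ?u <= cosh r" using u by (simp add: cosh_arcosh_real)
 also have "... \<longleftrightarrow> frob2 ?k <= 2 * cosh r" unfolding hdist_mobius[OF z g] by (simp add: mult.commute)
 finally show ?thesis using g k by (simp add: ballF_def fball_def)
qed

lemma ballF_sets:
 assumes z: "z : H2" and r: "0 <= r"
 shows "ballF z r : sets SL2_borel"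
proof -
 have "(%g. adj2 (base z) ** g ** base z) : measurable SL2_borel SL2_borel"
  using base_SL2[OF z] by (intro measurable_mult_SL2 measurable_const_SL2) auto
 from measurable_sets[OF this fball_sets] have "(%g. adj2 (base z) ** g ** base z) -` fball (2 * cosh r) \<inter> SL2 : sets SL2_borel" by simp
 also have "(%g. adj2 (base z) ** g ** base z) -` fball (2 * cosh r) \<inter> SL2 = ballF z r"
  using ballF_iff[OF z r] by (auto simp: ballF_def)
 finally show ?thesis .
qed

text \<open>A ball around another base point is a conjugate of a norm ball, and \<open>haar\<close>
  is invariant on both sides.\<close>

lemma nn_integral_ballF:
 assumes z: "z : H2" and r: "0 <= r" and \<phi>: "\<phi> : borel_measurable SL2_borel"
 shows "(\<integral>\<^sup>+g. \<phi> g * indicator (ballF z r) g \<partial>haar)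
  = (\<integral>\<^sup>+k. \<phi> (base z ** k ** adj2 (base z)) * indicator (fball (2 * cosh r)) k \<partial>haar)"
proof -
 let ?h = "base z"
 note h = base_SL2[OF z]
 define \<psi> where "\<psi> g = \<phi> g * indicator (ballF z r) g" for g
 have \<psi>: "\<psi> : borel_measurable SL2_borel" unfolding \<psi>_def using \<phi> ballF_sets[OF z r] by measurable
 have "(\<integral>\<^sup>+g. \<psi> g \<partial>haar) = (\<integral>\<^sup>+g. \<psi> (g ** adj2 ?h) \<partial>haar)"
  by (rule nn_integral_haar_right[OF \<psi>, symmetric]) (simp add: h)
 also have "... = (\<integral>\<^sup>+k. \<psi> (?h ** k ** adj2 ?h) \<partial>haar)"
  by (rule nn_integral_haar_left[OF measurable_compose[OF measurable_mult_right_SL2 \<psi>] h, symmetric]) (simp add: h)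
 also have "... = (\<integral>\<^sup>+k. \<phi> (?h ** k ** adj2 ?h) * indicator (fball (2 * cosh r)) k \<partial>haar)"
 proof (rule nn_integral_cong)
  fix k assume "k : space haar"
  then have k: "k : SL2" by simp
  have "adj2 ?h ** (?h ** k ** adj2 ?h) ** ?h = k" using h by (simp add: matrix_mul_assoc[symmetric])
  then have "?h ** k ** adj2 ?h : ballF z r \<longleftrightarrow> k : fball (2 * cosh r)"
   using ballF_iff[OF z r, of "?h ** k ** adj2 ?h"] h k by simp
  then show "\<psi> (?h ** k ** adj2 ?h) = \<phi> (?h ** k ** adj2 ?h) * indicator (fball (2 * cosh r)) k"
   by (simp add: \<psi>_def indicator_def)
 qed
 finally show ?thesis unfolding \<psi>_def .
qed

section \<open>The action on a Borel subset of the line\<close>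

text \<open>The image of the space under the coding, written as a set of fixed points of coding
  after decoding so that it is visibly Borel.\<close>

definition SS :: "real set" where
 "SS = {z. point_decode z : DD \<times> {0..<1} & point_code (point_decode z) = z}"

definition MM :: "real measure" where
 "MM = distr YY (restrict_space borel SS) point_code"

definition actM :: "real^2^2 => real => real" where
 "actM g x = point_code (actY g (point_decode x))"

lemma SS_sets: "SS : sets borel"
proof -
 have [measurable]: "DD : sets borel" using DD_sets unfolding SL2_borel_def by (simp add: sets_restrict_space_iff)
 have m: "(%z. point_decode z) : measurable borel (borel \<Otimes>\<^sub>M borel)" by (rule measurable_point_decode)
 have "(%z. point_code (point_decode z)) : borel_measurable borel" by (rule measurable_compose[OF m measurable_point_code])
 then have 2: "{z : space borel. point_code (point_decode z) = z} : sets borel" by measurable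
 have "DD \<times> {0..<1::real} : sets (borel \<Otimes>\<^sub>M borel)" by (rule pair_measureI) auto
 from measurable_sets[OF m this] have 1: "point_decode -` (DD \<times> {0..<1}) \<inter> space borel : sets borel" by simp
 have "SS = (point_decode -` (DD \<times> {0..<1}) \<inter> space borel) \<inter> {z : space borel. point_code (point_decode z) = z}"
  by (auto simp: SS_def)
 then show ?thesis using sets.Int[OF 1 2] by (simp only:)
qed

lemma space_MM [simp]: "space MM = SS"
 by (simp add: MM_def space_restrict_space)

lemma sets_MM: "sets MM = sets (restrict_space borel SS)"
 by (simp add: MM_def)

lemma decode_space: "x : SS ==> point_decode x : space YY" "x : SS ==> point_code (point_decode x) = x"
 by (auto simp: SS_def)

lemma code_SS: "y : space YY ==> point_code y : SS"
 by (simp add: SS_def point_decode_code)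

lemma measurable_code: "point_code : measurable YY (restrict_space borel SS)"
proof (rule measurable_restrict_space2)
 have "(%z. (fst z, snd z)) : measurable (SL2_borel \<Otimes>\<^sub>M Om) (borel \<Otimes>\<^sub>M borel)"
  by (intro measurable_Pair measurable_compose[OF measurable_fst measurable_ident_SL2] measurable_compose[OF measurable_snd measurable_Om_borel])
 from measurable_compose[OF measurable_compose[OF measurable_YY_ident this] measurable_point_code]
 show "point_code : borel_measurable YY" by simp
qed (use code_SS in auto)

lemma measurable_code_MM: "point_code : measurable YY MM"
 using measurable_code sets_MM by (simp cong: measurable_cong_sets)

lemma measurable_decode: "point_decode : measurable MM YY"
proof -
 have m: "point_decode : measurable (restrict_space borel SS) (borel \<Otimes>\<^sub>M borel)"
  by (rule measurable_restrict_space1[OF measurable_point_decode])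
 have "(%x. (fst (point_decode x), snd (point_decode x))) : measurable (restrict_space borel SS) YY"
  unfolding YY_def
 proof (intro measurable_Pair measurable_to_MD measurable_SL2_borelI measurable_to_Om)
  show "(%x. fst (point_decode x)) : borel_measurable (restrict_space borel SS)" by (rule measurable_compose[OF m measurable_fst])
  show "(%x. snd (point_decode x)) : borel_measurable (restrict_space borel SS)" by (rule measurable_compose[OF m measurable_snd])
 qed (use DD_SL2 in \<open>auto simp: space_restrict_space SS_def mem_Times_iff\<close>)
 then show ?thesis using sets_MM by (simp cong: measurable_cong_sets)
qed

lemma distr_decode: "distr MM YY point_decode = YY"
proof -
 have "distr MM YY point_decode = distr YY YY (point_decode \<circ> point_code)"
  unfolding MM_def using measurable_decode sets_MM
  by (intro distr_distr measurable_code) (simp cong: measurable_cong_sets)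
 also have "... = distr YY YY (%y. y)" by (rule distr_cong) (simp_all add: point_decode_code)
 finally show ?thesis by (simp add: distr_id2)
qed

lemma AE_MM: "AE y in YY. P y ==> AE x in MM. P (point_decode x)"
 using AE_distrD[OF measurable_decode, of P] unfolding distr_decode .

lemma AE_actY:
 assumes "AE y in YY. P y" and g: "g : SL2"
 shows "AE y in YY. P (actY g y)"
 using AE_distrD[OF YS.act_measurable[OF g], of P] assms(1) unfolding YS.act_distr[OF g] .

lemma actY_space: "g : SL2 ==> y : space YY ==> actY g y : space YY"
 by (rule measurable_space[OF YS.act_measurable])

lemma standard_MM: "standard_prob_space_real MM"
proof -
 have "prob_space MM" unfolding MM_def by (rule YS.prob_space_distr[OF measurable_code])
 then show ?thesis unfolding standard_prob_space_real_def using SS_sets sets_MM by simp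
qed

text \<open>The element \<open>- mat 1\<close> is central, so it can be moved to the right, where it
  belongs to \<open>Gam\<close> with \<open>hom\<close> equal to zero. Thus the action descends to
  the quotient by the centre.\<close>

lemma actY_neg_one:
 assumes y: "y : space YY"
 shows "actY (- mat 1) y = y"
proof -
 obtain d w where yd: "y = (d, w)" "d : DD" "w : {0..<1}" using y by auto
 have "(- mat 1) ** d = d ** (- mat 1)" by (cases d rule: mk2_cases) (simp add: mat_1_mk2 uminus_mk2)
 then have "actY (- mat 1) y = proj (d ** (- mat 1), w)" by (simp add: actY_def yd)
 also have "... = proj (d, rot (hom (- mat 1)) w)" using yd DD_SL2 Gam_neg_one by (intro proj_mult) auto
 also have "... = y" using yd proj_id[OF y] by (simp add: hom_neg_one rot_0)
 finally show ?thesis .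
qed

lemma measurable_actM: "(%(g, x). actM g x) : measurable (SL2_borel \<Otimes>\<^sub>M MM) MM"
proof -
 have "(%z. (fst z, point_decode (snd z))) : measurable (SL2_borel \<Otimes>\<^sub>M MM) (SL2_borel \<Otimes>\<^sub>M YY)"
  by (intro measurable_Pair measurable_fst measurable_compose[OF measurable_snd measurable_decode])
 from measurable_compose[OF measurable_compose[OF this YS.act_meas] measurable_code_MM]
 show ?thesis by (simp add: actM_def case_prod_beta')
qed

lemma pmp_MM: "pmp_action MM actM"
 unfolding pmp_action_def
proof (intro conjI ballI)
 show "(%(g, x). actM g x) : measurable (SL2_borel \<Otimes>\<^sub>M MM) MM" by (rule measurable_actM)
 show "actM (mat 1) x = x" if "x : space MM" for x
  using that by (simp add: actM_def YS.act_one decode_space del: space_YY)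
 show "actM (- mat 1) x = x" if "x : space MM" for x
  using that by (simp add: actM_def actY_neg_one decode_space del: space_YY)
 show "actM (g ** h) x = actM g (actM h x)" if "g : SL2" "h : SL2" "x : space MM" for g h x
  using that by (simp add: actM_def YS.act_mult point_decode_code decode_space del: space_YY)
 show "measure_preserving_map MM (actM g)" if g: "g : SL2" for g
  unfolding measure_preserving_map_def
 proof
  have "(%x. actY g (point_decode x)) : measurable MM YY"
   by (rule measurable_compose[OF measurable_decode YS.act_measurable[OF g]])
  from measurable_compose[OF this measurable_code_MM] show m: "actM g : measurable MM MM" by (simp add: actM_def[abs_def])
  have "distr MM MM (actM g) = distr YY MM (actM g \<circ> point_code)"
  proof -
   have "actM g : measurable (restrict_space borel SS) MM" using m sets_MM by (simp cong: measurable_cong_sets)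
   from distr_distr[OF this measurable_code] show ?thesis unfolding MM_def[symmetric] .
  qed
  also have "... = distr YY MM (point_code \<circ> actY g)"
   by (rule distr_cong) (simp_all add: actM_def point_decode_code)
  also have "... = distr (distr YY YY (actY g)) MM point_code"
   by (rule distr_distr[OF measurable_code_MM YS.act_measurable[OF g], symmetric])
  also have "... = distr YY MM point_code" by (simp add: YS.act_distr[OF g])
  also have "... = MM" unfolding MM_def by (rule distr_cong) auto
  finally show "distr MM MM (actM g) = MM" .
 qed
qed

lemma ergodic_MM: "ergodic_action MM actM"
 unfolding ergodic_action_def
proof (intro ballI impI)
 fix A assume A: "A : sets MM" and inv: "\<forall>g\<in>SL2. actM g -` A \<inter> space MM = A"
 define B where "B = point_code -` A \<inter> space YY"
 have B [measurable]: "B : sets YY" unfolding B_def by (rule measurable_sets[OF measurable_code_MM A])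
 have em: "emeasure MM A = emeasure YY B"
  unfolding MM_def B_def using A sets_MM by (intro emeasure_distr measurable_code) simp
 have bf: "YS.bfun 1 (indicator B)" by (auto simp: YS.bfun_def split: split_indicator)
 have "indicator B (actY g y) = (indicator B y :: real)" if g: "g : SL2" and y: "y : space YY" for g y
 proof -
  have "actM g (point_code y) : A \<longleftrightarrow> point_code y : A" using inv g code_SS[OF y] by auto
  then have "actY g y : B \<longleftrightarrow> y : B"
   using y actY_space[OF g y] by (simp add: B_def actM_def point_decode_code del: space_YY)
  then show ?thesis by (simp add: indicator_def)
 qed
 then obtain c where c: "AE y in YY. indicator B y = (c::real)"
  using YS.erg[OF bf] by (auto simp del: space_YY)
 show "emeasure MM A = 0 \<or> emeasure MM A = 1"
 proof (cases "c = 1")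
  case True
  have "AE y in YY. y : B" using c by eventually_elim (auto simp: True split: split_indicator_asm)
  then have "emeasure YY B = 1" by (rule YS.emeasure_eq_1_AE[OF B])
  then show ?thesis using em by simp
 next
  case False
  have "AE y in YY. y \<notin> B" using c by eventually_elim (use False in \<open>auto split: split_indicator_asm\<close>)
  moreover have eqB: "{y : space YY. \<not> y \<notin> B} = B" using sets.sets_into_space[OF B] by blast
  have "(AE y in YY. y \<notin> B) \<longleftrightarrow> emeasure YY B = 0" by (rule AE_iff_measurable[OF B eqB])
  ultimately have "emeasure YY B = 0" by simp
  then show ?thesis using em by simp
 qed
qed

lemma ennreal_cancel_divide:
 fixes a b :: ennreal
 assumes "0 < c" "b ~= 0" "b ~= \<infinity>"
 shows "ennreal c * a / (ennreal c * b) = a / b"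
proof -
 have "a / b * b = a * 1" unfolding ennreal_divide_times using assms by (subst ennreal_divide_self) (auto simp: less_top)
 from arg_cong[OF this, of "%x. ennreal c * x"]
 have "ennreal c * a = a / b * (ennreal c * b)" by (simp add: mult_ac)
 then have "ennreal c * a / (ennreal c * b) = (a / b * (ennreal c * b)) / (ennreal c * b)" by (rule arg_cong)
 also have "... = a / b" using assms by (intro ennreal_mult_divide_eq) (auto simp: ennreal_mult_eq_top_iff)
 finally show ?thesis .
qed

lemma enn2real_divide:
 assumes "b ~= 0" "b ~= \<infinity>"
 shows "enn2real (a / b) = enn2real a / enn2real b"
proof (cases b)
 case (real b')
 then have "0 < b'" using assms by (cases "b' = 0") auto
 then show ?thesis using real by (cases a) (auto simp: divide_ennreal ennreal_top_divide)
qed (use assms in simp)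

theorem theorem1p2:
  fixes p0 :: complex and lam :: "(real^2^2) measure"
  assumes "p0 \<in> H2"
    and "haar_measure_SL2 lam"
  shows "\<exists>(M :: real measure) (act :: real^2^2 \<Rightarrow> real \<Rightarrow> real) (f :: real \<Rightarrow> real).
           standard_prob_space_real M \<and> pmp_action M act \<and> ergodic_action M act \<and>
           f \<in> borel_measurable M \<and> integrable M f \<and> (\<forall>x\<in>space M. f x \<ge> 0) \<and>
           (AE x in M. maximal_fn lam p0 act f x = \<infinity>) \<and>
           (AE x in M. \<not> (\<exists>L. ((\<lambda>r. ball_avg lam p0 act f r x) \<longlongrightarrow> L) at_top))"
proof -
 obtain c where c: "0 < c" "\<And>\<phi>. \<phi> : borel_measurable SL2_borel ==> (\<integral>\<^sup>+g. \<phi> g \<partial>lam) = ennreal c * (\<integral>\<^sup>+g. \<phi> g \<partial>haar)"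
  using lam_proportional_haar[OF assms(2)] by blast
 note sl = sets_lam[OF assms(2)]
 obtain f where fm: "f : borel_measurable YY" and f0: "\<And>y. 0 <= f y" and fi: "integrable YY f"
  and fK: "AE y in YY. (\<forall>s. orb f s y < \<infinity>) \<and>
    (\<forall>K::nat. \<exists>r. late r & of_nat K <= orb f (2 * cosh r) y / emeasure haar (fball (2 * cosh r)))"
  using unbounded_orbit_averages by blast
 define h where "h = base p0"
 have h: "h : SL2" "adj2 h : SL2" using base_SL2[OF assms(1)] by (simp_all add: h_def)
 \<comment> \<open>The ball around \<open>p0\<close> consists of the elements
   \<open>h ** k ** adj2 h\<close> with \<open>k\<close> in a norm ball. Translating the function by
   \<open>adj2 h\<close> removes the left factor, and the right factor only moves the point at which
   averages are taken.\<close>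
 define f' where "f' x = f (actY (adj2 h) (point_decode x))" for x
 define v where "v y r = orb f (2 * cosh r) y / emeasure haar (fball (2 * cosh r))" for y r
 have f'0: "0 <= f' x" for x by (simp add: f'_def f0)
 have fam: "(%y. f (actY (adj2 h) y)) : borel_measurable YY"
  by (rule measurable_compose[OF YS.act_measurable[OF h(2)] fm])
 have f'm: "f' : borel_measurable MM"
  unfolding f'_def by (rule measurable_compose[OF measurable_decode fam])
 have f'i: "integrable MM f'"
 proof -
  have "integrable (distr YY YY (actY (adj2 h))) f" using fi by (simp add: YS.act_distr[OF h(2)])
  then have "integrable YY (%y. f (actY (adj2 h) y))"
   using integrable_distr[OF YS.act_measurable[OF h(2)]] by blast
  then have "integrable (distr MM YY point_decode) (%y. f (actY (adj2 h) y))" by (simp add: distr_decode)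
  from integrable_distr[OF measurable_decode this] show ?thesis unfolding f'_def[abs_def] .
 qed
 have fact: "f' (actM g x) = f (actY (adj2 h ** g) (point_decode x))" if "g : SL2" "x : SS" for g x
  using that h decode_space(1)[OF that(2)] by (simp add: f'_def actM_def point_decode_code YS.act_mult del: space_YY)
 have om: "(%g. f' (actM g x)) : borel_measurable SL2_borel" if x: "x : SS" for x
 proof -
  have "(%g. actM g x) : measurable SL2_borel MM"
   using measurable_compose[OF measurable_Pair2' measurable_actM, of x] x by simp
  from measurable_compose[OF this f'm] show ?thesis .
 qed
 have ball: "emeasure lam (ballF p0 r) = ennreal c * emeasure haar (fball (2 * cosh r))" if "late r" for r
 proof -
  have r: "0 <= r" using that by (simp add: late_def)
  have "emeasure lam (ballF p0 r) = (\<integral>\<^sup>+g. indicator (ballF p0 r) g \<partial>lam)"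
   using ballF_sets[OF assms(1) r] sl by simp
  also have "... = ennreal c * (\<integral>\<^sup>+g. 1 * indicator (ballF p0 r) g \<partial>haar)"
   using ballF_sets[OF assms(1) r] by (subst c(2)) auto
  also have "(\<integral>\<^sup>+g. 1 * indicator (ballF p0 r) g \<partial>haar) = (\<integral>\<^sup>+k. 1 * indicator (fball (2 * cosh r)) k \<partial>haar)"
   by (rule nn_integral_ballF[OF assms(1) r]) simp
  finally show ?thesis by simp
 qed
 have num: "(\<integral>\<^sup>+g. ennreal (f' (actM g x)) * indicator (ballF p0 r) g \<partial>lam) = ennreal c * orb f (2 * cosh r) (actY (adj2 h) (point_decode x))"
  if "late r" and x: "x : SS" for r x
 proof -
  have r: "0 <= r" using that by (simp add: late_def)
  note y = decode_space(1)[OF x]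
  have "(\<integral>\<^sup>+g. ennreal (f' (actM g x)) * indicator (ballF p0 r) g \<partial>lam) = ennreal c * (\<integral>\<^sup>+g. ennreal (f' (actM g x)) * indicator (ballF p0 r) g \<partial>haar)"
   by (rule c(2)) (intro borel_measurable_times_ennreal borel_measurable_indicator
    measurable_compose[OF om[OF x] measurable_ennreal] ballF_sets[OF assms(1) r])
  also have "(\<integral>\<^sup>+g. ennreal (f' (actM g x)) * indicator (ballF p0 r) g \<partial>haar)
    = (\<integral>\<^sup>+k. ennreal (f' (actM (h ** k ** adj2 h) x)) * indicator (fball (2 * cosh r)) k \<partial>haar)"
   unfolding h_def by (rule nn_integral_ballF[OF assms(1) r]) (use om[OF x] in measurable)
  also have "... = orb f (2 * cosh r) (actY (adj2 h) (point_decode x))"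
   unfolding orb_def
  proof (rule nn_integral_cong)
   fix k assume "k : space haar"
   then have k: "k : SL2" by simp
   have e: "adj2 h ** (h ** k ** adj2 h) = k ** adj2 h" using h by (simp add: matrix_mul_assoc[symmetric])
   have "f' (actM (h ** k ** adj2 h) x) = f (actY (k ** adj2 h) (point_decode x))"
    using fact[of "h ** k ** adj2 h" x] h k x unfolding e by simp
   also have "... = f (actY k (actY (adj2 h) (point_decode x)))" using YS.act_mult[OF k h(2) y] by simp
   finally show "ennreal (f' (actM (h ** k ** adj2 h) x)) * indicator (fball (2 * cosh r)) k
    = ennreal (f (actY k (actY (adj2 h) (point_decode x)))) * indicator (fball (2 * cosh r)) k" by simp
  qed
  finally show ?thesis .
 qed
 have nt: "emeasure haar (fball (2 * cosh r)) ~= 0" "emeasure haar (fball (2 * cosh r)) ~= \<infinity>" if "late r" for r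
  using that emeasure_fball_nontrivial[of "2 * cosh r"] by (auto simp: late_def)
 have avg: "ball_avg_ennreal lam p0 actM f' r x = v (actY (adj2 h) (point_decode x)) r" if "late r" "x : SS" for r x
  unfolding ball_avg_ennreal_def num[OF that] ball[OF that(1)] v_def
  by (rule ennreal_cancel_divide[OF c(1) nt[OF that(1)]])
 have ravg: "ball_avg lam p0 actM f' r x = enn2real (v (actY (adj2 h) (point_decode x)) r)" if "late r" "x : SS" for r x
 proof -
  have r: "0 <= r" using that by (simp add: late_def)
  have "(\<integral>g. indicator (ballF p0 r) g * f' (actM g x) \<partial>lam) = enn2real (\<integral>\<^sup>+g. ennreal (indicator (ballF p0 r) g * f' (actM g x)) \<partial>lam)"
  proof (rule integral_eq_nn_integral)
   have "(%g. indicator (ballF p0 r) g * f' (actM g x)) : borel_measurable SL2_borel"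
    by (intro borel_measurable_times borel_measurable_indicator om[OF that(2)] ballF_sets[OF assms(1) r])
   then show "(%g. indicator (ballF p0 r) g * f' (actM g x)) : borel_measurable lam" using sl by (simp cong: measurable_cong_sets)
  qed (simp add: f'0)
  also have "(\<integral>\<^sup>+g. ennreal (indicator (ballF p0 r) g * f' (actM g x)) \<partial>lam) = (\<integral>\<^sup>+g. ennreal (f' (actM g x)) * indicator (ballF p0 r) g \<partial>lam)"
   by (rule nn_integral_cong) (simp split: split_indicator)
  finally have "ball_avg lam p0 actM f' r x = enn2real (ball_avg_ennreal lam p0 actM f' r x)"
   unfolding ball_avg_def ball_avg_ennreal_def measure_def
   using ball[OF that(1)] nt[OF that(1)] c(1) by (simp add: enn2real_divide ennreal_mult_eq_top_iff)
  then show ?thesis using avg[OF that] by simp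
 qed
 have "AE y in YY. (\<forall>s. orb f s y < \<infinity>) & (\<forall>K::nat. \<exists>r. late r & of_nat K <= v y r)"
  unfolding v_def by (rule fK)
 from AE_MM[OF AE_actY[OF this h(2)]]
 have good: "AE x in MM. x : SS & (\<forall>s. orb f s (actY (adj2 h) (point_decode x)) < \<infinity>) \<and>
   (\<forall>K::nat. \<exists>r. late r & of_nat K <= v (actY (adj2 h) (point_decode x)) r)"
  using AE_space[of MM] by eventually_elim simp
 have "AE x in MM. maximal_fn lam p0 actM f' x = \<infinity>"
  using good
 proof eventually_elim
  case (elim x)
  show ?case
  proof (rule ccontr)
   assume "maximal_fn lam p0 actM f' x ~= \<infinity>"
   then obtain K :: nat where K: "maximal_fn lam p0 actM f' x < of_nat K"
    using ennreal_Ex_less_of_nat by (auto simp: less_top)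
   obtain r where r: "late r" "of_nat K <= v (actY (adj2 h) (point_decode x)) r" using elim by blast
   have "ball_avg_ennreal lam p0 actM (%y. \<bar>f' y\<bar>) r x <= maximal_fn lam p0 actM f' x"
    unfolding maximal_fn_def using late_ge_1[OF r(1)] by (intro SUP_upper) simp
   moreover have "(%y. \<bar>f' y\<bar>) = f'" using f'0 by auto
   ultimately show False using avg[OF r(1), of x] elim r(2) K by (auto simp: not_less[symmetric])
  qed
 qed
 moreover have "AE x in MM. \<not> (\<exists>L. ((%r. ball_avg lam p0 actM f' r x) \<longlongrightarrow> L) at_top)"
  using good
 proof eventually_elim
  case (elim x)
  define y where "y = actY (adj2 h) (point_decode x)"
  have fin: "orb f s y < \<infinity>" for s using elim by (simp add: y_def)
  have vfin: "v y r < \<infinity>" if "late r" for r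
   unfolding v_def using fin[of "2 * cosh r"] nt[OF that] by (simp add: ennreal_divide_eq_top_iff less_top[symmetric])
  show ?case
  proof
   assume "\<exists>L. ((%r. ball_avg lam p0 actM f' r x) \<longlongrightarrow> L) at_top"
   then obtain L where "((%r. ball_avg lam p0 actM f' r x) \<longlongrightarrow> L) at_top" by blast
   then have "\<forall>\<^sub>F r in at_top. ball_avg lam p0 actM f' r x < L + 1" by (rule order_tendstoD) simp
   then obtain r1 where r1: "\<And>r. r1 <= r ==> ball_avg lam p0 actM f' r x < L + 1"
    unfolding eventually_at_top_linorder by blast
   \<comment> \<open>Large averages cannot come from bounded radii: for late \<open>r\<close> below
     \<open>r2\<close> the integral is at most that at \<open>r2\<close> and the volume at least
     that of \<open>fball 24\<close>, so the average is at most \<open>V\<close>. Averages above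
     \<open>V\<close> and \<open>L + 1\<close> therefore occur beyond \<open>r1\<close>, where
     convergence forbids them.\<close>
   define r2 where "r2 = max 0 r1"
   define V where "V = orb f (2 * cosh r2) y / emeasure haar (fball 24)"
   have "V < \<infinity>" unfolding V_def using fin[of "2 * cosh r2"] emeasure_fball_nontrivial[of 24]
    by (simp add: ennreal_divide_eq_top_iff less_top[symmetric])
   then have "max V (ennreal (L + 1)) < top" by simp
   from ennreal_Ex_less_of_nat[OF this] obtain K :: nat where "max V (ennreal (L + 1)) < of_nat K" by blast
   then have K: "V < of_nat K" "ennreal (L + 1) < of_nat K" by simp_all
   obtain r where r: "late r" "of_nat K <= v y r" using elim unfolding y_def by blast
   show False
   proof (cases "r2 <= r")
    case True
    then have "enn2real (v y r) < L + 1" using r1[of r] ravg[OF r(1), of x] elim by (simp add: r2_def y_def)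
    moreover have "v y r = ennreal (enn2real (v y r))" using vfin[OF r(1)] by simp
    ultimately have "v y r <= ennreal (L + 1)" by (metis ennreal_leI less_imp_le)
    then show False using K r(2) by (meson leD order_trans)
   next
    case False
    have "cosh r <= cosh r2" using False r(1) by (subst cosh_real_nonneg_le_iff) (auto simp: late_def r2_def)
    then have "orb f (2 * cosh r) y <= orb f (2 * cosh r2) y"
     unfolding orb_def by (intro nn_integral_mono) (auto simp: fball_def split: split_indicator)
    moreover have "emeasure haar (fball 24) <= emeasure haar (fball (2 * cosh r))"
     using r(1) by (intro emeasure_mono) (auto simp: fball_def late_def fball_sets[unfolded fball_def])
    ultimately have "v y r <= V"
     unfolding v_def V_def by (intro order_trans[OF divide_right_mono_ennreal ennreal_divide_left_mono])
    then show False using K r(2) by (meson leD order_trans)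
   qed
  qed
 qed
 ultimately show ?thesis
  using standard_MM pmp_MM ergodic_MM f'm f'i f'0 by blast
qed

end
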